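(* Let $\overline H\in\mathbb{R}$ with $\overline H^2>1$. The Gauss map of every rotational surface of constant harmonic mean curvature $\overline H$ in $\mathbb{H}^3\subset\mathbb{R}^{3,1}$ can be parametrized, depending on the type of rotation and with respect to a suitable basis, as follows. (Elliptic rotations, $\kappa_1=1$; orthonormal basis) $$(\theta,t)\mapsto\Big(\sqrt{|r(t)^2-1|}\cosh\psi(t),\ \sqrt{|r(t)^2-1|}\sinh\psi(t),\ r(t)\cos\theta,\ r(t)\sin\theta\Big).$$ (Hyperbolic rotations, $\kappa_1=-1$; orthonormal basis) $$(\theta,t)\mapsto\Big(r(t)\cosh\theta,\ r(t)\sinh\theta,\ \sqrt{r^2(t)+1}\cos\psi(t),\ \sqrt{r^2(t)+1}\sin\psi(t)\Big).$$ In both of these cases $$r(t)=\sqrt{C^+}\,\operatorname{cn}_p(\Xi t),\qquad p^2=\frac{C^+}{C^+-C^-},$$ $$\psi(t)=\frac{1}{\overline H}\left\{-\kappa_1t+\frac{\overline HC-\kappa_1}{\kappa_1C^+-1}\,\frac1\Xi\,\Pi_p\!\left(\frac{\kappa_1C^+}{\kappa_1C^+-1};\,\Xi t\right)\right\},$$ where $\Xi=\sqrt{1-\frac{1}{\overline H^2}}\,\sqrt{C^+-C^-}$, $C$ is a real constant, and $C^+>0>C^-$ are the (real) roots of $$p_C(x)=\left(\frac{1}{\overline H^2}-1\right)x^2+\left(\kappa_1-\frac{2C}{\overline H}\right)x+C^2.$$ (Parabolic rotations; pseudo-orthonormal basis) $$(\theta,t)\mapsto\left(\frac{-1+r^2(t)(\psi^2(t)+\theta^2)}{2r(t)},\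 r(t)\theta,\ r(t),\ r(t)\psi(t)\right)$$ with $$r(t)=\sqrt{C^+}\,\operatorname{cn}_p(\Xi t),\qquad p^2=\frac{C^+}{C^+-C^-},\qquad \psi(t)=-\frac{1}{\overline H}t+\frac{C}{C^+}\,\frac1\Xi\,\Pi_p(1;\,\Xi t),$$ where $C$ is a real constant, $\Xi=\sqrt{2|C|}$ and $$C^\pm=\frac{C}{\frac1{\overline H}\pm\operatorname{sign}C}.$$
   Context: $\mathbb{R}^{3,1}$ is Minkowski space and $\mathbb{H}^3$ hyperbolic space of curvature $-1$, realized as (one sheet of) $\{x\in\mathbb{R}^{3,1}:(x,x)=-1\}$. The Gauss map (tangent plane congruence) $\mathfrak n$ of a surface $\mathfrak f$ in $\mathbb{H}^3$ is its unit normal field, viewed as a map into de Sitter space $\{x\in\mathbb{R}^{3,1}:(x,x)=1\}$; it satisfies $(\mathfrak f,\mathfrak n)=0$, $(d\mathfrak f,\mathfrak n)=0$. With mean curvature $H=\frac{k_1+k_2}{2}$ and extrinsic Gauss curvature $K=k_1k_2$ ($k_1,k_2$ principal curvatures), the harmonic mean curvature is $\overline H=K/H$. A surface in $\mathbb{H}^3$ is rotational if it is invariant under a 1-parameter group of isometries that acts as the identity on the orthogonal complement of a 2-plane $\Pi_1\subset\mathbb{R}^{3,1}$; the rotation is elliptic, parabolic or hyperbolic if $\Pi_1$ has signature $(++)$, $(+0)$ or $(+-)$. For non-parabolic rotations coordinates are with respect to an orthonormal basis $(e_0,e_1,e_2,e_3)$ with $e_0$ timelike. In the elliptic case the part of the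 Gauss map orthogonal to the rotation plane is not necessarily timelike; the absolute values in the parametrization are there for this reason. For parabolic rotations coordinates are with respect to a pseudo-orthonormal basis $(\mathfrak v,\mathfrak e_1,\mathfrak o,\mathfrak e_2)$: $\mathfrak v,\mathfrak o$ lightlike with $(\mathfrak v,\mathfrak o)=-1$, $\mathfrak e_1,\mathfrak e_2$ unit spacelike, all other inner products zero; the rotation is then $\mathfrak v\mapsto\mathfrak v$, $\mathfrak e_1\mapsto\mathfrak e_1+\theta\mathfrak v$, $\mathfrak o\mapsto\mathfrak o+\theta\mathfrak e_1+\frac{\theta^2}{2}\mathfrak v$, $\mathfrak e_2\mapsto\mathfrak e_2$. The sign $\kappa_1\in\{\pm1\}$ encodes the type of non-parabolic rotation. $\operatorname{sn}_p,\operatorname{cn}_p,\operatorname{dn}_p$ are the Jacobi elliptic functions with modulus $p$, and $\Pi_p(k;s)=\int_0^s\frac{du}{1-k\,\operatorname{sn}_p^2(u)}$ is the incomplete elliptic integral of the third kind.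
   Formalization: Elliptic case: where r²<1 the first two basis vectors are swapped up to a sign; no formula is claimed at r²=1; Π is a principal value past its pole; if C⁺=1 the Π term is 0; umbilic spheres have C=C⁻=0 instead of 0>C⁻, their axis points excluded. Parabolic case: C≠0. *)

theory Defs
  imports "HOL-Analysis.Analysis"
begin

section \<open>Minkowski space, hyperbolic space, de Sitter space\<close>

type_synonym vec4 = "real^4"

text \<open>Component \<open>0\<close> (which is component \<open>4\<close> of the index type) is the timelike one.\<close>

definition mink :: "vec4 \<Rightarrow> vec4 \<Rightarrow> real" where
  "mink x y = - (x$0 * y$0) + x$1 * y$1 + x$2 * y$2 + x$3 * y$3"

definition hyperbolic3 :: "vec4 set" where
  "hyperbolic3 = {x. mink x x = -1 \<and> x$0 > 0}"

definition de_sitter3 :: "vec4 set" where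
  "de_sitter3 = {x. mink x x = 1}"

definition mink_perp :: "vec4 set \<Rightarrow> vec4 set" where
  "mink_perp P = {x. \<forall>y\<in>P. mink x y = 0}"

definition orthonormal_basis :: "vec4 \<Rightarrow> vec4 \<Rightarrow> vec4 \<Rightarrow> vec4 \<Rightarrow> bool" where
  "orthonormal_basis e0 e1 e2 e3 \<longleftrightarrow>
     mink e0 e0 = -1 \<and> mink e1 e1 = 1 \<and> mink e2 e2 = 1 \<and> mink e3 e3 = 1 \<and>
     mink e0 e1 = 0 \<and> mink e0 e2 = 0 \<and> mink e0 e3 = 0 \<and>
     mink e1 e2 = 0 \<and> mink e1 e3 = 0 \<and> mink e2 e3 = 0"

definition pseudo_orthonormal_basis :: "vec4 \<Rightarrow> vec4 \<Rightarrow> vec4 \<Rightarrow> vec4 \<Rightarrow> bool" where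
  "pseudo_orthonormal_basis v e1 u e2 \<longleftrightarrow>
     mink v v = 0 \<and> mink u u = 0 \<and> mink v u = -1 \<and>
     mink e1 e1 = 1 \<and> mink e2 e2 = 1 \<and> mink e1 e2 = 0 \<and>
     mink v e1 = 0 \<and> mink v e2 = 0 \<and> mink u e1 = 0 \<and> mink u e2 = 0"

fun in_basis ::
  "vec4 \<times> vec4 \<times> vec4 \<times> vec4 \<Rightarrow> real \<times> real \<times> real \<times> real \<Rightarrow> vec4" where
  "in_basis (b0, b1, b2, b3) (x0, x1, x2, x3) =
     x0 *\<^sub>R b0 + x1 *\<^sub>R b1 + x2 *\<^sub>R b2 + x3 *\<^sub>R b3"

section \<open>Surfaces in hyperbolic space and their curvatures\<close>

definition C1_on :: "(real \<times> real) set \<Rightarrow> (real \<times> real \<Rightarrow> vec4) \<Rightarrow> bool" where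
  "C1_on W g \<longleftrightarrow>
     (\<exists>g'. (\<forall>w\<in>W. (g has_derivative blinfun_apply (g' w)) (at w)) \<and> continuous_on W g')"

text \<open>
  An immersed surface is given by a map \<open>f\<close> on a connected Hausdorff space \<open>M\<close> that is covered
  by local parametrizations \<open>h\<close> for which \<open>f \<circ> h\<close> is an immersion; these determine the
  differentiable structure of \<open>M\<close>. Embedded surfaces are the case where \<open>f\<close> is the inclusion
  of a subset \<open>M\<close> of hyperbolic space. The regularity asked for is that \<open>f\<close> and its
  unit normal \<open>n\<close> be \<open>C\<^sup>1\<close>, which holds for every \<open>C\<^sup>2\<close> surface, in particular for smooth ones,
  and is what the Weingarten equation \<open>dn = - k df\<close> needs.
\<close>

definition local_param ::
  "'a::t2_space set \<Rightarrow> ('a \<Rightarrow> vec4) \<Rightarrow> ('a \<Rightarrow> vec4) \<Rightarrow>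
   (real \<times> real) set \<Rightarrow> (real \<times> real \<Rightarrow> 'a) \<Rightarrow> bool" where
  "local_param M f n W h \<longleftrightarrow>
     open W \<and> openin (top_of_set M) (h ` W) \<and> (\<exists>g. homeomorphism W (h ` W) h g) \<and>
     C1_on W (f \<circ> h) \<and> C1_on W (n \<circ> h) \<and>
     (\<forall>w\<in>W. inj (frechet_derivative (f \<circ> h) (at w)))"

definition surface_with_gauss_map ::
  "'a::t2_space set \<Rightarrow> ('a \<Rightarrow> vec4) \<Rightarrow> ('a \<Rightarrow> vec4) \<Rightarrow> bool" where
  "surface_with_gauss_map M f n \<longleftrightarrow>
     connected M \<and> M \<noteq> {} \<and>
     (\<forall>x\<in>M. \<exists>W h. local_param M f n W h \<and> x \<in> h ` W) \<and>
     f ` M \<subseteq> hyperbolic3 \<and> n ` M \<subseteq> de_sitter3 \<and>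
     (\<forall>x\<in>M. mink (f x) (n x) = 0) \<and>
     (\<forall>W h. local_param M f n W h \<longrightarrow>
        (\<forall>w\<in>W. \<forall>v. mink (frechet_derivative (f \<circ> h) (at w) v) (n (h w)) = 0))"

text \<open>\<open>k1\<close> and \<open>k2\<close> are the principal curvatures at \<open>x\<close>, listed with multiplicity.\<close>

definition principal_curvatures ::
  "'a::t2_space set \<Rightarrow> ('a \<Rightarrow> vec4) \<Rightarrow> ('a \<Rightarrow> vec4) \<Rightarrow> 'a \<Rightarrow> real \<Rightarrow> real \<Rightarrow> bool" where
  "principal_curvatures M f n x k1 k2 \<longleftrightarrow>
     (\<exists>W h w v1 v2. local_param M f n W h \<and> w \<in> W \<and> h w = x \<and>
        v1 \<noteq> v2 \<and> independent {v1, v2} \<and>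
        frechet_derivative (n \<circ> h) (at w) v1 = - k1 *\<^sub>R frechet_derivative (f \<circ> h) (at w) v1 \<and>
        frechet_derivative (n \<circ> h) (at w) v2 = - k2 *\<^sub>R frechet_derivative (f \<circ> h) (at w) v2)"

definition mean_curvature :: "real \<Rightarrow> real \<Rightarrow> real" where
  "mean_curvature k1 k2 = (k1 + k2) / 2"

definition gauss_curvature :: "real \<Rightarrow> real \<Rightarrow> real" where
  "gauss_curvature k1 k2 = k1 * k2"

definition constant_harmonic_mean_curvature ::
  "'a::t2_space set \<Rightarrow> ('a \<Rightarrow> vec4) \<Rightarrow> ('a \<Rightarrow> vec4) \<Rightarrow> real \<Rightarrow> bool" where
  "constant_harmonic_mean_curvature M f n Hb \<longleftrightarrow>
     (\<forall>x\<in>M. \<exists>k1 k2. principal_curvatures M f n x k1 k2 \<and>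
        mean_curvature k1 k2 \<noteq> 0 \<and> gauss_curvature k1 k2 / mean_curvature k1 k2 = Hb)"

definition totally_umbilic ::
  "'a::t2_space set \<Rightarrow> ('a \<Rightarrow> vec4) \<Rightarrow> ('a \<Rightarrow> vec4) \<Rightarrow> bool" where
  "totally_umbilic M f n \<longleftrightarrow> (\<forall>x\<in>M. \<exists>k. principal_curvatures M f n x k k)"

section \<open>Rotational surfaces\<close>

text \<open>
  A continuous 1-parameter group automatically preserves each sheet of the hyperboloid, so the
  maps \<open>R s\<close> are isometries of hyperbolic space.
\<close>

definition rotation_group :: "vec4 set \<Rightarrow> (real \<Rightarrow> vec4 \<Rightarrow> vec4) \<Rightarrow> bool" where
  "rotation_group P R \<longleftrightarrow>
     subspace P \<and> dim P = 2 \<and>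
     (\<forall>s. linear (R s) \<and> (\<forall>x y. mink (R s x) (R s y) = mink x y)) \<and>
     (\<forall>s t. R (s + t) = R s \<circ> R t) \<and>
     (\<forall>x. continuous_on UNIV (\<lambda>s. R s x)) \<and>
     (\<forall>s. \<forall>x\<in>mink_perp P. R s x = x) \<and>
     (\<exists>s. R s \<noteq> id)"

text \<open>
  The sign \<open>\<epsilon> = 1, 0, -1\<close> stands for signature \<open>(++)\<close>, \<open>(+0)\<close>, \<open>(+-)\<close>, that is, for elliptic,
  parabolic, hyperbolic rotations. A 2-plane in Minkowski space has exactly one of these.
\<close>

definition plane_signature :: "vec4 set \<Rightarrow> real \<Rightarrow> bool" where
  "plane_signature P \<epsilon> \<longleftrightarrow>
     (\<exists>a b. a \<noteq> b \<and> independent {a, b} \<and> P = span {a, b} \<and>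
        mink a a = 1 \<and> mink a b = 0 \<and> mink b b = \<epsilon>)"

text \<open>
  Invariance of an immersed surface: the group acts on \<open>M\<close> so that \<open>f\<close> is equivariant. For an
  embedded surface, with \<open>f\<close> the inclusion, this says that each \<open>R s\<close> maps \<open>M\<close> to itself.
\<close>

definition invariant_under ::
  "(real \<Rightarrow> vec4 \<Rightarrow> vec4) \<Rightarrow> 'a::t2_space set \<Rightarrow> ('a \<Rightarrow> vec4) \<Rightarrow> bool" where
  "invariant_under R M f \<longleftrightarrow>
     (\<exists>\<phi>. (\<forall>s. \<forall>x\<in>M. \<phi> s x \<in> M \<and> f (\<phi> s x) = R s (f x)) \<and>
          (\<forall>x\<in>M. \<phi> 0 x = x) \<and> (\<forall>s t. \<forall>x\<in>M. \<phi> (s + t) x = \<phi> s (\<phi> t x)) \<and>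
          continuous_on (UNIV \<times> M) (\<lambda>(s, x). \<phi> s x))"

text \<open>
  \<open>\<Phi>\<close> is a regular parametrization over \<open>\<real> \<times> J\<close> of the part of the surface off the axis of
  rotation, i.e. of the part that is not fixed by the rotations. (Only elliptic rotations have
  fixed points in hyperbolic space.) It is a local diffeomorphism; it cannot be asked to be
  injective, since angles differing by \<open>2 \<pi>\<close> may give the same point.
\<close>

definition parametrizes ::
  "(real \<times> real \<Rightarrow> 'a) \<Rightarrow> real set \<Rightarrow>
   'a::t2_space set \<Rightarrow> ('a \<Rightarrow> vec4) \<Rightarrow> ('a \<Rightarrow> vec4) \<Rightarrow> vec4 set \<Rightarrow> bool" where
  "parametrizes \<Phi> J M f n P \<longleftrightarrow>
     open J \<and> is_interval J \<and> J \<noteq> {} \<and>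
     \<Phi> ` (UNIV \<times> J) = {x \<in> M. f x \<notin> mink_perp P} \<and>
     (\<forall>w \<in> UNIV \<times> J. \<exists>W. w \<in> W \<and> W \<subseteq> UNIV \<times> J \<and> local_param M f n W \<Phi>)"

section \<open>Jacobi elliptic functions\<close>

definition ellip_F :: "real \<Rightarrow> real \<Rightarrow> real" where
  "ellip_F p \<phi> = (LBINT x=0..\<phi>. 1 / sqrt (1 - p\<^sup>2 * (sin x)\<^sup>2))"

text \<open>
  The amplitude inverts \<open>ellip_F p\<close>. The condition on the segment from \<open>0\<close> to \<open>\<phi>\<close> is void for
  \<open>p\<^sup>2 < 1\<close>; for \<open>p\<^sup>2 = 1\<close> it says \<open>\<bar>\<phi>\<bar> < \<pi> / 2\<close>, beyond which the integral diverges, and the functions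
  below become \<open>sn = tanh\<close> and \<open>cn = 1 / cosh\<close>.
\<close>

definition jacobi_am :: "real \<Rightarrow> real \<Rightarrow> real" where
  "jacobi_am p u =
     (THE \<phi>. (\<forall>x\<in>closed_segment 0 \<phi>. p\<^sup>2 * (sin x)\<^sup>2 < 1) \<and> ellip_F p \<phi> = u)"

definition jacobi_sn :: "real \<Rightarrow> real \<Rightarrow> real" where
  "jacobi_sn p u = sin (jacobi_am p u)"

definition jacobi_cn :: "real \<Rightarrow> real \<Rightarrow> real" where
  "jacobi_cn p u = cos (jacobi_am p u)"

text \<open>
  Incomplete elliptic integral of the third kind. As usual, it is a Cauchy principal value if
  \<open>1 - k sn\<^sup>2\<close> vanishes between \<open>0\<close> and \<open>s\<close>; otherwise the truncated integrals below are
  eventually equal to the plain integral (for \<open>s\<close> not a zero either).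
\<close>

definition ellip_Pi :: "real \<Rightarrow> real \<Rightarrow> real \<Rightarrow> real" where
  "ellip_Pi p k s =
     Lim (at_right 0) (\<lambda>\<epsilon>. LBINT u=0..s.
       indicator {u. \<forall>z. 1 - k * (jacobi_sn p z)\<^sup>2 = 0 \<longrightarrow> \<epsilon> \<le> \<bar>u - z\<bar>} u
         * (1 / (1 - k * (jacobi_sn p u)\<^sup>2)))"

section \<open>The parametrizations\<close>

definition modulus :: "real \<Rightarrow> real \<Rightarrow> real" where
  "modulus Cp Cm = sqrt (Cp / (Cp - Cm))"

definition profile_r :: "real \<Rightarrow> real \<Rightarrow> real \<Rightarrow> real \<Rightarrow> real" where
  "profile_r \<Xi> Cp Cm t = sqrt Cp * jacobi_cn (modulus Cp Cm) (\<Xi> * t)"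

subsection \<open>Elliptic (\<open>\<kappa> = 1\<close>) and hyperbolic (\<open>\<kappa> = -1\<close>) rotations\<close>

text \<open>
  The roots satisfy \<open>Cp > 0 > Cm\<close> except for spheres, which are elliptic rotational surfaces of
  constant harmonic mean curvature: there \<open>C = 0\<close>, the roots are \<open>Cp > 0 = Cm\<close>, and the modulus is \<open>1\<close>.
\<close>

definition p_poly :: "real \<Rightarrow> real \<Rightarrow> real \<Rightarrow> real \<Rightarrow> real" where
  "p_poly \<kappa> Hb C x = (1 / Hb\<^sup>2 - 1) * x\<^sup>2 + (\<kappa> - 2 * C / Hb) * x + C\<^sup>2"

definition Xi :: "real \<Rightarrow> real \<Rightarrow> real \<Rightarrow> real" where
  "Xi Hb Cp Cm = sqrt (1 - 1 / Hb\<^sup>2) * sqrt (Cp - Cm)"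

text \<open>
  If \<open>\<kappa> * Cp = 1\<close>, then \<open>Hb * C = \<kappa>\<close>, and the second summand, formally \<open>0/0\<close>, is \<open>0\<close> by the
  convention \<open>x / 0 = 0\<close>. That is the right value: for \<open>\<kappa> * Cp \<noteq> 1\<close> the derivative of the
  function is \<open>(1 / Hb) * (- \<kappa> + (Hb * C - \<kappa>) / (\<kappa> * r\<^sup>2 - 1))\<close>.
\<close>

definition profile_psi :: "real \<Rightarrow> real \<Rightarrow> real \<Rightarrow> real \<Rightarrow> real \<Rightarrow> real \<Rightarrow> real" where
  "profile_psi \<kappa> Hb C Cp Cm t =
     (1 / Hb) * (- \<kappa> * t
       + (Hb * C - \<kappa>) / (\<kappa> * Cp - 1) * (1 / Xi Hb Cp Cm)
         * ellip_Pi (modulus Cp Cm) (\<kappa> * Cp / (\<kappa> * Cp - 1)) (Xi Hb Cp Cm * t))"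

definition elliptic_coords ::
  "real \<Rightarrow> real \<Rightarrow> real \<Rightarrow> real \<Rightarrow> real \<Rightarrow> real \<Rightarrow> real \<times> real \<times> real \<times> real" where
  "elliptic_coords Hb C Cp Cm \<theta> t =
     (let r = profile_r (Xi Hb Cp Cm) Cp Cm t; \<psi> = profile_psi 1 Hb C Cp Cm t
      in (sqrt \<bar>r\<^sup>2 - 1\<bar> * cosh \<psi>, sqrt \<bar>r\<^sup>2 - 1\<bar> * sinh \<psi>, r * cos \<theta>, r * sin \<theta>))"

definition hyperbolic_coords ::
  "real \<Rightarrow> real \<Rightarrow> real \<Rightarrow> real \<Rightarrow> real \<Rightarrow> real \<Rightarrow> real \<times> real \<times> real \<times> real" where
  "hyperbolic_coords Hb C Cp Cm \<theta> t =
     (let r = profile_r (Xi Hb Cp Cm) Cp Cm t; \<psi> = profile_psi (-1) Hb C Cp Cm t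
      in (r * cosh \<theta>, r * sinh \<theta>, sqrt (r\<^sup>2 + 1) * cos \<psi>, sqrt (r\<^sup>2 + 1) * sin \<psi>))"

subsection \<open>Parabolic rotations\<close>

definition par_Cp :: "real \<Rightarrow> real \<Rightarrow> real" where
  "par_Cp Hb C = C / (1 / Hb + sgn C)"

definition par_Cm :: "real \<Rightarrow> real \<Rightarrow> real" where
  "par_Cm Hb C = C / (1 / Hb - sgn C)"

definition par_Xi :: "real \<Rightarrow> real" where
  "par_Xi C = sqrt (2 * \<bar>C\<bar>)"

definition par_psi :: "real \<Rightarrow> real \<Rightarrow> real \<Rightarrow> real" where
  "par_psi Hb C t =
     - (1 / Hb) * t
     + C / par_Cp Hb C * (1 / par_Xi C)
       * ellip_Pi (modulus (par_Cp Hb C) (par_Cm Hb C)) 1 (par_Xi C * t)"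

definition parabolic_coords ::
  "real \<Rightarrow> real \<Rightarrow> real \<Rightarrow> real \<Rightarrow> real \<times> real \<times> real \<times> real" where
  "parabolic_coords Hb C \<theta> t =
     (let r = profile_r (par_Xi C) (par_Cp Hb C) (par_Cm Hb C) t; \<psi> = par_psi Hb C t
      in ((-1 + r\<^sup>2 * (\<psi>\<^sup>2 + \<theta>\<^sup>2)) / (2 * r), r * \<theta>, r, r * \<psi>))"

subsection \<open>The Gauss map in the elliptic case\<close>

text \<open>
  The coordinates \<open>(\<surd>\<bar>r\<^sup>2 - 1\<bar> cosh \<psi>, \<surd>\<bar>r\<^sup>2 - 1\<bar> sinh \<psi>)\<close> of the part of the Gauss map orthogonal to
  the rotation plane refer to a basis of the orthogonal Lorentz plane whose first vector is
  timelike where \<open>r\<^sup>2 > 1\<close> and spacelike where \<open>r\<^sup>2 < 1\<close>. From one orthonormal basis with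
  \<open>e0\<close> timelike, these are \<open>(e0, e1)\<close> and \<open>\<sigma> (e1, e0)\<close>, with a sign \<open>\<sigma> = \<plusminus>1\<close> that is constant on each
  interval where \<open>r\<^sup>2 < 1\<close>. At \<open>r\<^sup>2 = 1\<close> this part of the Gauss map is lightlike and \<open>\<psi>\<close> has
  a singularity.
\<close>

definition elliptic_basis ::
  "vec4 \<Rightarrow> vec4 \<Rightarrow> vec4 \<Rightarrow> vec4 \<Rightarrow> real \<Rightarrow> real \<Rightarrow> vec4 \<times> vec4 \<times> vec4 \<times> vec4"
  where
  "elliptic_basis e0 e1 e2 e3 \<sigma> r =
     (if r\<^sup>2 > 1 then (e0, e1, e2, e3) else (\<sigma> *\<^sub>R e1, \<sigma> *\<^sub>R e0, e2, e3))"

end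

theory Submission
  imports Defs
begin

text \<open>
  Let \<open>X\<close> be the infinitesimal generator of the rotation and \<open>Q x y = (X x, X y)\<close>. In the orthonormal frame
  given by \<open>f\<close>, \<open>n\<close>, the direction \<open>X f\<close> of the rotation and the direction of the meridian, the two
  principal curvatures are read off, and the condition \<open>K = Hb * H\<close> becomes \<open>d (Q f n + Q n n / Hb) = 0\<close>;
  the conserved quantity is \<open>C\<close>. With \<open>r\<^sup>2 = Q n n\<close> it turns the Gauss map along a meridian, suitably
  parametrized, into \<open>r'\<^sup>2 = \<mu> (Cp - r\<^sup>2) (r\<^sup>2 - Cm)\<close>, solved by \<open>cn\<close>. The component of the Gauss map in the
  complement of the rotation plane has Wronskian \<open>C - r\<^sup>2 / Hb\<close>, which determines its angle \<open>\<psi>\<close>. In the elliptic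
  case \<open>\<psi>\<close> has a logarithmic singularity where \<open>r\<^sup>2 = 1\<close>; the residue is such that one of the two null
  coordinates, multiplied by the exponential of \<open>\<psi>\<close> stripped of the logarithm, stays
  differentiable and hence constant across it.
\<close>


text \<open>The surface is an abstract immersed one whose normal is only continuously
  differentiable, and the group action on it is only continuous. So there is no profile curve to
  start from and no second-order equation to integrate. Both are replaced by a function
  \<open>that\<close> on the surface: the first integral makes the amplitude of the elliptic
  function readable, with its sign, from the pair \<open>(f x, n x)\<close> alone, and
  \<open>that\<close> is the time belonging to it. The formula for \<open>r\<close> then holds by
  construction, and only the derivative of \<open>that\<close> has to be computed. Since the
  principal curvatures are nonzero, \<open>r\<close> does not vanish off the axis, so one branch of
  \<open>cn\<close> suffices and \<open>that\<close> is single-valued. A meridian is a curve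
  orthogonal to the orbits and parametrized by \<open>that\<close>; local meridians are glued to a
  maximal one, and connectedness shows that its rotations cover everything off the axis. The sign
  \<open>\<epsilon>\<close> and the form \<open>B\<close> carry the three types of rotation through
  this at once; they separate only when the Gauss map is written in coordinates.\<close>

section \<open>Linear algebra of Minkowski space\<close>

lemma exhaust_4': "(x::4) = 0 \<or> x = 1 \<or> x = 2 \<or> x = 3"
  using exhaust_4[of x] by auto

lemma bilinear_mink: "bilinear mink"
  unfolding bilinear_def mink_def
  by (auto intro!: linearI simp: algebra_simps)

interpretation mink: bounded_bilinear mink
  using bilinear_conv_bounded_bilinear bilinear_mink by blast

lemma mink_commute: "mink x y = mink y x"
  by (simp add: mink_def)

lemmas mink_simps = mink.add_left mink.add_right mink.diff_left mink.diff_right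
  mink.scaleR_left mink.scaleR_right mink.minus_left mink.minus_right
  mink.zero_left mink.zero_right

lemma mink_nondegenerate:
  assumes "\<And>y. mink x y = 0"
  shows "x = 0"
proof -
  have "x $ i = 0" for i
    using assms[of "axis 0 1"] assms[of "axis 1 1"] assms[of "axis 2 1"] assms[of "axis 3 1"]
      exhaust_4'[of i] by (auto simp: mink_def axis_def)
  then show ?thesis by (simp add: vec_eq_iff)
qed

text \<open>Reverse Cauchy-Schwarz. If \<open>x\<close> were not spacelike, orthogonality would give
  \<open>w = x$0 * f$0\<close> for the spatial product \<open>w\<close>, and the ordinary
  Cauchy-Schwarz inequality, here from Lagrange's identity, would force the spatial square
  \<open>u\<close> of \<open>x\<close> to vanish because \<open>v < (f$0)\<^sup>2\<close> is
  strict.\<close>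

lemma perp_timelike_spacelike:
  assumes "mink f f < 0" "mink x f = 0" "x \<noteq> 0"
  shows "mink x x > 0"
proof (rule ccontr)
  assume "\<not> mink x x > 0"
  define u v w where "u = (x$1)\<^sup>2 + (x$2)\<^sup>2 + (x$3)\<^sup>2" and "v = (f$1)\<^sup>2 + (f$2)\<^sup>2 + (f$3)\<^sup>2"
    and "w = x$1 * f$1 + x$2 * f$2 + x$3 * f$3"
  have xu: "u \<le> (x$0)\<^sup>2" and fv: "v < (f$0)\<^sup>2" and w: "w = x$0 * f$0"
    using assms \<open>\<not> mink x x > 0\<close> by (auto simp: mink_def u_def v_def w_def power2_eq_square)
  have "u * v - w\<^sup>2 = (x$1 * f$2 - x$2 * f$1)\<^sup>2 + (x$1 * f$3 - x$3 * f$1)\<^sup>2 + (x$2 * f$3 - x$3 * f$2)\<^sup>2"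
    unfolding u_def v_def w_def by algebra
  then have cs: "w\<^sup>2 \<le> u * v" by (smt (verit) zero_le_power2)
  have u0: "u \<ge> 0" unfolding u_def by simp
  have "w\<^sup>2 = (x$0)\<^sup>2 * (f$0)\<^sup>2" by (simp add: w power_mult_distrib)
  also have "\<dots> \<ge> u * (f$0)\<^sup>2" using xu by (simp add: mult_right_mono)
  finally have "u * (f$0)\<^sup>2 \<le> u * v" using cs by linarith
  then have "u = 0" using u0 fv by (metis less_eq_real_def mult_le_cancel_left_pos not_le)
  moreover from this have "w = 0" using cs by simp
  then have "x$0 = 0" using w fv u0 by (smt (verit) mult_eq_0_iff sum_power2_ge_zero v_def zero_le_power2 zero_power2)
  ultimately have "x $ i = 0" for i
    using exhaust_4'[of i] unfolding u_def by (smt (verit) zero_eq_power2 zero_le_power2)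
  then show False using assms(3) by (simp add: vec_eq_iff)
qed

text \<open>Pairing with the basis recovers the coordinates, so the coordinate map is injective and,
  in equal dimensions, surjective.\<close>

lemma orthonormal_basis_expansion:
  assumes "orthonormal_basis f n m u"
  shows "x = - mink x f *\<^sub>R f + mink x n *\<^sub>R n + mink x m *\<^sub>R m + mink x u *\<^sub>R u"
proof -
  define L :: "vec4 \<Rightarrow> vec4" where
    "L c = c$0 *\<^sub>R f + c$1 *\<^sub>R n + c$2 *\<^sub>R m + c$3 *\<^sub>R u" for c
  have coord: "mink (L c) f = - c$0" "mink (L c) n = c$1" "mink (L c) m = c$2" "mink (L c) u = c$3" for c
    using assms unfolding L_def orthonormal_basis_def by (auto simp: mink_simps mink_commute)
  have lin: "linear L" unfolding L_def by (auto intro!: linearI simp: algebra_simps)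
  have "inj L"
  proof (rule injI)
    fix c c' assume eq: "L c = L c'"
    have "c $ i = c' $ i" for i
      using coord[of c] coord[of c'] exhaust_4'[of i] unfolding eq by auto
    then show "c = c'" by (simp add: vec_eq_iff)
  qed
  then have "surj L" using lin linear_injective_imp_surjective by blast
  then obtain c where c: "x = L c" by (metis surjD)
  show ?thesis using coord[of c] unfolding c[symmetric] by (simp add: c L_def)
qed

text \<open>The three conditions, padded by a zero as fourth component, form an endomorphism of a
  four-dimensional space that misses a coordinate axis and therefore has a kernel.\<close>

lemma exists_mink_perp:
  fixes p q s :: vec4
  obtains w where "w \<noteq> 0" "mink w p = 0" "mink w q = 0" "mink w s = 0"
proof -
  define L :: "vec4 \<Rightarrow> vec4" where "L w = (\<chi> i. if i = 0 then mink w p else if i = 1 then mink w q else if i = 2 then mink w s else 0)" for w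
  have lin: "linear L" unfolding L_def
    by (auto intro!: linearI simp: vec_eq_iff mink_simps)
  have "\<not> surj L"
  proof
    assume "surj L"
    then obtain w where "axis 3 1 = L w" by (metis surjD)
    then have "(axis 3 1 :: vec4) $ 3 = L w $ 3" by simp
    then show False by (simp add: L_def)
  qed
  then have "\<not> inj L" using lin linear_injective_imp_surjective by blast
  then obtain w where "L w = 0" "w \<noteq> 0" using lin linear_injective_0 by blast
  then have "L w $ 0 = 0" "L w $ 1 = 0" "L w $ 2 = 0" by simp_all
  then have "mink w p = 0" "mink w q = 0" "mink w s = 0" by (simp_all add: L_def)
  then show ?thesis using that \<open>w \<noteq> 0\<close> by blast
qed

text \<open>The absolute value lets the same formula serve spacelike and timelike vectors.\<close>

definition normalize :: "vec4 \<Rightarrow> vec4" where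
  "normalize w = (1 / sqrt \<bar>mink w w\<bar>) *\<^sub>R w"

lemma mink_normalize:
  assumes "mink w w > 0" shows "mink (normalize w) (normalize w) = 1"
  using assms by (simp add: normalize_def mink_simps power2_eq_square[symmetric] field_simps)

lemma mink_normalize':
  assumes "mink w w < 0" shows "mink (normalize w) (normalize w) = -1"
  using assms by (simp add: normalize_def mink_simps power2_eq_square[symmetric] field_simps)

lemma mink_normalize_left: "mink w y = 0 \<Longrightarrow> mink (normalize w) y = 0"
  by (simp add: normalize_def mink_simps)

text \<open>Removing from a timelike vector its part in a spacelike plane leaves it timelike; any
  nonzero vector orthogonal to the result and to the plane is then spacelike.\<close>

lemma complete_spacelike_plane:
  assumes "mink a a = 1" "mink a b = 0" "mink b b = 1"
  obtains c d where "mink c c = -1" "mink d d = 1" "mink c d = 0"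
    "mink c a = 0" "mink c b = 0" "mink d a = 0" "mink d b = 0"
proof -
  define e :: vec4 where "e = axis 0 1"
  have e: "mink e e = -1" by (simp add: e_def mink_def axis_def)
  define c' where "c' = e - mink e a *\<^sub>R a - mink e b *\<^sub>R b"
  have cc: "mink c' c' = -1 - (mink e a)\<^sup>2 - (mink e b)\<^sup>2" and ca: "mink c' a = 0" "mink c' b = 0"
    using assms e by (simp_all add: c'_def mink_simps mink_commute[of b a] mink_commute[of a e] mink_commute[of b e] power2_eq_square algebra_simps)
  have neg: "mink c' c' < 0" unfolding cc by (smt (verit) zero_le_power2)
  obtain d' where d': "d' \<noteq> 0" "mink d' c' = 0" "mink d' a = 0" "mink d' b = 0" using exists_mink_perp .
  have pos: "mink d' d' > 0" using perp_timelike_spacelike[OF neg d'(2,1)] .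
  show ?thesis
    by (rule that[of "normalize c'" "normalize d'"])
      (use mink_normalize[OF pos] mink_normalize'[OF neg] d' ca in
        \<open>auto intro!: mink_normalize_left simp: mink_commute[of c' "normalize d'"]\<close>)
qed

lemma complete_lorentz_plane:
  assumes "mink a a = 1" "mink a b = 0" "mink b b = -1"
  obtains c d where "mink c c = 1" "mink d d = 1" "mink c d = 0"
    "mink c a = 0" "mink c b = 0" "mink d a = 0" "mink d b = 0"
proof -
  have neg: "mink b b < 0" using assms by simp
  obtain c' where c': "c' \<noteq> 0" "mink c' b = 0" "mink c' a = 0" using exists_mink_perp .
  have posc: "mink c' c' > 0" using perp_timelike_spacelike[OF neg c'(2,1)] .
  obtain d' where d': "d' \<noteq> 0" "mink d' c' = 0" "mink d' a = 0" "mink d' b = 0" using exists_mink_perp .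
  have posd: "mink d' d' > 0" using perp_timelike_spacelike[OF neg d'(4,1)] .
  show ?thesis
    by (rule that[of "normalize c'" "normalize d'"])
      (use mink_normalize[OF posc] mink_normalize[OF posd] d' c' in
        \<open>auto intro!: mink_normalize_left simp: mink_commute[of c' "normalize d'"]\<close>)
qed

text \<open>A timelike vector \<open>e\<close> cannot be orthogonal to the nonzero lightlike
  \<open>b\<close>, so it supplies a transverse vector. Scaling fixes its product with
  \<open>b\<close>, and adding a multiple of \<open>b\<close> afterwards makes it lightlike without
  changing that product.\<close>

lemma complete_null_plane:
  assumes "mink a a = 1" "mink a b = 0" "mink b b = 0" "b \<noteq> 0"
  obtains u d where "pseudo_orthonormal_basis b a u d"
proof -
  define e :: vec4 where "e = axis 0 1"
  have e: "mink e e = -1" by (simp add: e_def mink_def axis_def)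
  have eb: "mink e b \<noteq> 0"
    using perp_timelike_spacelike[of e b] e assms by (auto simp: mink_commute)
  define u' where "u' = (- 1 / mink e b) *\<^sub>R (e - mink e a *\<^sub>R a)"
  have u': "mink u' b = -1" "mink u' a = 0"
    using eb assms by (simp_all add: u'_def mink_simps)
  define u where "u = u' + (mink u' u' / 2) *\<^sub>R b"
  have u: "mink u b = -1" "mink u a = 0" "mink u u = 0"
    using u' assms by (simp_all add: u_def mink_simps mink_commute[of b u'] mink_commute[of b a])
  obtain d' where d': "d' \<noteq> 0" "mink d' u = 0" "mink d' a = 0" "mink d' b = 0" using exists_mink_perp .
  \<comment> \<open>The sum \<open>b + u\<close> has square \<open>-2\<close>, so nonzero vectors
    orthogonal to both \<open>b\<close> and \<open>u\<close> are spacelike although \<open>b\<close>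
    and \<open>u\<close> are lightlike.\<close>
  have "mink (b + u) (b + u) < 0" "mink d' (b + u) = 0"
    using u assms d' by (simp_all add: mink_simps mink_commute[of b u])
  then have pos: "mink d' d' > 0" using perp_timelike_spacelike d' by blast
  show ?thesis
    by (rule that[of u "normalize d'"])
      (use mink_normalize[OF pos] assms u mink_normalize_left[OF d'(2)] mink_normalize_left[OF d'(3)]
         mink_normalize_left[OF d'(4)] in \<open>simp add: pseudo_orthonormal_basis_def mink_commute\<close>)
qed

text \<open>The vectors \<open>(v + u) / sqrt 2\<close> and \<open>(v - u) / sqrt 2\<close> replace
  the null pair by a timelike and a spacelike unit vector, which reduces this to the orthonormal
  case.\<close>

lemma pseudo_orthonormal_basis_expansion:
  assumes "pseudo_orthonormal_basis v e1 u e2"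
  shows "x = - mink x u *\<^sub>R v + mink x e1 *\<^sub>R e1 - mink x v *\<^sub>R u + mink x e2 *\<^sub>R e2"
proof -
  define s where "s = 1 / sqrt 2"
  have s: "s * s = 1/2" by (simp add: s_def)
  define f where "f = s *\<^sub>R (v + u)"
  define k where "k = s *\<^sub>R (v - u)"
  have B: "orthonormal_basis f k e1 e2"
    using assms s unfolding orthonormal_basis_def pseudo_orthonormal_basis_def f_def k_def
    by (auto simp: mink_simps mink_commute[of e1 v] mink_commute[of u v] mink_commute[of e2 v] mink_commute[of e2 u] mink_commute[of e1 u] algebra_simps)
  have "- mink x f *\<^sub>R f + mink x k *\<^sub>R k = - mink x u *\<^sub>R v - mink x v *\<^sub>R u"
  proof -
    have "- mink x f *\<^sub>R f + mink x k *\<^sub>R k = (2 * (s * s)) *\<^sub>R (- mink x u *\<^sub>R v - mink x v *\<^sub>R u)"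
      by (simp add: f_def k_def mink_simps scaleR_add_right scaleR_diff_right scaleR_add_left scaleR_diff_left algebra_simps)
        (simp add: vec_eq_iff algebra_simps)
    then show ?thesis unfolding s by simp
  qed
  moreover have "x = (- mink x f *\<^sub>R f + mink x k *\<^sub>R k) + (mink x e1 *\<^sub>R e1 + mink x e2 *\<^sub>R e2)"
    using orthonormal_basis_expansion[OF B, of x] by (simp only: add.assoc)
  ultimately have "x = (- mink x u *\<^sub>R v - mink x v *\<^sub>R u) + (mink x e1 *\<^sub>R e1 + mink x e2 *\<^sub>R e2)"
    by simp
  then show ?thesis by (simp add: algebra_simps)
qed

lemma mink_perp_span: "mink_perp (span S) = mink_perp S"
proof
  show "mink_perp (span S) \<subseteq> mink_perp S" by (auto simp: mink_perp_def span_base)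
  have "mink x y = 0" if "y \<in> span S" "x \<in> mink_perp S" for x y
    using that(1) by (induction y rule: span_induct_alt) (use that(2) in \<open>auto simp: mink_simps mink_perp_def\<close>)
  then show "mink_perp S \<subseteq> mink_perp (span S)" by (auto simp: mink_perp_def)
qed

section \<open>The generator of the rotation and its invariant forms\<close>

text \<open>Common setting for the three signatures. The vectors \<open>c\<close>, \<open>d\<close>
  are meant to span the orthogonal complement of the plane; in the parabolic case the complement
  meets the plane and \<open>c\<close> is \<open>b\<close> itself, so they cannot be required to
  complete \<open>a\<close>, \<open>b\<close> to a basis. What replaces this is
  \<open>wedge_sq\<close>, which expresses the square of the \<open>c\<close>, \<open>d\<close>
  minor of two vectors by their Minkowski products and their products with \<open>a\<close>,
  \<open>b\<close>.\<close>

locale plane_frame =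
  fixes a b c d :: vec4 and \<epsilon> :: real
  assumes aa: "mink a a = 1" and ab: "mink a b = 0" and bb: "mink b b = \<epsilon>" and b_nz: "b \<noteq> 0"
    and ca: "mink c a = 0" and cb: "mink c b = 0" and da: "mink d a = 0" and db: "mink d b = 0"
    and wedge_sq: "\<And>x y. (mink x c * mink y d - mink x d * mink y c)\<^sup>2 =
        - \<epsilon> * (mink x x * mink y y - (mink x y)\<^sup>2)
        + mink x x * (\<epsilon> * (mink y a)\<^sup>2 + (mink y b)\<^sup>2) + mink y y * (\<epsilon> * (mink x a)\<^sup>2 + (mink x b)\<^sup>2)
        - 2 * mink x y * (\<epsilon> * (mink x a * mink y a) + mink x b * mink y b)
        - (mink x a * mink y b - mink x b * mink y a)\<^sup>2"
begin

text \<open>The bivector of \<open>a\<close> and \<open>b\<close> as a skew endomorphism: it maps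
  \<open>a\<close> to \<open>b\<close> and \<open>b\<close> to
  \<open>- \<epsilon> *\<^sub>R a\<close>.\<close>

definition X :: "vec4 \<Rightarrow> vec4" where "X x = mink x a *\<^sub>R b - mink x b *\<^sub>R a"
definition Q :: "vec4 \<Rightarrow> vec4 \<Rightarrow> real" where "Q x y = mink (X x) (X y)"
text \<open>For a curve \<open>x\<close> with velocity \<open>y\<close> this is the Wronskian of the
  products with \<open>c\<close> and \<open>d\<close>. It annihilates the image of
  \<open>X\<close>.\<close>

definition B :: "vec4 \<Rightarrow> vec4 \<Rightarrow> real" where "B x y = mink x c * mink y d - mink x d * mink y c"

lemmas frame_simps = aa ab bb ca cb da db
  ab[unfolded mink_commute[of a]] ca[unfolded mink_commute[of c]] cb[unfolded mink_commute[of c]]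
  da[unfolded mink_commute[of d]] db[unfolded mink_commute[of d]]

lemma linear_X: "linear X"
  unfolding X_def by (auto intro!: linearI simp: mink_simps algebra_simps)

lemma bounded_linear_X: "bounded_linear X"
  using linear_X linear_conv_bounded_linear by blast

lemma bilinear_B: "bilinear B"
  unfolding bilinear_def B_def by (auto intro!: linearI simp: mink_simps algebra_simps)

sublocale B: bounded_bilinear B
  using bilinear_conv_bounded_bilinear bilinear_B by blast

lemma bilinear_Q: "bilinear Q"
  unfolding bilinear_def Q_def X_def by (auto intro!: linearI simp: mink_simps algebra_simps)

sublocale Q: bounded_bilinear Q
  using bilinear_conv_bounded_bilinear bilinear_Q by blast

lemma X_simps: "X (x + y) = X x + X y" "X (r *\<^sub>R x) = r *\<^sub>R X x" "X (x - y) = X x - X y" "X (- x) = - X x" "X 0 = 0"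
  using linear_X by (simp_all add: linear_iff X_def mink_simps algebra_simps)

lemma Q_eq: "Q x y = \<epsilon> * (mink x a * mink y a) + mink x b * mink y b"
  by (simp add: Q_def X_def mink_simps frame_simps algebra_simps)

lemma Q_commute: "Q x y = Q y x"
  by (simp add: Q_def mink_commute)

lemma X_skew: "mink (X x) y = - mink x (X y)"
  using mink_commute[of a y] mink_commute[of b y] by (simp add: X_def mink_simps)

lemma X_skew': "mink x (X x) = 0"
  using X_skew[of x x] by (simp add: mink_commute)

lemma XX: "X (X x) = - \<epsilon> *\<^sub>R (mink x a *\<^sub>R a) - mink x b *\<^sub>R b"
  by (simp add: X_def mink_simps frame_simps algebra_simps)

lemma XXX: "X (X (X x)) = - \<epsilon> *\<^sub>R X x"
  by (simp add: X_def mink_simps frame_simps algebra_simps)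

lemma X_eq_0_iff: "X x = 0 \<longleftrightarrow> mink x a = 0 \<and> mink x b = 0"
proof
  assume *: "X x = 0"
  have "mink (X x) a = - mink x b" by (simp add: X_def mink_simps frame_simps)
  then have "mink x b = 0" using * by (simp add: mink_simps)
  moreover from this have "mink x a = 0" using * b_nz by (simp add: X_def)
  ultimately show "mink x a = 0 \<and> mink x b = 0" by simp
qed (simp add: X_def)

lemma X_eq_0_iff_perp: "X x = 0 \<longleftrightarrow> x \<in> mink_perp (span {a, b})"
  unfolding X_eq_0_iff mink_perp_span by (simp add: mink_perp_def)

lemma B_X: "B (X x) y = 0" "B y (X x) = 0"
  by (simp_all add: B_def X_def mink_simps frame_simps)

lemma B_commute: "B x y = - B y x" by (simp add: B_def)

lemma B_same: "B x x = 0" by (simp add: B_def)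

lemma wedge_P: "mink x (X y) = mink y a * mink x b - mink y b * mink x a"
  by (simp add: X_def mink_simps)

lemma B_sq: "(B x y)\<^sup>2 = - \<epsilon> * (mink x x * mink y y - (mink x y)\<^sup>2)
        + mink x x * Q y y + mink y y * Q x x - 2 * mink x y * Q x y - (mink x (X y))\<^sup>2"
  unfolding B_def wedge_sq Q_eq wedge_P by (simp add: power2_eq_square algebra_simps)

text \<open>Vectors whose \<open>X\<close>-images are orthogonal to the vectors themselves have parallel \<open>X\<close>-images,
  since \<open>X\<close> has rank 2.\<close>

lemma X_parallel:
  assumes "mink x (X y) = 0"
  shows "Q y y *\<^sub>R X x = Q x y *\<^sub>R X y"
proof -
  have e: "mink y a * mink x b = mink y b * mink x a" using assms unfolding wedge_P by simp
  have 1: "Q y y * mink x a = Q x y * mink y a" "Q y y * mink x b = Q x y * mink y b"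
    unfolding Q_eq using e by algebra+
  show ?thesis unfolding X_def scaleR_diff_right scaleR_scaleR 1 ..
qed

text \<open>The pair \<open>m\<close>, \<open>X m\<close> is another frame of the same plane, and
  \<open>\<epsilon> * p\<^sup>2 + q\<^sup>2 = 1\<close> says that the change of frame has
  determinant one, so both frames define the same bivector.\<close>

lemma X_change_frame:
  assumes "m = X y" "mink m m = 1"
  shows "X x = mink x m *\<^sub>R X m - mink x (X m) *\<^sub>R m"
proof -
  define p q where "p = mink y a" and "q = mink y b"
  have m: "m = p *\<^sub>R b - q *\<^sub>R a" unfolding assms(1) p_def q_def X_def ..
  have Xm: "X m = (- q) *\<^sub>R b - (\<epsilon> * p) *\<^sub>R a" unfolding m X_def by (simp add: mink_simps frame_simps algebra_simps)
  have 1: "\<epsilon> * p\<^sup>2 + q\<^sup>2 = 1" using assms(2) unfolding m by (simp add: mink_simps frame_simps power2_eq_square algebra_simps)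
  have "mink x m *\<^sub>R X m - mink x (X m) *\<^sub>R m = ((\<epsilon> * p\<^sup>2 + q\<^sup>2) * mink x a) *\<^sub>R b - ((\<epsilon> * p\<^sup>2 + q\<^sup>2) * mink x b) *\<^sub>R a"
    unfolding Xm unfolding m by (simp add: mink_simps power2_eq_square) (simp add: vec_eq_iff algebra_simps)
  then show ?thesis unfolding 1 X_def by simp
qed

text \<open>The pointwise relations between the position vector \<open>f\<close>, the normal \<open>n\<close> and the meridian direction \<open>T\<close>.\<close>

lemma frame_relations:
  assumes f: "mink f f = -1" and n: "mink n n = 1" and T: "mink T T = 1"
    and fn: "mink f n = 0" and fT: "mink f T = 0" and nT: "mink n T = 0"
    and fX: "mink f (X n) = 0" and TX: "mink T (X n) = 0" and pos: "Q n n > 0"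
  shows "(B f T)\<^sup>2 = Q n n" "Q n n * B n T = Q f n * B f T"
    "Q n T = - B f n * B f T" "(B f n)\<^sup>2 = \<epsilon> + (Q f n)\<^sup>2 / Q n n - Q n n"
proof -
  define r where "r = sqrt (Q n n)"
  have r: "r > 0" "r\<^sup>2 = Q n n" using pos by (auto simp: r_def)
  define m where "m = (1/r) *\<^sub>R X n"
  have Xn: "X n = r *\<^sub>R m" using r by (simp add: m_def)
  have mm: "mink m m = 1" using r pos unfolding m_def by (simp add: mink_simps Q_def[symmetric] power2_eq_square)
  have "mink f m = 0" "mink n m = 0" "mink m T = 0"
    using fX TX X_skew'[of n] mink_commute[of "X n" T] by (simp_all add: m_def mink_simps)
  then have "orthonormal_basis f n m T"
    unfolding orthonormal_basis_def using assms mm by simp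
  note ex = orthonormal_basis_expansion[OF this]
  have mX: "m = X ((1/r) *\<^sub>R n)" by (simp add: m_def X_simps)
  define \<rho> \<tau> where "\<rho> = Q f n / r" and "\<tau> = Q n T / r"
  have "mink (X m) y = - Q n y / r" for y
    unfolding X_skew[of m] by (simp add: m_def mink_simps Q_def)
  then have e1: "mink (X m) f = - \<rho>" "mink (X m) n = - r" "mink (X m) T = - \<tau>" "mink (X m) m = 0"
    using X_skew'[of m] r by (simp_all add: \<rho>_def \<tau>_def Q_commute mink_commute r(2)[symmetric] power2_eq_square)
  have Xm: "X m = \<rho> *\<^sub>R f - r *\<^sub>R n - \<tau> *\<^sub>R T"
    using ex[of "X m"] e1 by simp
  \<comment> \<open>The square of \<open>X m\<close> is computed twice: from
    \<open>X (X m) = - \<epsilon> *\<^sub>R m\<close>, valid on the image of \<open>X\<close>, and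
    from the expansion in the frame. The comparison determines \<open>\<tau>\<close> up to
    sign.\<close>
  have "mink (X m) (X m) = \<epsilon>"
    using XXX[of "(1/r) *\<^sub>R n"] mm by (simp add: X_skew[of m] mX[symmetric] mink_simps)
  moreover have "mink (X m) (X m) = - \<rho>\<^sup>2 + r\<^sup>2 + \<tau>\<^sup>2"
    unfolding Xm using assms mink_commute[of n f] mink_commute[of T f] mink_commute[of T n]
    by (simp add: mink_simps power2_eq_square)
  ultimately have t: "\<tau>\<^sup>2 = \<epsilon> + \<rho>\<^sup>2 - r\<^sup>2" by simp
  have Qff: "Q f f = \<rho>\<^sup>2" and QTT: "Q T T = \<tau>\<^sup>2" and QfT: "Q f T = \<rho> * \<tau>"
  proof -
    have "Q n n *\<^sub>R X f = Q f n *\<^sub>R X n" "Q n n *\<^sub>R X T = Q T n *\<^sub>R X n" 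
      using X_parallel fX TX by auto
    then have "(r * r) *\<^sub>R X f = (r * (\<rho> * r)) *\<^sub>R m" "(r * r) *\<^sub>R X T = (r * (\<tau> * r)) *\<^sub>R m"
      using r by (simp_all add: Xn r(2)[symmetric] \<rho>_def \<tau>_def power2_eq_square Q_commute mult.commute)
    then have "(r * r) *\<^sub>R X f = (r * r) *\<^sub>R (\<rho> *\<^sub>R m)" "(r * r) *\<^sub>R X T = (r * r) *\<^sub>R (\<tau> *\<^sub>R m)"
      by (simp_all only: scaleR_scaleR mult.assoc mult.commute mult.left_commute)
    then have "X f = \<rho> *\<^sub>R m" "X T = \<tau> *\<^sub>R m"
      using r(1) unfolding scaleR_cancel_left by simp_all
    then show "Q f f = \<rho>\<^sup>2" "Q T T = \<tau>\<^sup>2" "Q f T = \<rho> * \<tau>" unfolding Q_def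
      by (simp_all add: mink_simps mm power2_eq_square)
  qed
  have fXT: "mink f (X T) = 0"
    using X_parallel[OF TX] fX pos by (metis mink.scaleR_right less_irrefl mult_zero_right real_scaleR_def scaleR_cancel_left mult_eq_0_iff)
  have BfT: "(B f T)\<^sup>2 = r\<^sup>2"
    unfolding B_sq using assms Qff QTT QfT fXT t by (simp add: power2_eq_square algebra_simps)
  then show "(B f T)\<^sup>2 = Q n n" using r by simp
  \<comment> \<open>As \<open>B\<close> annihilates \<open>X m\<close>, the expansion of
    \<open>X m\<close> becomes a linear relation between the values of \<open>B\<close> on
    \<open>f\<close>, \<open>n\<close> and \<open>T\<close>.\<close>
  have B0: "\<rho> * B f y - r * B n y - \<tau> * B T y = 0" for y
    using B_X(1)[of m y] unfolding Xm by (simp add: B.diff_left B.scaleR_left)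
  have "\<rho> * B f T = r * B n T" using B0[of T] by (simp add: B_same)
  then show "Q n n * B n T = Q f n * B f T"
    using r by (simp add: \<rho>_def r(2)[symmetric] field_simps power2_eq_square)
  have 2: "r * B f n = - \<tau> * B f T" using B0[of f] by (simp add: B_same B_commute[of n f] B_commute[of T f])
  then have "B f n * B f T * r = - \<tau> * (B f T)\<^sup>2"  using 2 by algebra
  then have "B f n * B f T * r = (- \<tau> * r) * r" unfolding BfT by (simp add: power2_eq_square)
  then have "B f n * B f T = - \<tau> * r" using r(1) by (metis mult_right_cancel less_irrefl)
  then show "Q n T = - B f n * B f T" using r by (simp add: \<tau>_def)
  have "r\<^sup>2 * (B f n)\<^sup>2 = \<tau>\<^sup>2 * (B f T)\<^sup>2" using 2 by algebra
  then have "(B f n)\<^sup>2 = \<tau>\<^sup>2" using BfT r pos by simp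
  then show "(B f n)\<^sup>2 = \<epsilon> + (Q f n)\<^sup>2 / Q n n - Q n n"
    unfolding t using r pos by (simp add: \<rho>_def power_divide)
qed

end

lemma plane_frame_elliptic:
  assumes "orthonormal_basis c d a b"
  shows "plane_frame a b c d 1"
proof
  note o = assms[unfolded orthonormal_basis_def]
  show "mink a a = 1" "mink a b = 0" "mink b b = 1" "b \<noteq> 0" "mink c a = 0" "mink c b = 0" "mink d a = 0" "mink d b = 0"
    using o by (auto simp: mink_simps)
  fix x y
  have "mink x y = - (mink x c * mink y c) + mink x d * mink y d + mink x a * mink y a + mink x b * mink y b" for x y
    by (subst orthonormal_basis_expansion[OF assms, of x]) (simp add: mink_simps mink_commute)
  note e = this[of x x] this[of y y] this[of x y]
  show "(mink x c * mink y d - mink x d * mink y c)\<^sup>2 =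
        - 1 * (mink x x * mink y y - (mink x y)\<^sup>2)
        + mink x x * (1 * (mink y a)\<^sup>2 + (mink y b)\<^sup>2) + mink y y * (1 * (mink x a)\<^sup>2 + (mink x b)\<^sup>2)
        - 2 * mink x y * (1 * (mink x a * mink y a) + mink x b * mink y b)
        - (mink x a * mink y b - mink x b * mink y a)\<^sup>2"
    unfolding e by (simp add: power2_eq_square algebra_simps)
qed

lemma plane_frame_hyperbolic:
  assumes "orthonormal_basis b a c d"
  shows "plane_frame a b c d (-1)"
proof
  note o = assms[unfolded orthonormal_basis_def]
  show "mink a a = 1" "mink a b = 0" "mink b b = -1" "b \<noteq> 0" "mink c a = 0" "mink c b = 0" "mink d a = 0" "mink d b = 0"
    using o by (auto simp: mink_simps mink_commute)
  fix x y
  have "mink x y = - (mink x b * mink y b) + mink x a * mink y a + mink x c * mink y c + mink x d * mink y d" for x y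
    by (subst orthonormal_basis_expansion[OF assms, of x]) (simp add: mink_simps mink_commute)
  note e = this[of x x] this[of y y] this[of x y]
  show "(mink x c * mink y d - mink x d * mink y c)\<^sup>2 =
        - (-1) * (mink x x * mink y y - (mink x y)\<^sup>2)
        + mink x x * (-1 * (mink y a)\<^sup>2 + (mink y b)\<^sup>2) + mink y y * (-1 * (mink x a)\<^sup>2 + (mink x b)\<^sup>2)
        - 2 * mink x y * (-1 * (mink x a * mink y a) + mink x b * mink y b)
        - (mink x a * mink y b - mink x b * mink y a)\<^sup>2"
    unfolding e by (simp add: power2_eq_square algebra_simps)
qed

text \<open>The complement of the degenerate plane spanned by \<open>b\<close> and \<open>a\<close>
  is spanned by \<open>b\<close> and \<open>d\<close>, so \<open>b\<close> takes the place of
  \<open>c\<close>.\<close>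

lemma plane_frame_parabolic:
  assumes "pseudo_orthonormal_basis b a u d"
  shows "plane_frame a b b d 0"
proof -
  note o = assms[unfolded pseudo_orthonormal_basis_def]
  have p: "mink a a = 1" "mink a b = 0" "mink b b = 0" "b \<noteq> 0" "mink b a = 0" "mink b b = 0" "mink d a = 0" "mink d b = 0"
    using o by (auto simp: mink_simps mink_commute)
  have "mink x y = - (mink x u * mink y b) + mink x a * mink y a - mink x b * mink y u + mink x d * mink y d" for x y
    by (subst pseudo_orthonormal_basis_expansion[OF assms, of x]) (simp add: mink_simps mink_commute)
  note e = this
  have "(mink x b * mink y d - mink x d * mink y b)\<^sup>2 =
        - 0 * (mink x x * mink y y - (mink x y)\<^sup>2)
        + mink x x * (0 * (mink y a)\<^sup>2 + (mink y b)\<^sup>2) + mink y y * (0 * (mink x a)\<^sup>2 + (mink x b)\<^sup>2)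
        - 2 * mink x y * (0 * (mink x a * mink y a) + mink x b * mink y b)
        - (mink x a * mink y b - mink x b * mink y a)\<^sup>2" for x y
    unfolding e[of x x] e[of y y] e[of x y] by (simp add: power2_eq_square algebra_simps)
  then show ?thesis using p by (intro plane_frame.intro) auto
qed

section \<open>One-parameter groups of linear maps\<close>

lemma has_vector_derivative_zero_constant:
  fixes f :: "real \<Rightarrow> 'b::real_normed_vector"
  assumes "convex S" "\<And>x. x \<in> S \<Longrightarrow> (f has_vector_derivative 0) (at x within S)"
  shows "\<exists>c. \<forall>x\<in>S. f x = c"
  using has_derivative_zero_constant[OF assms(1), of f] assms(2)
  by (auto simp: has_vector_derivative_def)

lemma has_vector_derivative_translate:
  fixes x c :: real
  assumes "(H has_vector_derivative D) (at (c + x))"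
  shows "((\<lambda>u. H (c + u)) has_vector_derivative D) (at x)" "((\<lambda>u. H (u + c)) has_vector_derivative D) (at x)"
proof -
  have "((\<lambda>u. c + u) has_vector_derivative 0 + 1) (at x)"
    by (intro has_vector_derivative_add has_vector_derivative_const has_vector_derivative_id)
  then show "((\<lambda>u. H (c + u)) has_vector_derivative D) (at x)"
    using vector_diff_chain_at[of "\<lambda>u. c + u" 1 x H D] assms by (simp add: o_def)
  then show "((\<lambda>u. H (u + c)) has_vector_derivative D) (at x)" by (simp add: add.commute)
qed

text \<open>Averages of orbits are differentiable vectors: for a primitive \<open>H\<close> of the
  orbit of \<open>x\<close>, applying \<open>R h\<close> to \<open>H u - H 0\<close> only shifts the
  limits of integration. The differentiable vectors form a subspace, which is closed in finite
  dimension, and the averages over short intervals tend to \<open>x\<close>.\<close>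

lemma one_parameter_group_differentiable:
  fixes R :: "real \<Rightarrow> 'v::euclidean_space \<Rightarrow> 'v"
  assumes lin: "\<And>s. linear (R s)" and R0: "\<And>x. R 0 x = x" and grp: "\<And>s t x. R (s + t) x = R s (R t x)"
    and cont: "\<And>x. continuous_on UNIV (\<lambda>s. R s x)"
  shows "\<exists>y'. ((\<lambda>s. R s y) has_vector_derivative y') (at 0)"
proof -
  define V where "V = {y. \<exists>y'. ((\<lambda>s. R s y) has_vector_derivative y') (at 0)}"
  have sub: "subspace V"
  proof (rule subspaceI)
    show "0 \<in> V" unfolding V_def using linear_0[OF lin] by (auto intro!: exI[of _ 0])
    show "x + y \<in> V" if "x \<in> V" "y \<in> V" for x y
      using that unfolding V_def by (auto simp: linear_add[OF lin] dest: has_vector_derivative_add)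
    show "c *\<^sub>R x \<in> V" if "x \<in> V" for c x
      using that unfolding V_def by (auto simp: linear_scale[OF lin] dest: bounded_linear.has_vector_derivative[OF bounded_linear_scaleR_right])
  qed
  have "x \<in> V" for x
  proof -
    \<comment> \<open>The interval leaves room for shifting points of \<open>(-1, 1)\<close> by an
      \<open>h\<close> with \<open>\<bar>h\<bar> < 1\<close>.\<close>
    have "continuous_on {-2..2::real} (\<lambda>s. R s x)" using cont continuous_on_subset by blast
    from antiderivative_continuous[OF this] obtain H where
      H0: "\<And>t. t \<in> {-2..2} \<Longrightarrow> (H has_vector_derivative R t x) (at t within {-2..2})" by metis
    have H: "(H has_vector_derivative R t x) (at t)" if "t \<in> {-2<..<2}" for t
      using H0[of t] that by (simp add: at_within_Icc_at)
    have key: "R h (H u - H 0) = H (h + u) - H h" if "h \<in> {-1<..<1}" "u \<in> {0<..<1}" for h u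
    proof -
      let ?d = "\<lambda>u. R h (H u - H 0) - (H (h + u) - H h)"
      have "(?d has_vector_derivative 0) (at v within {-1<..<1})" if "v \<in> {-1<..<1}" for v
      proof -
        have "((\<lambda>u. R h (H u - H 0)) has_vector_derivative R h (R v x)) (at v)"
          by (rule bounded_linear.has_vector_derivative)
            (use lin[of h] H[of v] that in \<open>auto simp: linear_conv_bounded_linear intro!: derivative_eq_intros\<close>)
        moreover have "((\<lambda>u. H (h + u)) has_vector_derivative R (h + v) x) (at v)"
          using H[of "h + v"] that \<open>h \<in> _\<close> by (intro has_vector_derivative_translate) auto
        ultimately have "(?d has_vector_derivative R h (R v x) - R (h + v) x) (at v)"
          by (auto intro!: derivative_eq_intros)
        then show ?thesis by (simp add: grp has_vector_derivative_at_within)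
      qed
      then obtain c where c: "\<And>v. v \<in> {-1<..<1} \<Longrightarrow> ?d v = c"
        using has_vector_derivative_zero_constant[of "{-1<..<1}" ?d] by auto
      from c[of 0] c[of u] that show ?thesis by (simp add: linear_0[OF lin])
    qed
    have inV: "H u - H 0 \<in> V" if "u \<in> {0<..<1}" for u
    proof -
      have "((\<lambda>h. H (h + u) - H h) has_vector_derivative R u x - R 0 x) (at 0)"
        using H[of u] H[of 0] that
        by (intro has_vector_derivative_diff has_vector_derivative_translate) auto
      then have "((\<lambda>h. R h (H u - H 0)) has_vector_derivative R u x - R 0 x) (at 0)"
        by (rule has_vector_derivative_transform_within_open[of _ _ _ "{-1<..<1}"]) (use key that in auto)
      then show ?thesis unfolding V_def by blast
    qed
    have "((\<lambda>u. (H u - H 0) /\<^sub>R u) \<longlongrightarrow> x) (at_right 0)"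
    proof -
      have "((\<lambda>u. (1 / norm (u - 0)) *\<^sub>R (H u - (H 0 + (u - 0) *\<^sub>R x))) \<longlongrightarrow> 0) (at 0)"
        using H[of 0] unfolding R0 has_vector_derivative_def has_derivative_at2 by simp
      then have "((\<lambda>u. (1 / norm u) *\<^sub>R (H u - (H 0 + u *\<^sub>R x))) \<longlongrightarrow> 0) (at_right 0)"
        by (simp add: filterlim_at_split)
      then have "((\<lambda>u. (1 / norm u) *\<^sub>R (H u - (H 0 + u *\<^sub>R x)) + x) \<longlongrightarrow> 0 + x) (at_right 0)"
        by (intro tendsto_intros)
      moreover have "eventually (\<lambda>u. (1 / norm u) *\<^sub>R (H u - (H 0 + u *\<^sub>R x)) + x = (H u - H 0) /\<^sub>R u) (at_right 0)"
        using eventually_at_right_less[of "0::real"]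
        by eventually_elim (simp add: algebra_simps divide_inverse_commute)
      ultimately show ?thesis by (simp add: tendsto_cong)
    qed
    moreover have "eventually (\<lambda>u. (H u - H 0) /\<^sub>R u \<in> V) (at_right 0)"
      using eventually_at_right_less[of 0] eventually_at_right_real[of 0 1] inV sub 
      by (auto elim!: eventually_mono simp: subspace_scale)
    ultimately show "x \<in> V"
      by (intro Lim_in_closed_set[OF closed_subspace[OF sub] _ trivial_limit_at_right_real[of 0]])
  qed
  then show ?thesis unfolding V_def by blast
qed

context plane_frame begin

text \<open>The derivative \<open>D\<close> at \<open>0\<close> is skew for \<open>mink\<close> and
  vanishes on the complement of the plane. Such a map \<open>Z\<close> is determined by the single
  number \<open>mink (Z a) g\<close>, so \<open>D\<close> is a multiple of \<open>X\<close>, and a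
  nonzero one because the group is not trivial.\<close>

lemma rotation_group_generator:
  assumes "rotation_group (span {a, b}) R"
  obtains \<omega> where "\<omega> \<noteq> 0" "\<And>s x. ((\<lambda>s. R s x) has_vector_derivative \<omega> *\<^sub>R X (R s x)) (at s)"
proof -
  note rg = assms[unfolded rotation_group_def]
  have lin: "linear (R s)" and iso: "mink (R s x) (R s y) = mink x y" and grp: "R (s + t) x = R s (R t x)"
    and cont: "continuous_on UNIV (\<lambda>s. R s x)" for s t x y
    using rg by (auto simp: o_def)
  have perp: "R s x = x" if "mink x a = 0" "mink x b = 0" for s x
    using that rg unfolding mink_perp_span by (auto simp: mink_perp_def)
  have R0: "R 0 x = x" for x
  proof -
    \<comment> \<open>\<open>R 0\<close> is idempotent and preserves a nondegenerate form, which
      makes it the identity.\<close>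
    have "mink (R 0 x - x) y = 0" for y
    proof -
      have "mink (R 0 (R 0 x - x)) (R 0 y) = 0" using grp[of 0 0 x] by (simp add: linear_diff[OF lin] mink_simps)
      then show ?thesis by (simp add: iso)
    qed
    then show ?thesis using mink_nondegenerate by fastforce
  qed
  obtain D where D: "\<And>y. ((\<lambda>s. R s y) has_vector_derivative D y) (at 0)"
    using one_parameter_group_differentiable[OF lin R0 grp cont] by metis
  have Ds: "((\<lambda>s. R s y) has_vector_derivative D (R t y)) (at t)" for y t
  proof -
    have "((\<lambda>s. R (s - t) (R t y)) has_vector_derivative D (R t y)) (at t)"
      using vector_diff_chain_at[of "\<lambda>s. s - t" 1 t "\<lambda>s. R s (R t y)" "D (R t y)"] D[of "R t y"]
      by (simp add: o_def has_vector_derivative_diff_const has_vector_derivative_id)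
    then show ?thesis by (simp add: grp[symmetric])
  qed
  have skew: "mink (D x) y = - mink x (D y)" for x y
  proof -
    have "((\<lambda>s. mink (R s x) (R s y)) has_vector_derivative mink (R 0 x) (D y) + mink (D x) (R 0 y)) (at 0)"
      by (rule mink.has_vector_derivative[OF D D])
    then have "((\<lambda>s. mink x y) has_vector_derivative mink x (D y) + mink (D x) y) (at (0::real))"
      by (simp add: iso R0)
    from vector_derivative_unique_at[OF this has_vector_derivative_const] show ?thesis by simp
  qed
  have Dadd: "D (x + y) = D x + D y" for x y
    using vector_derivative_unique_at[OF D[of "x + y"]] has_vector_derivative_add[OF D[of x] D[of y]]
    by (simp add: linear_add[OF lin])
  have Dscale: "D (k *\<^sub>R x) = k *\<^sub>R D x" for k x
    using vector_derivative_unique_at[OF D[of "k *\<^sub>R x"]]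
      bounded_linear.has_vector_derivative[OF bounded_linear_scaleR_right D[of x]]
    by (simp add: linear_scale[OF lin])
  have Dperp: "D x = 0" if "mink x a = 0" "mink x b = 0" for x
  proof -
    have "((\<lambda>s. x) has_vector_derivative D x) (at (0::real))" using D[of x] perp[OF that] by simp
    from vector_derivative_unique_at[OF this has_vector_derivative_const] show ?thesis .
  qed
  obtain y where y: "mink b y \<noteq> 0" using mink_nondegenerate b_nz by blast
  \<comment> \<open>In a degenerate plane \<open>b\<close> is orthogonal to the whole plane. So a
    vector \<open>g\<close> orthogonal to \<open>a\<close> with \<open>mink g b \<noteq> 0\<close>
    is taken as its partner; with \<open>a\<close> and the complement of the plane it spans the
    space.\<close>
  define g where "g = y - mink y a *\<^sub>R a"
  have g: "mink g a = 0" "mink g b \<noteq> 0" using y by (auto simp: g_def mink_simps frame_simps mink_commute[of b y])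
  have dec: "\<exists>p. x = mink x a *\<^sub>R a + (mink x b / mink g b) *\<^sub>R g + p \<and> mink p a = 0 \<and> mink p b = 0" for x
    by (rule exI[of _ "x - mink x a *\<^sub>R a - (mink x b / mink g b) *\<^sub>R g"])
      (use g in \<open>simp add: mink_simps frame_simps\<close>)
  have form: "mink (Z x) y' = (mink x a * (mink y' b / mink g b) - (mink x b / mink g b) * mink y' a) * mink (Z a) g"
    if Zs: "\<And>x y. mink (Z x) y = - mink x (Z y)" and Zadd: "\<And>x y. Z (x + y) = Z x + Z y" and
      Zsc: "\<And>k x. Z (k *\<^sub>R x) = k *\<^sub>R Z x" and Zp: "\<And>x. mink x a = 0 \<Longrightarrow> mink x b = 0 \<Longrightarrow> Z x = 0" for Z x y'
  proof -
    obtain p where p: "x = mink x a *\<^sub>R a + (mink x b / mink g b) *\<^sub>R g + p" "mink p a = 0" "mink p b = 0" using dec by blast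
    obtain p' where p': "y' = mink y' a *\<^sub>R a + (mink y' b / mink g b) *\<^sub>R g + p'" "mink p' a = 0" "mink p' b = 0" using dec by blast
    have Zp': "Z p = 0" "mink (Z u) p' = 0" for u using Zp p(2,3) Zs Zp[OF p'(2,3)] by (auto simp: mink_simps)
    have Z1: "mink (Z a) a = 0" "mink (Z g) g = 0" "mink (Z g) a = - mink (Z a) g" using Zs[of a a] Zs[of g g] Zs[of g a] by (auto simp: mink_commute)
    have "mink (Z x) y' = mink (mink x a *\<^sub>R Z a + (mink x b / mink g b) *\<^sub>R Z g) (mink y' a *\<^sub>R a + (mink y' b / mink g b) *\<^sub>R g + p')"
      by (subst p(1), subst p'(1)) (simp only: Zadd Zsc Zp' add_0_right)
    also have "\<dots> = (mink x a * (mink y' b / mink g b) - (mink x b / mink g b) * mink y' a) * mink (Z a) g"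
      by (simp add: mink.add_left mink.add_right mink.scaleR_left mink.scaleR_right Z1 Zp' algebra_simps)
    finally show ?thesis .
  qed
  have Xa: "X a = b" by (simp add: X_def frame_simps)
  define \<omega> where "\<omega> = mink (D a) g / mink b g"
  have DX: "D x = \<omega> *\<^sub>R X x" for x
  proof -
    have "mink (D x - \<omega> *\<^sub>R X x) y = 0" for y
      using form[of D x y, OF skew Dadd Dscale Dperp] form[of X x y, OF X_skew X_simps(1,2)] g X_eq_0_iff
      by (simp add: mink_simps Xa \<omega>_def mink_commute[of b g])
    then show ?thesis using mink_nondegenerate[of "D x - \<omega> *\<^sub>R X x"] by simp
  qed
  have "\<omega> \<noteq> 0"
  proof
    assume "\<omega> = 0"
    then have "((\<lambda>s. R s x) has_vector_derivative 0) (at t within UNIV)" for x t using Ds[of x t] by (simp add: DX)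
    then have "\<exists>c. \<forall>s. R s x = c" for x
      using has_vector_derivative_zero_constant[of UNIV "\<lambda>s. R s x"] by auto
    then have "R s x = x" for s x using R0 by metis
    then show False using rg by (auto simp: fun_eq_iff)
  qed
  then show ?thesis using that Ds unfolding DX by blast
qed

end

text \<open>The rotation group with its parameter scaled so that the generator is \<open>X\<close>
  itself and not a multiple of it.\<close>

locale flow = plane_frame +
  fixes R :: "real \<Rightarrow> vec4 \<Rightarrow> vec4"
  assumes linear_R: "\<And>s. linear (R s)" and mink_R: "\<And>s x y. mink (R s x) (R s y) = mink x y"
    and R_0: "\<And>x. R 0 x = x" and R_add: "\<And>s t x. R (s + t) x = R s (R t x)"
    and R_derivative: "\<And>s x. ((\<lambda>s. R s x) has_vector_derivative X (R s x)) (at s)"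
begin

lemma R_minus: "R (- s) (R s x) = x" "R s (R (- s) x) = x"
  by (simp_all add: R_0 flip: R_add)

lemma R_X: "R s (X x) = X (R s x)"
proof -
  have "((\<lambda>t. R t x) has_vector_derivative X x) (at 0)" using R_derivative[of x 0] by (simp add: R_0)
  then have "((\<lambda>t. R s (R t x)) has_vector_derivative R s (X x)) (at 0)"
    using linear_R linear_conv_bounded_linear bounded_linear.has_vector_derivative by blast
  moreover have "((\<lambda>t. R t (R s x)) has_vector_derivative X (R s x)) (at 0)"
    using R_derivative[of "R s x" 0] by (simp add: R_0)
  moreover have "R s (R t x) = R t (R s x)" for t by (simp add: add.commute flip: R_add)
  ultimately show ?thesis using vector_derivative_unique_at by simp
qed

text \<open>Skewness of \<open>X\<close> makes the product of any two solutions constant in time.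
  Comparing \<open>z\<close> with the solution that passes through \<open>w\<close> at time
  \<open>s\<close>, for every \<open>w\<close>, gives equality by nondegeneracy.\<close>

lemma R_unique:
  assumes z: "\<And>s. (z has_vector_derivative X (z s)) (at s)" and z0: "z 0 = x"
  shows "R s x = z s"
proof -
  have "mink w (z s - R s x) = 0" for w
  proof -
    let ?w = "R (- s) w"
    have "((\<lambda>t. mink (R t ?w) (z t)) has_vector_derivative mink (R t ?w) (X (z t)) + mink (X (R t ?w)) (z t)) (at t within UNIV)" for t
      using mink.has_vector_derivative[OF R_derivative z] by simp
    then have "((\<lambda>t. mink (R t ?w) (z t)) has_vector_derivative 0) (at t within UNIV)" for t
      by (simp add: X_skew)
    then obtain k where k: "\<And>t. mink (R t ?w) (z t) = k"
      using has_vector_derivative_zero_constant[of UNIV "\<lambda>t. mink (R t ?w) (z t)"] by auto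
    have "mink w (z s) = mink ?w x" using k[of s] k[of 0] by (simp add: R_minus R_0 z0)
    also have "\<dots> = mink w (R s x)" using mink_R[of s ?w x] by (simp add: R_minus)
    finally show ?thesis by (simp add: mink_simps)
  qed
  then show ?thesis using mink_nondegenerate[of "z s - R s x"] by (simp add: mink_commute)
qed

lemma Q_R: "Q (R s x) (R s y) = Q x y"
  by (simp add: Q_def mink_R flip: R_X)

lemma R_perp: "R s c = c" "R s d = d"
  by (rule R_unique; simp add: X_def frame_simps)+

lemma B_R: "B (R s x) (R s y) = B x y"
  using mink_R[of s _ c] mink_R[of s _ d] by (simp add: B_def R_perp)

end

section \<open>Calculus in local parametrizations\<close>

lemma C1_on_has_derivative:
  assumes "C1_on W g" "w \<in> W"
  shows "(g has_derivative frechet_derivative g (at w)) (at w)"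
  using assms frechet_derivative_works unfolding C1_on_def differentiable_def by blast

lemma C1_on_continuous_frechet:
  assumes "C1_on W g"
  shows "continuous_on W (\<lambda>w. frechet_derivative g (at w) v)"
proof -
  obtain g' where g': "\<And>w. w \<in> W \<Longrightarrow> (g has_derivative blinfun_apply (g' w)) (at w)" "continuous_on W g'"
    using assms unfolding C1_on_def by blast
  have "continuous_on W (\<lambda>w. blinfun_apply (g' w) v)" by (intro continuous_intros g')
  then show ?thesis
    by (rule continuous_on_eq) (use frechet_derivative_at[OF g'(1)] in auto)
qed

lemma C1_on_continuous: "C1_on W g \<Longrightarrow> continuous_on W g"
  unfolding C1_on_def by (meson has_derivative_continuous continuous_at_imp_continuous_on)

lemma C1_on_compose:
  assumes F: "C1_on W F" and gW: "g ` V \<subseteq> W"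
    and g: "\<And>y. y \<in> V \<Longrightarrow> (g has_derivative blinfun_apply (g' y)) (at y)" "continuous_on V g'"
  shows "C1_on V (F \<circ> g)"
proof -
  obtain F' where F': "\<And>w. w \<in> W \<Longrightarrow> (F has_derivative blinfun_apply (F' w)) (at w)" "continuous_on W F'"
    using F unfolding C1_on_def by blast
  have cg: "continuous_on V g"
    using g(1) by (meson has_derivative_continuous continuous_at_imp_continuous_on)
  have "continuous_on V (\<lambda>y. F' (g y) o\<^sub>L g' y)"
    by (intro continuous_intros continuous_on_compose2[OF F'(2) cg gW] g)
  moreover have "(F \<circ> g has_derivative blinfun_apply (F' (g y) o\<^sub>L g' y)) (at y)" if "y \<in> V" for y
  proof -
    have "(F \<circ> g has_derivative blinfun_apply (F' (g y)) \<circ> blinfun_apply (g' y)) (at y)"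
      using g(1)[OF that] F'(1)[of "g y"] gW that by (intro diff_chain_at) auto
    moreover have "blinfun_apply (F' (g y)) \<circ> blinfun_apply (g' y) = blinfun_apply (F' (g y) o\<^sub>L g' y)"
      by (simp add: fun_eq_iff)
    ultimately show ?thesis by simp
  qed
  ultimately show ?thesis unfolding C1_on_def by (intro exI[of _ "\<lambda>y. F' (g y) o\<^sub>L g' y"]) blast
qed

text \<open>An immersion reflects differentiability of continuous curves; this makes a merely
  continuous action on the surface usable. With a left inverse \<open>L\<close> of
  \<open>F'\<close>, the norm of \<open>c s - w - s *\<^sub>R v\<close> is at most
  \<open>\<eta> * norm (c s - w) + \<eta> * \<bar>s\<bar>\<close>. One fixed \<open>\<eta>\<close>
  gives a Lipschitz bound for \<open>c\<close> at \<open>0\<close>, and with this bound the estimate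
  for arbitrary \<open>\<eta>\<close> becomes differentiability.\<close>

lemma immersion_curve:
  fixes F :: "'u::euclidean_space \<Rightarrow> 'v::euclidean_space" and c :: "real \<Rightarrow> 'u"
  assumes F: "(F has_derivative F') (at w)" and inj: "inj F'"
    and c: "isCont c 0" "c 0 = w" and u: "((\<lambda>s. F (c s)) has_vector_derivative u) (at 0)"
  shows "\<exists>v. (c has_vector_derivative v) (at 0) \<and> F' v = u"
proof -
  have lin: "linear F'" using F has_derivative_linear by blast
  obtain L where L: "linear L" "L \<circ> F' = id"
    using linear_injective_left_inverse[OF lin inj] by blast
  have bL: "bounded_linear L" using L(1) linear_conv_bounded_linear by blast
  define v where "v = L u"
  have G: "((\<lambda>x. L (F x)) has_derivative (\<lambda>x. x)) (at w)"
    using bounded_linear.has_derivative[OF bL F] L(2) by (simp add: fun_eq_iff)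
  have e: "((\<lambda>s. L (F (c s))) has_derivative (\<lambda>s. s *\<^sub>R v)) (at 0)"
    using bounded_linear.has_vector_derivative[OF bL u] by (simp add: has_vector_derivative_def v_def)
  have est: "\<exists>d>0. \<forall>s. \<bar>s\<bar> < d \<longrightarrow> norm (c s - w - s *\<^sub>R v) \<le> \<eta> * norm (c s - w) + \<eta> * \<bar>s\<bar>" if eta: "\<eta> > 0" for \<eta>
  proof -
    obtain d1 where d1: "d1 > 0" "\<And>y. norm (y - w) < d1 \<Longrightarrow> norm (L (F y) - L (F w) - (y - w)) \<le> \<eta> * norm (y - w)"
      using conjunct2[OF G[unfolded has_derivative_at_alt], rule_format, OF eta] by auto
    obtain d2 where d2: "d2 > 0" "\<And>s. norm (s - 0) < d2 \<Longrightarrow> norm (L (F (c s)) - L (F (c 0)) - (s - 0) *\<^sub>R v) \<le> \<eta> * norm (s - 0)"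
      using conjunct2[OF e[unfolded has_derivative_at_alt], rule_format, OF eta] by auto
    obtain d3 where d3: "d3 > 0" "\<And>s. \<bar>s\<bar> < d3 \<Longrightarrow> norm (c s - w) < d1"
      using c d1(1) unfolding continuous_at_eps_delta by (auto simp: dist_norm)
    have "norm (c s - w - s *\<^sub>R v) \<le> \<eta> * norm (c s - w) + \<eta> * \<bar>s\<bar>" if "\<bar>s\<bar> < min d2 d3" for s
    proof -
      have "c s - w - s *\<^sub>R v = (L (F (c s)) - L (F w) - s *\<^sub>R v) - (L (F (c s)) - L (F w) - (c s - w))" by simp
      then have "norm (c s - w - s *\<^sub>R v) \<le> norm (L (F (c s)) - L (F w) - s *\<^sub>R v) + norm (L (F (c s)) - L (F w) - (c s - w))"
        by (metis norm_triangle_ineq4)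
      also have "\<dots> \<le> \<eta> * \<bar>s\<bar> + \<eta> * norm (c s - w)"
        using d1(2)[of "c s"] d2(2)[of s] d3(2)[of s] that c(2) by (intro add_mono) auto
      finally show ?thesis by simp
    qed
    then show ?thesis using d2 d3 by (intro exI[of _ "min d2 d3"]) auto
  qed
  obtain d0 where d0: "d0 > 0" "\<And>s. \<bar>s\<bar> < d0 \<Longrightarrow> norm (c s - w - s *\<^sub>R v) \<le> (1/2) * norm (c s - w) + (1/2) * \<bar>s\<bar>"
    using est[of "1/2"] by auto
  \<comment> \<open>Absorbing half of \<open>norm (c s - w)\<close> on the left leaves
    \<open>2 * norm v + 1\<close> as Lipschitz constant.\<close>
  define K where "K = 2 * norm v + 1"
  have lip: "norm (c s - w) \<le> K * \<bar>s\<bar>" if "\<bar>s\<bar> < d0" for s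
  proof -
    have "norm (c s - w) \<le> norm (c s - w - s *\<^sub>R v) + norm (s *\<^sub>R v)"
      by (metis diff_add_cancel norm_triangle_ineq)
    then show ?thesis using d0(2)[OF that] by (simp add: K_def algebra_simps)
  qed
  have Kpos: "K > 0" by (simp add: K_def add_nonneg_pos)
  have "(c has_derivative (\<lambda>s. s *\<^sub>R v)) (at 0)"
    unfolding has_derivative_at_alt
  proof (intro conjI allI impI)
    show "bounded_linear (\<lambda>s. s *\<^sub>R v)" by (rule bounded_linear_scaleR_left)
    fix \<epsilon> :: real assume "\<epsilon> > 0"
    define \<eta> where "\<eta> = \<epsilon> / (K + 1)"
    have \<eta>: "\<eta> > 0" "\<eta> * (K + 1) = \<epsilon>" using \<open>\<epsilon> > 0\<close> Kpos by (auto simp: \<eta>_def)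
    obtain d where d: "d > 0" "\<And>s. \<bar>s\<bar> < d \<Longrightarrow> norm (c s - w - s *\<^sub>R v) \<le> \<eta> * norm (c s - w) + \<eta> * \<bar>s\<bar>"
      using est[OF \<eta>(1)] by blast
    have "norm (c s - w - s *\<^sub>R v) \<le> \<epsilon> * \<bar>s\<bar>" if "\<bar>s\<bar> < min d d0" for s
    proof -
      have "\<eta> * norm (c s - w) \<le> \<eta> * (K * \<bar>s\<bar>)" using lip[of s] that \<eta>(1) by (intro mult_left_mono) auto
      then have "norm (c s - w - s *\<^sub>R v) \<le> \<eta> * (K + 1) * \<bar>s\<bar>" using d(2)[of s] that by (simp add: algebra_simps)
      then show ?thesis by (simp add: \<eta>(2))
    qed
    then show "\<exists>d>0. \<forall>y. norm (y - 0) < d \<longrightarrow> norm (c y - c 0 - (y - 0) *\<^sub>R v) \<le> \<epsilon> * norm (y - 0)"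
      using d(1) d0(1) c(2) by (intro exI[of _ "min d d0"]) auto
  qed
  then have cv: "(c has_vector_derivative v) (at 0)" by (simp add: has_vector_derivative_def)
  have "((\<lambda>s. F (c s)) has_vector_derivative F' v) (at 0)"
    using vector_derivative_diff_chain_within[OF cv, of F F'] F c(2) has_derivative_at_withinI
    by (fastforce simp: o_def)
  then have "F' v = u" using u vector_derivative_unique_at by blast
  then show ?thesis using cv by blast
qed

lemma local_param_D:
  assumes "local_param M f n W h"
  shows "open W" "openin (top_of_set M) (h ` W)" "C1_on W (f \<circ> h)" "C1_on W (n \<circ> h)"
    "\<And>w. w \<in> W \<Longrightarrow> inj (frechet_derivative (f \<circ> h) (at w))"
    "\<And>w. w \<in> W \<Longrightarrow> h w \<in> M"
  using assms openin_imp_subset unfolding local_param_def by blast+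

text \<open>A continuous curve whose image under \<open>f\<close> is differentiable is
  differentiable in the chart, by \<open>immersion_curve\<close>. So \<open>n\<close> can be
  differentiated along curves, such as orbits, of which only the image under \<open>f\<close> is
  known to be differentiable.\<close>

lemma curve_lift:
  fixes c :: "real \<Rightarrow> 'a::t2_space"
  assumes lp: "local_param M f n W h" and w: "w \<in> W" and U: "open U" "0 \<in> U"
    and c: "continuous_on U c" "c ` U \<subseteq> M" "c 0 = h w"
    and p: "((\<lambda>s. f (c s)) has_vector_derivative p) (at 0)"
  shows "\<exists>v. frechet_derivative (f \<circ> h) (at w) v = p \<and>
    ((\<lambda>s. n (c s)) has_vector_derivative frechet_derivative (n \<circ> h) (at w) v) (at 0)"
proof -
  obtain k where k: "homeomorphism W (h ` W) h k" using lp unfolding local_param_def by blast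
  define U1 where "U1 = U \<inter> c -` (h ` W)"
  have "openin (top_of_set U) U1" unfolding U1_def
    using continuous_openin_preimage[OF c(1) _ local_param_D(2)[OF lp]] c(2) by blast
  then have oU1: "open U1" using U(1) openin_open_eq by blast
  have 0: "0 \<in> U1" using U c(3) w by (auto simp: U1_def)
  have "continuous_on U1 (k \<circ> c)"
    using k c(1) unfolding homeomorphism_def U1_def
    by (intro continuous_on_compose) (auto intro: continuous_on_subset)
  then have "isCont (k \<circ> c) 0" using oU1 0 continuous_on_eq_continuous_at by blast
  moreover have kc: "h ((k \<circ> c) s) = c s" if "s \<in> U1" for s
    using k that unfolding homeomorphism_def U1_def by auto
  have k0: "(k \<circ> c) 0 = w" using k c(3) w unfolding homeomorphism_def by auto
  have "((\<lambda>s. (f \<circ> h) ((k \<circ> c) s)) has_vector_derivative p) (at 0)"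
    using has_vector_derivative_transform_within_open[OF p oU1 0] kc by simp
  ultimately obtain v where v: "(k \<circ> c has_vector_derivative v) (at 0)" "frechet_derivative (f \<circ> h) (at w) v = p"
    using immersion_curve[OF C1_on_has_derivative[OF local_param_D(3)[OF lp] w] local_param_D(5)[OF lp w]] k0 by blast
  have "((n \<circ> h) \<circ> (k \<circ> c) has_vector_derivative frechet_derivative (n \<circ> h) (at w) v) (at 0)"
    using vector_derivative_diff_chain_within[OF v(1), of "n \<circ> h"] k0
      C1_on_has_derivative[OF local_param_D(4)[OF lp] w] has_derivative_at_withinI by fastforce
  then have "((\<lambda>s. n (c s)) has_vector_derivative frechet_derivative (n \<circ> h) (at w) v) (at 0)"
    by (rule has_vector_derivative_transform_within_open[OF _ oU1 0]) (use kc in simp)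
  then show ?thesis using v(2) by blast
qed

text \<open>The addition to the inverse function theorem is the continuity of the derivative of the
  inverse, which in two dimensions is visible from Cramer's rule with the Jacobian determinant
  \<open>\<Delta>\<close>.\<close>

lemma C1_inverse_2d:
  fixes G :: "real \<times> real \<Rightarrow> real \<times> real" and G' :: "real \<times> real \<Rightarrow> real \<times> real \<Rightarrow> real \<times> real"
  assumes U: "open U" and G: "\<And>w. w \<in> U \<Longrightarrow> (G has_derivative G' w) (at w)"
    and cont: "\<And>v. continuous_on U (\<lambda>w. G' w v)" and w0: "w0 \<in> U" and inj: "inj (G' w0)"
  obtains U' V g g' where "open U'" "U' \<subseteq> U" "w0 \<in> U'" "open V" "homeomorphism U' V G g"
    "\<And>y. y \<in> V \<Longrightarrow> (g has_derivative blinfun_apply (g' y)) (at y)" "continuous_on V g'"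
    "\<And>y v. y \<in> V \<Longrightarrow> G' (g y) (blinfun_apply (g' y) v) = v"
proof -
  define Gb where "Gb w = Blinfun (G' w)" for w
  have bl: "bounded_linear (G' w)" if "w \<in> U" for w using G[OF that] has_derivative_bounded_linear by blast
  have Gb: "blinfun_apply (Gb w) = G' w" if "w \<in> U" for w
    using bl[OF that] by (simp add: Gb_def bounded_linear_Blinfun_apply)
  have contb: "continuous_on U Gb"
    by (intro continuous_on_blinfun_componentwise continuous_on_eq[OF cont]) (simp add: Gb)
  obtain L where L: "linear L" "L \<circ> G' w0 = id"
    using linear_injective_left_inverse[OF bounded_linear.linear[OF bl[OF w0]] inj] by blast
  have "L (G' w0 v) = v" for v using L(2) by (metis comp_apply id_apply)
  then have "Blinfun L o\<^sub>L Gb w0 = id_blinfun"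
    using L(1) by (intro blinfun_eqI) (simp add: Gb[OF w0] bounded_linear_Blinfun_apply linear_conv_bounded_linear[symmetric])
  from inverse_function_theorem[OF U _ contb w0 this, of G] G Gb
  obtain U' V g g' where *: "open U'" "U' \<subseteq> U" "w0 \<in> U'" "open V" "homeomorphism U' V G g"
    "\<And>y. y \<in> V \<Longrightarrow> (g has_derivative g' y) (at y)"
    "\<And>y. y \<in> V \<Longrightarrow> g' y = inv (blinfun_apply (Gb (g y)))"
    "\<And>y. y \<in> V \<Longrightarrow> bij (blinfun_apply (Gb (g y)))" by auto metis
  have gU: "g y \<in> U" if "y \<in> V" for y using *(2,5) that unfolding homeomorphism_def by blast
  have bij: "bij (G' (g y))" and g'_inv: "g' y = inv (G' (g y))" if "y \<in> V" for y
    using *(7,8)[OF that] Gb[OF gU[OF that]] by auto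
  have GG: "G' (g y) (g' y v) = v" if "y \<in> V" for y v
    using bij[OF that] g'_inv[OF that] by (simp add: bij_is_surj surj_f_inv_f)
  have cg: "continuous_on V g" using *(5) unfolding homeomorphism_def by blast
  define P where "P y = G' (g y) (1, 0)" for y
  define S where "S y = G' (g y) (0, 1)" for y
  have cP: "continuous_on V P" "continuous_on V S" unfolding P_def S_def
    using gU by (auto intro!: continuous_on_compose2[OF cont cg])
  have lin: "G' (g y) (s, t) = s *\<^sub>R P y + t *\<^sub>R S y" if "y \<in> V" for y s t
  proof -
    interpret bounded_linear "G' (g y)" using bl gU that by blast
    have "(s, t) = s *\<^sub>R (1, 0) + t *\<^sub>R (0, 1::real)" by simp
    then show ?thesis unfolding P_def S_def by (metis add scaleR)
  qed
  define \<Delta> where "\<Delta> y = fst (P y) * snd (S y) - snd (P y) * fst (S y)" for y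
  have \<Delta>: "\<Delta> y \<noteq> 0" if "y \<in> V" for y
  proof
    assume "\<Delta> y = 0"
    then have "G' (g y) (snd (S y), - snd (P y)) = G' (g y) (0, 0)" "G' (g y) (- fst (S y), fst (P y)) = G' (g y) (0, 0)"
      unfolding lin[OF that] by (auto simp: \<Delta>_def prod_eq_iff algebra_simps)
    then have "(snd (S y), - snd (P y)) = (0, 0)" "(- fst (S y), fst (P y)) = (0, 0)"
      using bij[OF that] by (meson bij_is_inj injD)+
    then have "G' (g y) (1, 0) = G' (g y) (0, 0)" unfolding lin[OF that] by (simp add: prod_eq_iff)
    then have "(1::real, 0::real) = (0, 0)" using bij[OF that] by (meson bij_is_inj injD)
    then show False by simp
  qed
  have g'_eq: "g' y v = ((fst v * snd (S y) - snd v * fst (S y)) / \<Delta> y, (snd v * fst (P y) - fst v * snd (P y)) / \<Delta> y)"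
    if "y \<in> V" for y v
  proof -
    have "G' (g y) ((fst v * snd (S y) - snd v * fst (S y)) / \<Delta> y, (snd v * fst (P y) - fst v * snd (P y)) / \<Delta> y) = v"
    proof -
      have "(fst v * snd (S y) - snd v * fst (S y)) * fst (P y) + (snd v * fst (P y) - fst v * snd (P y)) * fst (S y) = fst v * \<Delta> y"
        "(fst v * snd (S y) - snd v * fst (S y)) * snd (P y) + (snd v * fst (P y) - fst v * snd (P y)) * snd (S y) = snd v * \<Delta> y"
        by (simp_all add: \<Delta>_def algebra_simps)
      then show ?thesis unfolding lin[OF that] using \<Delta>[OF that]
        by (simp add: prod_eq_iff flip: add_divide_distrib)
    qed
    then show ?thesis using GG[OF that] bij[OF that] by (metis bij_is_inj injD)
  qed
  define gb where "gb y = Blinfun (g' y)" for y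
  have gb: "blinfun_apply (gb y) = g' y" if "y \<in> V" for y
    unfolding gb_def by (rule bounded_linear_Blinfun_apply[OF has_derivative_bounded_linear[OF *(6)[OF that]]])
  have "continuous_on V gb"
  proof (rule continuous_on_blinfun_componentwise)
    fix i :: "real \<times> real"
    have "continuous_on V (\<lambda>y. ((fst i * snd (S y) - snd i * fst (S y)) / \<Delta> y, (snd i * fst (P y) - fst i * snd (P y)) / \<Delta> y))"
      unfolding \<Delta>_def by (intro continuous_intros cP) (use \<Delta> in \<open>auto simp: \<Delta>_def\<close>)
    then show "continuous_on V (\<lambda>y. blinfun_apply (gb y) i)"
      by (rule continuous_on_eq) (simp add: gb g'_eq)
  qed
  then show ?thesis
    using * GG gb by (intro that[of U' V g gb]) auto
qed

lemma local_param_reparam: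
  assumes lp: "local_param M f n W h" and U: "open U" "U \<subseteq> W" and V: "open V" and hom: "homeomorphism U V G g"
    and g': "\<And>y. y \<in> V \<Longrightarrow> (g has_derivative blinfun_apply (g' y)) (at y)" "continuous_on V g'"
    and inj: "\<And>y. y \<in> V \<Longrightarrow> inj (blinfun_apply (g' y))"
  shows "local_param M f n V (h \<circ> g)"
proof -
  obtain k where k: "homeomorphism W (h ` W) h k" using lp unfolding local_param_def by blast
  have gV: "g ` V = U" using hom unfolding homeomorphism_def by blast
  then have gW: "g ` V \<subseteq> W" using U by blast
  have hom2: "homeomorphism V (h ` U) (h \<circ> g) (G \<circ> k)"
    using homeomorphism_compose[OF homeomorphism_symD[OF hom] homeomorphism_of_subsets[OF k U(2) image_mono[OF U(2)] refl]] by simp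
  have "openin (top_of_set W) U" using U by (simp add: open_subset)
  then have "openin (top_of_set (h ` W)) (h ` U)" using homeomorphism_imp_open_map[OF k] by blast
  then have op: "openin (top_of_set M) (h ` U)" using local_param_D(2)[OF lp] openin_trans by blast
  have "inj (frechet_derivative (f \<circ> (h \<circ> g)) (at y))" if "y \<in> V" for y
  proof -
    have gy: "g y \<in> W" using that gW by blast
    have "(f \<circ> h \<circ> g has_derivative frechet_derivative (f \<circ> h) (at (g y)) \<circ> blinfun_apply (g' y)) (at y)"
      by (intro diff_chain_at g' that C1_on_has_derivative[OF local_param_D(3)[OF lp]] gy)
    then have "frechet_derivative (f \<circ> (h \<circ> g)) (at y) = frechet_derivative (f \<circ> h) (at (g y)) \<circ> blinfun_apply (g' y)"
      using frechet_derivative_at by (metis comp_assoc)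
    then show ?thesis using local_param_D(5)[OF lp gy] inj[OF that] by (simp add: inj_compose)
  qed
  moreover have "C1_on V (f \<circ> (h \<circ> g))" "C1_on V (n \<circ> (h \<circ> g))"
    using C1_on_compose[OF local_param_D(3)[OF lp] gW g'] C1_on_compose[OF local_param_D(4)[OF lp] gW g']
    by (simp_all add: comp_assoc)
  moreover have "(h \<circ> g) ` V = h ` U" unfolding image_comp[symmetric] gV ..
  ultimately show ?thesis unfolding local_param_def using V op hom2 by metis
qed

lemma local_param_subset:
  assumes lp: "local_param M f n W h" and U: "open U" "U \<subseteq> W"
  shows "local_param M f n U h"
  using local_param_reparam[OF lp U U(1), of id id "\<lambda>_. id_blinfun"]
  by (simp add: homeomorphism_def has_derivative_ident id_def[symmetric] has_derivative_id)

lemma local_param_cong: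
  assumes lp: "local_param M f n W h" and eq: "\<And>w. w \<in> W \<Longrightarrow> h w = h' w"
  shows "local_param M f n W h'"
proof -
  have W: "open W" using lp local_param_D by blast
  have im: "h ` W = h' ` W" using eq by auto
  have der: "((F \<circ> h) has_derivative D) (at w) \<Longrightarrow> ((F \<circ> h') has_derivative D) (at w)" if "w \<in> W" for F :: "'a \<Rightarrow> vec4" and D w
    using has_derivative_transform_within_open[of "F \<circ> h" D w UNIV W "F \<circ> h'"] W that eq by auto
  have C1: "C1_on W (F \<circ> h) \<Longrightarrow> C1_on W (F \<circ> h')" for F :: "'a \<Rightarrow> vec4" unfolding C1_on_def using der by blast
  have "frechet_derivative (f \<circ> h') (at w) = frechet_derivative (f \<circ> h) (at w)" if "w \<in> W" for w
    using der[OF that C1_on_has_derivative[OF local_param_D(3)[OF lp] that]] frechet_derivative_at by metis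
  moreover have "homeomorphism W (h' ` W) h' k" if "homeomorphism W (h ` W) h k" for k
    using that eq im by (simp add: homeomorphism_def cong: continuous_on_cong)
  ultimately show ?thesis using lp C1 W im unfolding local_param_def by auto
qed

lemma local_param_image:
  assumes lp: "local_param M f n W h" and A: "homeomorphism M M A A'" and L: "linear L" "inj L"
    and fA: "\<And>x. x \<in> M \<Longrightarrow> f (A x) = L (f x)" and nA: "\<And>x. x \<in> M \<Longrightarrow> n (A x) = L (n x)"
  shows "local_param M f n W (A \<circ> h)"
proof -
  obtain k where k: "homeomorphism W (h ` W) h k" using lp unfolding local_param_def by blast
  have hM: "h ` W \<subseteq> M" using local_param_D(6)[OF lp] by blast
  have bL: "bounded_linear L" using L linear_conv_bounded_linear by blast
  have op: "openin (top_of_set M) ((A \<circ> h) ` W)"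
    using homeomorphism_imp_open_map[OF A local_param_D(2)[OF lp]] by (simp add: image_comp)
  have "A ` h ` W \<subseteq> M" using A hM unfolding homeomorphism_def by blast
  then have hom: "homeomorphism W ((A \<circ> h) ` W) (A \<circ> h) (k \<circ> A')"
    using homeomorphism_compose[OF k homeomorphism_of_subsets[OF A hM _ refl]] by (simp add: image_comp)
  have eqf: "(f \<circ> (A \<circ> h)) w = (L \<circ> (f \<circ> h)) w" "(n \<circ> (A \<circ> h)) w = (L \<circ> (n \<circ> h)) w" if "w \<in> W" for w
    using that hM fA nA by auto
  have W: "open W" using lp local_param_D by blast
  have der: "(f \<circ> (A \<circ> h) has_derivative L \<circ> frechet_derivative (f \<circ> h) (at w)) (at w)" if "w \<in> W" for w
    using has_derivative_transform_within_open[of "L \<circ> (f \<circ> h)" "L \<circ> frechet_derivative (f \<circ> h) (at w)" w UNIV W "f \<circ> (A \<circ> h)"]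
      eqf W that diff_chain_at[OF C1_on_has_derivative[OF local_param_D(3)[OF lp] that] bounded_linear_imp_has_derivative[OF bL]] by auto
  have C1: "C1_on W F'" if F: "C1_on W F" and eq: "\<And>w. w \<in> W \<Longrightarrow> F' w = (L \<circ> F) w" for F F' :: "real \<times> real \<Rightarrow> vec4"
  proof -
    obtain D where D: "\<And>w. w \<in> W \<Longrightarrow> (F has_derivative blinfun_apply (D w)) (at w)" "continuous_on W D"
      using F unfolding C1_on_def by blast
    have "(F' has_derivative blinfun_apply (Blinfun L o\<^sub>L D w)) (at w)" if "w \<in> W" for w
    proof -
      have "L \<circ> blinfun_apply (D w) = blinfun_apply (Blinfun L o\<^sub>L D w)"
        using bL by (simp add: fun_eq_iff bounded_linear_Blinfun_apply)
      then show ?thesis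
        using has_derivative_transform_within_open[of "L \<circ> F" "L \<circ> blinfun_apply (D w)" w UNIV W F'] W that eq
          diff_chain_at[OF D(1)[OF that] bounded_linear_imp_has_derivative[OF bL]] by auto
    qed
    moreover have "continuous_on W (\<lambda>w. Blinfun L o\<^sub>L D w)" by (intro continuous_intros D)
    ultimately show ?thesis unfolding C1_on_def by (intro exI[of _ "\<lambda>w. Blinfun L o\<^sub>L D w"]) blast
  qed
  have "inj (frechet_derivative (f \<circ> (A \<circ> h)) (at w))" if "w \<in> W" for w
    using frechet_derivative_at[OF der[OF that]] local_param_D(5)[OF lp that] L(2) by (metis inj_compose)
  then show ?thesis unfolding local_param_def
    using W op hom C1[OF local_param_D(3)[OF lp] eqf(1)] C1[OF local_param_D(4)[OF lp] eqf(2)] by blast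
qed

lemma continuous_on_locally:
  fixes M :: "'a::t2_space set"
  assumes "\<And>x. x \<in> M \<Longrightarrow> \<exists>T. openin (top_of_set M) T \<and> x \<in> T \<and> continuous_on T F"
  shows "continuous_on M F"
  unfolding continuous_on_eq_continuous_within
proof
  fix x assume "x \<in> M"
  then obtain T where T: "openin (top_of_set M) T" "x \<in> T" "continuous_on T F" using assms by blast
  then obtain S where S: "open S" "T = M \<inter> S" by (auto simp: openin_open)
  have "at x within M = at x within T"
    by (rule at_within_nhd[of x S]) (use S T in auto)
  then show "continuous (at x within M) F" using T by (simp add: continuous_on_eq_continuous_within)
qed

lemma surface_continuous:
  assumes "surface_with_gauss_map M f n"
  shows "continuous_on M f" "continuous_on M n"
proof -
  have cont: "continuous_on (h ` W) F" if lp: "local_param M f n W h" and C1: "C1_on W (F \<circ> h)" for W h and F :: "'a \<Rightarrow> vec4"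
  proof -
    obtain k where k: "homeomorphism W (h ` W) h k" using lp unfolding local_param_def by blast
    have "k ` h ` W = W" "continuous_on (h ` W) k" using k unfolding homeomorphism_def by auto
    then have "continuous_on (h ` W) ((F \<circ> h) \<circ> k)"
      using C1_on_continuous[OF C1] by (intro continuous_on_compose[of _ k]) simp_all
    then show ?thesis by (rule continuous_on_eq) (use k in \<open>auto simp: homeomorphism_def\<close>)
  qed
  have ex: "\<exists>W h. local_param M f n W h \<and> x \<in> h ` W" if "x \<in> M" for x
    using assms that unfolding surface_with_gauss_map_def by blast
  show "continuous_on M f"
    by (rule continuous_on_locally) (metis ex cont local_param_D(2,3))
  show "continuous_on M n"
    by (rule continuous_on_locally) (metis ex cont local_param_D(2,4))
qed

lemma constant_has_derivative_zero:
  assumes "(g has_derivative D) (at w)" "open W" "w \<in> W" "\<And>y. y \<in> W \<Longrightarrow> g y = k"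
  shows "D v = 0"
proof -
  have "((\<lambda>_. k) has_derivative D) (at w)"
    using has_derivative_transform_within_open[OF assms(1-3)] assms(4) by simp
  then show ?thesis using has_derivative_unique has_derivative_const by metis
qed

section \<open>Rotational surfaces and their principal directions\<close>

text \<open>\<open>Q_pos\<close> says that the orbit of a point off the axis is spacelike. In
  hyperbolic space this is true for a different reason in each signature; as an assumption it keeps
  the rest uniform.\<close>

locale rot_surface = flow a b c d \<epsilon> R for a b c d \<epsilon> R +
  fixes Hb :: real and M :: "'a::t2_space set" and f n :: "'a \<Rightarrow> vec4" and \<phi> :: "real \<Rightarrow> 'a \<Rightarrow> 'a"
  assumes eps: "\<epsilon> = 1 \<or> \<epsilon> = 0 \<or> \<epsilon> = -1" and Hb: "Hb\<^sup>2 > 1"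
    and surf: "surface_with_gauss_map M f n" and chmc: "constant_harmonic_mean_curvature M f n Hb"
    and \<phi>_M: "\<And>s x. x \<in> M \<Longrightarrow> \<phi> s x \<in> M" and f_\<phi>: "\<And>s x. x \<in> M \<Longrightarrow> f (\<phi> s x) = R s (f x)"
    and \<phi>_0: "\<And>x. x \<in> M \<Longrightarrow> \<phi> 0 x = x" and \<phi>_add: "\<And>s t x. x \<in> M \<Longrightarrow> \<phi> (s + t) x = \<phi> s (\<phi> t x)"
    and \<phi>_cont: "continuous_on (UNIV \<times> M) (\<lambda>(s, x). \<phi> s x)"
    and Q_pos: "\<And>x. x \<in> M \<Longrightarrow> X (f x) \<noteq> 0 \<Longrightarrow> Q (f x) (f x) > 0"
begin

definition DF :: "(real \<times> real \<Rightarrow> 'a) \<Rightarrow> real \<times> real \<Rightarrow> real \<times> real \<Rightarrow> vec4" where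
  "DF h w = frechet_derivative (f \<circ> h) (at w)"
definition DN :: "(real \<times> real \<Rightarrow> 'a) \<Rightarrow> real \<times> real \<Rightarrow> real \<times> real \<Rightarrow> vec4" where
  "DN h w = frechet_derivative (n \<circ> h) (at w)"

abbreviation chart where "chart \<equiv> local_param M f n"

lemma Hb_nz: "Hb \<noteq> 0" using Hb by auto

lemma mink_fn: 
  assumes "x \<in> M" shows "mink (f x) (f x) = -1" "mink (n x) (n x) = 1" "mink (f x) (n x) = 0" "mink (n x) (f x) = 0"
  using assms surf mink_commute[of "n x" "f x"]
  unfolding surface_with_gauss_map_def hyperbolic3_def de_sitter3_def by auto

lemma chart_exists:
  assumes "x \<in> M" obtains W h w where "chart W h" "w \<in> W" "h w = x"
proof -
  have "\<exists>W h. chart W h \<and> x \<in> h ` W" using assms surf unfolding surface_with_gauss_map_def by blast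
  then show ?thesis using that by blast
qed

lemma cont_f: "continuous_on M f" and cont_n: "continuous_on M n"
  using surface_continuous[OF surf] by auto

lemma \<phi>_minus: assumes "x \<in> M" shows "\<phi> (- s) (\<phi> s x) = x" "\<phi> s (\<phi> (- s) x) = x"
  using assms \<phi>_add[of x "-s" s] \<phi>_add[of x s "-s"] \<phi>_0 by auto

lemma \<phi>_cont_s: assumes "x \<in> M" shows "continuous_on S (\<lambda>s. \<phi> s x)"
proof -
  have "continuous_on S ((\<lambda>(s, x). \<phi> s x) \<circ> (\<lambda>s. (s, x)))"
    by (intro continuous_on_compose continuous_intros continuous_on_subset[OF \<phi>_cont]) (use assms in auto)
  then show ?thesis by (simp add: o_def)
qed

lemma \<phi>_cont_x: "continuous_on M (\<phi> s)"
proof -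
  have "continuous_on M ((\<lambda>(s, x). \<phi> s x) \<circ> (\<lambda>x. (s, x)))"
    by (intro continuous_on_compose continuous_intros continuous_on_subset[OF \<phi>_cont]) auto
  then show ?thesis by (simp add: o_def)
qed

lemma \<phi>_homeomorphism: "homeomorphism M M (\<phi> s) (\<phi> (- s))"
  unfolding homeomorphism_def using \<phi>_cont_x \<phi>_minus \<phi>_M by (auto simp: image_iff) metis+

context
  fixes W h w assumes ch: "chart W h" and w: "w \<in> W"
begin

lemma DF: "(f \<circ> h has_derivative DF h w) (at w)" and DN: "(n \<circ> h has_derivative DN h w) (at w)"
  unfolding DF_def DN_def using C1_on_has_derivative local_param_D[OF ch] w by blast+

lemma linear_DF: "linear (DF h w)" and linear_DN: "linear (DN h w)" and inj_DF: "inj (DF h w)"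
  using DF DN has_derivative_linear local_param_D(5)[OF ch w] by (auto simp: DF_def)

lemma DF_perp: "mink (DF h w v) (n (h w)) = 0" "mink (DF h w v) (f (h w)) = 0"
  and DN_perp: "mink (DN h w v) (n (h w)) = 0" "mink (DN h w v) (f (h w)) = 0"
proof -
  note W = local_param_D(1)[OF ch]
  note hM = local_param_D(6)[OF ch]
  show 1: "mink (DF h w v) (n (h w)) = 0"
    using surf ch w unfolding surface_with_gauss_map_def DF_def by blast
  have "mink ((f \<circ> h) w) (DF h w v) + mink (DF h w v) ((f \<circ> h) w) = 0"
    by (rule constant_has_derivative_zero[OF mink.FDERIV[OF DF DF] W w, of "-1"]) (use mink_fn hM in auto)
  then show "mink (DF h w v) (f (h w)) = 0" by (simp add: mink_commute)
  have "mink ((n \<circ> h) w) (DN h w v) + mink (DN h w v) ((n \<circ> h) w) = 0"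
    by (rule constant_has_derivative_zero[OF mink.FDERIV[OF DN DN] W w, of 1]) (use mink_fn hM in auto)
  then show "mink (DN h w v) (n (h w)) = 0" by (simp add: mink_commute)
  have "mink ((n \<circ> h) w) (DF h w v) + mink (DN h w v) ((f \<circ> h) w) = 0"
    by (rule constant_has_derivative_zero[OF mink.FDERIV[OF DN DF] W w, of 0]) (use mink_fn hM in auto)
  then show "mink (DN h w v) (f (h w)) = 0" using 1 by (simp add: mink_commute)
qed

text \<open>Gram-Schmidt on the coordinate vectors, which are spacelike because they are orthogonal
  to the timelike \<open>f\<close>. The preimages under \<open>DF\<close> are kept so that
  \<open>DN\<close> can be evaluated on them.\<close>

lemma tangent_frame:
  obtains m T vm vT where "DF h w vm = m" "DF h w vT = T" "orthonormal_basis (f (h w)) (n (h w)) m T"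
proof -
  have hM: "h w \<in> M" using local_param_D(6)[OF ch w] .
  have neg: "mink (f (h w)) (f (h w)) < 0" using mink_fn[OF hM] by simp
  have nz: "DF h w v \<noteq> 0" if "v \<noteq> 0" for v
    using inj_DF that linear_DF linear_injective_0 by blast
  have pos: "mink (DF h w v) (DF h w v) > 0" if "v \<noteq> 0" for v
    using perp_timelike_spacelike[OF neg DF_perp(2) nz[OF that]] .
  define u1 where "u1 = DF h w (1, 0)"
  define \<alpha> where "\<alpha> = mink (DF h w (0, 1)) u1 / mink u1 u1"
  define v2 where "v2 = (- \<alpha>, 1::real)"
  have v2: "v2 = (0, 1) - \<alpha> *\<^sub>R (1, 0)" by (simp add: v2_def)
  define u2 where "u2 = DF h w v2"
  have u2: "u2 = DF h w (0, 1) - \<alpha> *\<^sub>R u1" unfolding u2_def v2 u1_def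
    by (simp only: linear_diff[OF linear_DF] linear_scale[OF linear_DF])
  have p1: "mink u1 u1 > 0" unfolding u1_def by (rule pos) (simp add: zero_prod_def)
  have p2: "mink u2 u2 > 0" unfolding u2_def by (rule pos) (simp add: v2_def zero_prod_def)
  have o: "mink u2 u1 = 0" using p1 unfolding u2 by (simp add: \<alpha>_def mink_simps)
  have perp: "mink (f (h w)) u1 = 0" "mink (n (h w)) u1 = 0" "mink (f (h w)) u2 = 0" "mink (n (h w)) u2 = 0"
    unfolding u1_def u2_def using DF_perp mink_commute by metis+
  have B: "orthonormal_basis (f (h w)) (n (h w)) (normalize u1) (normalize u2)"
    unfolding orthonormal_basis_def
    using mink_fn[OF hM] mink_normalize[OF p1] mink_normalize[OF p2] perp o mink_commute[of u1 u2]
    by (simp add: normalize_def mink_simps)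
  have "normalize u1 = DF h w ((1 / sqrt \<bar>mink u1 u1\<bar>) *\<^sub>R (1, 0))" "normalize u2 = DF h w ((1 / sqrt \<bar>mink u2 u2\<bar>) *\<^sub>R v2)"
    unfolding normalize_def linear_scale[OF linear_DF] by (simp_all add: u1_def u2_def)
  then show ?thesis using that B by metis
qed

end

lemma mink_perp_tangent:
  assumes ch: "chart W h" "w \<in> W" and y: "mink y (f (h w)) = 0" "\<And>v. mink y (DF h w v) = 0"
  shows "y = mink y (n (h w)) *\<^sub>R n (h w)"
proof -
  obtain m T vm vT where mT: "DF h w vm = m" "DF h w vT = T" and B: "orthonormal_basis (f (h w)) (n (h w)) m T"
    using tangent_frame[OF ch] .
  show ?thesis using orthonormal_basis_expansion[OF B, of y] y(1) y(2)[of vm] y(2)[of vT] mT by simp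
qed

text \<open>The homeomorphism \<open>\<phi> s\<close> is not known to be differentiable, but the
  image under \<open>f\<close> of a transported straight line is \<open>R s\<close> applied to a
  differentiable curve, so \<open>curve_lift\<close> gives its tangent vector in the target
  chart.\<close>

lemma chart_curve:
  assumes ch: "chart W h" and w: "w \<in> W" and ch2: "chart W' h'" and w': "w' \<in> W'" and eq: "\<phi> s (h w) = h' w'"
  shows "\<exists>v'. DF h' w' v' = R s (DF h w v) \<and>
     ((\<lambda>t. n (\<phi> s (h (w + t *\<^sub>R v)))) has_vector_derivative DN h' w' v') (at 0)"
proof -
  define U where "U = (\<lambda>t. w + t *\<^sub>R v) -` W"
  have U: "open U" "0 \<in> U"
    unfolding U_def using local_param_D(1)[OF ch] w by (auto intro!: continuous_open_vimage continuous_intros)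
  have ch_cont: "continuous_on W h" using ch unfolding local_param_def homeomorphism_def by blast
  have c: "continuous_on U (\<lambda>t. \<phi> s (h (w + t *\<^sub>R v)))"
    by (rule continuous_on_compose2[OF \<phi>_cont_x, of U], rule continuous_on_compose2[OF ch_cont])
      (use local_param_D(6)[OF ch] in \<open>auto simp: U_def intro!: continuous_intros\<close>)
  have "((\<lambda>t. w + t *\<^sub>R v) has_vector_derivative v) (at 0)"
    by (auto intro!: derivative_eq_intros simp: has_vector_derivative_def)
  from vector_derivative_diff_chain_within[OF this, of "f \<circ> h" "DF h w"]
  have "((\<lambda>t. f (h (w + t *\<^sub>R v))) has_vector_derivative DF h w v) (at 0)"
    using DF[OF ch w] by (simp add: o_def has_derivative_at_withinI)
  then have "((\<lambda>t. R s (f (h (w + t *\<^sub>R v)))) has_vector_derivative R s (DF h w v)) (at 0)"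
    using linear_R linear_conv_bounded_linear bounded_linear.has_vector_derivative by blast
  then have "((\<lambda>t. f (\<phi> s (h (w + t *\<^sub>R v)))) has_vector_derivative R s (DF h w v)) (at 0)"
    by (rule has_vector_derivative_transform_within_open[OF _ U])
      (use local_param_D(6)[OF ch] f_\<phi> in \<open>auto simp: U_def\<close>)
  moreover have "(\<lambda>t. \<phi> s (h (w + t *\<^sub>R v))) ` U \<subseteq> M"
    using local_param_D(6)[OF ch] \<phi>_M by (auto simp: U_def)
  ultimately show ?thesis
    using curve_lift[OF ch2 w' U c] eq unfolding DF_def DN_def by simp
qed

text \<open>Equivariance is assumed for \<open>f\<close> only. It carries tangent planes to tangent
  planes, which fixes the normal up to a sign; the sign is continuous in \<open>s\<close> and equals
  one at \<open>s = 0\<close>.\<close>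

lemma n_\<phi>: assumes x: "x \<in> M" shows "n (\<phi> s x) = R s (n x)"
proof -
  obtain W h w where ch: "chart W h" "w \<in> W" "h w = x" using chart_exists[OF x] .
  define g where "g s = mink (n (\<phi> s x)) (R s (n x))" for s
  have key: "n (\<phi> s x) = g s *\<^sub>R R s (n x)" "(g s)\<^sup>2 = 1" for s
  proof -
    have sx: "\<phi> s x \<in> M" using \<phi>_M x .
    obtain W' h' w' where ch': "chart W' h'" "w' \<in> W'" "h' w' = \<phi> s x" using chart_exists[OF sx] .
    define y where "y = R (- s) (n (\<phi> s x))"
    have yR: "mink y z = mink (n (\<phi> s x)) (R s z)" for z
      using mink_R[of s y z] by (simp add: y_def R_minus)
    have "mink y (DF h w v) = 0" for v
      using chart_curve[OF ch(1,2) ch'(1,2), of s v] DF_perp(1)[OF ch'(1,2)] ch(3) ch'(3) mink_commute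
      unfolding yR by metis
    moreover have "mink y (f (h w)) = 0" unfolding yR using mink_fn[OF sx] ch(3) f_\<phi>[OF x] by metis
    ultimately have y: "y = mink y (n x) *\<^sub>R n x" using mink_perp_tangent[OF ch(1,2), of y] ch(3) by simp
    have gy: "mink y (n x) = g s" by (simp add: yR g_def)
    have "n (\<phi> s x) = R s y" by (simp add: y_def R_minus)
    also have "\<dots> = g s *\<^sub>R R s (n x)" using y gy linear_scale[OF linear_R] by metis
    finally show *: "n (\<phi> s x) = g s *\<^sub>R R s (n x)" .
    have "mink y y = 1" unfolding yR by (simp add: y_def R_minus mink_fn[OF sx])
    then show "(g s)\<^sup>2 = 1" using y gy mink_fn(2)[OF x]
      by (metis mink.scaleR_left mink.scaleR_right mult.right_neutral power2_eq_square real_scaleR_def)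
  qed
  have "continuous_on UNIV (\<lambda>s. n (\<phi> s x))"
    by (rule continuous_on_compose2[OF cont_n \<phi>_cont_s[OF x]]) (use \<phi>_M[OF x] in auto)
  moreover have "continuous_on UNIV (\<lambda>s. R s (n x))"
    by (rule continuous_at_imp_continuous_on) (use has_vector_derivative_continuous[OF R_derivative] in auto)
  ultimately have "continuous_on UNIV g" unfolding g_def by (rule mink.continuous_on)
  moreover have "finite (range g)"
    by (rule finite_subset[of _ "{-1, 1}"]) (use key(2) in \<open>auto simp: power2_eq_1_iff\<close>)
  ultimately have "g s = g 0" using continuous_finite_range_constant[of UNIV g]
    by (auto simp: constant_on_def)
  moreover have "g 0 = 1" by (simp add: g_def \<phi>_0[OF x] R_0 mink_fn[OF x])
  ultimately show ?thesis using key(1)[of s] by simp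
qed

text \<open>The orbit of a point is a continuous curve on the surface along which \<open>f\<close>
  and \<open>n\<close> move with velocities \<open>X f\<close> and \<open>X n\<close>, so it has a
  tangent vector in every chart.\<close>

lemma rot_tangent:
  assumes ch: "chart W h" "w \<in> W"
  obtains v where "DF h w v = X (f (h w))" "DN h w v = X (n (h w))"
proof -
  have x: "h w \<in> M" using local_param_D(6)[OF ch] .
  have eq: "f (\<phi> s (h w)) = R s (f (h w))" "n (\<phi> s (h w)) = R s (n (h w))" for s using f_\<phi> n_\<phi> x by auto
  have d: "((\<lambda>s. R s y) has_vector_derivative X y) (at 0)" for y
    using R_derivative[of y 0] by (simp add: R_0)
  have "\<exists>v. DF h w v = X (f (h w)) \<and> ((\<lambda>s. n (\<phi> s (h w))) has_vector_derivative DN h w v) (at 0)"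
    unfolding DF_def DN_def
    by (rule curve_lift[OF ch open_UNIV _ \<phi>_cont_s[OF x]]) (use x \<phi>_M \<phi>_0 d eq in auto)
  then show ?thesis using that d[of "n (h w)"] vector_derivative_unique_at unfolding eq by blast
qed

text \<open>Taking \<open>s = 0\<close> in \<open>chart_curve\<close> compares two charts at a
  common point. The principal curvatures come with a chart of their own and are evaluated in another
  one through this.\<close>

lemma transfer_tangent:
  assumes "chart W h" "w \<in> W" "chart W' h'" "w' \<in> W'" "h w = h' w'"
  shows "\<exists>v'. DF h' w' v' = DF h w v \<and> DN h' w' v' = DN h w v"
proof -
  have x: "h w \<in> M" using local_param_D(6) assms by blast
  obtain v' where v': "DF h' w' v' = R 0 (DF h w v)"
     "((\<lambda>t. n (\<phi> 0 (h (w + t *\<^sub>R v)))) has_vector_derivative DN h' w' v') (at 0)"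
    using chart_curve[OF assms(1-4), of 0 v] \<phi>_0[OF x] assms(5) by auto
  define U where "U = (\<lambda>t. w + t *\<^sub>R v) -` W"
  have U: "open U" "0 \<in> U"
    unfolding U_def using local_param_D(1)[OF assms(1)] assms(2) by (auto intro!: continuous_open_vimage continuous_intros)
  have "((\<lambda>t. n (h (w + t *\<^sub>R v))) has_vector_derivative DN h' w' v') (at 0)"
    by (rule has_vector_derivative_transform_within_open[OF v'(2) U])
      (use local_param_D(6)[OF assms(1)] \<phi>_0 in \<open>auto simp: U_def\<close>)
  moreover have "((\<lambda>t. w + t *\<^sub>R v) has_vector_derivative v) (at 0)"
    by (auto intro!: derivative_eq_intros simp: has_vector_derivative_def)
  from vector_derivative_diff_chain_within[OF this, of "n \<circ> h" "DN h w"]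
  have "((\<lambda>t. n (h (w + t *\<^sub>R v))) has_vector_derivative DN h w v) (at 0)"
    using DN[OF assms(1,2)] by (simp add: o_def has_derivative_at_withinI)
  ultimately have "DN h' w' v' = DN h w v" by (rule vector_derivative_unique_at)
  then show ?thesis using v'(1) R_0 by metis
qed

text \<open>The part of the surface off the axis of rotation.\<close>

definition Mst :: "'a set" where "Mst = {x \<in> M. X (f x) \<noteq> 0}"

lemma Mst_M: "x \<in> Mst \<Longrightarrow> x \<in> M" by (simp add: Mst_def)

lemma f_perp_Xn: assumes "x \<in> M" shows "mink (f x) (X (n x)) = 0" "mink (n x) (X (f x)) = 0"
proof -
  obtain W h w where ch: "chart W h" "w \<in> W" "h w = x" using chart_exists[OF assms] .
  obtain v where "DF h w v = X (f (h w))" using rot_tangent[OF ch(1,2)] by metis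
  then show "mink (n x) (X (f x)) = 0" using DF_perp(1)[OF ch(1,2)] ch(3) mink_commute by metis
  then show "mink (f x) (X (n x)) = 0" using X_skew[of "n x" "f x"] mink_commute by (metis neg_equal_0_iff_equal X_skew)
qed

lemma principal_transfer:
  assumes ch: "chart W h" "w \<in> W"
  obtains k1 k2 v1 v2 where "2 * (k1 * k2) = Hb * (k1 + k2)" "k1 + k2 \<noteq> 0"
    "DN h w v1 = - k1 *\<^sub>R DF h w v1" "DN h w v2 = - k2 *\<^sub>R DF h w v2"
    "\<And>s t. s *\<^sub>R DF h w v1 + t *\<^sub>R DF h w v2 = 0 \<Longrightarrow> s = 0 \<and> t = 0"
proof -
  have "h w \<in> M" using local_param_D(6)[OF ch] .
  then obtain k1 k2 where pc: "principal_curvatures M f n (h w) k1 k2" "mean_curvature k1 k2 \<noteq> 0"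
    "gauss_curvature k1 k2 / mean_curvature k1 k2 = Hb"
    using chmc unfolding constant_harmonic_mean_curvature_def by blast
  obtain W' h' w' v1' v2' where ch': "chart W' h'" "w' \<in> W'" "h' w' = h w" and ne: "v1' \<noteq> v2'" and ind: "independent {v1', v2'}"
    and eig: "DN h' w' v1' = - k1 *\<^sub>R DF h' w' v1'" "DN h' w' v2' = - k2 *\<^sub>R DF h' w' v2'"
    using pc(1) unfolding principal_curvatures_def DF_def DN_def by metis
  obtain v1 where v1: "DF h w v1 = DF h' w' v1'" "DN h w v1 = DN h' w' v1'"
    using transfer_tangent[OF ch'(1,2) ch ch'(3)] by blast
  obtain v2 where v2: "DF h w v2 = DF h' w' v2'" "DN h w v2 = DN h' w' v2'"
    using transfer_tangent[OF ch'(1,2) ch ch'(3)] by blast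
  note lin = linear_DF[OF ch'(1,2)]
  have "s = 0 \<and> t = 0" if "s *\<^sub>R DF h w v1 + t *\<^sub>R DF h w v2 = 0" for s t
  proof -
    have "DF h' w' (s *\<^sub>R v1' + t *\<^sub>R v2') = 0"
      using that unfolding v1 v2 by (simp add: linear_add[OF lin] linear_scale[OF lin])
    then have "s *\<^sub>R v1' + t *\<^sub>R v2' = 0"
      using inj_DF[OF ch'(1,2)] lin linear_injective_0 by blast
    then have "(\<Sum>v\<in>{v1', v2'}. (if v = v1' then s else t) *\<^sub>R v) = 0" using ne by simp
    from independentD[OF ind _ subset_refl this, of v1'] independentD[OF ind _ subset_refl this, of v2']
    show ?thesis using ne by auto
  qed
  moreover have "2 * (k1 * k2) = Hb * (k1 + k2)" "k1 + k2 \<noteq> 0"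
    using pc(2,3) by (auto simp: mean_curvature_def gauss_curvature_def field_simps)
  ultimately show ?thesis using that[of k1 k2 v1 v2] eig v1 v2 by simp
qed

lemma f_parallel: assumes "x \<in> M" shows "Q (f x) (f x) *\<^sub>R X (n x) = Q (f x) (n x) *\<^sub>R X (f x)"
  using X_parallel[OF f_perp_Xn(2)[OF assms]] by (simp add: Q_commute)

text \<open>The orbit direction \<open>X F\<close> is principal since \<open>X N\<close> is a
  multiple of it, hence so is the tangent direction orthogonal to it. The curvature condition reads
  \<open>1/k1 + 1/k2 = 2/Hb\<close>, and \<open>1/k1 = - Q F N / Q N N\<close>, which gives the
  coefficient of \<open>Y\<close>. The meridian vector \<open>Y\<close> is a velocity of the Gauss
  map, not of \<open>f\<close>, and is scaled to \<open>B F Y = Q N N\<close>, the scale in which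
  the later function \<open>that\<close> has unit speed.\<close>

lemma frame_at:
  assumes x: "h w \<in> Mst" and ch: "chart W h" "w \<in> W"
  defines "F \<equiv> f (h w)" and "N \<equiv> n (h w)"
  shows "Q N N > 0" "Q F N \<noteq> 0" "(B F N)\<^sup>2 = \<epsilon> + (Q F N)\<^sup>2 / Q N N - Q N N"
    "\<exists>v1 v2 Y. DF h w v1 = X F \<and> DN h w v1 = X N \<and> DN h w v2 = Y \<and>
      DF h w v2 = - (2 / Hb + Q F N / Q N N) *\<^sub>R Y \<and> (\<forall>v. \<exists>\<alpha> \<beta>. v = \<alpha> *\<^sub>R v1 + \<beta> *\<^sub>R v2) \<and>
      mink Y F = 0 \<and> mink Y N = 0 \<and> mink Y (X N) = 0 \<and>
      B F Y = Q N N \<and> B N Y = Q F N \<and> Q N Y = - B F N * Q N N"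
proof -
  have hM: "h w \<in> M" and XF: "X F \<noteq> 0" using x by (auto simp: Mst_def F_def)
  have QFF: "Q F F > 0" using Q_pos[OF hM] XF by (simp add: F_def)
  note mfn = mink_fn[OF hM, folded F_def N_def]
  note lF = linear_DF[OF ch] and lN = linear_DN[OF ch]
  obtain v1 where v1: "DF h w v1 = X F" "DN h w v1 = X N" using rot_tangent[OF ch] by (metis F_def N_def)
  define k1 where "k1 = - Q F N / Q F F"
  have XN: "X N = - k1 *\<^sub>R X F"
  proof -
    have "X N = (1 / Q F F) *\<^sub>R (Q F F *\<^sub>R X N)" using QFF by simp
    also have "\<dots> = (1 / Q F F) *\<^sub>R (Q F N *\<^sub>R X F)" using f_parallel[OF hM] by (simp add: F_def N_def)
    finally show ?thesis by (simp add: k1_def)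
  qed
  have FXN: "mink F (X N) = 0" and NXF: "mink N (X F) = 0" using f_perp_Xn[OF hM] by (simp_all add: F_def N_def)
  obtain m T vm vT where mT: "DF h w vm = m" "DF h w vT = T" and B0: "orthonormal_basis F N m T"
    using tangent_frame[OF ch] F_def N_def by metis
  define \<alpha> \<beta> where "\<alpha> = mink (X F) m" and "\<beta> = mink (X F) T"
  have XFe: "X F = \<alpha> *\<^sub>R m + \<beta> *\<^sub>R T"
    using orthonormal_basis_expansion[OF B0, of "X F"] X_skew'[of F] NXF mink_commute
    by (simp add: \<alpha>_def \<beta>_def)
  \<comment> \<open>\<open>u\<close> is \<open>X F\<close> turned by a right angle in the tangent
    plane, and \<open>e\<close> is its preimage.\<close>
  define e u where "e = \<alpha> *\<^sub>R vT - \<beta> *\<^sub>R vm" and "u = \<alpha> *\<^sub>R T - \<beta> *\<^sub>R m"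
  have eu: "DF h w e = u" unfolding e_def u_def using mT by (simp add: linear_diff[OF lF] linear_scale[OF lF])
  note B0' = B0[unfolded orthonormal_basis_def]
  have uXF: "mink u (X F) = 0" and uu: "mink u u = Q F F"
    using B0' mink_commute[of T m] unfolding Q_def XFe u_def by (simp_all add: mink_simps algebra_simps)
  have uF: "mink u F = 0" and uN: "mink u N = 0"
    using DF_perp[OF ch, of e] eu by (simp_all add: F_def N_def)
  define su where "su = sqrt (Q F F)"
  have su: "su > 0" "su * su = Q F F" using QFF by (auto simp: su_def)
  have B1: "orthonormal_basis F N ((1/su) *\<^sub>R X F) ((1/su) *\<^sub>R u)"
    unfolding orthonormal_basis_def
    using mfn uu su QFF uXF uF uN NXF X_skew'[of F] mink_commute[of F u] mink_commute[of N u] mink_commute[of "X F" u]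
    by (simp add: mink_simps Q_def[symmetric])
  have exp: "z = (mink z (X F) / Q F F) *\<^sub>R X F + (mink z u / Q F F) *\<^sub>R u" if "mink z F = 0" "mink z N = 0" for z
    using orthonormal_basis_expansion[OF B1, of z] that su by (simp add: mink_simps)
  have span: "\<exists>\<alpha> \<beta>. v = \<alpha> *\<^sub>R v1 + \<beta> *\<^sub>R e" for v
  proof -
    have "DF h w v = DF h w ((mink (DF h w v) (X F) / Q F F) *\<^sub>R v1 + (mink (DF h w v) u / Q F F) *\<^sub>R e)"
      unfolding linear_add[OF lF] linear_scale[OF lF] v1 eu
      by (rule exp) (use DF_perp[OF ch] F_def N_def in auto)
    then show ?thesis using inj_DF[OF ch] by (metis injD)
  qed
  define k2 where "k2 = - mink (DN h w e) u / Q F F"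
  \<comment> \<open>Differentiating \<open>mink (n x) (X (f x)) = 0\<close> in the direction
    \<open>e\<close> shows that \<open>DN h w e\<close> is orthogonal to \<open>X F\<close>. This is
    the symmetry of the shape operator in one instance, obtained without second derivatives of
    \<open>f\<close>.\<close>
  have qe: "DN h w e = - k2 *\<^sub>R u"
  proof -
    note W = local_param_D(1)[OF ch(1)]
    have Xd: "((\<lambda>y. X ((f \<circ> h) y)) has_derivative (\<lambda>v. X (DF h w v))) (at w)"
      using bounded_linear.has_derivative[OF bounded_linear_X DF[OF ch]] by simp
    have "mink ((n \<circ> h) w) (X (DF h w e)) + mink (DN h w e) (X ((f \<circ> h) w)) = 0"
      by (rule constant_has_derivative_zero[OF mink.FDERIV[OF DN[OF ch] Xd] W ch(2), of 0])
        (use f_perp_Xn local_param_D(6)[OF ch(1)] in auto)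
    then have "mink N (X u) + mink (DN h w e) (X F) = 0" by (simp add: eu N_def F_def)
    moreover have "mink N (X u) = 0" using X_skew[of N u] XN uXF by (simp add: mink_simps mink_commute[of "X F" u])
    ultimately have "mink (DN h w e) (X F) = 0" by simp
    then show ?thesis using exp[of "DN h w e"] DN_perp[OF ch] by (simp add: F_def N_def k2_def)
  qed
  have unz: "s = 0 \<and> t = 0" if "s *\<^sub>R X F + t *\<^sub>R u = 0" for s t
  proof -
    have "mink (s *\<^sub>R X F + t *\<^sub>R u) (X F) = s * Q F F" "mink (s *\<^sub>R X F + t *\<^sub>R u) u = t * Q F F"
      using uXF uu mink_commute[of "X F" u] by (simp_all add: mink_simps Q_def)
    then show ?thesis using QFF unfolding that by (simp add: mink_simps)
  qed
  have "2 * (k1 * k2) = Hb * (k1 + k2) \<and> k1 + k2 \<noteq> 0"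
  proof -
    obtain l1 l2 w1 w2 where l: "2 * (l1 * l2) = Hb * (l1 + l2)" "l1 + l2 \<noteq> 0"
      "DN h w w1 = - l1 *\<^sub>R DF h w w1" "DN h w w2 = - l2 *\<^sub>R DF h w w2"
      "\<And>s t. s *\<^sub>R DF h w w1 + t *\<^sub>R DF h w w2 = 0 \<Longrightarrow> s = 0 \<and> t = 0"
      using principal_transfer[OF ch] by blast
    \<comment> \<open>The principal directions given by the hypothesis and the pair
      \<open>v1\<close>, \<open>e\<close> are both bases of eigenvectors, so their eigenvalues agree
      up to order.\<close>
    have eig: "p * (k1 - l) = 0 \<and> q * (k2 - l) = 0"
      if "v = p *\<^sub>R v1 + q *\<^sub>R e" "DN h w v = - l *\<^sub>R DF h w v" for v p q l
    proof -
      have "DN h w v = (- p * k1) *\<^sub>R X F + (- q * k2) *\<^sub>R u" "DF h w v = p *\<^sub>R X F + q *\<^sub>R u"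
        unfolding that(1) linear_add[OF lF] linear_scale[OF lF] linear_add[OF lN] linear_scale[OF lN] v1 eu qe XN by simp_all
      then have "(p * (k1 - l)) *\<^sub>R X F + (q * (k2 - l)) *\<^sub>R u = 0"
        using that(2) by (simp add: algebra_simps)
      then show ?thesis by (rule unz)
    qed
    obtain p1 q1 where w1: "w1 = p1 *\<^sub>R v1 + q1 *\<^sub>R e" using span by blast
    obtain p2 q2 where w2: "w2 = p2 *\<^sub>R v1 + q2 *\<^sub>R e" using span by blast
    have d: "DF h w w1 = p1 *\<^sub>R X F + q1 *\<^sub>R u" "DF h w w2 = p2 *\<^sub>R X F + q2 *\<^sub>R u"
      unfolding w1 w2 linear_add[OF lF] linear_scale[OF lF] v1 eu by simp_all
    have "p1 * q2 \<noteq> q1 * p2"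
    proof
      assume *: "p1 * q2 = q1 * p2"
      have "q2 *\<^sub>R DF h w w1 + (- q1) *\<^sub>R DF h w w2 = (p1 * q2 - q1 * p2) *\<^sub>R X F"
        "p2 *\<^sub>R DF h w w1 + (- p1) *\<^sub>R DF h w w2 = (q1 * p2 - p1 * q2) *\<^sub>R u"
        unfolding d by (simp_all add: algebra_simps)
      then have "q1 = 0" "p1 = 0" using l(5)[of q2 "- q1"] l(5)[of p2 "- p1"] * by auto
      then have "1 *\<^sub>R DF h w w1 + 0 *\<^sub>R DF h w w2 = 0" unfolding d by simp
      then show False using l(5)[of 1 0] by simp
    qed
    then have "(k1 = l1 \<and> k2 = l2) \<or> (k1 = l2 \<and> k2 = l1)"
      using eig[OF w1 l(3)] eig[OF w2 l(4)] by auto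
    then show ?thesis using l(1,2) by (auto simp: algebra_simps)
  qed
  then have k: "2 * (k1 * k2) = Hb * (k1 + k2)" "k1 + k2 \<noteq> 0" by auto
  \<comment> \<open>If one curvature vanished, the first relation would make the other vanish too,
    against \<open>k1 + k2 \<noteq> 0\<close>.\<close>
  then have k1nz: "k1 \<noteq> 0" and k2nz: "k2 \<noteq> 0" using Hb_nz by auto
  have QFN: "Q F N = - k1 * Q F F" using QFF by (simp add: k1_def)
  have QNN: "Q N N = k1\<^sup>2 * Q F F" by (simp add: Q_def XN mink_simps power2_eq_square)
  show Qpos: "Q N N > 0" using QNN QFF k1nz by simp
  show QFNnz: "Q F N \<noteq> 0" using QFN QFF k1nz by simp
  define T' where "T' = (1/su) *\<^sub>R u"
  have rel: "(B F T')\<^sup>2 = Q N N" "Q N N * B N T' = Q F N * B F T'"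
    "Q N T' = - B F N * B F T'" "(B F N)\<^sup>2 = \<epsilon> + (Q F N)\<^sup>2 / Q N N - Q N N"
  proof -
    note o = B1[unfolded orthonormal_basis_def, folded T'_def]
    have "mink T' (X N) = 0" using o XN su by (simp add: T'_def mink_simps uXF)
    then show "(B F T')\<^sup>2 = Q N N" "Q N N * B N T' = Q F N * B F T'"
    "Q N T' = - B F N * B F T'" "(B F N)\<^sup>2 = \<epsilon> + (Q F N)\<^sup>2 / Q N N - Q N N"
      using frame_relations[of F N T'] o mfn FXN Qpos by auto
  qed
  show "(B F N)\<^sup>2 = \<epsilon> + (Q F N)\<^sup>2 / Q N N - Q N N" by (rule rel)
  have BFT: "B F T' \<noteq> 0" using rel(1) Qpos by auto
  \<comment> \<open>This factor turns the unit vector \<open>T'\<close> into \<open>Y\<close> with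
    \<open>B F Y = Q N N\<close>; then also \<open>B N Y = Q F N\<close>, the Wronskian of the Gauss
    map.\<close>
  define \<eta> where "\<eta> = Q N N / B F T'"
  define Y where "Y = \<eta> *\<^sub>R T'"
  have \<eta>nz: "\<eta> \<noteq> 0" using BFT Qpos by (simp add: \<eta>_def)
  define v2 where "v2 = (- \<eta> / (k2 * su)) *\<^sub>R e"
  have DN2: "DN h w v2 = Y" and DF2: "DF h w v2 = - (1 / k2) *\<^sub>R Y"
    unfolding v2_def linear_scale[OF lF] linear_scale[OF lN] qe eu Y_def T'_def using k2nz su by simp_all
  have ik: "1 / k2 = 2 / Hb + Q F N / Q N N"
    unfolding QFN QNN using k k1nz k2nz Hb_nz QFF by (simp add: field_simps power2_eq_square)
  have "mink Y F = 0" "mink Y N = 0" "mink Y (X N) = 0"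
    using uF uN uXF by (simp_all add: Y_def T'_def mink_simps XN)
  moreover have "B F Y = Q N N" "B N Y = Q F N" "Q N Y = - B F N * Q N N"
    unfolding Y_def B.scaleR_right Q.scaleR_right using rel(2,3) BFT Qpos by (simp_all add: \<eta>_def field_simps)
  moreover have "\<exists>\<alpha> \<beta>. v = \<alpha> *\<^sub>R v1 + \<beta> *\<^sub>R v2" for v
  proof -
    obtain p q where pq: "v = p *\<^sub>R v1 + q *\<^sub>R e" using span by blast
    have "v = p *\<^sub>R v1 + (- q * k2 * su / \<eta>) *\<^sub>R v2" unfolding pq v2_def using k2nz su \<eta>nz by simp
    then show ?thesis by blast
  qed
  ultimately show "\<exists>v1 v2 Y. DF h w v1 = X F \<and> DN h w v1 = X N \<and> DN h w v2 = Y \<and>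
      DF h w v2 = - (2 / Hb + Q F N / Q N N) *\<^sub>R Y \<and> (\<forall>v. \<exists>\<alpha> \<beta>. v = \<alpha> *\<^sub>R v1 + \<beta> *\<^sub>R v2) \<and>
      mink Y F = 0 \<and> mink Y N = 0 \<and> mink Y (X N) = 0 \<and>
      B F Y = Q N N \<and> B N Y = Q F N \<and> Q N Y = - B F N * Q N N"
    using v1 DN2 DF2[unfolded ik] by blast
qed

end

section \<open>Jacobi functions and the elliptic integral of the third kind\<close>

lemma ellip_F_has_derivative:
  assumes "\<And>x. x \<in> {l..u} \<Longrightarrow> p\<^sup>2 * (sin x)\<^sup>2 < 1" "l \<le> 0" "0 \<le> u" "\<phi> \<in> {l..u}"
  shows "(ellip_F p has_real_derivative 1 / sqrt (1 - p\<^sup>2 * (sin \<phi>)\<^sup>2)) (at \<phi> within {l..u})"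
proof -
  have "continuous_on {l..u} (\<lambda>x. 1 / sqrt (1 - p\<^sup>2 * (sin x)\<^sup>2))"
    using assms(1) by (intro continuous_intros) fastforce
  from interval_integral_FTC2[OF assms(2,3) this, of \<phi>] assms(4)
  show ?thesis unfolding ellip_F_def[abs_def] has_real_derivative_iff_has_vector_derivative zero_ereal_def by simp
qed

lemma ellip_F_0: "ellip_F p 0 = 0"
  by (simp add: ellip_F_def zero_ereal_def[symmetric])

lemma ellip_F_less:
  assumes "\<forall>x\<in>closed_segment 0 \<phi>. p\<^sup>2 * (sin x)\<^sup>2 < 1" "\<forall>x\<in>closed_segment 0 \<psi>. p\<^sup>2 * (sin x)\<^sup>2 < 1" "\<phi> < \<psi>"
  shows "ellip_F p \<phi> < ellip_F p \<psi>"
proof -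
  define l u where "l = min 0 \<phi>" and "u = max 0 \<psi>"
  have seg: "p\<^sup>2 * (sin x)\<^sup>2 < 1" if "x \<in> {l..u}" for x
    using that assms unfolding l_def u_def closed_segment_eq_real_ivl min_def max_def
    by (auto split: if_splits)
  have l: "l \<le> 0" "0 \<le> u" "l \<le> \<phi>" "\<psi> \<le> u" by (auto simp: l_def u_def)
  have der: "(ellip_F p has_real_derivative 1 / sqrt (1 - p\<^sup>2 * (sin x)\<^sup>2)) (at x within {l..u})" if "x \<in> {l..u}" for x
    using ellip_F_has_derivative[OF seg l(1,2) that] .
  show ?thesis
  proof (rule DERIV_pos_imp_increasing_open[OF assms(3)])
    show "\<exists>y. (ellip_F p has_real_derivative y) (at x) \<and> y > 0" if "\<phi> < x" "x < \<psi>" for x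
      using der[of x] seg[of x] that l at_within_Icc_at[of l x u] by (intro exI conjI) auto
    show "continuous_on {\<phi>..\<psi>} (ellip_F p)"
      using der l by (meson DERIV_continuous_on continuous_on_subset atLeastatMost_subset_iff)
  qed
qed

text \<open>Strict monotonicity of \<open>ellip_F p\<close> on the admissible amplitudes makes the
  description in \<open>jacobi_am\<close> unique.\<close>

lemma jacobi_am_ellip_F:
  assumes "\<forall>x\<in>closed_segment 0 \<phi>. p\<^sup>2 * (sin x)\<^sup>2 < 1"
  shows "jacobi_am p (ellip_F p \<phi>) = \<phi>"
  unfolding jacobi_am_def
proof (rule the_equality)
  show "(\<forall>x\<in>closed_segment 0 \<phi>. p\<^sup>2 * (sin x)\<^sup>2 < 1) \<and> ellip_F p \<phi> = ellip_F p \<phi>" using assms by simp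
  fix \<psi> assume "(\<forall>x\<in>closed_segment 0 \<psi>. p\<^sup>2 * (sin x)\<^sup>2 < 1) \<and> ellip_F p \<psi> = ellip_F p \<phi>"
  then show "\<psi> = \<phi>" using ellip_F_less[of \<phi> p \<psi>] ellip_F_less[of \<psi> p \<phi>] assms by (metis linorder_less_linear less_irrefl)
qed

text \<open>The branch of the amplitude with \<open>cn > 0\<close>: \<open>quarter p\<close> is the interval \<open>(-K, K)\<close>, all of the line for \<open>p = 1\<close>.\<close>

definition quarter :: "real \<Rightarrow> real set" where
  "quarter p = ellip_F p ` {-pi/2<..<pi/2}"

text \<open>The value \<open>p\<^sup>2 = 1\<close> is included because spheres have
  \<open>Cm = 0\<close> and hence modulus one.\<close>

locale modulus_le_1 =
  fixes p :: real assumes p: "p\<^sup>2 \<le> 1"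
begin

abbreviation "am \<equiv> jacobi_am p"
abbreviation "sn \<equiv> jacobi_sn p"
abbreviation "cn \<equiv> jacobi_cn p"
definition "dn u = sqrt (1 - p\<^sup>2 * (sn u)\<^sup>2)"

text \<open>For \<open>p\<^sup>2 = 1\<close> the strict inequality comes from
  \<open>cos x > 0\<close>.\<close>

lemma p_sin: assumes "\<bar>x\<bar> < pi/2" shows "p\<^sup>2 * (sin x)\<^sup>2 < 1"
proof -
  have "cos x > 0" using assms by (intro cos_gt_zero_pi) auto
  then have "(cos x)\<^sup>2 > 0" by simp
  then have "(sin x)\<^sup>2 < 1" using sin_cos_squared_add[of x] by linarith
  moreover have "p\<^sup>2 * (sin x)\<^sup>2 \<le> 1 * (sin x)\<^sup>2" by (rule mult_right_mono[OF p]) simp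
  ultimately show ?thesis by simp
qed

lemma p_sin_segment: "\<bar>\<phi>\<bar> < pi/2 \<Longrightarrow> \<forall>x\<in>closed_segment 0 \<phi>. p\<^sup>2 * (sin x)\<^sup>2 < 1"
  by (auto simp: closed_segment_eq_real_ivl split: if_splits intro!: p_sin)

lemma ellip_F_deriv:
  assumes "\<bar>\<phi>\<bar> < pi/2"
  shows "(ellip_F p has_real_derivative 1 / sqrt (1 - p\<^sup>2 * (sin \<phi>)\<^sup>2)) (at \<phi>)"
proof -
  obtain r where r: "\<bar>\<phi>\<bar> < r" "r < pi/2" using assms dense by blast
  then have "(ellip_F p has_real_derivative 1 / sqrt (1 - p\<^sup>2 * (sin \<phi>)\<^sup>2)) (at \<phi> within {-r..r})"
    by (intro ellip_F_has_derivative p_sin) auto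
  then show ?thesis using r by (simp add: at_within_Icc_at)
qed

lemma am_F: "\<bar>\<phi>\<bar> < pi/2 \<Longrightarrow> am (ellip_F p \<phi>) = \<phi>"
  by (rule jacobi_am_ellip_F[OF p_sin_segment])

lemma am_quarter: assumes "u \<in> quarter p" shows "\<bar>am u\<bar> < pi/2" "ellip_F p (am u) = u"
  using assms am_F by (auto simp: quarter_def abs_less_iff)

lemma abs_less_pi_half: "\<bar>x\<bar> < pi/2 \<longleftrightarrow> x \<in> {-pi/2<..<pi/2}"
  by auto

lemma F_quarter: "\<bar>\<phi>\<bar> < pi/2 \<Longrightarrow> ellip_F p \<phi> \<in> quarter p"
  unfolding quarter_def abs_less_pi_half by (rule imageI)

lemma quarter_0: "0 \<in> quarter p" using F_quarter[of 0] by (simp add: ellip_F_0)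

lemma am_0: "am 0 = 0" using am_F[of 0] by (simp add: ellip_F_0)

lemma F_cont: "continuous_on {-pi/2<..<pi/2} (ellip_F p)"
  by (rule continuous_at_imp_continuous_on) (metis abs_less_pi_half ellip_F_deriv DERIV_isCont)

lemma open_quarter: "open (quarter p)"
proof -
  have "inj_on (ellip_F p) {-pi/2<..<pi/2}" by (rule inj_on_inverseI[of _ am]) (auto intro!: am_F)
  then show ?thesis unfolding quarter_def
    using injective_eq_1d_open_map_UNIV[OF F_cont] by (auto simp: is_interval_oo)
qed

lemma interval_quarter: "is_interval (quarter p)"
  unfolding quarter_def is_interval_connected_1
  by (rule connected_continuous_image[OF F_cont]) simp

lemma F_mono: assumes "\<bar>x\<bar> < pi/2" "\<bar>y\<bar> < pi/2" shows "ellip_F p x < ellip_F p y \<longleftrightarrow> x < y"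
  using ellip_F_less[OF p_sin_segment p_sin_segment, of x y] ellip_F_less[OF p_sin_segment p_sin_segment, of y x] assms
  by (metis linorder_less_linear less_asym)

lemma am_mono: assumes "u \<in> quarter p" "v \<in> quarter p" shows "am u < am v \<longleftrightarrow> u < v"
  using F_mono[OF am_quarter(1)[OF assms(1)] am_quarter(1)[OF assms(2)]] am_quarter(2) assms by simp

lemma am_deriv:
  assumes u: "u \<in> quarter p"
  shows "(am has_real_derivative dn u) (at u)"
proof -
  note a = am_quarter[OF u]
  define D where "D = sqrt (1 - p\<^sup>2 * (sin (am u))\<^sup>2)"
  have D: "D > 0" using p_sin[OF a(1)] by (simp add: D_def)
  have "(am has_derivative (*) D) (at (ellip_F p (am u)))"
    by (rule has_derivative_inverse_strong[of "{-pi/2<..<pi/2}" _ _ _ "(*) (1/D)"])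
      (use F_cont am_F a ellip_F_deriv[OF a(1)] D in \<open>auto simp: D_def has_field_derivative_def abs_less_iff\<close>)
  then show ?thesis using a(2) by (simp add: has_field_derivative_def D_def dn_def jacobi_sn_def)
qed

lemma cn_pos: "u \<in> quarter p \<Longrightarrow> cn u > 0"
  unfolding jacobi_cn_def using am_quarter[of u] by (intro cos_gt_zero_pi) auto

lemma sn_cn: "(sn u)\<^sup>2 + (cn u)\<^sup>2 = 1" by (simp add: jacobi_sn_def jacobi_cn_def)

lemma dn_sq: "u \<in> quarter p \<Longrightarrow> (dn u)\<^sup>2 = 1 - p\<^sup>2 * (sn u)\<^sup>2" and dn_pos: "u \<in> quarter p \<Longrightarrow> dn u > 0"
  using p_sin[OF am_quarter(1), of u] by (auto simp: dn_def jacobi_sn_def)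

lemma sn_deriv: "u \<in> quarter p \<Longrightarrow> (sn has_real_derivative cn u * dn u) (at u)"
  unfolding jacobi_sn_def[abs_def] jacobi_cn_def using am_deriv by (auto intro!: derivative_eq_intros)

lemma cn_deriv: "u \<in> quarter p \<Longrightarrow> (cn has_real_derivative - sn u * dn u) (at u)"
  unfolding jacobi_sn_def jacobi_cn_def[abs_def] using am_deriv by (auto intro!: derivative_eq_intros)

lemma sn_cont: "continuous_on (quarter p) sn" and cn_cont: "continuous_on (quarter p) cn"
  using sn_deriv cn_deriv DERIV_isCont continuous_at_imp_continuous_on by blast+

lemma dn_cont: "continuous_on (quarter p) dn"
  unfolding dn_def[abs_def] by (intro continuous_intros sn_cont)

lemma sn_pos: "u \<in> quarter p \<Longrightarrow> 0 < u \<Longrightarrow> 0 < sn u" and sn_neg: "u \<in> quarter p \<Longrightarrow> u < 0 \<Longrightarrow> sn u < 0"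
  using am_mono[OF quarter_0, of u] am_mono[OF _ quarter_0, of u] am_quarter(1)[of u] am_0
    sin_gt_zero2[of "am u"] sin_gt_zero2[of "- am u"] by (auto simp: jacobi_sn_def abs_less_iff)

lemma sn_inj: assumes "u \<in> quarter p" "v \<in> quarter p" "sn u = sn v" shows "u = v"
proof -
  have "am u = am v"
    using am_quarter(1)[OF assms(1)] am_quarter(1)[OF assms(2)] assms(3) sin_inj_pi[of "am u" "am v"]
    by (auto simp: jacobi_sn_def abs_less_iff)
  then show ?thesis using am_quarter(2) assms by metis
qed

text \<open>The truncation in \<open>ellip_Pi\<close> removes neighborhoods of all zeros on the real
  line, also of those outside the interval of integration. The compact segment has a neighborhood
  free of zeros, so the truncation has no effect for small \<open>\<epsilon>\<close>.\<close>

lemma ellip_Pi_primitive: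
  assumes s: "s \<in> quarter p"
    and nz: "\<And>u. u \<in> closed_segment 0 s \<Longrightarrow> 1 - k * (sn u)\<^sup>2 \<noteq> 0"
    and G: "\<And>u. u \<in> closed_segment 0 s \<Longrightarrow>
      (G has_real_derivative 1 / (1 - k * (sn u)\<^sup>2)) (at u within closed_segment 0 s)"
  shows "ellip_Pi p k s = G s - G 0"
proof -
  define l r where "l = min 0 s" and "r = max 0 s"
  have lr: "closed_segment 0 s = {l..r}" "l \<le> r" by (auto simp: l_def r_def closed_segment_eq_real_ivl)
  have sub: "{l..r} \<subseteq> quarter p"
    using interval_quarter s quarter_0 closed_segment_subset is_interval_convex lr(1) by metis
  \<comment> \<open>Zeros are controlled only on \<open>quarter p\<close>; this set is open, so
    small balls around points of the segment do not leave it.\<close>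
  define O' where "O' = {u \<in> quarter p. 1 - k * (sn u)\<^sup>2 \<noteq> 0}"
  have "O' = quarter p \<inter> (\<lambda>u. 1 - k * (sn u)\<^sup>2) -` (- {0})" by (auto simp: O'_def)
  then have "open O'"
    by (simp only:) (intro continuous_open_preimage open_quarter continuous_intros sn_cont; simp)
  moreover have "{l..r} \<subseteq> O'" using sub nz lr by (auto simp: O'_def)
  ultimately obtain \<delta> where \<delta>: "\<delta> > 0" "(\<Union>x\<in>{l..r}. ball x \<delta>) \<subseteq> O'"
    using compact_subset_open_imp_ball_epsilon_subset[of "{l..r}"] by blast
  let ?g = "\<lambda>u. 1 / (1 - k * (sn u)\<^sup>2)"
  let ?t = "\<lambda>\<epsilon> u. indicator {u. \<forall>z. 1 - k * (sn z)\<^sup>2 = 0 \<longrightarrow> \<epsilon> \<le> \<bar>u - z\<bar>} u * ?g u"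
  have eq: "?t \<epsilon> u = ?g u" if "u \<in> {l..r}" "\<epsilon> < \<delta>" for u \<epsilon>
  proof -
    have "\<epsilon> \<le> \<bar>u - z\<bar>" if z: "1 - k * (sn z)\<^sup>2 = 0" for z
    proof (rule ccontr)
      assume "\<not> \<epsilon> \<le> \<bar>u - z\<bar>"
      then have "z \<in> ball u \<delta>" using \<open>\<epsilon> < \<delta>\<close> by (simp add: dist_real_def)
      then have "z \<in> O'" using \<delta>(2) \<open>u \<in> {l..r}\<close> by blast
      then show False using z by (simp add: O'_def)
    qed
    then show ?thesis by simp
  qed
  have cont: "continuous_on {l..r} ?g"
    by (intro continuous_intros continuous_on_subset[OF sn_cont sub]) (use nz lr in auto)
  have FTC: "(LBINT u=l..r. ?g u) = G r - G l"
    by (rule interval_integral_FTC_finite)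
      (use lr cont G in \<open>auto simp: min_def max_def has_real_derivative_iff_has_vector_derivative[symmetric]\<close>)
  have "(LBINT u=0..s. ?t \<epsilon> u) = G s - G 0" if "\<epsilon> < \<delta>" for \<epsilon>
  proof -
    have 1: "(LBINT u=l..r. ?t \<epsilon> u) = (LBINT u=l..r. ?g u)"
      by (rule interval_integral_cong) (use eq[OF _ that] lr(2) in \<open>auto simp: min_def max_def einterval_eq\<close>)
    show ?thesis
    proof (cases "0 \<le> s")
      case True
      then show ?thesis using 1 FTC by (simp add: l_def r_def zero_ereal_def)
    next
      case False
      then have "(LBINT u=s..0. ?t \<epsilon> u) = G 0 - G s" using 1 FTC by (simp add: l_def r_def zero_ereal_def)
      then show ?thesis by (subst interval_integral_endpoints_reverse) simp
    qed
  qed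
  then have "\<forall>\<^sub>F \<epsilon> in at_right 0. (LBINT u=0..s. ?t \<epsilon> u) = G s - G 0"
    using eventually_at_right_real[OF \<delta>(1)] by (auto elim: eventually_mono)
  then have "((\<lambda>\<epsilon>. LBINT u=0..s. ?t \<epsilon> u) \<longlongrightarrow> G s - G 0) (at_right 0)"
    by (rule tendsto_eventually)
  then show ?thesis unfolding ellip_Pi_def by (intro tendsto_Lim) simp
qed

text \<open>With a single zero \<open>z0\<close> inside the segment, the truncated integral is the
  sum over the two remaining pieces. It differs from the increment of \<open>G\<close> by the
  difference of the values of \<open>G\<close> on the two sides of \<open>z0\<close>, which tends to
  \<open>0\<close> by \<open>lim\<close>.\<close>

lemma ellip_Pi_principal_value:
  assumes s: "s \<in> quarter p"
    and z0: "z0 \<in> open_segment 0 s" "1 - k * (sn z0)\<^sup>2 = 0"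
    and nz: "\<And>u. u \<in> closed_segment 0 s \<Longrightarrow> u \<noteq> z0 \<Longrightarrow> 1 - k * (sn u)\<^sup>2 \<noteq> 0"
    and G: "\<And>u. u \<in> closed_segment 0 s \<Longrightarrow> u \<noteq> z0 \<Longrightarrow>
      (G has_real_derivative 1 / (1 - k * (sn u)\<^sup>2)) (at u within closed_segment 0 s)"
    and lim: "((\<lambda>\<epsilon>. G (z0 - \<epsilon>) - G (z0 + \<epsilon>)) \<longlongrightarrow> 0) (at_right 0)"
  shows "ellip_Pi p k s = G s - G 0"
proof -
  define l r where "l = min 0 s" and "r = max 0 s"
  have lr: "closed_segment 0 s = {l..r}" "l < z0" "z0 < r"
    using z0(1) by (auto simp: l_def r_def closed_segment_eq_real_ivl open_segment_eq_real_ivl min_def max_def split: if_splits)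
  have sub: "{l..r} \<subseteq> quarter p"
    using interval_quarter s quarter_0 closed_segment_subset is_interval_convex lr(1) by metis
  have sub0: "z0 \<in> quarter p" using sub lr by auto
  define O' where "O' = {u \<in> quarter p. 1 - k * (sn u)\<^sup>2 \<noteq> 0 \<or> u \<in> {l<..<r}}"
  have "O' = (quarter p \<inter> (\<lambda>u. 1 - k * (sn u)\<^sup>2) -` (- {0})) \<union> (quarter p \<inter> {l<..<r})" by (auto simp: O'_def)
  then have "open O'"
    by (simp only:) (intro open_Un open_Int continuous_open_preimage open_quarter continuous_intros sn_cont; simp)
  moreover have "{l..r} \<subseteq> O'" using sub nz lr by (force simp: O'_def)
  ultimately obtain \<delta> where \<delta>: "\<delta> > 0" "(\<Union>x\<in>{l..r}. ball x \<delta>) \<subseteq> O'"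
    using compact_subset_open_imp_ball_epsilon_subset[of "{l..r}"] by blast
  let ?g = "\<lambda>u. 1 / (1 - k * (sn u)\<^sup>2)"
  let ?t = "\<lambda>\<epsilon> u. indicator {u. \<forall>z. 1 - k * (sn z)\<^sup>2 = 0 \<longrightarrow> \<epsilon> \<le> \<bar>u - z\<bar>} u * ?g u"
  have eq: "?t \<epsilon> u = indicator {u. \<epsilon> \<le> \<bar>u - z0\<bar>} u * ?g u" if "u \<in> {l..r}" "\<epsilon> < \<delta>" for u \<epsilon>
  proof -
    have "(\<forall>z. 1 - k * (sn z)\<^sup>2 = 0 \<longrightarrow> \<epsilon> \<le> \<bar>u - z\<bar>) \<longleftrightarrow> \<epsilon> \<le> \<bar>u - z0\<bar>"
    proof (intro iffI allI impI)
      fix z assume z: "1 - k * (sn z)\<^sup>2 = 0" and e: "\<epsilon> \<le> \<bar>u - z0\<bar>"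
      show "\<epsilon> \<le> \<bar>u - z\<bar>"
      proof (rule ccontr)
        assume "\<not> \<epsilon> \<le> \<bar>u - z\<bar>"
        then have "z \<in> ball u \<delta>" using \<open>\<epsilon> < \<delta>\<close> by (simp add: dist_real_def)
        then have "z \<in> O'" using \<delta>(2) \<open>u \<in> {l..r}\<close> by blast
        then have "z \<in> {l<..<r}" using z by (simp add: O'_def)
        then have "z = z0" using nz[of z] z lr by auto
        then show False using e \<open>\<not> \<epsilon> \<le> \<bar>u - z\<bar>\<close> by simp
      qed
    qed (use z0 in auto)
    then show ?thesis by (simp add: indicator_def)
  qed
  define \<delta>' where "\<delta>' = min \<delta> (min (z0 - l) (r - z0))"
  have \<delta>': "\<delta>' > 0" using \<delta> lr by (auto simp: \<delta>'_def)
  have int: "(LBINT u=l..r. ?t \<epsilon> u) = G r - G l + (G (z0 - \<epsilon>) - G (z0 + \<epsilon>))" if \<epsilon>: "0 < \<epsilon>" "\<epsilon> < \<delta>'" for \<epsilon>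
  proof -
    let ?f = "\<lambda>u. indicator {u. \<epsilon> \<le> \<bar>u - z0\<bar>} u * ?g u"
    define E where "E = {l..z0 - \<epsilon>} \<union> {z0 + \<epsilon>..r}"
    have E: "compact E" "E \<subseteq> {l..r}" "z0 \<notin> E" using \<epsilon> lr by (auto simp: E_def \<delta>'_def)
    have "1 - k * (sn u)\<^sup>2 \<noteq> 0" if "u \<in> E" for u using nz[of u] that E lr(1) by blast
    then have contE: "continuous_on E ?g"
      by (intro continuous_intros continuous_on_subset[OF sn_cont]) (use E sub in auto)
    have ind: "indicator {l..r} u *\<^sub>R ?f u = indicator E u *\<^sub>R ?g u" for u
      using \<epsilon> lr by (auto simp: indicator_def E_def \<delta>'_def split: if_splits)
    have setint: "set_integrable lborel {l..r} ?f"
      unfolding set_integrable_def ind by (rule borel_integrable_compact[OF E(1) contE])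
    have FTC: "(?g has_integral G y - G x) {x..y}" if "x \<le> y" "{x..y} \<subseteq> E" for x y
    proof (rule fundamental_theorem_of_calculus[OF that(1)])
      fix u assume u: "u \<in> {x..y}"
      have "{x..y} \<subseteq> {l..r}" "u \<noteq> z0" using that(2) E u by blast+
      then show "(G has_vector_derivative ?g u) (at u within {x..y})"
        using has_field_derivative_subset[OF G[of u]] u that(2) E lr(1)
        by (auto simp: has_real_derivative_iff_has_vector_derivative[symmetric])
    qed
    have "(?f has_integral G (z0 - \<epsilon>) - G l) {l..z0 - \<epsilon>}"
      by (rule has_integral_eq[OF _ FTC]) (use \<epsilon> lr in \<open>auto simp: E_def \<delta>'_def\<close>)
    moreover have "(?f has_integral G r - G (z0 + \<epsilon>)) {z0 + \<epsilon>..r}"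
      by (rule has_integral_eq[OF _ FTC]) (use \<epsilon> lr in \<open>auto simp: E_def \<delta>'_def\<close>)
    \<comment> \<open>On the removed piece the integrand vanishes except at the two end points,
      where the indicator is one.\<close>
    moreover have "(?f has_integral 0) {z0 - \<epsilon>..z0 + \<epsilon>}"
      by (rule has_integral_spike_finite[of "{z0 - \<epsilon>, z0 + \<epsilon>}" _ _ "\<lambda>_. 0"]) (auto simp: indicator_def)
    ultimately have "(?f has_integral (G (z0 - \<epsilon>) - G l) + 0 + (G r - G (z0 + \<epsilon>))) {l..r}"
      by (intro has_integral_combine[of l "z0 + \<epsilon>" r] has_integral_combine[of l "z0 - \<epsilon>" "z0 + \<epsilon>"])
        (use \<epsilon> lr in \<open>auto simp: \<delta>'_def\<close>)
    then have "integral {l..r} ?f = G r - G l + (G (z0 - \<epsilon>) - G (z0 + \<epsilon>))"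
      by (simp add: integral_unique)
    moreover have "(LBINT u=l..r. ?f u) = integral {l..r} ?f"
      by (rule interval_integral_eq_integral[OF _ setint]) (use lr in simp)
    moreover have "(LBINT u=l..r. ?t \<epsilon> u) = (LBINT u=l..r. ?f u)"
    proof -
      have e: "\<epsilon> < \<delta>" using \<epsilon> by (simp add: \<delta>'_def)
      show ?thesis
        by (rule interval_integral_cong) (use eq[OF _ e] lr in \<open>simp add: min_def max_def einterval_eq\<close>)
    qed
    ultimately show ?thesis by simp
  qed
  have ev: "\<forall>\<^sub>F \<epsilon> in at_right 0. \<epsilon> > 0 \<and> \<epsilon> < \<delta>'"
    using eventually_at_right_real[OF \<delta>'] by (auto elim: eventually_mono)
  have "((\<lambda>\<epsilon>. LBINT u=0..s. ?t \<epsilon> u) \<longlongrightarrow> G s - G 0) (at_right 0)"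
  proof (cases "0 \<le> s")
    case True
    have "((\<lambda>\<epsilon>. G s - G 0 + (G (z0 - \<epsilon>) - G (z0 + \<epsilon>))) \<longlongrightarrow> G s - G 0 + 0) (at_right 0)"
      by (intro tendsto_intros lim)
    moreover have "\<forall>\<^sub>F \<epsilon> in at_right 0. G s - G 0 + (G (z0 - \<epsilon>) - G (z0 + \<epsilon>)) = (LBINT u=0..s. ?t \<epsilon> u)"
      using ev
    proof eventually_elim
      case (elim \<epsilon>)
      then show ?case using int[of \<epsilon>] True by (simp add: l_def r_def zero_ereal_def)
    qed
    ultimately show ?thesis using Lim_transform_eventually by fastforce
  next
    case False
    have "((\<lambda>\<epsilon>. - (G 0 - G s + (G (z0 - \<epsilon>) - G (z0 + \<epsilon>)))) \<longlongrightarrow> - (G 0 - G s + 0)) (at_right 0)"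
      by (intro tendsto_intros lim)
    moreover have "\<forall>\<^sub>F \<epsilon> in at_right 0. - (G 0 - G s + (G (z0 - \<epsilon>) - G (z0 + \<epsilon>))) = (LBINT u=0..s. ?t \<epsilon> u)"
      using ev
    proof eventually_elim
      case (elim \<epsilon>)
      then show ?case using int[of \<epsilon>] False
        by (subst interval_integral_endpoints_reverse) (simp add: l_def r_def zero_ereal_def)
    qed
    ultimately show ?thesis using Lim_transform_eventually by fastforce
  qed
  then show ?thesis unfolding ellip_Pi_def by (intro tendsto_Lim) simp
qed

end

context modulus_le_1 begin

lemma quarter_Icc: "l \<in> quarter p \<Longrightarrow> r \<in> quarter p \<Longrightarrow> {l..r} \<subseteq> quarter p"
  using mem_is_interval_1_I[OF interval_quarter, of l r] by (meson atLeastAtMost_iff subsetI)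

lemma has_real_derivative_ln_abs:
  assumes "(w has_real_derivative w') (at x within S)" "w x \<noteq> 0"
  shows "((\<lambda>x. ln \<bar>w x\<bar>) has_real_derivative w' / w x) (at x within S)"
proof -
  have "ln \<bar>y\<bar> = ln (y\<^sup>2) / 2" for y :: real
  proof (cases "y = 0")
    case False
    then have "ln (\<bar>y\<bar> ^ 2) = 2 * ln \<bar>y\<bar>" by (subst ln_realpow) auto
    then show ?thesis by simp
  qed simp
  then have eq: "(\<lambda>x. ln \<bar>w x\<bar>) = (\<lambda>x. ln ((w x)\<^sup>2) / 2)" by blast
  have "((\<lambda>x. ln ((w x)\<^sup>2) / 2) has_real_derivative w' / w x) (at x within S)"
    using assms
    by (auto intro!: derivative_eq_intros simp: field_simps power2_eq_square zero_less_mult_iff linorder_neq_iff)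
  then show ?thesis unfolding eq .
qed

text \<open>Split off the logarithm: with \<open>\<mu> = 1 / w' z\<close> at a zero \<open>z\<close>
  of \<open>w\<close>, the numerator of \<open>(1 - \<mu> * w' u) / w u\<close> vanishes at
  \<open>z\<close> and the quotient extends continuously. At a zero the square of \<open>sn\<close>
  is \<open>1 / k\<close>, so the square of \<open>w'\<close> is
  \<open>4 * ((k - 1) * (1 - p\<^sup>2 / k))\<close>, whence the constant. The sign of
  \<open>w'\<close> differs on the two sides of \<open>0\<close>, so \<open>\<sigma>\<close> and the
  half \<open>H\<close> go together, and each half contains at most one zero.\<close>

lemma ellip_Pi_log:
  fixes k \<sigma> :: real
  assumes k: "k > 1" and H: "\<sigma> = -1 \<and> H = quarter p \<inter> {0..} \<or> \<sigma> = 1 \<and> H = quarter p \<inter> {..0}"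
  defines "w \<equiv> \<lambda>u. 1 - k * (sn u)\<^sup>2" and "w' \<equiv> \<lambda>u. - 2 * k * sn u * cn u * dn u"
    and "\<mu> \<equiv> \<sigma> / (2 * sqrt ((k - 1) * (1 - p\<^sup>2 / k)))"
  shows "\<exists>R. continuous_on H R \<and>
    (\<forall>u\<in>H. w u \<noteq> 0 \<longrightarrow> (R has_real_derivative (1 - \<mu> * w' u) / w u) (at u)) \<and>
    (\<forall>u\<in>H. w u \<noteq> 0 \<longrightarrow> ellip_Pi p k u = R u + \<mu> * ln \<bar>w u\<bar>)"
proof -
  have \<sigma>: "\<sigma>\<^sup>2 = 1" using H by auto
  have "p\<^sup>2 / k < 1" using p k by (simp add: divide_less_eq)
  then have k': "(k - 1) * (1 - p\<^sup>2 / k) > 0" using k by simp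
  have \<mu>2: "\<mu>\<^sup>2 = 1 / (4 * ((k - 1) * (1 - p\<^sup>2 / k)))"
    using k' \<sigma> by (simp add: \<mu>_def power_divide power_mult_distrib)
  \<comment> \<open>The quotient \<open>(1 - \<mu> * w' u) / w u\<close>, expanded by
    \<open>1 + \<mu> * w' u\<close>: the new numerator \<open>1 - (\<mu> * w' u)\<^sup>2\<close> is
    a polynomial in the square of \<open>sn\<close> divisible by \<open>w u\<close>, and the bracket
    is the result of the division up to a factor. The absolute value agrees with
    \<open>\<mu> * w' u\<close> on \<open>H\<close> and keeps the denominator positive on the other
    half.\<close>
  define q where "q u = 4 * k * \<mu>\<^sup>2 * (1 - (1 + p\<^sup>2) * ((sn u)\<^sup>2 + 1/k) + p\<^sup>2 * ((sn u)^4 + (sn u)\<^sup>2 / k + 1/k\<^sup>2)) / (1 + \<bar>\<mu> * w' u\<bar>)" for u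
  have wc: "continuous_on (quarter p) w'"
    unfolding w'_def by (intro continuous_on_mult continuous_on_const sn_cont cn_cont dn_cont)
  have den: "1 + \<bar>\<mu> * w' u\<bar> \<noteq> 0" for u by linarith
  have qc: "continuous_on (quarter p) q"
    unfolding q_def[abs_def]
    by (intro continuous_on_divide continuous_on_mult continuous_on_add continuous_on_diff continuous_on_power
        continuous_on_rabs continuous_on_const sn_cont wc) (use den k in auto)
  have wd: "(w has_real_derivative w' u) (at u)" if "u \<in> quarter p" for u
    unfolding w_def w'_def using sn_deriv[OF that] by (auto intro!: derivative_eq_intros)
  have Hq: "H \<subseteq> quarter p" and H0: "0 \<in> H" using H quarter_0 by auto
  have seg: "closed_segment 0 u \<subseteq> H" if "u \<in> H" for u
  proof -
    have "closed_segment 0 u \<subseteq> quarter p"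
      using interval_quarter that Hq quarter_0 closed_segment_subset is_interval_convex by blast
    then show ?thesis using that H by (auto simp: closed_segment_eq_real_ivl split: if_splits)
  qed
  have sign: "\<mu> * w' u \<ge> 0" if "u \<in> H" for u
  proof -
    have "sn 0 = 0" by (simp add: jacobi_sn_def am_0)
    then have "\<sigma> * sn u \<le> 0" using H that sn_pos[of u] sn_neg[of u] by (cases "u = 0") fastforce+
    then have "(\<sigma> * sn u) * (- 2 * k * cn u * dn u) \<ge> 0"
      using k cn_pos[of u] dn_pos[of u] that Hq by (intro mult_nonpos_nonpos) auto
    then have "\<sigma> * w' u \<ge> 0" by (simp add: w'_def algebra_simps)
    then show ?thesis unfolding \<mu>_def using k' by (simp add: zero_le_divide_iff)
  qed
  have qw: "w u * q u = 1 - \<mu> * w' u" if "u \<in> H" for u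
  proof -
    define S where "S = (sn u)\<^sup>2"
    have u: "u \<in> quarter p" using that Hq by blast
    have "(w' u)\<^sup>2 = 4 * k\<^sup>2 * S * (cn u)\<^sup>2 * (dn u)\<^sup>2" by (simp add: w'_def S_def power_mult_distrib)
    also have "(cn u)\<^sup>2 = 1 - S" using sn_cn[of u] by (simp add: S_def)
    also have "(dn u)\<^sup>2 = 1 - p\<^sup>2 * S" using dn_sq[OF u] by (simp add: S_def)
    finally have w2: "(w' u)\<^sup>2 = 4 * k\<^sup>2 * S * (1 - S) * (1 - p\<^sup>2 * S)" .
    have S4: "(sn u)^4 = S\<^sup>2" by (simp add: S_def)
    define qq where "qq = 1 - (1 + p\<^sup>2) * (S + 1/k) + p\<^sup>2 * (S\<^sup>2 + S / k + 1/k\<^sup>2)"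
    define K where "K = (k - 1) * (1 - p\<^sup>2 / k)"
    have "(1 - k * S) * (4 * k * qq) = 4 * K - (w' u)\<^sup>2"
      unfolding w2 qq_def K_def using k by (simp add: field_simps power2_eq_square)
    moreover have "\<mu>\<^sup>2 * (4 * K) = 1" using k' unfolding \<mu>2 K_def[symmetric] by simp
    ultimately have "\<mu>\<^sup>2 * ((1 - k * S) * (4 * k * qq)) = 1 - \<mu>\<^sup>2 * (w' u)\<^sup>2"
      by (simp only: right_diff_distrib)
    also have "\<dots> = (1 - \<mu> * w' u) * (1 + \<mu> * w' u)" by (simp add: algebra_simps power2_eq_square)
    finally have "w u * (4 * k * \<mu>\<^sup>2 * qq) = (1 - \<mu> * w' u) * (1 + \<mu> * w' u)"
      by (simp add: w_def S_def algebra_simps)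
    then show ?thesis using sign[OF that]
      unfolding q_def S_def[symmetric] S4 qq_def[symmetric] by (simp add: field_simps)
  qed
  obtain R0 where R0: "\<And>u. u \<in> quarter p \<Longrightarrow> (R0 has_real_derivative q u) (at u)"
  proof -
    have "((\<lambda>u. LBINT y=0..u. q y) has_real_derivative q u) (at u)" if u: "u \<in> quarter p" for u
    proof -
      obtain e where e: "e > 0" "cball u e \<subseteq> quarter p" using open_quarter u open_contains_cball by blast
      define l r where "l = min 0 (u - e)" and "r = max 0 (u + e)"
      have "u - e \<in> quarter p" "u + e \<in> quarter p" using e by (auto simp: cball_def dist_real_def subset_iff)
      then have "l \<in> quarter p" "r \<in> quarter p" using quarter_0 by (auto simp: l_def r_def min_def max_def)
      then have "{l..r} \<subseteq> quarter p" by (rule quarter_Icc)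
      then have "((\<lambda>u. LBINT y=0..u. q y) has_vector_derivative q u) (at u within {l..r})"
        using interval_integral_FTC2[of l 0 r q u] continuous_on_subset[OF qc] e(1) by (auto simp: l_def r_def zero_ereal_def)
      moreover have "l < u" "u < r" using e by (auto simp: l_def r_def)
      ultimately show ?thesis by (simp add: has_real_derivative_iff_has_vector_derivative at_within_Icc_at)
    qed
    then show ?thesis using that by blast
  qed
  define R where "R u = R0 u - R0 0" for u
  have Rd: "(R has_real_derivative q u) (at u)" if "u \<in> quarter p" for u
    unfolding R_def[abs_def] using R0[OF that] by (auto intro!: derivative_eq_intros)
  have w0: "w 0 = 1" by (simp add: w_def jacobi_sn_def am_0)
  define G where "G u = R u + \<mu> * ln \<bar>w u\<bar>" for u
  have G0: "G 0 = 0" by (simp add: G_def R_def w0)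
  have Gd: "(G has_real_derivative 1 / w u) (at u within S)" if u: "u \<in> H" "w u \<noteq> 0" for u S
  proof -
    have "(G has_real_derivative q u + \<mu> * (w' u / w u)) (at u)"
      unfolding G_def[abs_def] by (intro DERIV_add Rd DERIV_cmult has_real_derivative_ln_abs wd) (use u Hq in auto)
    moreover have "q u + \<mu> * (w' u / w u) = 1 / w u" using qw[OF u(1)] u(2) by (simp add: field_simps)
    ultimately show ?thesis using has_field_derivative_at_within by metis
  qed
  have "ellip_Pi p k u = G u" if u: "u \<in> H" "w u \<noteq> 0" for u
  proof (cases "\<exists>z\<in>closed_segment 0 u. w z = 0")
    case False
    then have "ellip_Pi p k u = G u - G 0"
      using u Hq seg[OF u(1)] Gd by (intro ellip_Pi_primitive) (auto simp: w_def)
    then show ?thesis by (simp add: G0)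
  next
    case True
    then obtain z where z: "z \<in> closed_segment 0 u" "w z = 0" by blast
    have zH: "z \<in> H" using z seg[OF u(1)] by blast
    have uniq: "v = z" if v: "v \<in> H" "w v = 0" for v
    proof -
      have "(sn v)\<^sup>2 = (sn z)\<^sup>2" using v(2) z(2) k by (simp add: w_def) (metis mult_cancel_left less_numeral_extra(3) not_one_less_zero)
      moreover have "v \<noteq> 0" "z \<noteq> 0" using v z w0 by auto
      then have "sn v > 0 \<and> sn z > 0 \<or> sn v < 0 \<and> sn z < 0"
        using H v(1) zH sn_pos[of v] sn_pos[of z] sn_neg[of v] sn_neg[of z] by fastforce
      ultimately have "sn v = sn z" by (auto simp: power2_eq_iff)
      then show ?thesis using sn_inj v(1) zH Hq by blast
    qed
    have zo: "z \<in> open_segment 0 u" using z u(2) w0 by (auto simp: open_segment_def)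
    have w'z: "w' z \<noteq> 0"
    proof -
      have "sn z \<noteq> 0" using z(2) by (auto simp: w_def)
      then show ?thesis using k cn_pos[of z] dn_pos[of z] zH Hq by (auto simp: w'_def)
    qed
    have zq: "z \<in> quarter p" using zH Hq by blast
    \<comment> \<open>Since \<open>w (z + c * \<epsilon>) / \<epsilon>\<close> tends to
      \<open>c * w' z\<close>, the difference of the two logarithms for \<open>c = -1\<close> and
      \<open>c = 1\<close> tends to \<open>0\<close>.\<close>
    have lim: "((\<lambda>\<epsilon>. G (z - \<epsilon>) - G (z + \<epsilon>)) \<longlongrightarrow> 0) (at_right 0)"
    proof -
      have wlim: "((\<lambda>\<epsilon>. w (z + c * \<epsilon>) / \<epsilon>) \<longlongrightarrow> c * w' z) (at_right 0)" for c
      proof -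
        have "((\<lambda>\<epsilon>. w (z + c * \<epsilon>)) has_real_derivative w' z * c) (at 0)"
          by (rule DERIV_chain2[of w]) (use wd[OF zq] in \<open>auto intro!: derivative_eq_intros\<close>)
        then show ?thesis using z(2) 
          by (simp add: has_field_derivative_iff filterlim_at_split mult.commute)
      qed
      have lnlim: "((\<lambda>\<epsilon>. ln \<bar>w (z + c * \<epsilon>) / \<epsilon>\<bar>) \<longlongrightarrow> ln \<bar>c * w' z\<bar>) (at_right 0)" if "c \<noteq> 0" for c
        by (intro tendsto_ln tendsto_rabs wlim) (use that w'z in auto)
      have Rl: "((\<lambda>\<epsilon>. R (z + c * \<epsilon>)) \<longlongrightarrow> R z) (at_right 0)" for c
      proof -
        have "isCont R z" using Rd[OF zq] DERIV_isCont by blast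
        moreover have "((\<lambda>\<epsilon>. z + c * \<epsilon>) \<longlongrightarrow> z + c * 0) (at_right 0)" by (intro tendsto_intros)
        ultimately show ?thesis using isCont_tendsto_compose[of z R] by simp
      qed
      have "((\<lambda>\<epsilon>. (R (z + (-1) * \<epsilon>) - R (z + 1 * \<epsilon>)) + \<mu> * (ln \<bar>w (z + (-1) * \<epsilon>) / \<epsilon>\<bar> - ln \<bar>w (z + 1 * \<epsilon>) / \<epsilon>\<bar>)) \<longlongrightarrow>
          (R z - R z) + \<mu> * (ln \<bar>(-1) * w' z\<bar> - ln \<bar>1 * w' z\<bar>)) (at_right 0)"
        by (intro tendsto_intros Rl lnlim) auto
      moreover have "\<forall>\<^sub>F \<epsilon> in at_right 0. (R (z + (-1) * \<epsilon>) - R (z + 1 * \<epsilon>)) + \<mu> * (ln \<bar>w (z + (-1) * \<epsilon>) / \<epsilon>\<bar> - ln \<bar>w (z + 1 * \<epsilon>) / \<epsilon>\<bar>) = G (z - \<epsilon>) - G (z + \<epsilon>)"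
      proof -
        have nz: "\<forall>\<^sub>F \<epsilon> in at_right 0. w (z + c * \<epsilon>) / \<epsilon> \<noteq> 0" if "c \<noteq> 0" for c
          using tendsto_imp_eventually_ne[OF wlim[of c], of 0] that w'z by auto
        show ?thesis using nz[of 1, simplified] nz[of "-1", simplified] eventually_at_right_less[of "0::real"]
        proof eventually_elim
          case (elim \<epsilon>)
          then show ?case by (simp add: G_def abs_divide ln_div algebra_simps)
        qed
      qed
      ultimately show ?thesis by (simp add: tendsto_cong)
    qed
    have "ellip_Pi p k u = G u - G 0"
    proof (rule ellip_Pi_principal_value[OF _ zo _ _ _ lim])
      show "u \<in> quarter p" using u(1) Hq by blast
      show "1 - k * (sn z)\<^sup>2 = 0" using z(2) by (simp add: w_def)
      fix v assume v: "v \<in> closed_segment 0 u" "v \<noteq> z"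
      then have v': "v \<in> H" "w v \<noteq> 0" using seg[OF u(1)] uniq by blast+
      then show "1 - k * (sn v)\<^sup>2 \<noteq> 0" by (simp add: w_def)
      show "(G has_real_derivative 1 / (1 - k * (sn v)\<^sup>2)) (at v within closed_segment 0 u)"
        using Gd[OF v'] by (simp add: w_def)
    qed
    then show ?thesis by (simp add: G0)
  qed
  moreover have "continuous_on H R"
    using Rd Hq DERIV_isCont continuous_at_imp_continuous_on by blast
  moreover have "(R has_real_derivative (1 - \<mu> * w' u) / w u) (at u)" if "u \<in> H" "w u \<noteq> 0" for u
  proof -
    have "q u = (1 - \<mu> * w' u) / w u" using qw[OF that(1)] that(2) by (simp add: field_simps)
    then show ?thesis using Rd[of u] that(1) Hq by auto
  qed
  ultimately show ?thesis by (intro exI[of _ R]) (simp add: G_def)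
qed

lemma ellip_Pi_has_derivative:
  assumes nz: "\<And>u. u \<in> quarter p \<Longrightarrow> 1 - k * (sn u)\<^sup>2 \<noteq> 0" and u: "u \<in> quarter p"
  shows "(ellip_Pi p k has_real_derivative 1 / (1 - k * (sn u)\<^sup>2)) (at u)"
proof -
  let ?g = "\<lambda>u. 1 / (1 - k * (sn u)\<^sup>2)"
  have gc: "continuous_on (quarter p) ?g" by (intro continuous_intros sn_cont) (use nz in auto)
  define G where "G u = (LBINT y=0..u. ?g y)" for u :: real
  have Gd: "(G has_real_derivative ?g u) (at u)" if u: "u \<in> quarter p" for u
  proof -
    obtain e where e: "e > 0" "cball u e \<subseteq> quarter p" using open_quarter u open_contains_cball by blast
    define l r where "l = min 0 (u - e)" and "r = max 0 (u + e)"
    have "u - e \<in> quarter p" "u + e \<in> quarter p" using e by (auto simp: cball_def dist_real_def subset_iff)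
    then have "l \<in> quarter p" "r \<in> quarter p" using quarter_0 by (auto simp: l_def r_def min_def max_def)
    then have "{l..r} \<subseteq> quarter p" by (rule quarter_Icc)
    then have "(G has_vector_derivative ?g u) (at u within {l..r})"
      unfolding G_def[abs_def]
      using interval_integral_FTC2[of l 0 r ?g u] continuous_on_subset[OF gc] e(1) by (auto simp: l_def r_def zero_ereal_def)
    moreover have "l < u" "u < r" using e by (auto simp: l_def r_def)
    ultimately show ?thesis by (simp add: has_real_derivative_iff_has_vector_derivative at_within_Icc_at)
  qed
  have "ellip_Pi p k v = G v - G 0" if v: "v \<in> quarter p" for v
  proof -
    have "closed_segment 0 v \<subseteq> quarter p"
      using interval_quarter v quarter_0 closed_segment_subset is_interval_convex by blast
    then show ?thesis using nz Gd v has_field_derivative_at_within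
      by (intro ellip_Pi_primitive) blast+
  qed
  moreover have "((\<lambda>v. G v - G 0) has_real_derivative ?g u) (at u)"
    using Gd[OF u] by (auto intro!: derivative_eq_intros)
  ultimately show ?thesis
    using has_field_derivative_transform_within_open[of "\<lambda>v. G v - G 0" _ u "quarter p"] open_quarter u by metis
qed

end

section \<open>The conserved quantity\<close>

context rot_surface begin

lemma Q_X: "Q x (X y) = - Q (X x) y"
  unfolding Q_def by (simp add: X_skew)

lemma Q_X': "Q x (X x) = 0"
  using Q_X[of x x] Q_commute[of x "X x"] by simp

lemma QN_parallel: assumes "x \<in> M" shows "Q (n x) (n x) *\<^sub>R X (f x) = Q (f x) (n x) *\<^sub>R X (n x)"
  using X_parallel[OF f_perp_Xn(1)[OF assms]] .

lemma openin_Mst: "openin (top_of_set M) Mst"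
proof -
  have "continuous_on M (\<lambda>x. X (f x))"
    using bounded_linear.continuous_on[OF bounded_linear_X cont_f] .
  then have "openin (top_of_set M) (M \<inter> (\<lambda>x. X (f x)) -` (- {0}))"
    by (rule continuous_openin_preimage_gen) (rule open_Compl, rule closed_singleton)
  moreover have "M \<inter> (\<lambda>x. X (f x)) -` (- {0}) = Mst" by (auto simp: Mst_def)
  ultimately show ?thesis by simp
qed

lemma chart_shrink:
  assumes "openin (top_of_set M) T" "x \<in> T"
  obtains W h w where "chart W h" "w \<in> W" "h w = x" "h ` W \<subseteq> T"
proof -
  have "x \<in> M" using assms openin_imp_subset by blast
  then obtain W h w where ch: "chart W h" "w \<in> W" "h w = x" using chart_exists by blast
  have "continuous_on W h" using ch(1) unfolding local_param_def homeomorphism_def by blast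
  then have "openin (top_of_set W) (W \<inter> h -` T)"
    using continuous_openin_preimage[of W h M T] local_param_D(6)[OF ch(1)] assms(1) by blast
  then have "open (W \<inter> h -` T)" using local_param_D(1)[OF ch(1)] openin_open_eq by blast
  then have "chart (W \<inter> h -` T) h" using local_param_subset[OF ch(1)] by blast
  then show ?thesis using that[of "W \<inter> h -` T" h w] ch assms(2) by auto
qed

lemma chart_openin_Mst:
  assumes "chart W h" "open U" "U \<subseteq> W" "h ` U \<subseteq> Mst"
  shows "openin (top_of_set Mst) (h ` U)"
  using local_param_D(2)[OF local_param_subset[OF assms(1-3)]] assms(4) openin_Mst openin_imp_subset
  by (meson openin_subset_trans)

text \<open>Along orbits the invariance of \<open>Q\<close> suffices. Along the meridian the terms
  with \<open>2 / Hb\<close> from \<open>f\<close> and from \<open>n\<close> cancel, and the rest is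
  \<open>Q N N * Q F Y = Q F N * Q N Y\<close>, which holds because \<open>X F\<close> and
  \<open>X N\<close> are parallel.\<close>

lemma conserved:
  assumes "connected Mst"
  shows "\<exists>C. \<forall>x\<in>Mst. Q (f x) (n x) + Q (n x) (n x) / Hb = C"
proof (cases "Mst = {}")
  case False
  then obtain x0 where x0: "x0 \<in> Mst" by blast
  define g where "g x = Q (f x) (n x) + Q (n x) (n x) / Hb" for x
  have "g x = g x0" if "x \<in> Mst" for x
  proof (rule connected_induction_simple[OF assms x0 that, of "\<lambda>x. g x = g x0"])
    fix y assume y: "y \<in> Mst"
    obtain W h w where ch: "chart W h" "w \<in> W" "h w = y" "h ` W \<subseteq> Mst" using chart_shrink[OF openin_Mst y] .
    obtain e where e: "e > 0" "ball w e \<subseteq> W" using local_param_D(1)[OF ch(1)] ch(2) open_contains_ball by blast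
    have "((\<lambda>z. g (h z)) has_derivative (\<lambda>v. 0)) (at z)" if z: "z \<in> W" for z
    proof -
      note D = DF[OF ch(1) z] DN[OF ch(1) z]
      have hz: "h z \<in> Mst" using ch(4) z by blast
      define F N where "F = f (h z)" and "N = n (h z)"
      have d: "((\<lambda>z. Q ((f \<circ> h) z) ((n \<circ> h) z) + Q ((n \<circ> h) z) ((n \<circ> h) z) / Hb) has_derivative
         (\<lambda>v. (Q F (DN h z v) + Q (DF h z v) N) + (Q N (DN h z v) + Q (DN h z v) N) / Hb)) (at z)"
        unfolding divide_inverse F_def N_def
        using has_derivative_add[OF Q.FDERIV[OF D] has_derivative_mult_left[OF Q.FDERIV[OF D(2) D(2)], of "inverse Hb"]]
        by simp
      have "(Q F (DN h z v) + Q (DF h z v) N) + (Q N (DN h z v) + Q (DN h z v) N) / Hb = 0" for v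
      proof -
        note fr = frame_at[OF hz ch(1) z, folded F_def N_def]
        obtain v1 v2 Y where v: "DF h z v1 = X F" "DN h z v1 = X N" "DN h z v2 = Y"
          "DF h z v2 = - (2 / Hb + Q F N / Q N N) *\<^sub>R Y" "\<forall>v. \<exists>\<alpha> \<beta>. v = \<alpha> *\<^sub>R v1 + \<beta> *\<^sub>R v2"
          using fr(4) by blast
        obtain \<alpha> \<beta> where ab: "v = \<alpha> *\<^sub>R v1 + \<beta> *\<^sub>R v2" using v(5) by blast
        note lin = linear_DF[OF ch(1) z] linear_DN[OF ch(1) z]
        have dv: "DF h z v = \<alpha> *\<^sub>R X F + (- \<beta> * (2 / Hb + Q F N / Q N N)) *\<^sub>R Y" "DN h z v = \<alpha> *\<^sub>R X N + \<beta> *\<^sub>R Y"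
          unfolding ab linear_add[OF lin(1)] linear_scale[OF lin(1)] linear_add[OF lin(2)] linear_scale[OF lin(2)] v(1-4)
          by (simp_all only: scaleR_scaleR mult_minus_left mult_minus_right)
        have "Q N N *\<^sub>R X F = Q F N *\<^sub>R X N" using QN_parallel hz Mst_M by (simp add: F_def N_def)
        then have "Q N N * Q F Y = Q F N * Q N Y" unfolding Q_def[of F Y] Q_def[of N Y]
          by (metis mink.scaleR_left real_scaleR_def)
        then have QFY: "Q F Y = Q F N * Q N Y / Q N N" using fr(1) by (simp add: field_simps)
        show ?thesis unfolding dv Q.add_left Q.add_right Q.scaleR_left Q.scaleR_right Q_X Q_X' QFY
          using Q_X[of N N] Q_X' Q_commute[of Y N] Q_commute[of N "X F"] Q_commute[of "X N" N] Q_commute[of "X F" N] by (simp add: algebra_simps)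
      qed
      then show ?thesis using d by (simp add: g_def F_def N_def)
    qed
    then have c: "g (h z) = g (h z')" if "z \<in> ball w e" "z' \<in> ball w e" for z z'
      using has_derivative_zero_unique[of "ball w e" "\<lambda>z. g (h z)" z z'] that e(2) has_derivative_at_withinI
      by (metis (no_types, lifting) convex_ball subsetD)
    show "\<exists>T. openin (top_of_set Mst) T \<and> y \<in> T \<and> (\<forall>x\<in>T. \<forall>y\<in>T. g x = g x0 \<longrightarrow> g y = g x0)"
    proof (intro exI[of _ "h ` ball w e"] conjI ballI impI)
      show "openin (top_of_set Mst) (h ` ball w e)"
        by (rule chart_openin_Mst[OF ch(1)]) (use e ch(4) in auto)
      show "y \<in> h ` ball w e" using ch(3) e(1) by force
      fix p p' assume "p \<in> h ` ball w e" "p' \<in> h ` ball w e" "g p = g x0"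
      then show "g p' = g x0" using c by (metis imageE)
    qed
  qed simp
  then show ?thesis unfolding g_def by blast
qed blast

end

section \<open>The meridian parameter as a function on the surface\<close>

text \<open>What the velocity \<open>Y\<close> of the Gauss map along a meridian satisfies: it is
  tangent, orthogonal to the orbit, and scaled as in \<open>frame_at\<close>. The relation
  \<open>Q N Y = - B F N * Q N N\<close> identifies \<open>- B F N\<close> as the logarithmic
  derivative of \<open>r\<close>.\<close>

definition merid_rel :: "(vec4 \<Rightarrow> vec4) \<Rightarrow> (vec4 \<Rightarrow> vec4 \<Rightarrow> real) \<Rightarrow> (vec4 \<Rightarrow> vec4 \<Rightarrow> real) \<Rightarrow> vec4 \<Rightarrow> vec4 \<Rightarrow> vec4 \<Rightarrow> bool" where
  "merid_rel X Q B F N Y \<longleftrightarrow> mink Y F = 0 \<and> mink Y N = 0 \<and> mink Y (X N) = 0 \<and>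
      B F Y = Q N N \<and> B N Y = Q F N \<and> Q N Y = - B F N * Q N N"

text \<open>\<open>Cm \<le> 0\<close> instead of \<open>Cm < 0\<close> keeps the spheres in.\<close>

locale rot_surface_const = rot_surface a b c d \<epsilon> R Hb M f n \<phi>
  for a b c d \<epsilon> R Hb and M :: "'a::t2_space set" and f n \<phi> +
  fixes C Cp Cm :: real
  assumes conn: "connected Mst" and C_val: "\<And>x. x \<in> Mst \<Longrightarrow> Q (f x) (n x) + Q (n x) (n x) / Hb = C"
    and factor: "\<And>x. p_poly \<epsilon> Hb C x = (1 - 1 / Hb\<^sup>2) * (Cp - x) * (x - Cm)" and Cp: "Cp > 0" and Cm: "Cm \<le> 0"
begin

abbreviation "merid \<equiv> merid_rel X Q B"

definition \<mu> where "\<mu> = 1 - 1 / Hb\<^sup>2"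
definition \<Xi> where "\<Xi> = Xi Hb Cp Cm"
definition pp where "pp = modulus Cp Cm"

lemma \<mu>: "\<mu> > 0"
proof -
  have "Hb\<^sup>2 > 0" using Hb by linarith
  then show ?thesis using Hb by (simp add: \<mu>_def divide_less_eq)
qed
lemma \<Xi>: "\<Xi> > 0" "\<Xi>\<^sup>2 = \<mu> * (Cp - Cm)" "\<Xi> = sqrt (\<mu> * (Cp - Cm))"
  using \<mu> Cp Cm by (simp_all add: \<Xi>_def Xi_def \<mu>_def real_sqrt_mult power_mult_distrib)
lemma pp: "pp\<^sup>2 = Cp / (Cp - Cm)" using Cp Cm by (simp add: pp_def modulus_def)

sublocale modulus_le_1 pp
  by unfold_locales (use Cp Cm in \<open>simp add: pp divide_le_eq\<close>)

text \<open>Obtained by inverting the solution. If \<open>r = sqrt Cp * cn (\<Xi> * t)\<close> with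
  amplitude \<open>\<psi>\<close>, then
  \<open>r' / r = - tan \<psi> * \<Xi> * dn (\<Xi> * t)\<close> and
  \<open>\<Xi> * dn (\<Xi> * t) = sqrt (\<mu> * (r\<^sup>2 - Cm))\<close>, while
  \<open>r' / r\<close> is \<open>- B (f x) (n x)\<close>. Solving for \<open>\<psi>\<close> and
  applying \<open>ellip_F pp\<close> gives \<open>\<Xi> * t\<close>. Recovering
  \<open>\<psi>\<close> from \<open>r\<close> alone by the inverse cosine would lose its sign, and
  differentiability where \<open>r\<^sup>2 = Cp\<close>.\<close>

definition that :: "'a \<Rightarrow> real" where
  "that x = ellip_F pp (- arctan (- B (f x) (n x) / sqrt (\<mu> * (Q (n x) (n x) - Cm)))) / \<Xi>"

context
  fixes x assumes x: "x \<in> Mst"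
begin

text \<open>The last equation is the first integral
  \<open>r'\<^sup>2 = \<mu> * (Cp - r\<^sup>2) * (r\<^sup>2 - Cm)\<close>, with
  \<open>- B (f x) (n x)\<close> for \<open>r' / r\<close>: by \<open>frame_at\<close> its left side
  is the value of \<open>p_poly \<epsilon> Hb C\<close> at \<open>r\<^sup>2\<close>, and the roots
  factor it.\<close>

lemma Mst_facts: "Q (n x) (n x) > 0" "Q (f x) (n x) \<noteq> 0" "Q (f x) (n x) = C - Q (n x) (n x) / Hb"
  "Q (n x) (n x) * (B (f x) (n x))\<^sup>2 = \<mu> * (Cp - Q (n x) (n x)) * (Q (n x) (n x) - Cm)"
proof -
  obtain W h w where ch: "chart W h" "w \<in> W" "h w = x" using chart_exists[OF Mst_M[OF x]] .
  note fr = frame_at[of h w, unfolded ch(3), OF x ch(1,2)]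
  show q: "Q (n x) (n x) > 0" and "Q (f x) (n x) \<noteq> 0" by (rule fr)+
  show Qfn: "Q (f x) (n x) = C - Q (n x) (n x) / Hb" using C_val[OF x] by simp
  have "Q (n x) (n x) * (B (f x) (n x))\<^sup>2 = p_poly \<epsilon> Hb C (Q (n x) (n x))"
    unfolding fr(3) Qfn p_poly_def using q Hb_nz by (simp add: field_simps power2_eq_square)
  then show "Q (n x) (n x) * (B (f x) (n x))\<^sup>2 = \<mu> * (Cp - Q (n x) (n x)) * (Q (n x) (n x) - Cm)"
    by (simp add: factor \<mu>_def)
qed

text \<open>By the first integral the squared tangent of \<open>\<psi>\<close> is
  \<open>Cp / r\<^sup>2 - 1\<close>, so \<open>cos \<psi> = r / sqrt Cp\<close>; the range of the
  arctangent is exactly the branch covered by \<open>quarter pp\<close>.\<close>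

lemma amplitude:
  defines "\<psi> \<equiv> - arctan (- B (f x) (n x) / sqrt (\<mu> * (Q (n x) (n x) - Cm)))"
  shows "\<bar>\<psi>\<bar> < pi / 2" "sqrt Cp * cos \<psi> = sqrt (Q (n x) (n x))" "ellip_F pp \<psi> = \<Xi> * that x"
    "\<Xi> * that x \<in> quarter pp" "am (\<Xi> * that x) = \<psi>"
    "1 - pp\<^sup>2 * (sin \<psi>)\<^sup>2 = \<mu> * (Q (n x) (n x) - Cm) / \<Xi>\<^sup>2"
    "(- B (f x) (n x) / sqrt (\<mu> * (Q (n x) (n x) - Cm)))\<^sup>2 = Cp / Q (n x) (n x) - 1"
proof -
  define q where "q = Q (n x) (n x)"
  have q: "q > 0" using Mst_facts(1) by (simp add: q_def)
  then have w: "\<mu> * (q - Cm) > 0" using \<mu> Cm by simp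
  show 1: "\<bar>\<psi>\<bar> < pi / 2" unfolding \<psi>_def using arctan_bounded[of "- B (f x) (n x) / sqrt (\<mu> * (Q (n x) (n x) - Cm))"] by auto
  have t2: "(- B (f x) (n x) / sqrt (\<mu> * (q - Cm)))\<^sup>2 = Cp / q - 1"
  proof -
    define s where "s = \<mu> * (q - Cm)"
    have "(B (f x) (n x))\<^sup>2 = s * (Cp / q - 1)"
      using Mst_facts(4) q by (simp add: q_def[symmetric] s_def field_simps)
    moreover have "(- B (f x) (n x) / sqrt s)\<^sup>2 = (B (f x) (n x))\<^sup>2 / s" "s > 0"
      using w by (simp_all add: power_divide s_def)
    ultimately show ?thesis by (simp add: s_def[symmetric])
  qed
  then show "(- B (f x) (n x) / sqrt (\<mu> * (Q (n x) (n x) - Cm)))\<^sup>2 = Cp / Q (n x) (n x) - 1" by (simp add: q_def)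
  have cs: "cos \<psi> = sqrt q / sqrt Cp"
    unfolding \<psi>_def cos_minus cos_arctan q_def[symmetric] t2 using q Cp by (simp add: real_sqrt_divide)
  then show "sqrt Cp * cos \<psi> = sqrt (Q (n x) (n x))" using Cp by (simp add: q_def)
  show F: "ellip_F pp \<psi> = \<Xi> * that x" using \<Xi>(1) by (simp add: that_def \<psi>_def)
  show "\<Xi> * that x \<in> quarter pp" "am (\<Xi> * that x) = \<psi>" using F_quarter[OF 1] am_F[OF 1] F by auto
  have sin2: "(sin \<psi>)\<^sup>2 = 1 - q / Cp"
    using sin_cos_squared_add[of \<psi>] q Cp unfolding cs by (simp add: power_divide)
  show "1 - pp\<^sup>2 * (sin \<psi>)\<^sup>2 = \<mu> * (Q (n x) (n x) - Cm) / \<Xi>\<^sup>2"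
    unfolding q_def[symmetric] pp \<Xi>(2) sin2 using \<mu> Cp Cm by (simp add: field_simps)
qed

text \<open>The formula for the radius is thus built into \<open>that\<close>. The unit speed of
  this function along meridians is the content of \<open>meridian_at\<close>.\<close>

lemma profile_r_that: "profile_r \<Xi> Cp Cm (that x) = sqrt (Q (n x) (n x))"
  using amplitude by (simp add: profile_r_def jacobi_cn_def pp_def[symmetric])

lemma \<phi>_Mst: "\<phi> s x \<in> Mst"
  using x \<phi>_M f_\<phi> R_X[of s "f x"] R_minus(1)[of s "X (f x)"] linear_0[OF linear_R] unfolding Mst_def by auto

lemma that_\<phi>: "that (\<phi> s x) = that x"
  using Mst_M[OF x] by (simp add: that_def f_\<phi> n_\<phi> Q_R B_R)

end

text \<open>The differential of \<open>that\<close> in a chart with all square roots cancelled: a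
  rational expression in the first-order data, hence visibly continuous and easy to evaluate on a
  frame.\<close>

definition Dthat :: "(real \<times> real \<Rightarrow> 'a) \<Rightarrow> real \<times> real \<Rightarrow> real \<times> real \<Rightarrow> real" where
  "Dthat h w v = (let q = Q (n (h w)) (n (h w)); \<tau> = - B (f (h w)) (n (h w)); s = \<mu> * (q - Cm) in
     q / (s * Cp) * (B (f (h w)) (DN h w v) + B (DF h w v) (n (h w)))
     + \<mu> * \<tau> * q / (2 * s\<^sup>2 * Cp) * (2 * Q (n (h w)) (DN h w v)))"

lemma that_has_derivative:
  assumes ch: "chart W h" "w \<in> W" and hw: "h w \<in> Mst"
  shows "((\<lambda>w. that (h w)) has_derivative Dthat h w) (at w)"
proof -
  note D = DF[OF ch] DN[OF ch]
  define F N where "F = f (h w)" and "N = n (h w)"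
  define q where "q = Q N N"
  define \<tau> where "\<tau> = - B F N"
  define s where "s = \<mu> * (q - Cm)"
  have q: "q > 0" using Mst_facts(1)[OF hw] by (simp add: q_def N_def)
  have s: "s > 0" unfolding s_def using \<mu> q Cm by simp
  note amp = amplitude[OF hw, folded F_def N_def, folded q_def, folded s_def, folded \<tau>_def]
  have d\<tau>: "((\<lambda>w. - B (f (h w)) (n (h w))) has_derivative (\<lambda>v. - (B F (DN h w v) + B (DF h w v) N))) (at w)"
    using has_derivative_minus[OF B.FDERIV[OF D]] by (simp add: F_def N_def)
  have dq: "((\<lambda>w. Q (n (h w)) (n (h w))) has_derivative (\<lambda>v. 2 * Q N (DN h w v))) (at w)"
    using Q.FDERIV[OF D(2) D(2)] by (simp add: N_def Q_commute)
  have "((\<lambda>w. \<mu> * (Q (n (h w)) (n (h w)) - Cm)) has_derivative (\<lambda>v. \<mu> * (2 * Q N (DN h w v)))) (at w)"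
    using has_derivative_mult_right[OF has_derivative_diff[OF dq has_derivative_const[of Cm]], of \<mu>] by simp
  from DERIV_compose_FDERIV[OF _ this, of sqrt "inverse (sqrt s) / 2"] DERIV_real_sqrt[OF s]
  have ds: "((\<lambda>w. sqrt (\<mu> * (Q (n (h w)) (n (h w)) - Cm))) has_derivative (\<lambda>v. \<mu> * (2 * Q N (DN h w v)) * (inverse (sqrt s) / 2))) (at w)"
    by (simp add: s_def q_def N_def)
  have s': "sqrt (\<mu> * (Q (n (h w)) (n (h w)) - Cm)) = sqrt s" by (simp add: s_def q_def N_def)
  have \<tau>': "- B (f (h w)) (n (h w)) = \<tau>" by (simp add: \<tau>_def F_def N_def)
  have "((\<lambda>w. - B (f (h w)) (n (h w)) / sqrt (\<mu> * (Q (n (h w)) (n (h w)) - Cm))) has_derivative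
      (\<lambda>v. (- (B F (DN h w v) + B (DF h w v) N) * sqrt s - \<tau> * (\<mu> * (2 * Q N (DN h w v)) * (inverse (sqrt s) / 2))) / (sqrt s * sqrt s))) (at w)"
    using has_derivative_divide'[OF d\<tau> ds] s unfolding s' \<tau>' by simp
  from has_derivative_minus[OF DERIV_compose_FDERIV[OF DERIV_arctan this]]
  have d1: "((\<lambda>w. - arctan (- B (f (h w)) (n (h w)) / sqrt (\<mu> * (Q (n (h w)) (n (h w)) - Cm)))) has_derivative
      (\<lambda>v. - ((- (B F (DN h w v) + B (DF h w v) N) * sqrt s - \<tau> * (\<mu> * (2 * Q N (DN h w v)) * (inverse (sqrt s) / 2))) / (sqrt s * sqrt s)
         * inverse (1 + (\<tau> / sqrt s)\<^sup>2)))) (at w)"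
    unfolding s' \<tau>' .
  define \<psi> where "\<psi> = - arctan (\<tau> / sqrt s)"
  have Fd: "(ellip_F pp has_real_derivative \<Xi> / sqrt s) (at \<psi>)"
    using ellip_F_deriv[OF amp(1)] amp(6) \<Xi>(1) s unfolding \<psi>_def by (simp add: real_sqrt_divide)
  have "((\<lambda>w. that (h w)) has_derivative (\<lambda>v. - ((- (B F (DN h w v) + B (DF h w v) N) * sqrt s - \<tau> * (\<mu> * (2 * Q N (DN h w v)) * (inverse (sqrt s) / 2))) / (sqrt s * sqrt s)
         * inverse (1 + (\<tau> / sqrt s)\<^sup>2)) * (\<Xi> / sqrt s) * inverse \<Xi>)) (at w)"
    unfolding that_def divide_inverse[of _ \<Xi>]
    by (intro has_derivative_mult_left DERIV_compose_FDERIV[OF _ d1]) (use Fd in \<open>simp add: s' \<tau>' \<psi>_def\<close>)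
  moreover have "- ((- (B F (DN h w v) + B (DF h w v) N) * sqrt s - \<tau> * (\<mu> * (2 * Q N (DN h w v)) * (inverse (sqrt s) / 2))) / (sqrt s * sqrt s)
         * inverse (1 + (\<tau> / sqrt s)\<^sup>2)) * (\<Xi> / sqrt s) * inverse \<Xi> = Dthat h w v" for v
  proof -
    define A Z where "A = B F (DN h w v) + B (DF h w v) N" and "Z = Q N (DN h w v)"
    define k where "k = sqrt s"
    have k: "k > 0" "s = k\<^sup>2" using s by (simp_all add: k_def)
    \<comment> \<open>The factor from the arctangent. With it and the factor
      \<open>\<Xi> / k\<close> from \<open>ellip_F\<close>, the roots combine to powers of
      \<open>s\<close>.\<close>
    have "1 + (\<tau> / k)\<^sup>2 = Cp / q" using amp(7) by (simp add: k_def)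
    then have inv: "inverse (1 + (\<tau> / k)\<^sup>2) = q / Cp" by simp
    have "- ((- A * k - \<tau> * (\<mu> * (2 * Z) * (inverse k / 2))) / (k * k) * inverse (1 + (\<tau> / k)\<^sup>2)) * (\<Xi> / k) * inverse \<Xi>
       = q / (k\<^sup>2 * Cp) * A + \<mu> * \<tau> * q / (2 * (k\<^sup>2)\<^sup>2 * Cp) * (2 * Z)"
      unfolding inv using k q Cp \<Xi>(1) by (simp add: field_simps power2_eq_square)
    then show ?thesis
      unfolding Dthat_def Let_def F_def[symmetric] N_def[symmetric] q_def[symmetric] \<tau>_def[symmetric] s_def[symmetric]
        A_def[symmetric] Z_def[symmetric] k_def[symmetric] unfolding k(2) by simp
  qed
  ultimately show ?thesis by (simp add: fun_eq_iff[symmetric])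
qed

text \<open>\<open>that\<close> is constant along orbits because \<open>Q\<close> and
  \<open>B\<close> are invariant. Along the meridian its derivative reduces to one by the first
  integral and by \<open>C\<^sup>2 = - \<mu> * Cp * Cm\<close>, the product of the roots.\<close>

lemma meridian_at:
  assumes ch: "chart W h" "w \<in> W" and hw: "h w \<in> Mst"
  obtains v1 v2 Y where "DF h w v1 = X (f (h w))" "DN h w v1 = X (n (h w))" "DN h w v2 = Y"
    "DF h w v2 = - (2 / Hb + Q (f (h w)) (n (h w)) / Q (n (h w)) (n (h w))) *\<^sub>R Y"
    "\<forall>v. \<exists>\<alpha> \<beta>. v = \<alpha> *\<^sub>R v1 + \<beta> *\<^sub>R v2" "merid (f (h w)) (n (h w)) Y"
    "Dthat h w v1 = 0" "Dthat h w v2 = 1" "mink Y (X (f (h w))) = 0"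
proof -
  define F N where "F = f (h w)" and "N = n (h w)"
  obtain v1 v2 Y where v: "DF h w v1 = X F" "DN h w v1 = X N" "DN h w v2 = Y"
    "DF h w v2 = - (2 / Hb + Q F N / Q N N) *\<^sub>R Y" "\<forall>v. \<exists>\<alpha> \<beta>. v = \<alpha> *\<^sub>R v1 + \<beta> *\<^sub>R v2" "merid F N Y"
    using frame_at(4)[OF hw ch] unfolding F_def N_def merid_rel_def by blast
  define q where "q = Q N N"
  define \<tau> where "\<tau> = - B F N"
  define s where "s = \<mu> * (q - Cm)"
  note mf = Mst_facts[OF hw, folded F_def N_def, folded q_def]
  have s: "s > 0" unfolding s_def using \<mu> mf(1) Cm by simp
  note Y = v(6)[unfolded merid_rel_def, folded q_def]
  have "Dthat h w v1 = 0"
    unfolding Dthat_def Let_def F_def[symmetric] N_def[symmetric] v(1,2) by (simp add: B_X Q_X')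
  moreover have "Dthat h w v2 = 1"
  proof -
    have A: "B F (DN h w v2) + B (DF h w v2) N = q + (2 / Hb + Q F N / q) * Q F N"
    proof -
      have "B F Y = q" "B Y N = - Q F N" using Y B_commute[of Y N] by simp_all
      then show ?thesis unfolding v(3,4) B.scaleR_left q_def[symmetric]
        by (simp only: real_scaleR_def mult_minus_left mult_minus_right minus_minus)
    qed
    have Z: "Q N (DN h w v2) = \<tau> * q" unfolding v(3) using Y by (simp add: \<tau>_def)
    have C2: "C\<^sup>2 = \<mu> * (Cp - 0) * (0 - Cm)" using factor[of 0] by (simp add: p_poly_def \<mu>_def)
    have "q * (q + (2 / Hb + Q F N / q) * Q F N) = q\<^sup>2 + (2 * q / Hb + Q F N) * Q F N"
      using mf(1) by (simp add: field_simps power2_eq_square)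
    \<comment> \<open>With \<open>Q F N = C - q / Hb\<close> the product is
      \<open>(C + q / Hb) * (C - q / Hb)\<close>.\<close>
    also have "\<dots> = C\<^sup>2 + \<mu> * q\<^sup>2" unfolding mf(3) \<mu>_def using Hb_nz by (simp add: field_simps power2_eq_square)
    also have "\<dots> = \<mu> * (q\<^sup>2 - Cp * Cm)" unfolding C2 by (simp add: algebra_simps)
    finally have qA: "q * (q + (2 / Hb + Q F N / q) * Q F N) = \<mu> * (q\<^sup>2 - Cp * Cm)" .
    have \<tau>2: "\<tau>\<^sup>2 * q = s * (Cp - q)" using mf(4) by (simp add: \<tau>_def s_def algebra_simps)
    have "Dthat h w v2 = q / (s * Cp) * (q + (2 / Hb + Q F N / q) * Q F N) + \<mu> * \<tau> * q / (2 * s\<^sup>2 * Cp) * (2 * (\<tau> * q))"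
      unfolding Dthat_def Let_def F_def[symmetric] N_def[symmetric] A Z q_def[symmetric] \<tau>_def[symmetric] s_def[symmetric] ..
    also have "\<dots> = (q * (q + (2 / Hb + Q F N / q) * Q F N)) / (s * Cp) + \<mu> * q * (\<tau>\<^sup>2 * q) / (s\<^sup>2 * Cp)"
    proof -
      have "q / (s * Cp) * W + \<mu> * \<tau> * q / (2 * s\<^sup>2 * Cp) * (2 * (\<tau> * q)) = (q * W) / (s * Cp) + \<mu> * q * (\<tau>\<^sup>2 * q) / (s\<^sup>2 * Cp)" for W
        by (simp add: power2_eq_square algebra_simps)
      then show ?thesis .
    qed
    also have "\<dots> = \<mu> * (q\<^sup>2 - Cp * Cm) / (s * Cp) + \<mu> * q * (Cp - q) / (s * Cp)"
      unfolding qA \<tau>2 using s by (simp add: power2_eq_square)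
    also have "\<dots> = \<mu> * (q - Cm) * Cp / (s * Cp)" by (simp add: add_divide_distrib[symmetric] algebra_simps power2_eq_square)
    also have "\<dots> = 1" unfolding s_def[symmetric] using s Cp by simp
    finally show ?thesis .
  qed
  moreover have "mink Y (X F) = 0"
  proof -
    have "q *\<^sub>R X F = Q F N *\<^sub>R X N" using QN_parallel[OF Mst_M[OF hw]] by (simp add: F_def N_def q_def)
    then have "q * mink Y (X F) = Q F N * mink Y (X N)" by (metis mink.scaleR_right real_scaleR_def)
    then show ?thesis using Y mf(1) by simp
  qed
  ultimately show ?thesis using that v unfolding F_def N_def by blast
qed

end

section \<open>The rotation angle and flow boxes\<close>

lemma angle_primitive:
  fixes \<epsilon> :: real
  assumes "\<epsilon> = 1 \<or> \<epsilon> = 0 \<or> \<epsilon> = -1"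
  obtains A where "A 0 = 0" "\<And>z. \<bar>z\<bar> < 1 \<Longrightarrow> (A has_real_derivative 1 / (1 + \<epsilon> * z\<^sup>2)) (at z)"
  using assms
proof (elim disjE)
  assume "\<epsilon> = 1"
  then show thesis using that[of arctan] DERIV_arctan by (auto simp: inverse_eq_divide)
next
  assume "\<epsilon> = 0"
  then show thesis using that[of "\<lambda>x. x"] DERIV_ident by auto
next
  assume "\<epsilon> = -1"
  then show thesis using that[of artanh] artanh_real_has_field_derivative by auto
qed

context plane_frame begin

text \<open>\<open>\<theta>\<close> is the rotation angle of the component in the plane, measured
  from the direction where the product with \<open>m\<close> vanishes. The set \<open>S\<close>
  keeps the slope below one in absolute value, which is the domain of \<open>artanh\<close> and
  makes \<open>Q y y\<close> positive in all three cases. The derivative shows that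
  \<open>\<theta>\<close> grows at unit rate along the flow and is stationary orthogonally to the
  orbits.\<close>

lemma angle_function:
  assumes eps: "\<epsilon> = 1 \<or> \<epsilon> = 0 \<or> \<epsilon> = -1" and m: "m = X y0" "mink m m = 1"
    and F0: "mink F0 m = 0" "mink F0 (X m) \<noteq> 0"
  obtains \<theta> S where "open S" "F0 \<in> S" "\<theta> F0 = 0"
    "\<And>y. y \<in> S \<Longrightarrow> Q y y > 0 \<and> (\<theta> has_derivative (\<lambda>u. mink u (X y) / Q y y)) (at y)"
proof -
  obtain A where A: "A 0 = 0" "\<And>z. \<bar>z\<bar> < 1 \<Longrightarrow> (A has_real_derivative 1 / (1 + \<epsilon> * z\<^sup>2)) (at z)"
    using angle_primitive[OF eps] by metis
  define S where "S = {y. \<bar>mink y m\<bar> < \<bar>mink y (X m)\<bar>}"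
  have "open S" unfolding S_def by (intro open_Collect_less continuous_intros mink.continuous_on)
  moreover have "F0 \<in> S" using F0 by (simp add: S_def)
  moreover define \<theta> where "\<theta> y = - A (mink y m / mink y (X m))" for y
  have "\<theta> F0 = 0" using F0 A by (simp add: \<theta>_def)
  moreover have "Q y y > 0 \<and> (\<theta> has_derivative (\<lambda>u. mink u (X y) / Q y y)) (at y)" if "y \<in> S" for y
  proof -
    define p q where "p = mink y m" and "q = mink y (X m)"
    have pq: "\<bar>p\<bar> < \<bar>q\<bar>" using that by (simp add: S_def p_def q_def)
    then have q: "q \<noteq> 0" and z: "\<bar>p / q\<bar> < 1" by (auto simp: abs_divide)
    have Xy: "X y = p *\<^sub>R X m - q *\<^sub>R m" unfolding p_def q_def by (rule X_change_frame[OF m])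
    have "mink (X m) (X m) = \<epsilon>"
      using XXX[of y0] m(2) unfolding X_skew[of m] m(1)[symmetric] by (simp add: mink_simps)
    then have Qyy: "Q y y = \<epsilon> * p\<^sup>2 + q\<^sup>2"
      unfolding Q_def Xy using m(2) X_skew'[of m] mink_commute[of "X m" m] by (simp add: mink_simps power2_eq_square algebra_simps)
    have "p\<^sup>2 < q\<^sup>2" using pq power_strict_mono[of "\<bar>p\<bar>" "\<bar>q\<bar>" 2] by simp
    then have pos: "Q y y > 0" unfolding Qyy using eps q by (auto simp: add_nonneg_pos)
    have "((\<lambda>y. mink y m / mink y (X m)) has_derivative (\<lambda>u. (mink u m * q - p * mink u (X m)) / (q * q))) (at y)"
      using has_derivative_divide'[OF mink.FDERIV[OF has_derivative_ident has_derivative_const] mink.FDERIV[OF has_derivative_ident has_derivative_const], of y "X m" m] q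
      by (simp add: p_def q_def mink_simps)
    from has_derivative_minus[OF DERIV_compose_FDERIV[OF _ this, of A "1 / (1 + \<epsilon> * (p/q)\<^sup>2)"]] A(2)[OF z]
    have "(\<theta> has_derivative (\<lambda>u. - ((mink u m * q - p * mink u (X m)) / (q * q) * (1 / (1 + \<epsilon> * (p/q)\<^sup>2))))) (at y)"
      unfolding \<theta>_def[abs_def] by (simp add: p_def q_def)
    moreover have "- ((mink u m * q - p * mink u (X m)) / (q * q) * (1 / (1 + \<epsilon> * (p/q)\<^sup>2))) = mink u (X y) / Q y y" for u
    proof -
      have "1 + \<epsilon> * (p/q)\<^sup>2 = Q y y / q\<^sup>2" unfolding Qyy using q by (simp add: field_simps)
      then have w: "- (W / (q * q) * (1 / (1 + \<epsilon> * (p/q)\<^sup>2))) = - W / Q y y" for W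
        using q pos by (simp add: field_simps power2_eq_square)
      have "mink u (X y) = - (mink u m * q - p * mink u (X m))" unfolding Xy by (simp add: mink_simps)
      then show ?thesis unfolding w by simp
    qed
    ultimately show ?thesis using pos by simp
  qed
  ultimately show ?thesis using that by blast
qed

end

context rot_surface_const begin

abbreviation "rect e t0 \<equiv> {-e<..<e} \<times> {t0-e<..<t0+e::real}"

text \<open>Angle and \<open>that\<close> together are coordinates near \<open>x0\<close>, since
  their differential sends the orbit and meridian vectors of \<open>meridian_at\<close> to the
  standard basis. In these coordinates the rotations translate the first coordinate, and the curve
  with first coordinate zero is orthogonal to the orbits.\<close>

lemma local_box:
  assumes x0: "x0 \<in> Mst"
  defines "t0 \<equiv> that x0"
  shows "\<exists>e>0. \<exists>\<kappa> \<theta>. chart (rect e t0) \<kappa> \<and> \<kappa> (0, t0) = x0 \<and> \<kappa> ` rect e t0 \<subseteq> Mst \<and>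
    (\<forall>s t. (s, t) \<in> rect e t0 \<longrightarrow> that (\<kappa> (s, t)) = t \<and> \<kappa> (s, t) = \<phi> s (\<kappa> (0, t)) \<and> \<theta> (f (\<kappa> (s, t))) = s \<and>
       (\<theta> has_derivative (\<lambda>u. mink u (X (f (\<kappa> (s, t)))) / Q (f (\<kappa> (s, t))) (f (\<kappa> (s, t))))) (at (f (\<kappa> (s, t))))) \<and>
    (\<forall>t\<in>{t0-e<..<t0+e}. \<exists>Y. merid (f (\<kappa> (0, t))) (n (\<kappa> (0, t))) Y \<and> mink Y (X (f (\<kappa> (0, t)))) = 0 \<and>
       ((\<lambda>t. n (\<kappa> (0, t))) has_vector_derivative Y) (at t) \<and>
       (\<exists>k. ((\<lambda>t. f (\<kappa> (0, t))) has_vector_derivative k *\<^sub>R Y) (at t)))"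
proof -
  define m where "m = (1 / sqrt (Q (n x0) (n x0))) *\<^sub>R X (n x0)"
  note mf = Mst_facts[OF x0]
  have m: "m = X ((1 / sqrt (Q (n x0) (n x0))) *\<^sub>R n x0)" "mink m m = 1"
    using mf(1) by (simp_all add: m_def X_simps mink_simps Q_def[symmetric])
  have F0: "mink (f x0) m = 0" "mink (f x0) (X m) \<noteq> 0"
    using f_perp_Xn(1)[OF Mst_M[OF x0]] X_skew[of "f x0" m] mf by (auto simp: m_def mink_simps Q_def)
  obtain \<theta> S where S: "open S" "f x0 \<in> S" "\<theta> (f x0) = 0"
    "\<And>y. y \<in> S \<Longrightarrow> Q y y > 0 \<and> (\<theta> has_derivative (\<lambda>u. mink u (X y) / Q y y)) (at y)"
    using angle_function[OF eps m F0] by metis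
  have "openin (top_of_set M) (M \<inter> f -` S)" by (rule continuous_openin_preimage_gen[OF cont_f S(1)])
  then have "openin (top_of_set M) (Mst \<inter> (M \<inter> f -` S))" using openin_Mst by (rule openin_Int[rotated])
  moreover have "x0 \<in> Mst \<inter> (M \<inter> f -` S)" using x0 S Mst_M by auto
  ultimately obtain W h w where ch: "chart W h" "w \<in> W" "h w = x0" "h ` W \<subseteq> Mst \<inter> (M \<inter> f -` S)"
    using chart_shrink by metis
  have hW: "h z \<in> Mst" "f (h z) \<in> S" if "z \<in> W" for z using ch(4) that by auto
  define G where "G z = (\<theta> (f (h z)), that (h z))" for z
  define G' where "G' z v = (mink (DF h z v) (X (f (h z))) / Q (f (h z)) (f (h z)), Dthat h z v)" for z v
  have Gd: "(G has_derivative G' z) (at z)" if z: "z \<in> W" for z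
  proof -
    have "((\<lambda>z. \<theta> ((f \<circ> h) z)) has_derivative (\<lambda>v. mink (DF h z v) (X (f (h z))) / Q (f (h z)) (f (h z)))) (at z)"
      using diff_chain_at[OF DF[OF ch(1) z], of \<theta> "\<lambda>u. mink u (X (f (h z))) / Q (f (h z)) (f (h z))"] S(4)[OF hW(2)[OF z]]
      by (simp add: o_def)
    from has_derivative_Pair[OF this that_has_derivative[OF ch(1) z hW(1)[OF z]]]
    show ?thesis by (simp add: G_def[abs_def] G'_def[abs_def])
  qed
  have cF: "continuous_on W (\<lambda>z. f (h z))" "continuous_on W (\<lambda>z. n (h z))"
    using C1_on_continuous[OF local_param_D(3)[OF ch(1)]] C1_on_continuous[OF local_param_D(4)[OF ch(1)]] by (simp_all add: o_def)
  have cD: "continuous_on W (\<lambda>z. DF h z v)" "continuous_on W (\<lambda>z. DN h z v)" for v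
    unfolding DF_def DN_def using C1_on_continuous_frechet local_param_D(3,4)[OF ch(1)] by blast+
  have Gc: "continuous_on W (\<lambda>z. G' z v)" for v
  proof -
    have nz: "\<mu> * (Q (n (h z)) (n (h z)) - Cm) \<noteq> 0" "Q (f (h z)) (f (h z)) \<noteq> 0" if "z \<in> W" for z
      using Mst_facts(1)[OF hW(1)[OF that]] \<mu> Cm S(4)[OF hW(2)[OF that]] by auto
    have q: "continuous_on W (\<lambda>z. Q (n (h z)) (n (h z)))" by (intro Q.continuous_on cF)
    have XF: "continuous_on W (\<lambda>z. X (f (h z)))" by (rule bounded_linear.continuous_on[OF bounded_linear_X cF(1)])
    show ?thesis unfolding G'_def Dthat_def Let_def
      by (intro continuous_on_Pair continuous_on_divide continuous_on_add continuous_on_mult continuous_on_diff continuous_on_minus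
          continuous_on_power continuous_on_const mink.continuous_on Q.continuous_on B.continuous_on cF cD XF q)
        (use nz Cp in auto)
  qed
  have basis: "\<exists>v1 v2 Y. (\<forall>\<alpha> \<beta>. G' z (\<alpha> *\<^sub>R v1 + \<beta> *\<^sub>R v2) = (\<alpha>, \<beta>)) \<and> (\<forall>v. \<exists>\<alpha> \<beta>. v = \<alpha> *\<^sub>R v1 + \<beta> *\<^sub>R v2) \<and>
     DN h z v2 = Y \<and> (\<exists>k. DF h z v2 = k *\<^sub>R Y) \<and> merid (f (h z)) (n (h z)) Y \<and> mink Y (X (f (h z))) = 0" if z: "z \<in> W" for z
  proof -
    obtain v1 v2 Y where v: "DF h z v1 = X (f (h z))" "DN h z v1 = X (n (h z))" "DN h z v2 = Y"
      "DF h z v2 = - (2 / Hb + Q (f (h z)) (n (h z)) / Q (n (h z)) (n (h z))) *\<^sub>R Y"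
      "\<forall>v. \<exists>\<alpha> \<beta>. v = \<alpha> *\<^sub>R v1 + \<beta> *\<^sub>R v2" "merid (f (h z)) (n (h z)) Y"
      "Dthat h z v1 = 0" "Dthat h z v2 = 1" "mink Y (X (f (h z))) = 0"
      by (rule meridian_at[OF ch(1) z hW(1)[OF z]]) (rule that; assumption)
    have lin: "linear (G' z)" using Gd[OF z] has_derivative_linear by blast
    have "Q (f (h z)) (f (h z)) \<noteq> 0" using S(4)[OF hW(2)[OF z]] by auto
    then have "G' z v1 = (1, 0)" "G' z v2 = (0, 1)"
      using v(9) by (simp_all add: G'_def v(1,4,7,8) Q_def mink_simps)
    then have "G' z (\<alpha> *\<^sub>R v1 + \<beta> *\<^sub>R v2) = (\<alpha>, \<beta>)" for \<alpha> \<beta>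
      by (simp add: linear_add[OF lin] linear_scale[OF lin])
    then show ?thesis using v by blast
  qed
  have inj: "inj (G' w)"
  proof (rule injI)
    fix u v assume "G' w u = G' w v"
    then show "u = v" using basis[OF ch(2)] by (metis prod.inject)
  qed
  obtain U' V g g' where UV: "open U'" "U' \<subseteq> W" "w \<in> U'" "open V" "homeomorphism U' V G g"
    "\<And>y. y \<in> V \<Longrightarrow> (g has_derivative blinfun_apply (g' y)) (at y)" "continuous_on V g'"
    "\<And>y v. y \<in> V \<Longrightarrow> G' (g y) (blinfun_apply (g' y) v) = v"
    using C1_inverse_2d[OF local_param_D(1)[OF ch(1)] Gd Gc ch(2) inj] by metis
  have gV: "g y \<in> W" "G (g y) = y" if "y \<in> V" for y using UV(2,5) that unfolding homeomorphism_def by auto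
  have gG: "g (G w) = w" "G w \<in> V" using UV(3,5) unfolding homeomorphism_def by auto
  have Gw: "G w = (0, t0)" using S(3) by (simp add: G_def ch(3) t0_def)
  have chg: "chart V (h \<circ> g)"
  proof (rule local_param_reparam[OF ch(1) UV(1,2,4-7)])
    show "inj (blinfun_apply (g' y))" if "y \<in> V" for y using UV(8)[OF that] by (metis injI)
  qed
  define \<kappa> where "\<kappa> = h \<circ> g"
  have \<kappa>: "\<kappa> y \<in> Mst" "f (\<kappa> y) \<in> S" "\<theta> (f (\<kappa> y)) = fst y" "that (\<kappa> y) = snd y" if "y \<in> V" for y
    using gV[OF that] hW by (auto simp: \<kappa>_def G_def prod_eq_iff)
  have \<kappa>0: "\<kappa> (0, t0) = x0" using gG Gw ch(3) by (simp add: \<kappa>_def)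
  have boxes: "\<exists>e>0. rect e t0 \<subseteq> Z" if Z: "open Z" "(0, t0) \<in> Z" for Z
  proof -
    obtain A B where AB: "open A" "open B" "(0, t0) \<in> A \<times> B" "A \<times> B \<subseteq> Z" using open_prod_elim[OF Z] by metis
    obtain e1 where e1: "e1 > 0" "ball 0 e1 \<subseteq> A" using AB open_contains_ball by (metis mem_Sigma_iff)
    obtain e2 where e2: "e2 > 0" "ball t0 e2 \<subseteq> B" using AB open_contains_ball by (metis mem_Sigma_iff)
    have "rect (min e1 e2) t0 \<subseteq> A \<times> B"
    proof (rule subsetI)
      fix y assume "y \<in> rect (min e1 e2) t0"
      then obtain s t where y: "y = (s, t)" "s \<in> {- min e1 e2<..<min e1 e2}" "t \<in> {t0 - min e1 e2<..<t0 + min e1 e2}" by blast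
      then have "\<bar>s\<bar> < e1" "\<bar>t - t0\<bar> < e2" by auto
      then have "s \<in> ball 0 e1" "t \<in> ball t0 e2" by (simp_all add: dist_real_def abs_minus_commute)
      then show "y \<in> A \<times> B" using e1 e2 y(1) by auto
    qed
    then show ?thesis using AB(4) e1 e2 by (intro exI[of _ "min e1 e2"]) auto
  qed
  obtain e0 where e0: "e0 > 0" "rect e0 t0 \<subseteq> V" using boxes[OF UV(4)] gG(2) Gw by auto
  have cont\<kappa>: "continuous_on V \<kappa>" using chg unfolding local_param_def homeomorphism_def \<kappa>_def by blast
  \<comment> \<open>The rotations are only continuous, so the box is shrunk until turning its
    section by small angles stays in the image of the chart.\<close>
  define \<Psi> where "\<Psi> = (\<lambda>(s, t). \<phi> s (\<kappa> (0, t)))"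
  have mem0: "(0, t) \<in> V" "\<kappa> (0, t) \<in> M" if "t \<in> {t0-e0<..<t0+e0}" for t
  proof -
    have "(0, t) \<in> rect e0 t0" using that e0(1) by simp
    then show "(0, t) \<in> V" using e0(2) by blast
    then show "\<kappa> (0, t) \<in> M" using \<kappa>(1) Mst_M by blast
  qed
  have "continuous_on (UNIV \<times> {t0-e0<..<t0+e0}) (\<lambda>y. \<phi> (fst y) (\<kappa> (0, snd y)))"
  proof -
    have "continuous_on (UNIV \<times> {t0-e0<..<t0+e0}) (\<lambda>y. (fst y, \<kappa> (0, snd y)))"
      by (intro continuous_intros continuous_on_compose2[OF cont\<kappa>]) (use mem0 in auto)
    moreover have "(\<lambda>y. (fst y, \<kappa> (0, snd y))) ` (UNIV \<times> {t0-e0<..<t0+e0}) \<subseteq> UNIV \<times> M" using mem0(2) by auto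
    ultimately have "continuous_on (UNIV \<times> {t0-e0<..<t0+e0}) (\<lambda>y. (\<lambda>(s, x). \<phi> s x) (fst y, \<kappa> (0, snd y)))"
      by (rule continuous_on_compose2[OF \<phi>_cont])
    then show ?thesis by simp
  qed
  then have \<Psi>c: "continuous_on (UNIV \<times> {t0-e0<..<t0+e0}) \<Psi>" by (simp add: \<Psi>_def case_prod_unfold)
  have oR: "open (rect e t0)" for e by (intro open_Times open_greaterThanLessThan)
  have "openin (top_of_set M) (\<kappa> ` rect e0 t0)"
    using local_param_D(2)[OF local_param_subset[OF chg oR e0(2)]] unfolding \<kappa>_def .
  moreover have "\<Psi> \<in> (UNIV \<times> {t0-e0<..<t0+e0}) \<rightarrow> M" using mem0(2) \<phi>_M by (auto simp: \<Psi>_def)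
  ultimately have oi: "openin (top_of_set (UNIV \<times> {t0-e0<..<t0+e0})) ((UNIV \<times> {t0-e0<..<t0+e0}) \<inter> \<Psi> -` (\<kappa> ` rect e0 t0))"
    by (intro continuous_openin_preimage[OF \<Psi>c])
  have "open (UNIV \<times> {t0-e0<..<t0+e0} :: (real \<times> real) set)" by (intro open_Times open_UNIV open_greaterThanLessThan)
  with oi have "open ((UNIV \<times> {t0-e0<..<t0+e0}) \<inter> \<Psi> -` (\<kappa> ` rect e0 t0))"
    using openin_open_eq by metis
  moreover have "(0, t0) \<in> (UNIV \<times> {t0-e0<..<t0+e0}) \<inter> \<Psi> -` (\<kappa> ` rect e0 t0)"
    using e0(1) \<phi>_0[OF Mst_M[OF x0]] \<kappa>0 by (auto simp: \<Psi>_def intro!: image_eqI[of x0 \<kappa> "(0, t0)"])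
  ultimately obtain e1 where e1: "e1 > 0" "rect e1 t0 \<subseteq> (UNIV \<times> {t0-e0<..<t0+e0}) \<inter> \<Psi> -` (\<kappa> ` rect e0 t0)"
    using boxes by blast
  define e where "e = min e0 e1"
  have "e > 0" "e \<le> e0" "e \<le> e1" using e0 e1 by (auto simp: e_def)
  then have "rect e t0 \<subseteq> rect e0 t0" "rect e t0 \<subseteq> rect e1 t0" by auto
  then have e: "e > 0" "rect e t0 \<subseteq> V" "rect e t0 \<subseteq> rect e0 t0" "rect e t0 \<subseteq> rect e1 t0"
    using \<open>e > 0\<close> e0(2) by blast+
  \<comment> \<open>Along the rotation the angle minus \<open>s'\<close> is constant and
    \<open>that\<close> does not change. So the rotated point, which lies in the chart, has
    coordinates \<open>(s, t)\<close>.\<close>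
  have flow: "\<phi> s (\<kappa> (0, t)) = \<kappa> (s, t)" if st: "(s, t) \<in> rect e t0" for s t
  proof -
    have t: "(0, t) \<in> V" using st e(1,2) by auto
    have im: "\<exists>y\<in>V. \<phi> s' (\<kappa> (0, t)) = \<kappa> y" if "\<bar>s'\<bar> < e" for s'
    proof -
      have "(s', t) \<in> rect e t0" using that st by (auto simp: abs_less_iff)
      then have "(s', t) \<in> \<Psi> -` (\<kappa> ` rect e0 t0)" using e1(2) e(4) by blast
      then have "\<phi> s' (\<kappa> (0, t)) \<in> \<kappa> ` rect e0 t0" by (simp add: \<Psi>_def)
      then show ?thesis using e0(2) by blast
    qed
    define y0 where "y0 = f (\<kappa> (0, t))"
    have \<kappa>M: "\<kappa> (0, t) \<in> M" using \<kappa>(1)[OF t] Mst_M by blast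
    have RS: "R s' y0 \<in> S" if "\<bar>s'\<bar> < e" for s'
      using im[OF that] \<kappa>(2) f_\<phi>[OF \<kappa>M, of s'] unfolding y0_def by metis
    have "((\<lambda>s'. \<theta> (R s' y0) - s') has_vector_derivative 0) (at s' within {-e<..<e})" if "s' \<in> {-e<..<e}" for s'
    proof -
      have Sy: "R s' y0 \<in> S" using RS[of s'] that by auto
      have "((\<lambda>s'. \<theta> (R s' y0)) has_vector_derivative mink (X (R s' y0)) (X (R s' y0)) / Q (R s' y0) (R s' y0)) (at s')"
        using vector_derivative_diff_chain_within[OF R_derivative[of y0 s'], of \<theta>] S(4)[OF Sy] has_derivative_at_withinI
        by (fastforce simp: o_def)
      then have "((\<lambda>s'. \<theta> (R s' y0)) has_vector_derivative 1) (at s')" using S(4)[OF Sy] by (simp add: Q_def)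
      then have "((\<lambda>s'. \<theta> (R s' y0) - s') has_vector_derivative 1 - 1) (at s')" by (intro has_vector_derivative_diff has_vector_derivative_id)
      then show ?thesis by (simp add: has_vector_derivative_at_within)
    qed
    then obtain k where k: "\<And>s'. s' \<in> {-e<..<e} \<Longrightarrow> \<theta> (R s' y0) - s' = k"
      using has_vector_derivative_zero_constant[of "{-e<..<e}" "\<lambda>s'. \<theta> (R s' y0) - s'"] by auto
    have "k = 0" using k[of 0] e(1) \<kappa>(3)[OF t] by (simp add: R_0 y0_def)
    then have \<theta>s: "\<theta> (R s y0) = s" using k[of s] st by simp
    obtain y where y: "y \<in> V" "\<phi> s (\<kappa> (0, t)) = \<kappa> y" using im[of s] st by (auto simp: abs_less_iff)
    have "fst y = s" using \<kappa>(3)[OF y(1)] \<theta>s f_\<phi>[OF \<kappa>M, of s] y(2) by (simp add: y0_def)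
    moreover have "snd y = t" using \<kappa>(4)[OF y(1)] that_\<phi>[OF \<kappa>(1)[OF t], of s] \<kappa>(4)[OF t] y(2) by simp
    ultimately show ?thesis using y(2) by (metis prod.collapse)
  qed
  have der: "\<exists>Y. merid (f (\<kappa> (0, t))) (n (\<kappa> (0, t))) Y \<and> mink Y (X (f (\<kappa> (0, t)))) = 0 \<and>
       ((\<lambda>t. n (\<kappa> (0, t))) has_vector_derivative Y) (at t) \<and>
       (\<exists>k. ((\<lambda>t. f (\<kappa> (0, t))) has_vector_derivative k *\<^sub>R Y) (at t))" if t: "t \<in> {t0-e<..<t0+e}" for t
  proof -
    have V: "(0, t) \<in> V" using t e(1,2) by auto
    define z where "z = g (0, t)"
    have zW: "z \<in> W" using gV[OF V] by (simp add: z_def)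
    obtain v1 v2 Y k where v: "\<forall>\<alpha> \<beta>. G' z (\<alpha> *\<^sub>R v1 + \<beta> *\<^sub>R v2) = (\<alpha>, \<beta>)" "\<forall>v. \<exists>\<alpha> \<beta>. v = \<alpha> *\<^sub>R v1 + \<beta> *\<^sub>R v2"
     "DN h z v2 = Y" "DF h z v2 = k *\<^sub>R Y" "merid (f (h z)) (n (h z)) Y" "mink Y (X (f (h z))) = 0"
      using basis[OF zW] by metis
    have g2: "blinfun_apply (g' (0, t)) (0, 1) = v2"
    proof -
      obtain \<alpha> \<beta> where ab: "blinfun_apply (g' (0, t)) (0, 1) = \<alpha> *\<^sub>R v1 + \<beta> *\<^sub>R v2" using v(2) by blast
      then have "(\<alpha>, \<beta>) = (0, 1)" using UV(8)[OF V, of "(0,1)"] v(1) unfolding z_def[symmetric] by metis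
      then show ?thesis using ab by simp
    qed
    have "((\<lambda>t. (0::real, t)) has_vector_derivative (0, 1)) (at t)"
      by (auto intro!: derivative_eq_intros simp: has_vector_derivative_def)
    from vector_derivative_diff_chain_within[OF this, of g "blinfun_apply (g' (0, t))"]
    have gd: "((\<lambda>t. g (0, t)) has_vector_derivative v2) (at t)"
      using UV(6)[OF V] has_derivative_at_withinI g2 by (auto simp: o_def)
    have "((\<lambda>t. f (\<kappa> (0, t))) has_vector_derivative DF h z v2) (at t)" "((\<lambda>t. n (\<kappa> (0, t))) has_vector_derivative DN h z v2) (at t)"
      using vector_derivative_diff_chain_within[OF gd, of "f \<circ> h" "DF h z"] vector_derivative_diff_chain_within[OF gd, of "n \<circ> h" "DN h z"]
        DF[OF ch(1) zW] DN[OF ch(1) zW] has_derivative_at_withinI unfolding z_def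
      by (auto simp: o_def \<kappa>_def)
    then show ?thesis using v(3-6) unfolding z_def \<kappa>_def by auto
  qed
  have chb: "chart (rect e t0) \<kappa>" unfolding \<kappa>_def by (rule local_param_subset[OF chg oR e(2)])
  have mem: "(s, t) \<in> V" if "(s, t) \<in> rect e t0" for s t using that e(2) by blast
  show ?thesis
  proof (intro exI[of _ e] exI[of _ \<kappa>] exI[of _ \<theta>] conjI allI impI)
    show "e > 0" by (rule e(1))
    show "chart (rect e t0) \<kappa>" by (rule chb)
    show "\<kappa> (0, t0) = x0" by (rule \<kappa>0)
    show "\<kappa> ` rect e t0 \<subseteq> Mst" using \<kappa>(1) e(2) by blast
    show "that (\<kappa> (s, t)) = t" "\<kappa> (s, t) = \<phi> s (\<kappa> (0, t))" "\<theta> (f (\<kappa> (s, t))) = s"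
      "(\<theta> has_derivative (\<lambda>u. mink u (X (f (\<kappa> (s, t)))) / Q (f (\<kappa> (s, t))) (f (\<kappa> (s, t))))) (at (f (\<kappa> (s, t))))"
      if st: "(s, t) \<in> rect e t0" for s t
    proof -
      note V = mem[OF st]
      show "that (\<kappa> (s, t)) = t" "\<theta> (f (\<kappa> (s, t))) = s" using \<kappa>(3,4)[OF V] by simp_all
      show "\<kappa> (s, t) = \<phi> s (\<kappa> (0, t))" using flow[OF st] by simp
      show "(\<theta> has_derivative (\<lambda>u. mink u (X (f (\<kappa> (s, t)))) / Q (f (\<kappa> (s, t))) (f (\<kappa> (s, t))))) (at (f (\<kappa> (s, t))))"
        using S(4)[OF \<kappa>(2)[OF V]] by blast
    qed
    show "\<forall>t\<in>{t0-e<..<t0+e}. \<exists>Y. merid (f (\<kappa> (0, t))) (n (\<kappa> (0, t))) Y \<and> mink Y (X (f (\<kappa> (0, t)))) = 0 \<and>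
       ((\<lambda>t. n (\<kappa> (0, t))) has_vector_derivative Y) (at t) \<and>
       (\<exists>k. ((\<lambda>t. f (\<kappa> (0, t))) has_vector_derivative k *\<^sub>R Y) (at t))" using der by blast
  qed
qed

end

section \<open>Meridians: uniqueness, extension and covering of the surface\<close>

context rot_surface_const begin

text \<open>Meridians as horizontal sections: curves orthogonal to the orbits. Their parameter is
  prescribed by the function \<open>that\<close>, so pieces can be compared and glued without
  reparametrization.\<close>

definition hsec :: "real set \<Rightarrow> (real \<Rightarrow> 'a) \<Rightarrow> bool" where
  "hsec I \<gamma> \<longleftrightarrow> open I \<and> is_interval I \<and> continuous_on I \<gamma> \<and>
     (\<forall>t\<in>I. \<gamma> t \<in> Mst \<and> that (\<gamma> t) = t \<and>
        (\<exists>u. ((\<lambda>t. f (\<gamma> t)) has_vector_derivative u) (at t) \<and> mink u (X (f (\<gamma> t))) = 0))"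

lemma hsec_D:
  assumes "hsec I \<gamma>"
  shows "open I" "is_interval I" "continuous_on I \<gamma>" "\<And>t. t \<in> I \<Longrightarrow> \<gamma> t \<in> Mst" "\<And>t. t \<in> I \<Longrightarrow> \<gamma> t \<in> M" "\<And>t. t \<in> I \<Longrightarrow> that (\<gamma> t) = t"
  using assms Mst_M unfolding hsec_def by auto

text \<open>Orthogonality to the orbits makes the angle constant along a section, so inside a flow
  box a section is a line of constant first coordinate, here \<open>0\<close>.\<close>

lemma hsec_box:
  assumes h: "hsec I \<gamma>" and t1: "t1 \<in> I"
    and \<kappa>: "chart (rect e t1) \<kappa>" "\<kappa> (0, t1) = \<gamma> t1" "e > 0"
    and \<theta>: "\<And>s t. (s, t) \<in> rect e t1 \<Longrightarrow> that (\<kappa> (s, t)) = t \<and> \<theta> (f (\<kappa> (s, t))) = s \<and>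
       (\<theta> has_derivative (\<lambda>u. mink u (X (f (\<kappa> (s, t)))) / Q (f (\<kappa> (s, t))) (f (\<kappa> (s, t))))) (at (f (\<kappa> (s, t))))"
  shows "\<exists>d>0. d \<le> e \<and> (\<forall>t\<in>{t1-d<..<t1+d}. t \<in> I \<and> \<gamma> t = \<kappa> (0, t))"
proof -
  note hD = hsec_D[OF h]
  have "openin (top_of_set I) (I \<inter> \<gamma> -` (\<kappa> ` rect e t1))"
    by (rule continuous_openin_preimage[OF hD(3) _ local_param_D(2)[OF \<kappa>(1)]]) (use hD(5) in auto)
  then have "open (I \<inter> \<gamma> -` (\<kappa> ` rect e t1))" using hD(1) openin_open_eq by blast
  moreover have "t1 \<in> I \<inter> \<gamma> -` (\<kappa> ` rect e t1)"
    using t1 \<kappa>(2,3) by (auto intro!: image_eqI[of _ _ "(0, t1)"])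
  ultimately obtain d0 where d0: "d0 > 0" "ball t1 d0 \<subseteq> I \<inter> \<gamma> -` (\<kappa> ` rect e t1)"
    using open_contains_ball by blast
  define d where "d = min d0 e"
  have d: "d > 0" "d \<le> e" using d0 \<kappa>(3) by (auto simp: d_def)
  have ev: "t \<in> I \<and> (\<theta> (f (\<gamma> t)), t) \<in> rect e t1 \<and> \<gamma> t = \<kappa> (\<theta> (f (\<gamma> t)), t)" if t: "t \<in> {t1-d<..<t1+d}" for t
  proof -
    have "t \<in> ball t1 d0" using t by (auto simp: d_def dist_real_def)
    then have tI: "t \<in> I" "\<gamma> t \<in> \<kappa> ` rect e t1" using d0 by auto
    then obtain y where y: "y \<in> rect e t1" "\<gamma> t = \<kappa> y" by blast
    obtain s t' where st: "y = (s, t')" by fastforce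
    have "t' = t" "\<theta> (f (\<gamma> t)) = s" using \<theta>[of s t'] y st hD(6)[OF tI(1)] by auto
    then show ?thesis using y st tI by simp
  qed
  have "((\<lambda>t. \<theta> (f (\<gamma> t))) has_vector_derivative 0) (at t within {t1-d<..<t1+d})" if t: "t \<in> {t1-d<..<t1+d}" for t
  proof -
    obtain u where u: "((\<lambda>t. f (\<gamma> t)) has_vector_derivative u) (at t)" "mink u (X (f (\<gamma> t))) = 0"
      using h ev[OF t] unfolding hsec_def by blast
    have d\<theta>: "(\<theta> has_derivative (\<lambda>u. mink u (X (f (\<gamma> t))) / Q (f (\<gamma> t)) (f (\<gamma> t)))) (at (f (\<gamma> t)))"
      using ev[OF t] \<theta>[of "\<theta> (f (\<gamma> t))" t] by metis
    have "((\<lambda>t. \<theta> (f (\<gamma> t))) has_vector_derivative mink u (X (f (\<gamma> t))) / Q (f (\<gamma> t)) (f (\<gamma> t))) (at t)"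
      using vector_derivative_diff_chain_within[OF u(1) has_derivative_at_withinI[OF d\<theta>]] by (simp add: o_def)
    then show ?thesis using u(2) by (simp add: has_vector_derivative_at_within)
  qed
  then obtain k where k: "\<And>t. t \<in> {t1-d<..<t1+d} \<Longrightarrow> \<theta> (f (\<gamma> t)) = k"
    using has_vector_derivative_zero_constant[of "{t1-d<..<t1+d}" "\<lambda>t. \<theta> (f (\<gamma> t))"] by auto
  have "k = 0" using k[of t1] \<theta>[of 0 t1] \<kappa>(2,3) d by simp
  then show ?thesis using ev k d by (intro exI[of _ d]) auto
qed

lemma hsec_local_unique:
  assumes h: "hsec I \<gamma>" "hsec I' \<gamma>'" and t1: "t1 \<in> I" "t1 \<in> I'" "\<gamma> t1 = \<gamma>' t1"
  shows "\<exists>d>0. \<forall>t\<in>{t1-d<..<t1+d}. \<gamma> t = \<gamma>' t"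
proof -
  note h1 = hsec_D[OF h(1)]
  have x0: "\<gamma> t1 \<in> Mst" "that (\<gamma> t1) = t1" using h1(4)[OF t1(1)] h1(6)[OF t1(1)] by simp_all
  obtain e \<kappa> \<theta> where e: "e > 0" and \<kappa>: "chart (rect e t1) \<kappa>" "\<kappa> (0, t1) = \<gamma> t1"
    and \<theta>: "\<forall>s t. (s, t) \<in> rect e t1 \<longrightarrow> that (\<kappa> (s, t)) = t \<and> \<kappa> (s, t) = \<phi> s (\<kappa> (0, t)) \<and> \<theta> (f (\<kappa> (s, t))) = s \<and>
       (\<theta> has_derivative (\<lambda>u. mink u (X (f (\<kappa> (s, t)))) / Q (f (\<kappa> (s, t))) (f (\<kappa> (s, t))))) (at (f (\<kappa> (s, t))))"
    using local_box[OF x0(1)] unfolding x0(2) by blast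
  have \<kappa>': "\<kappa> (0, t1) = \<gamma>' t1" using \<kappa> t1 by simp
  obtain d where d: "d > 0" "\<forall>t\<in>{t1-d<..<t1+d}. t \<in> I \<and> \<gamma> t = \<kappa> (0, t)"
    using hsec_box[OF h(1) t1(1) \<kappa> e, of \<theta>] \<theta> by blast
  obtain d' where d': "d' > 0" "\<forall>t\<in>{t1-d'<..<t1+d'}. t \<in> I' \<and> \<gamma>' t = \<kappa> (0, t)"
    using hsec_box[OF h(2) t1(2) \<kappa>(1) \<kappa>' e, of \<theta>] \<theta> by blast
  have "\<gamma> t = \<gamma>' t" if "t \<in> {t1 - min d d'<..<t1 + min d d'}" for t
  proof -
    have "t \<in> {t1-d<..<t1+d}" "t \<in> {t1-d'<..<t1+d'}" using that by (auto simp: min_def split: if_splits)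
    then show ?thesis using d(2) d'(2) by simp
  qed
  then show ?thesis using d(1) d'(1) by (intro exI[of _ "min d d'"]) simp
qed

text \<open>On the connected overlap the set of agreement is open by local uniqueness, and its
  complement is open because the surface is a Hausdorff space.\<close>

lemma hsec_unique:
  assumes h: "hsec I \<gamma>" "hsec I' \<gamma>'" and t1: "t1 \<in> I \<inter> I'" "\<gamma> t1 = \<gamma>' t1" and t: "t \<in> I \<inter> I'"
  shows "\<gamma> t = \<gamma>' t"
proof -
  note hD = hsec_D[OF h(1)] hsec_D[OF h(2)]
  have con: "connected (I \<inter> I')" using hD is_interval_Int is_interval_connected by blast
  have op: "open (I \<inter> I')" using hD by blast
  show ?thesis
  proof (rule connected_induction_simple[OF con t1(1) t, of "\<lambda>t. \<gamma> t = \<gamma>' t", OF t1(2)])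
    fix r assume r: "r \<in> I \<inter> I'"
    show "\<exists>T. openin (top_of_set (I \<inter> I')) T \<and> r \<in> T \<and> (\<forall>x\<in>T. \<forall>y\<in>T. \<gamma> x = \<gamma>' x \<longrightarrow> \<gamma> y = \<gamma>' y)"
    proof (cases "\<gamma> r = \<gamma>' r")
      case True
      obtain d where d: "d > 0" "\<forall>t\<in>{r-d<..<r+d}. \<gamma> t = \<gamma>' t"
        using hsec_local_unique[OF h _ _ True] r by blast
      show ?thesis
      proof (intro exI[of _ "(I \<inter> I') \<inter> {r-d<..<r+d}"] conjI)
        show "openin (top_of_set (I \<inter> I')) ((I \<inter> I') \<inter> {r-d<..<r+d})" by (simp add: openin_open_Int)
      qed (use d r in auto)
    next
      case False
      then obtain U V where UV: "open U" "open V" "\<gamma> r \<in> U" "\<gamma>' r \<in> V" "U \<inter> V = {}" using hausdorff[OF False] by metis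
      have c: "continuous_on (I \<inter> I') \<gamma>" "continuous_on (I \<inter> I') \<gamma>'"
        by (rule continuous_on_subset[OF hsec_D(3)[OF h(1)]], blast) (rule continuous_on_subset[OF hsec_D(3)[OF h(2)]], blast)
      show ?thesis
      proof (intro exI[of _ "((I \<inter> I') \<inter> \<gamma> -` U) \<inter> ((I \<inter> I') \<inter> \<gamma>' -` V)"] conjI)
        show "openin (top_of_set (I \<inter> I')) (((I \<inter> I') \<inter> \<gamma> -` U) \<inter> ((I \<inter> I') \<inter> \<gamma>' -` V))"
          by (intro openin_Int continuous_openin_preimage_gen c UV)
        show "r \<in> ((I \<inter> I') \<inter> \<gamma> -` U) \<inter> ((I \<inter> I') \<inter> \<gamma>' -` V)" using r UV by auto
        have "\<gamma> x \<noteq> \<gamma>' x" if "x \<in> ((I \<inter> I') \<inter> \<gamma> -` U) \<inter> ((I \<inter> I') \<inter> \<gamma>' -` V)" for x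
          using that UV(5) by auto
        then show "\<forall>x\<in>((I \<inter> I') \<inter> \<gamma> -` U) \<inter> ((I \<inter> I') \<inter> \<gamma>' -` V). \<forall>y\<in>((I \<inter> I') \<inter> \<gamma> -` U) \<inter> ((I \<inter> I') \<inter> \<gamma>' -` V). \<gamma> x = \<gamma>' x \<longrightarrow> \<gamma> y = \<gamma>' y"
          by blast
      qed
    qed
  qed
qed

lemma hsec_\<phi>:
  assumes h: "hsec I \<gamma>" shows "hsec I (\<lambda>t. \<phi> s (\<gamma> t))"
proof -
  note hD = hsec_D[OF h]
  have "\<exists>u. ((\<lambda>t. f (\<phi> s (\<gamma> t))) has_vector_derivative u) (at t) \<and> mink u (X (f (\<phi> s (\<gamma> t)))) = 0" if t: "t \<in> I" for t
  proof -
    obtain u where u: "((\<lambda>t. f (\<gamma> t)) has_vector_derivative u) (at t)" "mink u (X (f (\<gamma> t))) = 0"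
      using h t unfolding hsec_def by blast
    have "((\<lambda>t. R s (f (\<gamma> t))) has_vector_derivative R s u) (at t)"
      using linear_R linear_conv_bounded_linear bounded_linear.has_vector_derivative u(1) by blast
    then have "((\<lambda>t. f (\<phi> s (\<gamma> t))) has_vector_derivative R s u) (at t)"
      by (rule has_vector_derivative_transform_within_open[OF _ hD(1) t]) (use f_\<phi> hD(5) in auto)
    moreover have "mink (R s u) (X (f (\<phi> s (\<gamma> t)))) = 0"
      using f_\<phi>[OF hD(5)[OF t]] mink_R u(2) by (simp flip: R_X)
    ultimately show ?thesis by blast
  qed
  moreover have "continuous_on I (\<lambda>t. \<phi> s (\<gamma> t))"
    by (rule continuous_on_compose2[OF \<phi>_cont_x hD(3)]) (use hD(5) in auto)
  ultimately show ?thesis using hD \<phi>_Mst that_\<phi> unfolding hsec_def by auto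
qed

lemma hsec_glue:
  assumes h: "hsec I \<gamma>" "hsec I' \<gamma>'" and t1: "t1 \<in> I \<inter> I'" "\<gamma> t1 = \<gamma>' t1"
  shows "hsec (I \<union> I') (\<lambda>t. if t \<in> I then \<gamma> t else \<gamma>' t)"
proof -
  let ?g = "\<lambda>t. if t \<in> I then \<gamma> t else \<gamma>' t"
  note hD = hsec_D[OF h(1)] and hD' = hsec_D[OF h(2)]
  have eq: "?g t = \<gamma> t" if "t \<in> I" for t using that by simp
  have eq': "?g t = \<gamma>' t" if "t \<in> I'" for t using that hsec_unique[OF h t1] by auto
  have "continuous_on I ?g" "continuous_on I' ?g"
    using hD(3) hD'(3) eq eq' by (simp_all cong: continuous_on_cong)
  then have c: "continuous_on (I \<union> I') ?g" using hD(1) hD'(1) by (intro continuous_on_open_Un)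
  have "connected (I \<union> I')" using t1 hD(2) hD'(2) is_interval_connected by (intro connected_Un) auto
  then have int: "is_interval (I \<union> I')" by (simp add: is_interval_connected_1)
  have D: "?g t \<in> Mst \<and> that (?g t) = t \<and> (\<exists>u. ((\<lambda>t. f (?g t)) has_vector_derivative u) (at t) \<and> mink u (X (f (?g t))) = 0)"
    if K: "hsec K k" "t \<in> K" "\<And>t. t \<in> K \<Longrightarrow> ?g t = k t" for K k t
  proof -
    note kD = hsec_D[OF K(1)]
    obtain u where u: "((\<lambda>t. f (k t)) has_vector_derivative u) (at t)" "mink u (X (f (k t))) = 0"
      using K(1,2) unfolding hsec_def by blast
    have "((\<lambda>t. f (?g t)) has_vector_derivative u) (at t)"
      by (rule has_vector_derivative_transform_within_open[OF u(1) kD(1) K(2)]) (use K(3) in metis)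
    then show ?thesis using u(2) kD(4,6)[OF K(2)] K(3)[OF K(2)] by auto
  qed
  show ?thesis unfolding hsec_def
  proof (intro conjI ballI)
    show "open (I \<union> I')" using hD hD' by blast
    fix t assume "t \<in> I \<union> I'"
    then have "?g t \<in> Mst \<and> that (?g t) = t \<and> (\<exists>u. ((\<lambda>t. f (?g t)) has_vector_derivative u) (at t) \<and> mink u (X (f (?g t))) = 0)"
      using D[OF h(1) _ eq, of t] D[OF h(2) _ eq', of t] by blast
    then show "?g t \<in> Mst" "that (?g t) = t" "\<exists>u. ((\<lambda>t. f (?g t)) has_vector_derivative u) (at t) \<and> mink u (X (f (?g t))) = 0" by blast+
  qed (use c int in auto)
qed

lemma box_section:
  assumes "x0 \<in> Mst"
  obtains e \<kappa> where "e > 0" "chart (rect e (that x0)) \<kappa>" "\<kappa> (0, that x0) = x0" "\<kappa> ` rect e (that x0) \<subseteq> Mst"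
    "hsec {that x0 - e<..<that x0 + e} (\<lambda>t. \<kappa> (0, t))"
    "\<And>s t. (s, t) \<in> rect e (that x0) \<Longrightarrow> \<kappa> (s, t) = \<phi> s (\<kappa> (0, t))"
    "\<And>t. t \<in> {that x0 - e<..<that x0 + e} \<Longrightarrow> \<exists>Y. merid (f (\<kappa> (0, t))) (n (\<kappa> (0, t))) Y \<and>
       ((\<lambda>t. n (\<kappa> (0, t))) has_vector_derivative Y) (at t)"
proof -
  define t0 where "t0 = that x0"
  obtain e \<kappa> \<theta> where e: "e > 0" and \<kappa>: "chart (rect e t0) \<kappa>" "\<kappa> (0, t0) = x0" "\<kappa> ` rect e t0 \<subseteq> Mst"
    and \<theta>: "\<forall>s t. (s, t) \<in> rect e t0 \<longrightarrow> that (\<kappa> (s, t)) = t \<and> \<kappa> (s, t) = \<phi> s (\<kappa> (0, t)) \<and> \<theta> (f (\<kappa> (s, t))) = s \<and>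
       (\<theta> has_derivative (\<lambda>u. mink u (X (f (\<kappa> (s, t)))) / Q (f (\<kappa> (s, t))) (f (\<kappa> (s, t))))) (at (f (\<kappa> (s, t))))"
    and Y: "\<forall>t\<in>{t0-e<..<t0+e}. \<exists>Y. merid (f (\<kappa> (0, t))) (n (\<kappa> (0, t))) Y \<and> mink Y (X (f (\<kappa> (0, t)))) = 0 \<and>
       ((\<lambda>t. n (\<kappa> (0, t))) has_vector_derivative Y) (at t) \<and>
       (\<exists>k. ((\<lambda>t. f (\<kappa> (0, t))) has_vector_derivative k *\<^sub>R Y) (at t))"
    using local_box[OF assms] unfolding t0_def[symmetric] by blast
  have mem: "(0, t) \<in> rect e t0" if "t \<in> {t0-e<..<t0+e}" for t using that e by simp
  have "continuous_on (rect e t0) \<kappa>" using \<kappa>(1) unfolding local_param_def homeomorphism_def by blast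
  then have c: "continuous_on {t0-e<..<t0+e} (\<lambda>t. \<kappa> (0, t))"
    by (rule continuous_on_compose2) (use mem in \<open>auto intro!: continuous_intros\<close>)
  have "hsec {t0-e<..<t0+e} (\<lambda>t. \<kappa> (0, t))" unfolding hsec_def
  proof (intro conjI ballI c open_greaterThanLessThan is_interval_oo)
    fix t assume t: "t \<in> {t0-e<..<t0+e}"
    show "\<kappa> (0, t) \<in> Mst" using \<kappa>(3) mem[OF t] by blast
    show "that (\<kappa> (0, t)) = t" using \<theta> mem[OF t] by blast
    show "\<exists>u. ((\<lambda>t. f (\<kappa> (0, t))) has_vector_derivative u) (at t) \<and> mink u (X (f (\<kappa> (0, t)))) = 0"
    proof -
      obtain Y k where "((\<lambda>t. f (\<kappa> (0, t))) has_vector_derivative k *\<^sub>R Y) (at t)" "mink Y (X (f (\<kappa> (0, t)))) = 0"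
        using Y t by blast
      then show ?thesis by (intro exI[of _ "k *\<^sub>R Y"]) (simp add: mink_simps)
    qed
  qed
  then show ?thesis using that[of e \<kappa>] e \<kappa> \<theta> Y unfolding t0_def[symmetric] by blast
qed

text \<open>Sections through \<open>x0\<close> agree where they overlap, so their union is itself a
  section. Any section that meets it can be glued to it, and the result is again one through
  \<open>x0\<close>, hence already contained in the union.\<close>

lemma maximal_section:
  assumes x0: "x0 \<in> Mst"
  obtains J \<gamma> where "hsec J \<gamma>" "that x0 \<in> J" "\<gamma> (that x0) = x0"
    "\<And>I \<gamma>' t. hsec I \<gamma>' \<Longrightarrow> t \<in> I \<Longrightarrow> t \<in> J \<Longrightarrow> \<gamma>' t = \<gamma> t \<Longrightarrow> I \<subseteq> J"
proof -
  define t0 where "t0 = that x0"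
  define SS where "SS = {(I, \<gamma>). hsec I \<gamma> \<and> t0 \<in> I \<and> \<gamma> t0 = x0}"
  define J where "J = \<Union> (fst ` SS)"
  have "\<forall>t. \<exists>p. t \<in> J \<longrightarrow> p \<in> SS \<and> t \<in> fst p" unfolding J_def by blast
  then obtain p where p: "\<And>t. t \<in> J \<Longrightarrow> p t \<in> SS \<and> t \<in> fst (p t)" by metis
  define \<gamma> where "\<gamma> t = snd (p t) t" for t
  have SSD: "hsec I k" "t0 \<in> I" "k t0 = x0" if "(I, k) \<in> SS" for I k using that by (auto simp: SS_def)
  have \<gamma>: "\<gamma> t = k t" if "(I, k) \<in> SS" "t \<in> I" for I k t
  proof -
    have "t \<in> J" using that by (force simp: J_def)
    then have pt: "(fst (p t), snd (p t)) \<in> SS" "t \<in> fst (p t)" using p by auto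
    show ?thesis unfolding \<gamma>_def
      by (rule hsec_unique[OF SSD(1)[OF pt(1)] SSD(1)[OF that(1)], of t0]) (use SSD[OF pt(1)] SSD[OF that(1)] pt that in auto)
  qed
  have sub: "I \<subseteq> J" if "(I, k) \<in> SS" for I k using that by (force simp: J_def)
  have ex: "\<exists>I k. (I, k) \<in> SS \<and> t \<in> I" if "t \<in> J" for t using p[OF that] by (metis prod.collapse)
  obtain e and \<kappa> :: "real \<times> real \<Rightarrow> 'a" where ek: "e > 0" "\<kappa> (0, t0) = x0" "hsec {t0 - e<..<t0 + e} (\<lambda>t. \<kappa> (0, t))"
    by (rule box_section[OF x0, folded t0_def]) (rule that; assumption)
  have S0: "({t0 - e<..<t0 + e}, \<lambda>t. \<kappa> (0, t)) \<in> SS" using ek by (simp add: SS_def)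
  have t0J: "t0 \<in> J" using sub[OF S0] ek(1) by auto
  have \<gamma>0: "\<gamma> t0 = x0" using \<gamma>[OF S0, of t0] ek by simp
  have SSf: "open I" "connected I" "t0 \<in> I" if I: "I \<in> fst ` SS" for I
  proof -
    obtain k where k: "(I, k) \<in> SS" using I by auto
    show "open I" "connected I" "t0 \<in> I"
      using hsec_D(1,2)[OF SSD(1)[OF k]] SSD(2)[OF k] by (simp_all add: is_interval_connected_1)
  qed
  have oJ: "open J" unfolding J_def using SSf(1) by (intro open_Union ballI)
  have "connected J" unfolding J_def
  proof (rule connected_Union)
    show "connected I" if "I \<in> fst ` SS" for I using SSf(2)[OF that] .
    have "t0 \<in> \<Inter> (fst ` SS)" using SSf(3) by blast
    then show "\<Inter> (fst ` SS) \<noteq> {}" by blast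
  qed
  then have iJ: "is_interval J" by (simp add: is_interval_connected_1)
  have secp: "(\<gamma> t \<in> Mst \<and> that (\<gamma> t) = t \<and>
        (\<exists>u. ((\<lambda>t. f (\<gamma> t)) has_vector_derivative u) (at t) \<and> mink u (X (f (\<gamma> t))) = 0)) \<and> isCont \<gamma> t" if t: "t \<in> J" for t
  proof -
    obtain I k where Ik: "(I, k) \<in> SS" "t \<in> I" using ex[OF t] by blast
    note kD = hsec_D[OF SSD(1)[OF Ik(1)]]
    obtain u where u: "((\<lambda>t. f (k t)) has_vector_derivative u) (at t)" "mink u (X (f (k t))) = 0"
      using SSD(1)[OF Ik(1)] Ik(2) unfolding hsec_def by blast
    have "((\<lambda>t. f (\<gamma> t)) has_vector_derivative u) (at t)"
      by (rule has_vector_derivative_transform_within_open[OF u(1) kD(1) Ik(2)]) (use \<gamma>[OF Ik(1)] in metis)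
    moreover have "continuous_on I \<gamma>" using kD(3) \<gamma>[OF Ik(1)] by (simp cong: continuous_on_cong)
    then have "isCont \<gamma> t" using kD(1) Ik(2) continuous_on_eq_continuous_at by blast
    ultimately show ?thesis using u(2) kD(4,6)[OF Ik(2)] \<gamma>[OF Ik] by auto
  qed
  have h: "hsec J \<gamma>" unfolding hsec_def
    using oJ iJ secp continuous_at_imp_continuous_on[of J \<gamma>] by blast
  have "I \<subseteq> J" if "hsec I k" "t \<in> I" "t \<in> J" "k t = \<gamma> t" for I k t
  proof -
    have "hsec (J \<union> I) (\<lambda>t. if t \<in> J then \<gamma> t else k t)"
      by (rule hsec_glue[OF h that(1), of t]) (use that in auto)
    then have "(J \<union> I, \<lambda>t. if t \<in> J then \<gamma> t else k t) \<in> SS" using t0J \<gamma>0 by (simp add: SS_def)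
    then show ?thesis using sub by blast
  qed
  then show ?thesis using that[OF h] t0J \<gamma>0 unfolding t0_def by blast
qed

text \<open>Let \<open>U\<close> be the union of the rotations of a maximal section. A flow box that
  meets \<open>U\<close> lies in \<open>U\<close>: turned suitably, its section meets the maximal
  one and by maximality lies within it. By connectedness \<open>U\<close> is everything off the
  axis.\<close>

lemma global_section:
  assumes "Mst \<noteq> {}"
  obtains J \<gamma> where "hsec J \<gamma>" "J \<noteq> {}" "Mst = (\<lambda>(s, t). \<phi> s (\<gamma> t)) ` (UNIV \<times> J)"
proof -
  obtain x0 where x0: "x0 \<in> Mst" using assms by blast
  obtain J \<gamma> where J: "hsec J \<gamma>" "that x0 \<in> J" "\<gamma> (that x0) = x0"
    and max: "\<And>I \<gamma>' t. hsec I \<gamma>' \<Longrightarrow> t \<in> I \<Longrightarrow> t \<in> J \<Longrightarrow> \<gamma>' t = \<gamma> t \<Longrightarrow> I \<subseteq> J"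
    by (rule maximal_section[OF x0]) (rule that; assumption)
  note JD = hsec_D[OF J(1)]
  define U where "U = (\<lambda>(s, t). \<phi> s (\<gamma> t)) ` (UNIV \<times> J)"
  have Ui: "x \<in> U \<longleftrightarrow> (\<exists>s. \<exists>t\<in>J. x = \<phi> s (\<gamma> t))" for x by (auto simp: U_def image_iff)
  have "x0 \<in> U" unfolding Ui using J \<phi>_0[OF Mst_M[OF x0]] by metis
  have "x \<in> U" if x: "x \<in> Mst" for x
  proof (rule connected_induction_simple[OF conn x0 x, of "\<lambda>x. x \<in> U", OF \<open>x0 \<in> U\<close>])
    fix y assume y: "y \<in> Mst"
    obtain e \<kappa> where e: "e > 0" and \<kappa>: "chart (rect e (that y)) \<kappa>" "\<kappa> (0, that y) = y" "\<kappa> ` rect e (that y) \<subseteq> Mst"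
      and h: "hsec {that y - e<..<that y + e} (\<lambda>t. \<kappa> (0, t))"
      and fl: "\<And>s t. (s, t) \<in> rect e (that y) \<Longrightarrow> \<kappa> (s, t) = \<phi> s (\<kappa> (0, t))"
      by (rule box_section[OF y]) (rule that; assumption)
    let ?I = "{that y - e<..<that y + e}"
    note hD = hsec_D[OF h]
    have "q \<in> U" if p: "p \<in> \<kappa> ` rect e (that y)" "p \<in> U" and q: "q \<in> \<kappa> ` rect e (that y)" for p q
    proof -
      obtain s1 t1 where 1: "(s1, t1) \<in> rect e (that y)" "p = \<kappa> (s1, t1)" using p(1) by auto
      obtain s2 t2 where 2: "(s2, t2) \<in> rect e (that y)" "q = \<kappa> (s2, t2)" using q by auto
      have tI: "t1 \<in> ?I" "t2 \<in> ?I" using 1 2 by auto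
      obtain s t where st: "t \<in> J" "p = \<phi> s (\<gamma> t)" using p(2) Ui by blast
      have "that p = t" using st that_\<phi>[OF JD(4)[OF st(1)]] JD(6)[OF st(1)] by simp
      moreover have "that p = t1" using 1 fl[OF 1(1)] that_\<phi>[OF hD(4)[OF tI(1)]] hD(6)[OF tI(1)] by simp
      ultimately have tt: "t = t1" by simp
      have eq: "\<phi> s1 (\<kappa> (0, t1)) = \<phi> s (\<gamma> t1)" using 1 fl[OF 1(1)] st tt by simp
      \<comment> \<open>\<open>s1 - s\<close> is the angle by which the section of the box has to be
        turned to meet \<open>\<gamma>\<close> at time \<open>t1\<close>.\<close>
      have "\<phi> (s1 - s) (\<kappa> (0, t1)) = \<phi> (- s) (\<phi> s1 (\<kappa> (0, t1)))"
        using \<phi>_add[OF hD(5)[OF tI(1)], of "- s" s1] by simp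
      also have "\<dots> = \<gamma> t1" unfolding eq using \<phi>_minus(1)[OF JD(5)] st tt by simp
      finally have g: "\<phi> (s1 - s) (\<kappa> (0, t1)) = \<gamma> t1" .
      note h' = hsec_\<phi>[OF h, of "s1 - s"]
      have sub: "?I \<subseteq> J" using max[OF h' tI(1) _ g] st tt by simp
      have t2J: "t2 \<in> J" using sub tI by blast
      have "\<phi> (s1 - s) (\<kappa> (0, t2)) = \<gamma> t2"
        by (rule hsec_unique[OF h' J(1), of t1]) (use tI st tt g t2J in auto)
      then have "\<kappa> (0, t2) = \<phi> (- (s1 - s)) (\<gamma> t2)" using \<phi>_minus(1)[OF hD(5)[OF tI(2)]] by metis
      then have "q = \<phi> s2 (\<phi> (- (s1 - s)) (\<gamma> t2))" using 2 fl[OF 2(1)] by simp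
      also have "\<dots> = \<phi> (s2 + - (s1 - s)) (\<gamma> t2)" using \<phi>_add[OF JD(5)[OF t2J]] by simp
      finally show ?thesis unfolding Ui using t2J by blast
    qed
    moreover have "openin (top_of_set Mst) (\<kappa> ` rect e (that y))"
      by (rule chart_openin_Mst[OF \<kappa>(1) local_param_D(1)[OF \<kappa>(1)] subset_refl \<kappa>(3)])
    moreover have "y \<in> \<kappa> ` rect e (that y)" using \<kappa>(2) e by (auto intro!: image_eqI[of _ _ "(0, that y)"])
    ultimately show "\<exists>T. openin (top_of_set Mst) T \<and> y \<in> T \<and> (\<forall>x\<in>T. \<forall>z\<in>T. x \<in> U \<longrightarrow> z \<in> U)" by blast
  qed
  moreover have "U \<subseteq> Mst" using JD(4) \<phi>_Mst by (auto simp: U_def)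
  ultimately have "Mst = U" by blast
  then show ?thesis using that[OF J(1)] J(2) unfolding U_def by blast
qed

lemma hsec_local:
  assumes h: "hsec J \<gamma>" and t1: "t1 \<in> J"
  obtains e \<kappa> where "e > 0" "chart (rect e t1) \<kappa>" "{t1-e<..<t1+e} \<subseteq> J" "\<And>s t. (s, t) \<in> rect e t1 \<Longrightarrow> \<kappa> (s, t) = \<phi> s (\<gamma> t)"
    "\<exists>Y. merid (f (\<gamma> t1)) (n (\<gamma> t1)) Y \<and> ((\<lambda>t. n (\<gamma> t)) has_vector_derivative Y) (at t1)"
proof -
  note hD = hsec_D[OF h]
  have th: "that (\<gamma> t1) = t1" using hD(6) t1 by simp
  obtain e \<kappa> where e: "e > 0" and \<kappa>: "chart (rect e t1) \<kappa>" "\<kappa> (0, t1) = \<gamma> t1"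
    and h': "hsec {t1 - e<..<t1 + e} (\<lambda>t. \<kappa> (0, t))"
    and fl: "\<And>s t. (s, t) \<in> rect e t1 \<Longrightarrow> \<kappa> (s, t) = \<phi> s (\<kappa> (0, t))"
    and Y: "\<And>t. t \<in> {t1 - e<..<t1 + e} \<Longrightarrow> \<exists>Y. merid (f (\<kappa> (0, t))) (n (\<kappa> (0, t))) Y \<and>
       ((\<lambda>t. n (\<kappa> (0, t))) has_vector_derivative Y) (at t)"
    by (rule box_section[OF hD(4)[OF t1], unfolded th]) (rule that; assumption)
  obtain d1 where d1: "d1 > 0" "\<forall>t\<in>{t1-d1<..<t1+d1}. \<gamma> t = \<kappa> (0, t)"
    using hsec_local_unique[OF h h' t1] e \<kappa>(2) by auto
  obtain d2 where d2: "d2 > 0" "ball t1 d2 \<subseteq> J" using hD(1) t1 open_contains_ball by blast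
  define d where "d = min e (min d1 d2)"
  have d: "d > 0" "d \<le> e" "d \<le> d1" "d \<le> d2" using e d1 d2 by (auto simp: d_def)
  have sub: "rect d t1 \<subseteq> rect e t1" using d by auto
  have dJ: "{t1-d<..<t1+d} \<subseteq> J"
  proof
    fix t assume "t \<in> {t1-d<..<t1+d}"
    then have "t \<in> ball t1 d2" using d by (auto simp: dist_real_def)
    then show "t \<in> J" using d2 by blast
  qed
  have eq: "\<gamma> t = \<kappa> (0, t)" if "t \<in> {t1-d<..<t1+d}" for t using d1(2) that d by auto
  have "\<kappa> (s, t) = \<phi> s (\<gamma> t)" if "(s, t) \<in> rect d t1" for s t
    using fl[OF subsetD[OF sub that]] eq[of t] that by auto
  moreover obtain Y0 where Y0: "merid (f (\<gamma> t1)) (n (\<gamma> t1)) Y0" "((\<lambda>t. n (\<kappa> (0, t))) has_vector_derivative Y0) (at t1)"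
    using Y[of t1] e \<kappa>(2) by auto
  have "((\<lambda>t. n (\<gamma> t)) has_vector_derivative Y0) (at t1)"
    by (rule has_vector_derivative_transform_within_open[OF Y0(2), of "{t1-d<..<t1+d}"]) (use eq d in auto)
  moreover have "chart (rect d t1) \<kappa>" by (rule local_param_subset[OF \<kappa>(1) _ sub]) (intro open_Times open_greaterThanLessThan)
  ultimately show ?thesis using that d(1) dJ Y0(1) by blast
qed

text \<open>Near \<open>(0, t1)\<close> the map is the chart of a flow box. Near
  \<open>(s1, t1)\<close> it is this chart followed by the homeomorphism \<open>\<phi> s1\<close>,
  with the first coordinate shifted by \<open>s1\<close>.\<close>

lemma hsec_local_param:
  assumes h: "hsec J \<gamma>" and t1: "t1 \<in> J"
  shows "\<exists>W. (s1, t1) \<in> W \<and> W \<subseteq> UNIV \<times> J \<and> chart W (\<lambda>(s, t). \<phi> s (\<gamma> t))"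
proof -
  obtain d \<kappa> where d: "d > 0" and \<kappa>: "chart (rect d t1) \<kappa>" "{t1-d<..<t1+d} \<subseteq> J"
    "\<And>s t. (s, t) \<in> rect d t1 \<Longrightarrow> \<kappa> (s, t) = \<phi> s (\<gamma> t)"
    by (rule hsec_local[OF assms]) (rule that; assumption)
  note hD = hsec_D[OF h]
  have inj: "inj (R s1)" by (rule inj_on_inverseI[of _ "R (- s1)"]) (simp add: R_minus)
  have 1: "chart (rect d t1) (\<phi> s1 \<circ> \<kappa>)"
    by (rule local_param_image[OF \<kappa>(1) \<phi>_homeomorphism linear_R inj]) (use f_\<phi> n_\<phi> in auto)
  define W where "W = {s1-d<..<s1+d} \<times> {t1-d<..<t1+d}"
  define g where "g y = y - (s1, 0::real)" for y :: "real \<times> real"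
  have oR: "open (rect d t1)" "open W" unfolding W_def by (intro open_Times open_greaterThanLessThan)+
  have gf: "g (y + (s1, 0)) = y" "g y + (s1, 0) = y" for y by (simp_all add: g_def)
  have gW: "y \<in> W \<longleftrightarrow> g y \<in> rect d t1" for y by (cases y) (auto simp: g_def W_def)
  have im: "(\<lambda>y. y + (s1, 0)) ` rect d t1 = W" "g ` W = rect d t1"
  proof -
    show "(\<lambda>y. y + (s1, 0)) ` rect d t1 = W"
    proof (intro set_eqI iffI)
      fix y assume "y \<in> W"
      then show "y \<in> (\<lambda>y. y + (s1, 0)) ` rect d t1" using gW gf(2) by (intro image_eqI[of _ _ "g y"]) simp_all
    next
      fix y assume "y \<in> (\<lambda>y. y + (s1, 0)) ` rect d t1"
      then obtain z where "z \<in> rect d t1" "y = z + (s1, 0)" by blast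
      then show "y \<in> W" using gW[of y] gf(1)[of z] by simp
    qed
    show "g ` W = rect d t1"
    proof (intro set_eqI iffI)
      fix y assume "y \<in> rect d t1"
      then show "y \<in> g ` W" using gW[of "y + (s1, 0)"] gf(1) by (intro image_eqI[of _ _ "y + (s1, 0)"]) simp_all
    next
      fix y assume "y \<in> g ` W"
      then show "y \<in> rect d t1" using gW by blast
    qed
  qed
  have hom: "homeomorphism (rect d t1) W (\<lambda>y. y + (s1, 0)) g"
    unfolding homeomorphism_def
  proof (intro conjI ballI gf im)
    show "continuous_on W g" unfolding g_def[abs_def] by (intro continuous_intros)
  qed (intro continuous_intros)
  have gd: "(g has_derivative blinfun_apply id_blinfun) (at y)" for y
    unfolding g_def[abs_def] by (auto intro!: derivative_eq_intros)
  have "chart W ((\<phi> s1 \<circ> \<kappa>) \<circ> g)"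
    by (rule local_param_reparam[OF 1 oR(1) subset_refl oR(2) hom gd]) (auto simp: inj_on_def)
  then have "chart W (\<lambda>(s, t). \<phi> s (\<gamma> t))"
  proof (rule local_param_cong)
    fix y assume "y \<in> W"
    then obtain s t where y: "y = (s, t)" "s \<in> {s1-d<..<s1+d}" "t \<in> {t1-d<..<t1+d}" by (auto simp: W_def)
    then have r: "(s - s1, t) \<in> rect d t1" by auto
    have "\<gamma> t \<in> M" using y(3) \<kappa>(2) hD(5) by blast
    then show "((\<phi> s1 \<circ> \<kappa>) \<circ> g) y = (case y of (s, t) \<Rightarrow> \<phi> s (\<gamma> t))"
      using \<kappa>(3)[OF r] \<phi>_add[of "\<gamma> t" s1 "s - s1"] by (simp add: y g_def)
  qed
  moreover have "(s1, t1) \<in> W" "W \<subseteq> UNIV \<times> J" using d \<kappa>(2) by (auto simp: W_def)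
  ultimately show ?thesis by blast
qed

text \<open>What the three coordinate computations start from. The unit vector in the direction of
  \<open>X n\<close> is constant along the meridian: with \<open>\<tau> = r' / r\<close> the
  velocity satisfies \<open>X Y = \<tau> *\<^sub>R X N\<close>, so the derivative of
  \<open>n\<close> divided by \<open>r\<close> is annihilated by \<open>X\<close>. Hence along the
  meridian the Gauss map stays orthogonal to a fixed \<open>m\<close>, and only \<open>r\<close> and
  the Wronskian of the complementary part are left to use.\<close>

theorem gauss_map_profile:
  assumes "Mst \<noteq> {}"
  obtains J \<gamma> m y where "open J" "is_interval J" "J \<noteq> {}"
    "(\<lambda>(s, t). \<phi> s (\<gamma> t)) ` (UNIV \<times> J) = Mst"
    "\<And>w. w \<in> UNIV \<times> J \<Longrightarrow> \<exists>W. w \<in> W \<and> W \<subseteq> UNIV \<times> J \<and> chart W (\<lambda>(s, t). \<phi> s (\<gamma> t))"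
    "m = X y" "mink m m = 1"
    "\<And>t. t \<in> J \<Longrightarrow> \<gamma> t \<in> Mst"
    "\<And>t. t \<in> J \<Longrightarrow> \<Xi> * t \<in> quarter pp"
    "\<And>t. t \<in> J \<Longrightarrow> X (n (\<gamma> t)) = profile_r \<Xi> Cp Cm t *\<^sub>R m"
    "\<And>t. t \<in> J \<Longrightarrow> profile_r \<Xi> Cp Cm t > 0 \<and> C - (profile_r \<Xi> Cp Cm t)\<^sup>2 / Hb \<noteq> 0"
    "\<And>t. t \<in> J \<Longrightarrow> \<exists>Y. ((\<lambda>t. n (\<gamma> t)) has_vector_derivative Y) (at t) \<and>
        B (n (\<gamma> t)) Y = C - (profile_r \<Xi> Cp Cm t)\<^sup>2 / Hb"
proof -
  obtain J \<gamma> where h: "hsec J \<gamma>" "J \<noteq> {}" and im: "Mst = (\<lambda>(s, t). \<phi> s (\<gamma> t)) ` (UNIV \<times> J)"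
    using global_section[OF assms] .
  note hD = hsec_D[OF h(1)]
  let ?r = "profile_r \<Xi> Cp Cm"
  have r: "?r t = sqrt (Q (n (\<gamma> t)) (n (\<gamma> t)))" "?r t > 0" "(?r t)\<^sup>2 = Q (n (\<gamma> t)) (n (\<gamma> t))" if "t \<in> J" for t
    using profile_r_that[OF hD(4)[OF that]] hD(6)[OF that] Mst_facts(1)[OF hD(4)[OF that]] by simp_all
  have Y: "\<exists>Y. merid (f (\<gamma> t)) (n (\<gamma> t)) Y \<and> ((\<lambda>t. n (\<gamma> t)) has_vector_derivative Y) (at t)" if "t \<in> J" for t
    by (rule hsec_local[OF h(1) that])
  define E where "E t = X ((1 / sqrt (Q (n (\<gamma> t)) (n (\<gamma> t)))) *\<^sub>R n (\<gamma> t))" for t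
  have "(E has_vector_derivative 0) (at t within J)" if t: "t \<in> J" for t
  proof -
    define q where "q = Q (n (\<gamma> t)) (n (\<gamma> t))"
    define N where "N = n (\<gamma> t)"
    have q: "q > 0" "q = Q N N" using Mst_facts(1)[OF hD(4)[OF t]] by (simp_all add: q_def N_def)
    obtain Y0 where Y0: "merid (f (\<gamma> t)) N Y0" "((\<lambda>t. n (\<gamma> t)) has_vector_derivative Y0) (at t)" using Y[OF t] by (auto simp: N_def)
    define \<tau> where "\<tau> = - B (f (\<gamma> t)) N"
    have QNY: "Q N Y0 = \<tau> * q" and YX: "mink Y0 (X N) = 0" using Y0(1) q by (simp_all add: merid_rel_def \<tau>_def)
    have "q *\<^sub>R X Y0 = Q Y0 N *\<^sub>R X N" using X_parallel[OF YX] q by simp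
    then have "q *\<^sub>R X Y0 = q *\<^sub>R (\<tau> *\<^sub>R X N)" using QNY Q_commute[of Y0 N] by (simp add: mult.commute)
    then have XY: "X Y0 = \<tau> *\<^sub>R X N" using q(1) unfolding scaleR_cancel_left by simp
    have dq: "((\<lambda>t. Q (n (\<gamma> t)) (n (\<gamma> t))) has_real_derivative 2 * (\<tau> * q)) (at t)"
      using Q.has_vector_derivative[OF Y0(2) Y0(2)] QNY Q_commute[of Y0 N]
      by (simp add: has_real_derivative_iff_has_vector_derivative N_def)
    have ds: "((\<lambda>t. 1 / sqrt (Q (n (\<gamma> t)) (n (\<gamma> t)))) has_real_derivative - \<tau> / sqrt q) (at t)"
    proof -
      have "((\<lambda>t. 1 / sqrt (Q (n (\<gamma> t)) (n (\<gamma> t)))) has_real_derivative - (inverse (sqrt q) / 2 * (2 * (\<tau> * q))) / (sqrt q)\<^sup>2) (at t)"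
        using dq q(1) unfolding q_def by (auto intro!: derivative_eq_intros simp: power2_eq_square)
      moreover have "- (inverse (sqrt q) / 2 * (2 * (\<tau> * q))) / (sqrt q)\<^sup>2 = - \<tau> / sqrt q"
        using q(1) by (simp add: field_simps)
      ultimately show ?thesis by simp
    qed
    have "((\<lambda>t. (1 / sqrt (Q (n (\<gamma> t)) (n (\<gamma> t)))) *\<^sub>R n (\<gamma> t)) has_vector_derivative (1 / sqrt q) *\<^sub>R Y0 + (- \<tau> / sqrt q) *\<^sub>R N) (at t)"
      using has_vector_derivative_scaleR[OF ds Y0(2)] by (simp add: q_def N_def)
    from bounded_linear.has_vector_derivative[OF bounded_linear_X this]
    have "(E has_vector_derivative X ((1 / sqrt q) *\<^sub>R Y0 + (- \<tau> / sqrt q) *\<^sub>R N)) (at t)" by (simp add: E_def[abs_def])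
    moreover have "X ((1 / sqrt q) *\<^sub>R Y0 + (- \<tau> / sqrt q) *\<^sub>R N) = 0" unfolding X_simps XY by simp
    ultimately show ?thesis by (simp add: has_vector_derivative_at_within)
  qed
  then obtain m where m: "\<And>t. t \<in> J \<Longrightarrow> E t = m"
    using has_vector_derivative_zero_constant[OF is_interval_convex[OF hD(2)], of E] by blast
  obtain t0 where t0: "t0 \<in> J" using h(2) by blast
  show ?thesis
  proof (rule that[OF hD(1,2) h(2) im[symmetric]])
    show "\<exists>W. w \<in> W \<and> W \<subseteq> UNIV \<times> J \<and> chart W (\<lambda>(s, t). \<phi> s (\<gamma> t))" if "w \<in> UNIV \<times> J" for w
      using hsec_local_param[OF h(1), of "snd w" "fst w"] that by auto
    show "m = X ((1 / sqrt (Q (n (\<gamma> t0)) (n (\<gamma> t0)))) *\<^sub>R n (\<gamma> t0))" using m[OF t0] by (simp add: E_def)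
    then show "mink m m = 1" using Mst_facts(1)[OF hD(4)[OF t0]] by (simp add: X_simps mink_simps Q_def[symmetric])
    fix t assume t: "t \<in> J"
    show "\<gamma> t \<in> Mst" using hD(4)[OF t] .
    show "\<Xi> * t \<in> quarter pp" using amplitude(4)[OF hD(4)[OF t]] hD(6)[OF t] by simp
    show "X (n (\<gamma> t)) = ?r t *\<^sub>R m" using m[OF t] r[OF t] by (auto simp: E_def X_simps)
    show "?r t > 0 \<and> C - (?r t)\<^sup>2 / Hb \<noteq> 0" using r[OF t] Mst_facts(2,3)[OF hD(4)[OF t]] by simp
    show "\<exists>Y. ((\<lambda>t. n (\<gamma> t)) has_vector_derivative Y) (at t) \<and> B (n (\<gamma> t)) Y = C - (?r t)\<^sup>2 / Hb"
      using Y[OF t] Mst_facts(3)[OF hD(4)[OF t]] r(3)[OF t] by (auto simp: merid_rel_def)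
  qed
qed

end

section \<open>The axis of rotation, the roots and the spheres\<close>

context plane_frame begin

text \<open>The sign \<open>k\<close> allows for the elliptic case, where \<open>- X m\<close> is
  taken as basis vector so that the coordinate of the Gauss map is \<open>r\<close> and not
  \<open>- r\<close>.\<close>

lemma span_rotated_frame:
  assumes m: "m = X y" "mink m m = 1" and k: "k = 1 \<or> k = -1"
  shows "span {k *\<^sub>R X m, m} = span {a, b}"
proof -
  define p q where "p = mink y a" and "q = mink y b"
  have me: "m = p *\<^sub>R b - q *\<^sub>R a" unfolding m(1) p_def q_def X_def ..
  have Xm: "X m = (- q) *\<^sub>R b - (\<epsilon> * p) *\<^sub>R a" unfolding me X_def by (simp add: mink_simps frame_simps algebra_simps)
  have 1: "\<epsilon> * p\<^sup>2 + q\<^sup>2 = 1" using m(2) unfolding me by (simp add: mink_simps frame_simps power2_eq_square algebra_simps)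
  have kk: "k * k = 1" using k by auto
  have "(- q) *\<^sub>R m - p *\<^sub>R X m = (\<epsilon> * p\<^sup>2 + q\<^sup>2) *\<^sub>R a" "(\<epsilon> * p) *\<^sub>R m - q *\<^sub>R X m = (\<epsilon> * p\<^sup>2 + q\<^sup>2) *\<^sub>R b"
    unfolding Xm unfolding me by (simp_all add: power2_eq_square) (simp_all add: vec_eq_iff algebra_simps)
  then have ab: "a = (- q) *\<^sub>R m - (p * k) *\<^sub>R (k *\<^sub>R X m)" "b = (\<epsilon> * p) *\<^sub>R m - (q * k) *\<^sub>R (k *\<^sub>R X m)"
    using kk by (simp_all add: 1 mult.assoc)
  show ?thesis
  proof (rule span_eq[THEN iffD2], intro conjI subsetI)
    have A: "a \<in> span {a, b}" "b \<in> span {a, b}" by (auto intro: span_base)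
    have m1: "m \<in> span {a, b}" by (simp only: me) (intro span_diff span_scale A)
    have "X m \<in> span {a, b}" by (simp only: Xm) (intro span_diff span_scale A)
    with m1
    show "x \<in> span {a, b}" if "x \<in> {k *\<^sub>R X m, m}" for x using that by (auto intro: span_scale)
    have M: "m \<in> span {k *\<^sub>R X m, m}" "k *\<^sub>R X m \<in> span {k *\<^sub>R X m, m}" by (auto intro: span_base)
    have "(- q) *\<^sub>R m - (p * k) *\<^sub>R (k *\<^sub>R X m) \<in> span {k *\<^sub>R X m, m}"
      "(\<epsilon> * p) *\<^sub>R m - (q * k) *\<^sub>R (k *\<^sub>R X m) \<in> span {k *\<^sub>R X m, m}"
      by (intro span_diff span_scale M)+
    then have "a \<in> span {k *\<^sub>R X m, m}" "b \<in> span {k *\<^sub>R X m, m}"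
      unfolding ab(1)[symmetric] ab(2)[symmetric] by blast+
    then show "x \<in> span {k *\<^sub>R X m, m}" if "x \<in> {a, b}" for x using that by auto
  qed
qed

end

context rot_surface begin

lemma Mst_eq: "Mst = {x \<in> M. f x \<notin> mink_perp (span {a, b})}"
  unfolding Mst_def X_eq_0_iff_perp ..

text \<open>At a fixed point the orbit has velocity zero, and the same chart vector is sent to
  \<open>X n\<close> by the differential of \<open>n\<close>.\<close>

lemma Xn_axis:
  assumes ch: "chart W h" "w \<in> W" and X0: "X (f (h w)) = 0"
  shows "X (n (h w)) = 0"
proof -
  obtain v where v: "DF h w v = X (f (h w))" "DN h w v = X (n (h w))" by (rule rot_tangent[OF ch])
  have "v = 0" using v(1) X0 inj_DF[OF ch] linear_DF[OF ch] linear_injective_0 by metis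
  then show ?thesis using v(2) linear_0[OF linear_DN[OF ch]] by simp
qed

text \<open>At a fixed point \<open>f\<close> and \<open>n\<close> both lie in the two-dimensional
  complement of the rotation plane, so no nonzero tangent vector does. Hence the differential of
  \<open>X \<circ> f\<close> is injective there and the zero is isolated.\<close>

lemma axis_isolated:
  assumes e1: "\<epsilon> = 1" and ch: "chart W h" "w \<in> W" and X0: "X (f (h w)) = 0"
  shows "\<exists>e>0. ball w e \<subseteq> W \<and> h ` (ball w e - {w}) \<subseteq> Mst"
proof -
  have hM: "h w \<in> M" by (rule local_param_D(6)[OF ch])
  note mf = mink_fn[OF hM]
  have Xn0: "X (n (h w)) = 0" by (rule Xn_axis[OF ch X0])
  define L where "L v = X (DF h w v)" for v
  have lL: "linear L" unfolding L_def using linear_compose[OF linear_DF[OF ch] linear_X] by (simp add: o_def)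
  have "v = 0" if "L v = 0" for v
  proof -
    define u where "u = DF h w v"
    have Xu: "X u = 0" using that by (simp add: L_def u_def)
    have uf: "mink u (f (h w)) = 0" and un: "mink u (n (h w)) = 0" using DF_perp[OF ch] by (simp_all add: u_def)
    \<comment> \<open>Evaluating \<open>B_sq\<close> against the timelike \<open>f\<close> and the
      spacelike \<open>n\<close> gives two squares that are negatives of each other.\<close>
    have "(B u (f (h w)))\<^sup>2 = mink u u" "(B u (n (h w)))\<^sup>2 = - mink u u"
      unfolding B_sq using e1 Xu X0 Xn0 mf uf un by (simp_all add: Q_def mink_simps)
    then have "mink u u = 0" by (smt (verit) zero_le_power2)
    then have "u = 0" using perp_timelike_spacelike[of "f (h w)" u] mf uf by auto
    then show ?thesis using inj_DF[OF ch] linear_DF[OF ch] linear_injective_0 unfolding u_def by metis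
  qed
  then have "inj L" using linear_injective_0[OF lL] by blast
  then obtain k where k: "k > 0" "\<And>v. k * norm v \<le> norm (L v)" using linear_inj_bounded_below_pos[OF lL] by metis
  have "((\<lambda>z. X ((f \<circ> h) z)) has_derivative L) (at w)"
    using bounded_linear.has_derivative[OF bounded_linear_X DF[OF ch]] by (simp add: L_def[abs_def])
  from conjunct2[OF this[unfolded has_derivative_at_alt], rule_format, of "k / 2"]
  obtain d0 where d0: "d0 > 0" "\<And>z. norm (z - w) < d0 \<Longrightarrow> norm (X (f (h z)) - L (z - w)) \<le> k / 2 * norm (z - w)"
    using k(1) X0 by auto
  obtain d1 where d1: "d1 > 0" "ball w d1 \<subseteq> W" using local_param_D(1)[OF ch(1)] ch(2) open_contains_ball by blast
  have "h z \<in> Mst" if z: "z \<in> ball w (min d0 d1)" "z \<noteq> w" for z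
  proof -
    have zd: "norm (z - w) < d0" "z \<in> W" using z(1) d1(2) by (auto simp: dist_norm norm_minus_commute)
    have "X (f (h z)) \<noteq> 0"
    proof
      assume "X (f (h z)) = 0"
      then have "norm (L (z - w)) \<le> k / 2 * norm (z - w)" using d0(2)[OF zd(1)] by simp
      then have "k * norm (z - w) \<le> k / 2 * norm (z - w)" using k(2)[of "z - w"] by linarith
      then show False using k(1) z(2) by simp
    qed
    then show ?thesis using local_param_D(6)[OF ch(1) zd(2)] by (simp add: Mst_def)
  qed
  then have "h ` (ball w (min d0 d1) - {w}) \<subseteq> Mst" by blast
  moreover have "ball w (min d0 d1) \<subseteq> W" using d1(2) by auto
  ultimately show ?thesis using d0(1) d1(1) by (intro exI[of _ "min d0 d1"]) simp
qed

lemma Mst_nonempty: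
  assumes "\<epsilon> = 1" shows "Mst \<noteq> {}"
proof -
  obtain x where x: "x \<in> M" using surf unfolding surface_with_gauss_map_def by blast
  show ?thesis
  proof (cases "x \<in> Mst")
    case False
    obtain W h w where ch: "chart W h" "w \<in> W" "h w = x" using chart_exists[OF x] .
    obtain e where e: "e > 0" "h ` (ball w e - {w}) \<subseteq> Mst"
      using axis_isolated[OF assms ch(1,2)] False x ch(3) by (auto simp: Mst_def)
    have "w + (e/2, 0) \<in> ball w e - {w}" using e(1) by (auto simp: dist_norm norm_Pair zero_prod_def)
    then show ?thesis using e(2) by blast
  qed blast
qed

text \<open>A surface stays connected when isolated points are removed. A separation of the rest
  would extend to the whole surface: a punctured disc is connected, so near each axis point only one
  of the two parts occurs.\<close>

lemma connected_Mst_elliptic: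
  assumes e1: "\<epsilon> = 1" shows "connected Mst"
  unfolding connected_openin
proof (rule notI, elim exE conjE)
  fix E1 E2
  assume E: "openin (top_of_set Mst) E1" "openin (top_of_set Mst) E2" "Mst \<subseteq> E1 \<union> E2" "E1 \<inter> E2 = {}" "E1 \<noteq> {}" "E2 \<noteq> {}"
  have E': "openin (top_of_set M) E1" "openin (top_of_set M) E2" using E openin_Mst openin_trans by blast+
  have EM: "E1 \<subseteq> Mst" "E2 \<subseteq> Mst" using E openin_imp_subset by blast+
  define A where "A E = E \<union> {x \<in> M - Mst. \<exists>T. openin (top_of_set M) T \<and> x \<in> T \<and> T - {x} \<subseteq> E}" for E
  have openA: "openin (top_of_set M) (A E)" if "openin (top_of_set M) E" for E
  proof (subst openin_subopen, intro ballI)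
    fix x assume "x \<in> A E"
    then show "\<exists>T. openin (top_of_set M) T \<and> x \<in> T \<and> T \<subseteq> A E"
    proof (cases "x \<in> E")
      case True
      then show ?thesis using that by (intro exI[of _ E]) (auto simp: A_def)
    next
      case False
      then obtain T where T: "x \<in> M - Mst" "openin (top_of_set M) T" "x \<in> T" "T - {x} \<subseteq> E"
        using \<open>x \<in> A E\<close> unfolding A_def by blast
      then have "T \<subseteq> A E" using \<open>x \<in> A E\<close> unfolding A_def by blast
      then show ?thesis using T by blast
    qed
  qed
  have cover: "M \<subseteq> A E1 \<union> A E2"
  proof
    fix x assume x: "x \<in> M"
    show "x \<in> A E1 \<union> A E2"
    proof (cases "x \<in> Mst")
      case True then show ?thesis using E(3) by (auto simp: A_def)
    next
      case False
      obtain W h w where ch: "chart W h" "w \<in> W" "h w = x" using chart_exists[OF x] .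
      obtain e where e: "e > 0" "ball w e \<subseteq> W" "h ` (ball w e - {w}) \<subseteq> Mst"
        using axis_isolated[OF e1 ch(1,2)] False x ch(3) by (auto simp: Mst_def)
      have ch_cont: "continuous_on W h" and hi: "inj_on h W"
        using ch(1) unfolding local_param_def homeomorphism_def by (blast, metis inj_on_inverseI)
      have "connected (ball w e - {w})" by (rule connected_punctured_ball) simp
      then have con: "connected (h ` (ball w e - {w}))"
        by (rule connected_continuous_image[rotated]) (use continuous_on_subset[OF ch_cont] e(2) in blast)
      have op: "openin (top_of_set M) (h ` ball w e)"
        using local_param_D(2)[OF local_param_subset[OF ch(1) open_ball e(2)]] .
      have wb: "w \<in> ball w e" using e(1) by simp
      have im: "h ` ball w e - {x} \<subseteq> h ` (ball w e - {w})" using ch(3) by blast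
      have xin: "x \<in> h ` ball w e" using wb ch(3) by blast
      obtain O1 O2 where O: "open O1" "open O2" "E1 = Mst \<inter> O1" "E2 = Mst \<inter> O2" using E(1,2) unfolding openin_open by blast
      have "O1 \<inter> O2 \<inter> h ` (ball w e - {w}) = {}" "h ` (ball w e - {w}) \<subseteq> O1 \<union> O2"
        using e(3) E(3,4) O by blast+
      then have "O1 \<inter> h ` (ball w e - {w}) = {} \<or> O2 \<inter> h ` (ball w e - {w}) = {}"
        using connectedD[OF con O(1,2)] by blast
      then have "h ` (ball w e - {w}) \<subseteq> E1 \<or> h ` (ball w e - {w}) \<subseteq> E2"
        using \<open>h ` (ball w e - {w}) \<subseteq> O1 \<union> O2\<close> e(3) O(3,4) by blast
      then have "h ` ball w e - {x} \<subseteq> E1 \<or> h ` ball w e - {x} \<subseteq> E2" using im by blast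
      then show ?thesis using op xin x False unfolding A_def by blast
    qed
  qed
  \<comment> \<open>A common point would form an open set by itself, which no point of a surface
    does.\<close>
  have disj: "A E1 \<inter> A E2 = {}"
  proof (rule ccontr)
    assume "A E1 \<inter> A E2 \<noteq> {}"
    then obtain x where x: "x \<in> A E1" "x \<in> A E2" by blast
    have xM: "x \<in> M - Mst" using x E(4) EM unfolding A_def by blast
    then have nE: "x \<notin> E1" "x \<notin> E2" using EM by blast+
    obtain T1 where T1: "openin (top_of_set M) T1" "x \<in> T1" "T1 - {x} \<subseteq> E1" using x(1) nE unfolding A_def by blast
    obtain T2 where T2: "openin (top_of_set M) T2" "x \<in> T2" "T2 - {x} \<subseteq> E2" using x(2) nE unfolding A_def by blast
    have "T1 \<inter> T2 = {x}" using T1 T2 E(4) by blast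
    then have "openin (top_of_set M) {x}" using openin_Int[OF T1(1) T2(1)] by simp
    then obtain W h w where ch: "chart W h" "w \<in> W" "h w = x" "h ` W \<subseteq> {x}" by (rule chart_shrink) (simp, rule that)
    have "inj_on h W" using ch(1) unfolding local_param_def homeomorphism_def by (metis inj_on_inverseI)
    then have "W = {w}" using ch(2,3,4) unfolding inj_on_def by blast
    then show False using local_param_D(1)[OF ch(1)] not_open_singleton by metis
  qed
  have "connected M" using surf unfolding surface_with_gauss_map_def by blast
  then show False unfolding connected_openin
    using openA[OF E'(1)] openA[OF E'(2)] cover disj E(5,6) by (auto simp: A_def)
qed

text \<open>The product of the roots is \<open>- C\<^sup>2 / \<mu>\<close>, and the polynomial takes
  the nonnegative value \<open>q * (B (f x) (n x))\<^sup>2\<close> at the positive number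
  \<open>q = Q (n x) (n x)\<close> of any point. Hence the larger root is positive, and the smaller
  one is negative unless \<open>C = 0\<close>; in that case
  \<open>\<epsilon> * q \<ge> \<mu> * q\<^sup>2\<close> forces
  \<open>\<epsilon> = 1\<close>.\<close>

lemma exists_roots:
  assumes con: "connected Mst" and ne: "Mst \<noteq> {}"
  obtains C Cp Cm where "rot_surface_const a b c d \<epsilon> R Hb M f n \<phi> C Cp Cm"
    "Cm < 0 \<or> \<epsilon> = 1 \<and> C = 0 \<and> Cm = 0"
proof -
  obtain C where C: "\<And>x. x \<in> Mst \<Longrightarrow> Q (f x) (n x) + Q (n x) (n x) / Hb = C" using conserved[OF con] by metis
  define \<mu> where "\<mu> = 1 - 1 / Hb\<^sup>2"
  have "Hb\<^sup>2 > 0" using Hb by linarith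
  then have \<mu>: "\<mu> > 0" using Hb by (simp add: \<mu>_def divide_less_eq)
  define \<beta> where "\<beta> = \<epsilon> - 2 * C / Hb"
  \<comment> \<open>The leading coefficient is \<open>- \<mu>\<close>, so this is the root of the
    discriminant. It dominates \<open>\<bar>\<beta>\<bar>\<close>, which separates the roots by
    sign.\<close>
  define D where "D = sqrt (\<beta>\<^sup>2 + 4 * \<mu> * C\<^sup>2)"
  have D2: "D * D = \<beta> * \<beta> + 4 * \<mu> * C\<^sup>2" using \<mu> by (simp add: D_def power2_eq_square)
  have "\<bar>\<beta>\<bar> \<le> D" unfolding D_def using \<mu> by (intro real_le_rsqrt) simp
  define Cp Cm where "Cp = (\<beta> + D) / (2 * \<mu>)" and "Cm = (\<beta> - D) / (2 * \<mu>)"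
  have Cm: "Cm \<le> 0" using \<open>\<bar>\<beta>\<bar> \<le> D\<close> \<mu> by (simp add: Cm_def divide_le_0_iff)
  have sum: "\<mu> * (Cp + Cm) = \<beta>" using \<mu> by (simp add: Cp_def Cm_def add_divide_distrib[symmetric])
  have cp: "2 * \<mu> * Cp = \<beta> + D" "2 * \<mu> * Cm = \<beta> - D" using \<mu> by (simp_all add: Cp_def Cm_def)
  have "4 * \<mu>\<^sup>2 * (Cp * Cm) = (2 * \<mu> * Cp) * (2 * \<mu> * Cm)" by (simp add: power2_eq_square)
  also have "\<dots> = \<beta> * \<beta> - D * D" unfolding cp by (simp add: algebra_simps)
  finally have "4 * \<mu>\<^sup>2 * (Cp * Cm) = \<beta> * \<beta> - D * D" .
  then have e4: "(4 * \<mu>) * (\<mu> * (Cp * Cm)) = (4 * \<mu>) * (- C\<^sup>2)" unfolding D2 by (simp add: power2_eq_square algebra_simps)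
  have "4 * \<mu> \<noteq> 0" using \<mu> by simp
  from iffD1[OF mult_left_cancel[OF this] e4] have prod: "\<mu> * (Cp * Cm) = - C\<^sup>2" .
  have p: "p_poly \<epsilon> Hb C x = - \<mu> * x\<^sup>2 + \<beta> * x + C\<^sup>2" for x by (simp add: p_poly_def \<mu>_def \<beta>_def algebra_simps)
  have "\<mu> * (Cp - x) * (x - Cm) = \<mu> * (Cp + Cm) * x - \<mu> * x\<^sup>2 - \<mu> * (Cp * Cm)" for x
    by (simp add: power2_eq_square algebra_simps)
  then have fac: "p_poly \<epsilon> Hb C x = \<mu> * (Cp - x) * (x - Cm)" for x unfolding p sum prod by simp
  obtain x where x: "x \<in> Mst" using ne by blast
  obtain W h w where ch: "chart W h" "w \<in> W" "h w = x" using chart_exists[OF Mst_M[OF x]] .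
  note fr = frame_at[of h w, unfolded ch(3), OF x ch(1,2)]
  define q where "q = Q (n x) (n x)"
  have q: "q > 0" using fr(1) by (simp add: q_def)
  have Qfn: "Q (f x) (n x) = C - q / Hb" using C[OF x] by (simp add: q_def)
  have "q * (B (f x) (n x))\<^sup>2 = p_poly \<epsilon> Hb C q"
    unfolding fr(3) q_def[symmetric] Qfn p_poly_def using q Hb_nz by (simp add: field_simps power2_eq_square)
  then have pos: "p_poly \<epsilon> Hb C q \<ge> 0" using q by (metis less_imp_le mult_nonneg_nonneg zero_le_power2)
  have "q - Cm > 0" using q Cm by simp
  then have "Cp \<ge> q" using pos \<mu> unfolding fac by (simp add: zero_le_mult_iff)
  then have Cp: "Cp > 0" using q by simp
  have last: "Cm < 0 \<or> \<epsilon> = 1 \<and> C = 0 \<and> Cm = 0"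
  proof (cases "C = 0")
    case True
    then have "Cm = 0" using prod \<mu> Cp by simp
    have "- \<mu> * q\<^sup>2 + \<epsilon> * q \<ge> 0" using pos True unfolding p by (simp add: \<beta>_def)
    moreover have "\<mu> * q\<^sup>2 > 0" using \<mu> q by simp
    ultimately have "\<epsilon> * q > 0" by simp
    then have "\<epsilon> = 1" using eps q by (auto simp: zero_less_mult_iff)
    then show ?thesis using True \<open>Cm = 0\<close> by simp
  next
    case False
    then have "\<mu> * (Cp * Cm) < 0" unfolding prod by simp
    then show ?thesis using \<mu> Cp Cm by (auto simp: mult_less_0_iff)
  qed
  have "rot_surface_const a b c d \<epsilon> R Hb M f n \<phi> C Cp Cm"
    by unfold_locales (use con C fac Cp Cm in \<open>auto simp: \<mu>_def\<close>)
  then show ?thesis using last by (rule that)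
qed

end

context rot_surface_const begin

text \<open>For \<open>C = 0\<close> the conservation law gives
  \<open>Q F N / Q N N = - 1 / Hb\<close>, so the curvature of the orbit direction is
  \<open>Hb\<close>; then \<open>1/k1 + 1/k2 = 2/Hb\<close> makes the other one \<open>Hb\<close> as
  well.\<close>

lemma umbilic_tangent:
  assumes C0: "C = 0" and ch: "chart W h" "w \<in> W" and hw: "h w \<in> Mst"
  shows "DN h w v = - Hb *\<^sub>R DF h w v"
proof -
  define F N where "F = f (h w)" and "N = n (h w)"
  obtain v1 v2 Y where v: "DF h w v1 = X F" "DN h w v1 = X N" "DN h w v2 = Y"
    "DF h w v2 = - (2 / Hb + Q F N / Q N N) *\<^sub>R Y"
    and sp: "\<forall>v. \<exists>\<alpha> \<beta>. v = \<alpha> *\<^sub>R v1 + \<beta> *\<^sub>R v2"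
    by (rule meridian_at[OF ch hw, folded F_def N_def]) (rule that; assumption)
  note mf = Mst_facts[OF hw, folded F_def N_def]
  have Qfn: "Q F N = - Q N N / Hb" using mf(3) C0 by simp
  have "Q N N *\<^sub>R X F = Q F N *\<^sub>R X N" using QN_parallel[OF Mst_M[OF hw]] by (simp add: F_def N_def)
  then have "Q N N *\<^sub>R X F = Q N N *\<^sub>R ((- 1 / Hb) *\<^sub>R X N)" unfolding Qfn by simp
  then have "X F = (- 1 / Hb) *\<^sub>R X N" using mf(1) unfolding scaleR_cancel_left by simp
  then have 1: "DN h w v1 = - Hb *\<^sub>R DF h w v1" unfolding v using Hb_nz by simp
  have "2 / Hb + Q F N / Q N N = 1 / Hb" unfolding Qfn using mf(1) by (simp add: field_simps)
  then have 2: "DN h w v2 = - Hb *\<^sub>R DF h w v2" unfolding v using Hb_nz by simp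
  obtain \<alpha> \<beta> where ab: "v = \<alpha> *\<^sub>R v1 + \<beta> *\<^sub>R v2" using sp by blast
  show ?thesis
    unfolding ab linear_add[OF linear_DF[OF ch]] linear_scale[OF linear_DF[OF ch]] linear_add[OF linear_DN[OF ch]]
      linear_scale[OF linear_DN[OF ch]] 1 2 by (simp add: scaleR_add_right mult.commute)
qed

lemma umbilic:
  assumes C0: "C = 0" and e1: "\<epsilon> = 1"
  shows "totally_umbilic M f n"
  unfolding totally_umbilic_def
proof
  fix x assume x: "x \<in> M"
  obtain W h w where ch: "chart W h" "w \<in> W" "h w = x" using chart_exists[OF x] .
  have all: "DN h w v = - Hb *\<^sub>R DF h w v" for v
  proof (cases "x \<in> Mst")
    case True then show ?thesis using umbilic_tangent[OF C0 ch(1,2)] ch(3) by simp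
  next
    case False
    obtain e where e: "e > 0" "ball w e \<subseteq> W" "h ` (ball w e - {w}) \<subseteq> Mst"
      using axis_isolated[OF e1 ch(1,2)] False x ch(3) by (auto simp: Mst_def)
    \<comment> \<open>Axis points are limits of points off the axis, and both differentials are
      continuous in the chart.\<close>
    define g where "g z = DN h z v + Hb *\<^sub>R DF h z v" for z
    have "continuous_on W g" unfolding g_def[abs_def] DF_def DN_def
      by (intro continuous_intros C1_on_continuous_frechet local_param_D(3,4)[OF ch(1)])
    then have "isCont g w" using local_param_D(1)[OF ch(1)] ch(2) continuous_on_eq_continuous_at by blast
    then have "(g \<longlongrightarrow> g w) (at w)" by (simp add: isCont_def)
    moreover have "\<forall>\<^sub>F z in at w. g z = 0"
    proof -
      have "g z = 0" if "z \<in> ball w e" "z \<noteq> w" for z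
      proof -
        have "z \<in> W" "h z \<in> Mst" using that e(2,3) by blast+
        from umbilic_tangent[OF C0 ch(1) this, of v] show ?thesis by (simp add: g_def)
      qed
      then show ?thesis using eventually_at_ball[OF e(1), of w UNIV] eventually_at_filter
        unfolding eventually_at by (metis (no_types, lifting) dist_commute e(1) mem_ball)
    qed
    then have "(g \<longlongrightarrow> 0) (at w)" by (rule tendsto_eventually)
    ultimately have "g w = 0" using tendsto_unique[OF at_neq_bot] by blast
    then show ?thesis by (simp add: g_def eq_neg_iff_add_eq_0)
  qed
  have ind: "independent {(1::real, 0::real), (0, 1)}"
  proof -
    have "{(1::real, 0::real), (0, 1)} \<subseteq> Basis" by (auto simp: Basis_prod_def)
    then show ?thesis using independent_Basis independent_mono by blast
  qed
  have "principal_curvatures M f n x Hb Hb" unfolding principal_curvatures_def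
    by (intro exI[of _ W] exI[of _ h] exI[of _ w] exI[of _ "(1,0)"] exI[of _ "(0,1)"] conjI ch ind)
      (use all in \<open>auto simp: DF_def DN_def\<close>)
  then show "\<exists>k. principal_curvatures M f n x k k" by blast
qed

lemma profile_sq: "(profile_r \<Xi> Cp Cm t)\<^sup>2 = Cp * (cn (\<Xi> * t))\<^sup>2"
  using Cp by (simp add: profile_r_def pp_def[symmetric] power_mult_distrib)

lemma Pi_scaled_derivative:
  assumes nz: "\<And>u. u \<in> quarter pp \<Longrightarrow> 1 - k * (sn u)\<^sup>2 \<noteq> 0" and t: "\<Xi> * t \<in> quarter pp"
  shows "((\<lambda>t. (1 / \<Xi>) * ellip_Pi pp k (\<Xi> * t)) has_real_derivative 1 / (1 - k * (sn (\<Xi> * t))\<^sup>2)) (at t)"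
proof -
  have "((\<lambda>t. ellip_Pi pp k (\<Xi> * t)) has_real_derivative 1 / (1 - k * (sn (\<Xi> * t))\<^sup>2) * \<Xi>) (at t)"
  proof -
    have d: "(ellip_Pi pp k has_real_derivative 1 / (1 - k * (sn (\<Xi> * t))\<^sup>2)) (at (\<Xi> * t))"
      by (rule ellip_Pi_has_derivative) (use nz t in auto)
    have l: "((\<lambda>t. \<Xi> * t) has_real_derivative \<Xi>) (at t)" by (auto intro!: derivative_eq_intros)
    show ?thesis by (rule DERIV_chain2[of "ellip_Pi pp k" _ "\<lambda>t. \<Xi> * t", OF d l])
  qed
  from DERIV_cmult[OF this, of "1 / \<Xi>"] show ?thesis using \<Xi>(1) by simp
qed

text \<open>With \<open>k = \<kappa> * Cp / (\<kappa> * Cp - 1)\<close> the denominator in the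
  elliptic integral is \<open>(\<kappa> * r\<^sup>2 - 1) / (\<kappa> * Cp - 1)\<close>. For
  \<open>\<kappa> * Cp < 1\<close> it has no zero, as \<open>r\<^sup>2 \<le> Cp\<close>; this covers
  all hyperbolic rotations and the elliptic ones with \<open>Cp < 1\<close>.\<close>

lemma profile_psi_derivative:
  assumes \<kappa>: "\<kappa> * Cp < 1" and t: "\<Xi> * t \<in> quarter pp"
    and \<kappa>': "\<kappa> = 1 \<or> \<kappa> = -1"
  shows "(profile_psi \<kappa> Hb C Cp Cm has_real_derivative
      (1 / Hb) * (- \<kappa> + (Hb * C - \<kappa>) / (\<kappa> * (profile_r \<Xi> Cp Cm t)\<^sup>2 - 1))) (at t)"
proof -
  define k where "k = \<kappa> * Cp / (\<kappa> * Cp - 1)"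
  have kz: "1 - k * (sn u)\<^sup>2 = (\<kappa> * (Cp * (cn u)\<^sup>2) - 1) / (\<kappa> * Cp - 1)" for u
  proof -
    have s: "(sn u)\<^sup>2 = 1 - (cn u)\<^sup>2" using sn_cn[of u] by linarith
    show ?thesis unfolding s k_def using \<kappa> by (simp add: field_simps)
  qed
  have lt: "\<kappa> * (Cp * (cn u)\<^sup>2) < 1" for u
  proof -
    have "(cn u)\<^sup>2 \<le> 1" using sn_cn[of u] zero_le_power2[of "sn u"] by linarith
    then have "Cp * (cn u)\<^sup>2 \<le> Cp" using Cp by (simp add: mult_left_le)
    moreover have "0 \<le> Cp * (cn u)\<^sup>2" using Cp by simp
    ultimately show ?thesis using \<kappa> \<kappa>' by auto
  qed
  have nz: "1 - k * (sn u)\<^sup>2 \<noteq> 0" for u unfolding kz using lt[of u] \<kappa> by simp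
  have "((\<lambda>t. (1 / Hb) * (- \<kappa> * t + (Hb * C - \<kappa>) / (\<kappa> * Cp - 1) * ((1 / \<Xi>) * ellip_Pi pp k (\<Xi> * t)))) has_real_derivative
      (1 / Hb) * (- \<kappa> * 1 + (Hb * C - \<kappa>) / (\<kappa> * Cp - 1) * (1 / (1 - k * (sn (\<Xi> * t))\<^sup>2)))) (at t)"
  proof -
    have d: "((\<lambda>t. (1 / \<Xi>) * ellip_Pi pp k (\<Xi> * t)) has_real_derivative 1 / (1 - k * (sn (\<Xi> * t))\<^sup>2)) (at t)"
      by (rule Pi_scaled_derivative) (use nz t in auto)
    show ?thesis by (intro DERIV_cmult DERIV_add DERIV_ident d)
  qed
  moreover have "(Hb * C - \<kappa>) / (\<kappa> * Cp - 1) * (1 / (1 - k * (sn (\<Xi> * t))\<^sup>2)) = (Hb * C - \<kappa>) / (\<kappa> * (profile_r \<Xi> Cp Cm t)\<^sup>2 - 1)"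
    unfolding kz profile_sq using \<kappa> by simp
  moreover have "profile_psi \<kappa> Hb C Cp Cm = (\<lambda>t. (1 / Hb) * (- \<kappa> * t + (Hb * C - \<kappa>) / (\<kappa> * Cp - 1) * ((1 / \<Xi>) * ellip_Pi pp k (\<Xi> * t))))"
    by (simp add: profile_psi_def[abs_def] k_def \<Xi>_def pp_def mult.assoc)
  ultimately show ?thesis by (simp only: mult_1_right)
qed

end

text \<open>Dividing the parameter of the group by \<open>\<omega>\<close> normalizes the generator;
  the action on the surface is rescaled with it.\<close>

lemma rot_surface_exists:
  fixes M :: "'a::t2_space set"
  assumes Hb: "Hb\<^sup>2 > 1" and surf: "surface_with_gauss_map M f n" and ch: "constant_harmonic_mean_curvature M f n Hb"
    and rg: "rotation_group (span {a, b}) R" and inv: "invariant_under R M f"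
    and pf: "plane_frame a b c d \<epsilon>" and eps: "\<epsilon> = 1 \<or> \<epsilon> = 0 \<or> \<epsilon> = -1"
    and Qpos: "\<And>y. mink y y = -1 \<Longrightarrow> plane_frame.X a b y \<noteq> 0 \<Longrightarrow> plane_frame.Q a b y y > 0"
  obtains R' \<phi> where "rot_surface a b c d \<epsilon> R' Hb M f n \<phi>"
proof -
  interpret plane_frame a b c d \<epsilon> by (rule pf)
  obtain \<omega> where \<omega>: "\<omega> \<noteq> 0" "\<And>s x. ((\<lambda>s. R s x) has_vector_derivative \<omega> *\<^sub>R X (R s x)) (at s)"
    using rotation_group_generator[OF rg] by blast
  have lin: "linear (R s)" and iso: "mink (R s x) (R s y) = mink x y" and grp: "R (s + t) x = R s (R t x)" for s t x y
    using rg unfolding rotation_group_def by (auto simp: o_def)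
  have R0: "R 0 x = x" for x
  proof -
    have "mink (R 0 x - x) y = 0" for y
    proof -
      have "mink (R 0 (R 0 x - x)) (R 0 y) = 0" using grp[of 0 0 x] by (simp add: linear_diff[OF lin] mink_simps)
      then show ?thesis by (simp add: iso)
    qed
    then show ?thesis using mink_nondegenerate by fastforce
  qed
  obtain \<phi> where \<phi>: "\<forall>s. \<forall>x\<in>M. \<phi> s x \<in> M \<and> f (\<phi> s x) = R s (f x)" "\<forall>x\<in>M. \<phi> 0 x = x"
    "\<forall>s t. \<forall>x\<in>M. \<phi> (s + t) x = \<phi> s (\<phi> t x)" "continuous_on (UNIV \<times> M) (\<lambda>(s, x). \<phi> s x)"
    using inv unfolding invariant_under_def by blast
  define R' \<phi>' where "R' s = R (s / \<omega>)" and "\<phi>' s = \<phi> (s / \<omega>)" for s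
  have der: "((\<lambda>s. R' s x) has_vector_derivative X (R' s x)) (at s)" for s x
  proof -
    have "((\<lambda>s. s / \<omega>) has_vector_derivative 1 / \<omega>) (at s)"
      by (auto intro!: derivative_eq_intros simp: has_vector_derivative_def divide_inverse)
    from vector_diff_chain_at[OF this \<omega>(2)[of x "s / \<omega>"]] \<omega>(1) show ?thesis by (simp add: o_def R'_def)
  qed
  have cont: "continuous_on (UNIV \<times> M) (\<lambda>(s, x). \<phi>' s x)"
  proof -
    have "continuous_on (UNIV \<times> M) (\<lambda>y. (\<lambda>(s, x). \<phi> s x) (fst y / \<omega>, snd y))"
      by (rule continuous_on_compose2[OF \<phi>(4)]) (use \<omega>(1) in \<open>auto intro!: continuous_intros\<close>)
    then show ?thesis by (simp add: \<phi>'_def case_prod_unfold)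
  qed
  have hyp: "mink (f x) (f x) = -1" if "x \<in> M" for x
    using surf that unfolding surface_with_gauss_map_def hyperbolic3_def by auto
  have "rot_surface a b c d \<epsilon> R' Hb M f n \<phi>'"
  proof (intro rot_surface.intro flow.intro pf flow_axioms.intro rot_surface_axioms.intro)
    show "linear (R' s)" "mink (R' s x) (R' s y) = mink x y" "R' 0 x = x" "R' (s + t) x = R' s (R' t x)" for s t x y
      by (simp_all add: R'_def lin iso R0 grp add_divide_distrib)
    show "((\<lambda>s. R' s x) has_vector_derivative X (R' s x)) (at s)" for s x by (rule der)
    show "X (f x) \<noteq> 0 \<Longrightarrow> 0 < Q (f x) (f x)" if "x \<in> M" for x using Qpos hyp[OF that] by blast
  qed (use eps Hb surf ch \<phi> cont in \<open>auto simp: R'_def \<phi>'_def add_divide_distrib\<close>)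
  then show ?thesis by (rule that)
qed

section \<open>The angle for elliptic rotations across the value one of the squared radius\<close>

context rot_surface_const begin

abbreviation "r \<equiv> profile_r \<Xi> Cp Cm"

lemma r_deriv: assumes "\<Xi> * t \<in> quarter pp"
  shows "((\<lambda>t. (r t)\<^sup>2) has_real_derivative - 2 * Cp * \<Xi> * sn (\<Xi> * t) * cn (\<Xi> * t) * dn (\<Xi> * t)) (at t)"
proof -
  have l: "((\<lambda>t. \<Xi> * t) has_real_derivative \<Xi>) (at t)" by (auto intro!: derivative_eq_intros)
  have "((\<lambda>t. cn (\<Xi> * t)) has_real_derivative (- sn (\<Xi> * t) * dn (\<Xi> * t)) * \<Xi>) (at t)"
    by (rule DERIV_chain2[of cn _ "\<lambda>t. \<Xi> * t", OF cn_deriv[OF assms] l])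
  from DERIV_cmult[OF DERIV_power[OF this, of 2], of Cp]
  show ?thesis unfolding profile_sq by (simp add: algebra_simps)
qed

lemma r_le: "(r t)\<^sup>2 \<le> Cp"
proof -
  have "(cn (\<Xi> * t))\<^sup>2 \<le> 1" using sn_cn[of "\<Xi> * t"] zero_le_power2[of "sn (\<Xi> * t)"] by linarith
  then show ?thesis unfolding profile_sq using Cp by (simp add: mult_left_le)
qed

text \<open>The derivative of \<open>(r t)\<^sup>2\<close>, and so of
  \<open>(r t)\<^sup>2 - 1\<close>.\<close>

definition "wd t = - 2 * Cp * \<Xi> * sn (\<Xi> * t) * cn (\<Xi> * t) * dn (\<Xi> * t)"

context
  fixes J :: "real set" and \<alpha> \<beta> \<alpha>' \<beta>' :: "real \<Rightarrow> real"
  assumes e1: "\<epsilon> = 1" and J: "open J" "is_interval J" and Jq: "\<And>t. t \<in> J \<Longrightarrow> \<Xi> * t \<in> quarter pp"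
    and qnz: "\<And>t. t \<in> J \<Longrightarrow> C - (r t)\<^sup>2 / Hb \<noteq> 0"
    and \<alpha>: "\<And>t. t \<in> J \<Longrightarrow> (\<alpha> has_real_derivative \<alpha>' t) (at t)" and \<beta>: "\<And>t. t \<in> J \<Longrightarrow> (\<beta> has_real_derivative \<beta>' t) (at t)"
    and sq: "\<And>t. t \<in> J \<Longrightarrow> (\<alpha> t)\<^sup>2 - (\<beta> t)\<^sup>2 = (r t)\<^sup>2 - 1"
    and wr: "\<And>t. t \<in> J \<Longrightarrow> \<alpha> t * \<beta>' t - \<alpha>' t * \<beta> t = C - (r t)\<^sup>2 / Hb"
begin

lemma w_deriv: assumes "t \<in> J" shows "((\<lambda>t. (r t)\<^sup>2 - 1) has_real_derivative wd t) (at t)"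
  using DERIV_diff[OF r_deriv[OF Jq[OF assms]] DERIV_const[of 1]] by (simp add: wd_def)

lemma half_deriv: assumes t: "t \<in> J" shows "\<alpha> t * \<alpha>' t - \<beta> t * \<beta>' t = wd t / 2"
proof -
  have "((\<lambda>t. (\<alpha> t)\<^sup>2 - (\<beta> t)\<^sup>2) has_real_derivative 2 * (\<alpha> t * \<alpha>' t) - 2 * (\<beta> t * \<beta>' t)) (at t)"
    using DERIV_diff[OF DERIV_power[OF \<alpha>[OF t], of 2] DERIV_power[OF \<beta>[OF t], of 2]] by (simp add: algebra_simps)
  then have "((\<lambda>t. (r t)\<^sup>2 - 1) has_real_derivative 2 * (\<alpha> t * \<alpha>' t) - 2 * (\<beta> t * \<beta>' t)) (at t)"
    by (rule has_field_derivative_transform_within_open[OF _ J(1) t]) (use sq in auto)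
  from DERIV_unique[OF this w_deriv[OF t]] show ?thesis by simp
qed

text \<open>A null component of the Gauss map times the exponential of the matching angle is constant.\<close>

lemma null_component_deriv:
  assumes t: "t \<in> J" and s: "s = 1 \<or> s = -1" and nz: "(r t)\<^sup>2 - 1 \<noteq> 0"
    and g: "(g has_real_derivative (C - (r t)\<^sup>2 / Hb) / ((r t)\<^sup>2 - 1) - s / 2 * wd t / ((r t)\<^sup>2 - 1)) (at t)"
  shows "((\<lambda>t. (\<alpha> t - s * \<beta> t)\<^sup>2 * exp (2 * s * g t)) has_real_derivative 0) (at t)"
proof -
  define N N' w q where "N = \<alpha> t - s * \<beta> t" and "N' = \<alpha>' t - s * \<beta>' t" and "w = (r t)\<^sup>2 - 1" and "q = C - (r t)\<^sup>2 / Hb"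
  have ss: "s * s = 1" using s by auto
  have d: "((\<lambda>t. (\<alpha> t - s * \<beta> t)\<^sup>2 * exp (2 * s * g t)) has_real_derivative
      (2 * N * N') * exp (2 * s * g t) + exp (2 * s * g t) * (2 * s * (q / w - s / 2 * wd t / w)) * N\<^sup>2) (at t)"
  proof -
    have "((\<lambda>t. (\<alpha> t - s * \<beta> t)\<^sup>2) has_real_derivative 2 * N * N') (at t)"
      by (rule DERIV_cong[OF DERIV_power[OF DERIV_diff[OF \<alpha>[OF t] DERIV_cmult[OF \<beta>[OF t]]], where n = 2]])
        (simp add: N_def N'_def mult.commute mult.left_commute)
    moreover have "((\<lambda>t. exp (2 * s * g t)) has_real_derivative exp (2 * s * g t) * (2 * s * (q / w - s / 2 * wd t / w))) (at t)"
      unfolding w_def q_def by (intro DERIV_fun_exp DERIV_cmult g)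
    ultimately show ?thesis
      by (rule DERIV_cong[OF DERIV_mult]) (simp add: N_def)
  qed
  \<comment> \<open>Multiplying by the other null component turns \<open>N\<close> into
    \<open>w\<close> and \<open>N'\<close> into an expression in \<open>wd t\<close> and the
    Wronskian \<open>q\<close>; in this way \<open>N'\<close> is compared with \<open>N\<close>
    through \<open>w\<close>.\<close>
  have NO: "N * (\<alpha> t + s * \<beta> t) = w" using sq[OF t] ss by (simp add: N_def w_def power2_eq_square algebra_simps)
  have "N' * (\<alpha> t + s * \<beta> t) = (\<alpha> t * \<alpha>' t - (s * s) * (\<beta> t * \<beta>' t)) - s * (\<alpha> t * \<beta>' t - \<alpha>' t * \<beta> t)"
    by (simp add: N'_def algebra_simps)
  then have N'O: "N' * (\<alpha> t + s * \<beta> t) = wd t / 2 - s * q" unfolding ss wr[OF t] using half_deriv[OF t] by (simp add: q_def)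
  have w: "w \<noteq> 0" using nz by (simp add: w_def)
  have N'w: "N' * w = (wd t / 2 - s * q) * N" unfolding NO[symmetric] N'O[symmetric] by (simp add: algebra_simps)
  have "w * (2 * N * N' + (2 * s * (q / w - s / 2 * wd t / w)) * N\<^sup>2) = 2 * N * (N' * w) + (2 * s * q - (s * s) * wd t) * N\<^sup>2"
    using w by (simp add: field_simps power2_eq_square)
  also have "\<dots> = 0" unfolding N'w ss by (simp add: power2_eq_square algebra_simps)
  finally have z: "2 * N * N' + (2 * s * (q / w - s / 2 * wd t / w)) * N\<^sup>2 = 0" using w by simp
  have "(2 * N * N') * exp (2 * s * g t) + exp (2 * s * g t) * (2 * s * (q / w - s / 2 * wd t / w)) * N\<^sup>2
     = exp (2 * s * g t) * (2 * N * N' + (2 * s * (q / w - s / 2 * wd t / w)) * N\<^sup>2)" by (simp add: algebra_simps)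
  then show ?thesis using d unfolding z by simp
qed

text \<open>The claim is that \<open>\<alpha> t + \<beta> t\<close> is up to sign a constant
  multiple of \<open>sqrt \<bar>(r t)\<^sup>2 - 1\<bar> * exp \<psi>\<close>, with the same constant
  on both sides of \<open>(r t)\<^sup>2 = 1\<close>. By \<open>ellip_Pi_log\<close>,
  \<open>\<psi>\<close> is a part \<open>g\<close> without singularity plus
  \<open>bb * ln \<bar>W (\<Xi> * t)\<bar>\<close>, where \<open>2 * bb\<close> is \<open>1\<close>
  or \<open>-1\<close>. This sign decides which null component is to be combined with the
  exponential of \<open>g\<close>: the product \<open>h\<close> is constant off the zeros of
  \<open>W\<close>, and continuity carries the constant across them.\<close>

lemma growth_half:
  fixes \<sigma> :: real
  assumes Cp1: "Cp > 1" and H: "\<sigma> = -1 \<and> H = quarter pp \<inter> {0..} \<or> \<sigma> = 1 \<and> H = quarter pp \<inter> {..0}"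
  shows "\<exists>k>0. \<forall>t\<in>J. \<Xi> * t \<in> H \<longrightarrow> (r t)\<^sup>2 \<noteq> 1 \<longrightarrow>
    (\<alpha> t + \<beta> t)\<^sup>2 = k * \<bar>(r t)\<^sup>2 - 1\<bar> * exp (2 * profile_psi 1 Hb C Cp Cm t)"
proof -
  define k where "k = Cp / (Cp - 1)"
  have k1: "k > 1" using Cp1 by (simp add: k_def field_simps)
  define W W' m where "W u = 1 - k * (sn u)\<^sup>2" and "W' u = - 2 * k * sn u * cn u * dn u"
    and "m = \<sigma> / (2 * sqrt ((k - 1) * (1 - pp\<^sup>2 / k)))" for u
  obtain S where Sc: "continuous_on H S"
    and Sd: "\<forall>u\<in>H. W u \<noteq> 0 \<longrightarrow> (S has_real_derivative (1 - m * W' u) / W u) (at u)"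
    and SPi: "\<forall>u\<in>H. W u \<noteq> 0 \<longrightarrow> ellip_Pi pp k u = S u + m * ln \<bar>W u\<bar>"
    using ellip_Pi_log[OF k1 H] unfolding W_def W'_def m_def by blast
  have wW: "(r t)\<^sup>2 - 1 = (Cp - 1) * W (\<Xi> * t)" for t
  proof -
    have c: "(cn (\<Xi> * t))\<^sup>2 = 1 - (sn (\<Xi> * t))\<^sup>2" using sn_cn[of "\<Xi> * t"] by linarith
    show ?thesis unfolding profile_sq c W_def k_def using Cp1 by (simp add: field_simps)
  qed
  have wdW: "wd t = (Cp - 1) * \<Xi> * W' (\<Xi> * t)" for t
    unfolding wd_def W'_def k_def using Cp1 by (simp add: field_simps)
  define K where "K = (Hb * C - 1) / (Cp - 1)"
  define g where "g t = (1 / Hb) * (- t + K * ((1 / \<Xi>) * S (\<Xi> * t)))" for t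
  \<comment> \<open>The coefficient of the logarithm in \<open>\<psi>\<close>: the factors in front
    of \<open>ellip_Pi\<close> in \<open>profile_psi\<close> times the residue
    \<open>m\<close>.\<close>
  define bb where "bb = (1 / Hb) * K * (1 / \<Xi>) * m"
  have \<psi>: "profile_psi 1 Hb C Cp Cm t = g t + bb * ln \<bar>W (\<Xi> * t)\<bar>" if "\<Xi> * t \<in> H" "W (\<Xi> * t) \<noteq> 0" for t
  proof -
    have "profile_psi 1 Hb C Cp Cm t = (1 / Hb) * (- t + K * ((1 / \<Xi>) * ellip_Pi pp k (\<Xi> * t)))"
      by (simp add: profile_psi_def K_def k_def \<Xi>_def pp_def)
    moreover have "ellip_Pi pp k (\<Xi> * t) = S (\<Xi> * t) + m * ln \<bar>W (\<Xi> * t)\<bar>" using SPi that by blast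
    moreover have "A * (- t + K * (B * (s + m * L))) = A * (- t + K * (B * s)) + A * K * B * m * L" for A B s L :: real
      by (simp add: algebra_simps)
    ultimately show ?thesis by (simp only: g_def bb_def)
  qed
  \<comment> \<open>The value of \<open>p_poly 1 Hb C\<close> at \<open>1\<close> is the square
    \<open>(C - 1 / Hb)\<^sup>2\<close>, and by the factorization it is also
    \<open>\<mu> * (Cp - 1) * (1 - Cm)\<close>. The latter is what \<open>\<Xi>\<close> and
    \<open>m\<close> leave in the denominator.\<close>
  have bb2: "(2 * bb)\<^sup>2 = 1"
  proof -
    have \<sigma>2: "\<sigma>\<^sup>2 = 1" using H by auto
    have kk: "(k - 1) * (1 - pp\<^sup>2 / k) = (1 - Cm) / ((Cp - 1) * (Cp - Cm))"
    proof -
      have "k - 1 = 1 / (Cp - 1)" unfolding k_def using Cp1 by (simp add: field_simps)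
      moreover have "pp\<^sup>2 / k = (Cp - 1) / (Cp - Cm)" unfolding pp k_def using Cp1 Cm by simp
      moreover have "1 - (Cp - 1) / (Cp - Cm) = (1 - Cm) / (Cp - Cm)" using Cp1 Cm by (simp add: diff_divide_eq_iff)
      ultimately show ?thesis by simp
    qed
    have pos: "(1 - Cm) / ((Cp - 1) * (Cp - Cm)) > 0" using Cp1 Cm by simp
    have "m\<^sup>2 = (Cp - 1) * (Cp - Cm) / (4 * (1 - Cm))"
      unfolding m_def kk power_divide \<sigma>2 power_mult_distrib using pos Cp1 Cm by simp
    moreover have "4 * (u / (4 * v)) = u / v" for u v :: real by simp
    ultimately have m4: "4 * m\<^sup>2 = (Cp - 1) * (Cp - Cm) / (1 - Cm)" by (simp only:)
    have "(2 * bb)\<^sup>2 = (Hb * C - 1)\<^sup>2 / (Hb\<^sup>2 * (Cp - 1)\<^sup>2 * \<Xi>\<^sup>2) * (4 * m\<^sup>2)"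
      by (simp add: bb_def K_def power_mult_distrib power_divide)
    then have "(2 * bb)\<^sup>2 = (Hb * C - 1)\<^sup>2 / (Hb\<^sup>2 * (Cp - 1)\<^sup>2 * \<Xi>\<^sup>2) * ((Cp - 1) * (Cp - Cm) / (1 - Cm))" unfolding m4 .
    also have "\<dots> = (Hb * C - 1)\<^sup>2 / (Hb\<^sup>2 * \<mu> * ((Cp - 1) * (1 - Cm)))"
      unfolding \<Xi>(2) using Cp1 Cm Hb_nz \<mu> by (simp add: power2_eq_square)
    also have "(Hb * C - 1)\<^sup>2 = Hb\<^sup>2 * (\<mu> * (Cp - 1) * (1 - Cm))"
    proof -
      have "p_poly \<epsilon> Hb C 1 = (C - 1 / Hb)\<^sup>2" using e1 by (simp add: p_poly_def power2_eq_square algebra_simps)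
      then have "(C - 1 / Hb)\<^sup>2 = \<mu> * (Cp - 1) * (1 - Cm)" using factor[of 1] by (simp add: \<mu>_def)
      moreover have "(Hb * C - 1)\<^sup>2 = Hb\<^sup>2 * (C - 1 / Hb)\<^sup>2" using Hb_nz by (simp add: power2_eq_square field_simps)
      ultimately show ?thesis by simp
    qed
    finally show ?thesis using Cp1 Cm Hb_nz \<mu> by (simp add: mult.assoc)
  qed
  define s where "s = 2 * bb"
  have s: "s = 1 \<or> s = -1" using bb2 unfolding s_def by (rule power2_eq_1_iff[THEN iffD1])
  define h where "h t = (\<alpha> t - s * \<beta> t)\<^sup>2 * exp (2 * s * g t)" for t
  define JH where "JH = {t \<in> J. \<Xi> * t \<in> H}"
  have Hq: "H \<subseteq> quarter pp" using H by auto
  have hd: "(h has_real_derivative 0) (at t)" if t: "t \<in> JH" "W (\<Xi> * t) \<noteq> 0" for t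
    unfolding h_def[abs_def]
  proof (rule null_component_deriv[OF _ s])
    show tJ: "t \<in> J" using t by (simp add: JH_def)
    show w: "(r t)\<^sup>2 - 1 \<noteq> 0" unfolding wW using t(2) Cp1 by simp
    have l: "((\<lambda>t. \<Xi> * t) has_real_derivative \<Xi>) (at t)" by (auto intro!: derivative_eq_intros)
    have Sdt: "(S has_real_derivative (1 - m * W' (\<Xi> * t)) / W (\<Xi> * t)) (at (\<Xi> * t))" using Sd t by (simp add: JH_def)
    have "(g has_real_derivative (1 / Hb) * (- 1 + K * ((1 / \<Xi>) * ((1 - m * W' (\<Xi> * t)) / W (\<Xi> * t) * \<Xi>)))) (at t)"
      unfolding g_def[abs_def]
      by (intro DERIV_cmult DERIV_add DERIV_minus DERIV_ident DERIV_chain2[of S _ "\<lambda>t. \<Xi> * t", OF Sdt l])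
    moreover have "(1 / Hb) * (- 1 + K * ((1 / \<Xi>) * ((1 - m * W' (\<Xi> * t)) / W (\<Xi> * t) * \<Xi>)))
       = (C - (r t)\<^sup>2 / Hb) / ((r t)\<^sup>2 - 1) - s / 2 * wd t / ((r t)\<^sup>2 - 1)"
    proof -
      define v where "v = W (\<Xi> * t)"
      define v' where "v' = W' (\<Xi> * t)"
      have v: "v \<noteq> 0" using t(2) by (simp add: v_def)
      have r2: "(r t)\<^sup>2 = 1 + (Cp - 1) * v" using wW[of t] by (simp add: v_def)
      have ang: "(C - (r t)\<^sup>2 / Hb) / ((r t)\<^sup>2 - 1) = (1 / Hb) * (- 1 + K / v)"
        unfolding r2 K_def using v Cp1 Hb_nz by (simp add: field_simps)
      have res: "s / 2 * wd t / ((r t)\<^sup>2 - 1) = (1 / Hb) * K * m * v' / v"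
        unfolding r2 wdW s_def bb_def v'_def[symmetric] using v Cp1 \<Xi>(1) by simp
      have gen: "(1 / H) * (- 1 + k * ((1 / x) * ((1 - z * z') / u * x))) = (1 / H) * (- 1 + k / u) - (1 / H) * k * z * z' / u"
        if "H \<noteq> 0" "x \<noteq> 0" "u \<noteq> 0" for H k x z z' u :: real using that by (simp add: field_simps)
      show ?thesis unfolding v_def[symmetric] v'_def[symmetric] ang res by (rule gen) (use v Hb_nz \<Xi>(1) in auto)
    qed
    ultimately show "(g has_real_derivative (C - (r t)\<^sup>2 / Hb) / ((r t)\<^sup>2 - 1) - s / 2 * wd t / ((r t)\<^sup>2 - 1)) (at t)" by (rule DERIV_cong)
  qed
  have hc: "continuous_on JH h"
  proof -
    have c1: "continuous_on JH \<alpha>"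
    proof (intro continuous_at_imp_continuous_on ballI)
      fix t assume "t \<in> JH"
      then show "isCont \<alpha> t" using DERIV_isCont[OF \<alpha>[of t]] by (simp add: JH_def)
    qed
    have c2: "continuous_on JH \<beta>"
    proof (intro continuous_at_imp_continuous_on ballI)
      fix t assume "t \<in> JH"
      then show "isCont \<beta> t" using DERIV_isCont[OF \<beta>[of t]] by (simp add: JH_def)
    qed
    have c3: "continuous_on JH (\<lambda>t. S (\<Xi> * t))"
      by (rule continuous_on_compose2[OF Sc continuous_on_mult[OF continuous_on_const continuous_on_id]]) (auto simp: JH_def)
    show ?thesis unfolding h_def[abs_def] g_def[abs_def]
      by (intro continuous_on_mult continuous_on_power continuous_on_diff continuous_on_exp continuous_on_const continuous_on_add
          continuous_on_minus continuous_on_id c1 c2 c3)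
  qed
  \<comment> \<open>At a zero of \<open>W\<close>, \<open>sn\<close> is \<open>sqrt (1 / k)\<close>
    or its negative, and \<open>sn\<close> is injective on \<open>quarter pp\<close>.\<close>
  have fin: "finite {t \<in> JH. W (\<Xi> * t) = 0}"
  proof -
    have one: "finite {t. \<Xi> * t \<in> quarter pp \<and> sn (\<Xi> * t) = y}" for y
    proof (cases "{t. \<Xi> * t \<in> quarter pp \<and> sn (\<Xi> * t) = y} = {}")
      case False
      then obtain t where t: "\<Xi> * t \<in> quarter pp" "sn (\<Xi> * t) = y" by blast
      have "{t. \<Xi> * t \<in> quarter pp \<and> sn (\<Xi> * t) = y} \<subseteq> {t}"
      proof
        fix x assume "x \<in> {t. \<Xi> * t \<in> quarter pp \<and> sn (\<Xi> * t) = y}"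
        then have "\<Xi> * x = \<Xi> * t" using sn_inj[OF _ t(1), of "\<Xi> * x"] t(2) by simp
        then show "x \<in> {t}" using \<Xi>(1) by simp
      qed
      then show ?thesis using finite_subset by blast
    next
      case True show ?thesis unfolding True by (rule finite.emptyI)
    qed
    have "{t \<in> JH. W (\<Xi> * t) = 0} \<subseteq> {t. \<Xi> * t \<in> quarter pp \<and> sn (\<Xi> * t) = sqrt (1 / k)} \<union> {t. \<Xi> * t \<in> quarter pp \<and> sn (\<Xi> * t) = - sqrt (1 / k)}"
    proof
      fix t assume "t \<in> {t \<in> JH. W (\<Xi> * t) = 0}"
      then have t: "\<Xi> * t \<in> quarter pp" "W (\<Xi> * t) = 0" using Hq by (auto simp: JH_def)
      have "(sn (\<Xi> * t))\<^sup>2 = (sqrt (1 / k))\<^sup>2" using t(2) k1 by (simp add: W_def field_simps)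
      then show "t \<in> {t. \<Xi> * t \<in> quarter pp \<and> sn (\<Xi> * t) = sqrt (1 / k)} \<union> {t. \<Xi> * t \<in> quarter pp \<and> sn (\<Xi> * t) = - sqrt (1 / k)}"
        using t(1) unfolding power2_eq_iff by blast
    qed
    then show ?thesis by (rule finite_subset) (intro finite_UnI one)
  qed
  have JHi: "{x..y} \<subseteq> JH" if "x \<in> JH" "y \<in> JH" for x y
  proof
    fix z assume z: "z \<in> {x..y}"
    have zJ: "z \<in> J" using mem_is_interval_1_I[OF J(2), of x y z] that z by (auto simp: JH_def)
    have "\<Xi> * x \<le> \<Xi> * z" "\<Xi> * z \<le> \<Xi> * y" using z \<Xi>(1) by simp_all
    then show "z \<in> JH" using Jq[OF zJ] that zJ H unfolding JH_def by auto
  qed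
  have le: "h x = h y" if "x \<in> JH" "y \<in> JH" "x \<le> y" for x y
  proof -
    have "h y = h x"
    proof (rule has_derivative_zero_unique_strong_interval[OF fin, of x y h])
      show "continuous_on {x..y} h" using continuous_on_subset[OF hc JHi[OF that(1,2)]] .
      show "(h has_derivative (\<lambda>h. 0)) (at z within {x..y})" if "z \<in> {x..y} - {t \<in> JH. W (\<Xi> * t) = 0}" for z
      proof -
        have "z \<in> JH" "W (\<Xi> * z) \<noteq> 0" using that JHi[OF \<open>x \<in> JH\<close> \<open>y \<in> JH\<close>] by blast+
        from has_field_derivative_at_within[OF hd[OF this], of "{x..y}"] show ?thesis
          by (simp add: has_field_derivative_def lambda_zero)
      qed
    qed (use that in auto)
    then show ?thesis by simp
  qed
  have const: "h x = h y" if "x \<in> JH" "y \<in> JH" for x y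
  proof (cases "x \<le> y")
    case True then show ?thesis by (rule le[OF that])
  next
    case False
    then have "y \<le> x" by simp
    then show ?thesis by (rule le[OF that(2,1), symmetric])
  qed
  show ?thesis
  proof (cases "\<exists>t0\<in>JH. (r t0)\<^sup>2 \<noteq> 1")
    case False
    then show ?thesis by (intro exI[of _ 1]) (auto simp: JH_def)
  next
    case True
    then obtain t0 where t0: "t0 \<in> JH" "(r t0)\<^sup>2 \<noteq> 1" by blast
    have prod: "(\<alpha> t - s * \<beta> t) * (\<alpha> t + s * \<beta> t) = (r t)\<^sup>2 - 1" if "t \<in> JH" for t
    proof -
      have "(\<alpha> t - s * \<beta> t) * (\<alpha> t + s * \<beta> t) = (\<alpha> t)\<^sup>2 - (\<beta> t)\<^sup>2" using s by (auto simp: power2_eq_square algebra_simps)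
      then show ?thesis using sq that by (simp add: JH_def)
    qed
    have "\<alpha> t0 - s * \<beta> t0 \<noteq> 0"
    proof
      assume z: "\<alpha> t0 - s * \<beta> t0 = 0"
      have "(r t0)\<^sup>2 - 1 = 0" using prod[OF t0(1)] unfolding z by simp
      then show False using t0(2) by simp
    qed
    then have hpos: "h t0 > 0" unfolding h_def by (intro mult_pos_pos) simp_all
    define c0 where "c0 = h t0"
    have hc0: "h t = c0" if "t \<in> JH" for t using const[OF that t0(1)] by (simp add: c0_def)
    have c0: "c0 > 0" using hpos by (simp add: c0_def)
    \<comment> \<open>For \<open>s = 1\<close> the constant \<open>c0\<close> concerns
      \<open>\<alpha> t - \<beta> t\<close> and is passed on to
      \<open>\<alpha> t + \<beta> t\<close> by their product \<open>(r t)\<^sup>2 - 1\<close>; for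
      \<open>s = -1\<close> it concerns \<open>\<alpha> t + \<beta> t\<close> directly. The factors
      \<open>Cp - 1\<close> come from
      \<open>(r t)\<^sup>2 - 1 = (Cp - 1) * W (\<Xi> * t)\<close>.\<close>
    define k0 where "k0 = (if s = 1 then (Cp - 1) / c0 else c0 / (Cp - 1))"
    have "(\<alpha> t + \<beta> t)\<^sup>2 = k0 * \<bar>(r t)\<^sup>2 - 1\<bar> * exp (2 * profile_psi 1 Hb C Cp Cm t)" if t: "t \<in> JH" "(r t)\<^sup>2 \<noteq> 1" for t
    proof -
      have v: "W (\<Xi> * t) \<noteq> 0" using t(2) wW[of t] by auto
      define A where "A = \<bar>W (\<Xi> * t)\<bar>"
      have A: "A > 0" using v by (simp add: A_def)
      have w: "\<bar>(r t)\<^sup>2 - 1\<bar> = (Cp - 1) * A" unfolding wW A_def using Cp1 by (simp add: abs_mult)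
      have e: "exp (2 * profile_psi 1 Hb C Cp Cm t) = exp (2 * g t) * exp (s * ln A)"
        using \<psi>[of t] t(1) v by (simp add: JH_def A_def s_def exp_add[symmetric] algebra_simps)
      show ?thesis
      proof (cases "s = 1")
        case True
        have h1: "(\<alpha> t - \<beta> t)\<^sup>2 * exp (2 * g t) = c0" using hc0[OF t(1)] True by (simp add: h_def)
        have "((\<alpha> t - \<beta> t) * (\<alpha> t + \<beta> t))\<^sup>2 = (\<bar>(r t)\<^sup>2 - 1\<bar>)\<^sup>2" using prod[OF t(1)] True by simp
        then have "(\<alpha> t - \<beta> t)\<^sup>2 * (\<alpha> t + \<beta> t)\<^sup>2 = ((Cp - 1) * A)\<^sup>2" unfolding w power_mult_distrib by simp
        then have "c0 * (\<alpha> t + \<beta> t)\<^sup>2 = ((Cp - 1) * A)\<^sup>2 * exp (2 * g t)" unfolding h1[symmetric] by (simp add: mult.commute mult.left_commute)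
        then have "(\<alpha> t + \<beta> t)\<^sup>2 = ((Cp - 1) * A)\<^sup>2 * exp (2 * g t) / c0" using c0 by (simp add: field_simps)
        then show ?thesis unfolding e w k0_def using True A c0 by (simp add: power2_eq_square)
      next
        case False
        then have sm: "s = -1" using s by simp
        have h1: "(\<alpha> t + \<beta> t)\<^sup>2 * exp (- (2 * g t)) = c0" using hc0[OF t(1)] sm by (simp add: h_def)
        have "exp (- (2 * g t)) * exp (2 * g t) = 1" by (simp add: exp_minus)
        then have "(\<alpha> t + \<beta> t)\<^sup>2 = c0 * exp (2 * g t)" unfolding h1[symmetric] by (simp add: mult.assoc)
        then show ?thesis unfolding e w k0_def using sm A Cp1 by (simp add: exp_minus)
      qed
    qed
    moreover have "k0 > 0" using c0 Cp1 by (simp add: k0_def)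
    ultimately show ?thesis by (intro exI[of _ k0]) (auto simp: JH_def)
  qed
qed

text \<open>Here \<open>(r t)\<^sup>2 < 1\<close> on all of \<open>J\<close>, so
  \<open>\<psi>\<close> has no singularity. For \<open>Cp = 1\<close> the polynomial gives
  \<open>Hb * C = 1\<close>, and the value \<open>(r t)\<^sup>2 = 1\<close> is excluded because the
  Wronskian \<open>C - (r t)\<^sup>2 / Hb\<close> does not vanish.\<close>

lemma growth_small:
  assumes Cp1: "Cp \<le> 1" and J0: "J \<noteq> {}"
  shows "\<exists>k>0. \<forall>t\<in>J. (r t)\<^sup>2 \<noteq> 1 \<longrightarrow>
    (\<alpha> t + \<beta> t)\<^sup>2 = k * \<bar>(r t)\<^sup>2 - 1\<bar> * exp (2 * profile_psi 1 Hb C Cp Cm t)"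
proof -
  define \<psi> where "\<psi> = profile_psi 1 Hb C Cp Cm"
  have C1: "Hb * C = 1" if "Cp = 1"
  proof -
    have "p_poly \<epsilon> Hb C 1 = (C - 1 / Hb)\<^sup>2" using e1 by (simp add: p_poly_def power2_eq_square algebra_simps)
    then have "(C - 1 / Hb)\<^sup>2 = 0" using factor[of 1] that by simp
    then show ?thesis using Hb_nz by (simp add: field_simps)
  qed
  have w: "(r t)\<^sup>2 < 1" if t: "t \<in> J" for t
  proof (cases "Cp = 1")
    case True
    have "(r t)\<^sup>2 \<noteq> 1" using qnz[OF t] C1[OF True] Hb_nz by (auto simp: field_simps)
    then show ?thesis using r_le[of t] True by simp
  qed (use r_le[of t] Cp1 in simp)
  have \<psi>d: "(\<psi> has_real_derivative (C - (r t)\<^sup>2 / Hb) / ((r t)\<^sup>2 - 1)) (at t)" if t: "t \<in> J" for t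
  proof (cases "Cp = 1")
    case True
    \<comment> \<open>The coefficient \<open>(Hb * C - 1) / (Cp - 1)\<close> is formally
      \<open>0 / 0\<close>, hence \<open>0\<close>, and only the linear term of
      \<open>\<psi>\<close> remains.\<close>
    have "\<psi> = (\<lambda>t. (1 / Hb) * (- t))" using C1[OF True] by (simp add: \<psi>_def profile_psi_def[abs_def])
    moreover have "((\<lambda>t. (1 / Hb) * (- t)) has_real_derivative (1 / Hb) * (- 1)) (at t)"
      by (intro DERIV_cmult DERIV_minus DERIV_ident)
    ultimately have \<psi>1: "(\<psi> has_real_derivative (1 / Hb) * (- 1)) (at t)" by simp
    have "C = 1 / Hb" using C1[OF True] Hb_nz by (simp add: field_simps)
    then have "(C - (r t)\<^sup>2 / Hb) / ((r t)\<^sup>2 - 1) = (1 / Hb) * (- 1)" using w[OF t] Hb_nz by (simp add: field_simps)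
    with \<psi>1 show ?thesis by simp
  next
    case False
    then have "(\<psi> has_real_derivative (1 / Hb) * (- 1 + (Hb * C - 1) / (1 * (r t)\<^sup>2 - 1))) (at t)"
      unfolding \<psi>_def using Cp1 Jq[OF t] by (intro profile_psi_derivative) auto
    moreover have "(1 / Hb) * (- 1 + (Hb * C - 1) / (1 * (r t)\<^sup>2 - 1)) = (C - (r t)\<^sup>2 / Hb) / ((r t)\<^sup>2 - 1)"
      using w[OF t] Hb_nz by (simp add: field_simps)
    ultimately show ?thesis by simp
  qed
  \<comment> \<open>The added logarithm supplies the term with \<open>wd\<close> that
    \<open>null_component_deriv\<close> expects for \<open>s = -1\<close>.\<close>
  define g where "g t = \<psi> t + ln (1 - (r t)\<^sup>2) / 2" for t
  define h where "h t = (\<alpha> t - (-1) * \<beta> t)\<^sup>2 * exp (2 * (-1) * g t)" for t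
  have "(h has_vector_derivative 0) (at t within J)" if t: "t \<in> J" for t
  proof -
    have "((\<lambda>t. ln (1 - (r t)\<^sup>2)) has_real_derivative (- wd t) / (1 - (r t)\<^sup>2)) (at t)"
    proof -
      have d: "((\<lambda>t. 1 - (r t)\<^sup>2) has_real_derivative 0 - wd t) (at t)"
        unfolding wd_def by (intro DERIV_diff DERIV_const r_deriv[OF Jq[OF t]])
      have "(ln has_real_derivative 1 / (1 - (r t)\<^sup>2)) (at (1 - (r t)\<^sup>2))" using w[OF t] by (intro DERIV_ln_divide) simp
      from DERIV_chain2[of ln _ "\<lambda>t. 1 - (r t)\<^sup>2", OF this d] show ?thesis by simp
    qed
    then have g1: "(g has_real_derivative (C - (r t)\<^sup>2 / Hb) / ((r t)\<^sup>2 - 1) + ((- wd t) / (1 - (r t)\<^sup>2)) / 2) (at t)"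
      unfolding g_def[abs_def] by (intro DERIV_add \<psi>d[OF t] DERIV_cdivide)
    have eq: "((- wd t) / (1 - (r t)\<^sup>2)) / 2 = - ((-1) / 2 * wd t / ((r t)\<^sup>2 - 1))"
      using w[OF t] by (simp add: field_simps)
    have "(g has_real_derivative (C - (r t)\<^sup>2 / Hb) / ((r t)\<^sup>2 - 1) - (-1) / 2 * wd t / ((r t)\<^sup>2 - 1)) (at t)"
      by (rule DERIV_cong[OF g1]) (unfold eq, rule add_uminus_conv_diff)
    then have "(h has_real_derivative 0) (at t)" unfolding h_def[abs_def]
      using w[OF t] by (intro null_component_deriv[OF t]) auto
    then show ?thesis by (simp add: has_real_derivative_iff_has_vector_derivative has_vector_derivative_at_within)
  qed
  then obtain k where k: "\<And>t. t \<in> J \<Longrightarrow> h t = k"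
    using has_vector_derivative_zero_constant[OF is_interval_convex[OF J(2)], of h] by blast
  have eq: "(\<alpha> t + \<beta> t)\<^sup>2 = k * \<bar>(r t)\<^sup>2 - 1\<bar> * exp (2 * \<psi> t)" if t: "t \<in> J" for t
  proof -
    have "exp (2 * g t) = exp (2 * \<psi> t) * (1 - (r t)\<^sup>2)" using w[OF t] by (simp add: g_def exp_add)
    moreover have "(\<alpha> t + \<beta> t)\<^sup>2 = k * exp (2 * g t)" using k[OF t] by (simp add: h_def exp_minus field_simps)
    ultimately show ?thesis using w[OF t] by simp
  qed
  obtain t where t: "t \<in> J" using J0 by blast
  have "k > 0"
  proof -
    have "k = (\<alpha> t + \<beta> t)\<^sup>2 * exp (2 * (-1) * g t)" using k[OF t] by (simp add: h_def)
    moreover have "\<alpha> t + \<beta> t \<noteq> 0"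
    proof
      assume "\<alpha> t + \<beta> t = 0"
      then have "(\<alpha> t)\<^sup>2 - (\<beta> t)\<^sup>2 = 0" by (simp add: square_diff_square_factored power2_eq_square)
      then show False using sq[OF t] w[OF t] by simp
    qed
    ultimately show ?thesis by simp
  qed
  then show ?thesis using eq unfolding \<psi>_def by blast
qed

text \<open>The two halves of the parameter interval give two constants. They are equal if
  \<open>0\<close> lies in the interval, since both formulas hold at \<open>0\<close>, where
  \<open>(r 0)\<^sup>2 = Cp > 1\<close>; otherwise the interval lies in one half.\<close>

lemma growth:
  assumes J0: "J \<noteq> {}"
  shows "\<exists>k>0. \<forall>t\<in>J. (r t)\<^sup>2 \<noteq> 1 \<longrightarrow>
    (\<alpha> t + \<beta> t)\<^sup>2 = k * \<bar>(r t)\<^sup>2 - 1\<bar> * exp (2 * profile_psi 1 Hb C Cp Cm t)"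
proof (cases "Cp \<le> 1")
  case True then show ?thesis by (rule growth_small[OF _ J0])
next
  case False
  then have Cp1: "Cp > 1" by simp
  define E where "E t = \<bar>(r t)\<^sup>2 - 1\<bar> * exp (2 * profile_psi 1 Hb C Cp Cm t)" for t
  obtain k1 where k1: "k1 > 0" "\<And>t. t \<in> J \<Longrightarrow> t \<ge> 0 \<Longrightarrow> (r t)\<^sup>2 \<noteq> 1 \<Longrightarrow> (\<alpha> t + \<beta> t)\<^sup>2 = k1 * E t"
    using growth_half[OF Cp1, of "-1" "quarter pp \<inter> {0..}"] Jq \<Xi>(1) unfolding E_def by (auto simp: mult.assoc)
  obtain k2 where k2: "k2 > 0" "\<And>t. t \<in> J \<Longrightarrow> t \<le> 0 \<Longrightarrow> (r t)\<^sup>2 \<noteq> 1 \<Longrightarrow> (\<alpha> t + \<beta> t)\<^sup>2 = k2 * E t"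
    using growth_half[OF Cp1, of 1 "quarter pp \<inter> {..0}"] Jq \<Xi>(1) unfolding E_def by (auto simp: mult.assoc mult_le_0_iff)
  have "\<exists>k>0. \<forall>t\<in>J. (r t)\<^sup>2 \<noteq> 1 \<longrightarrow> (\<alpha> t + \<beta> t)\<^sup>2 = k * E t"
  proof (cases "0 \<in> J")
    case True
    have r0: "(r 0)\<^sup>2 = Cp" unfolding profile_sq by (simp add: jacobi_cn_def am_0)
    then have "E 0 \<noteq> 0" using Cp1 by (simp add: E_def)
    then have "k1 = k2" using k1(2)[OF True] k2(2)[OF True] r0 Cp1 by simp
    have "(\<alpha> t + \<beta> t)\<^sup>2 = k1 * E t" if t: "t \<in> J" "(r t)\<^sup>2 \<noteq> 1" for t
    proof (cases "t \<ge> 0")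
      case True then show ?thesis by (rule k1(2)[OF t(1) _ t(2)])
    next
      case False
      then have "t \<le> 0" by simp
      then show ?thesis unfolding \<open>k1 = k2\<close> by (rule k2(2)[OF t(1) _ t(2)])
    qed
    then show ?thesis using k1(1) by blast
  next
    case False
    have "(\<forall>t\<in>J. t \<ge> 0) \<or> (\<forall>t\<in>J. t \<le> 0)"
    proof (rule ccontr)
      assume "\<not> ?thesis"
      then obtain x y where "x \<in> J" "y \<in> J" "x < 0" "y > 0" by (auto simp: not_le)
      then have "0 \<in> J" using mem_is_interval_1_I[OF J(2), of x y 0] by simp
      then show False using False by simp
    qed
    then show ?thesis using k1 k2 by blast
  qed
  then show ?thesis by (simp add: E_def mult.assoc)
qed

end

end

section \<open>Coordinates of the Gauss map for each type of rotation\<close>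

context rot_surface_const begin

lemma profile_frame:
  assumes "m = X y" "mink m m = 1" and Xn: "X N = \<rho> *\<^sub>R m"
  shows "mink N m * \<rho> = 0" "mink N (X m) = - \<rho>" "X (X m) = - \<epsilon> *\<^sub>R m" "mink (X m) (X m) = \<epsilon>" "mink (X m) m = 0"
    "mink m c = 0" "mink m d = 0" "mink (X m) c = 0" "mink (X m) d = 0"
proof -
  show "mink N m * \<rho> = 0" using X_skew'[of N] Xn by (simp add: mink_simps mult.commute)
  show "mink N (X m) = - \<rho>" using X_skew[of N m] Xn assms(2) by (simp add: mink_simps)
  show XX: "X (X m) = - \<epsilon> *\<^sub>R m" unfolding assms(1) by (rule XXX)
  show "mink (X m) (X m) = \<epsilon>" using X_skew[of m "X m"] XX assms(2) by (simp add: mink_simps)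
  show "mink (X m) m = 0" using X_skew'[of m] mink_commute by metis
  have "mink (X z) c = 0" "mink (X z) d = 0" for z by (simp_all add: X_def mink_simps frame_simps)
  then show "mink m c = 0" "mink m d = 0" "mink (X m) c = 0" "mink (X m) d = 0" unfolding assms(1) by blast+
qed

lemma parametrizes_profile:
  assumes J: "open J" "is_interval J" "J \<noteq> {}" "(\<lambda>(s, t). \<phi> s (\<gamma> t)) ` (UNIV \<times> J) = Mst"
    "\<And>w. w \<in> UNIV \<times> J \<Longrightarrow> \<exists>W. w \<in> W \<and> W \<subseteq> UNIV \<times> J \<and> chart W (\<lambda>(s, t). \<phi> s (\<gamma> t))"
  shows "parametrizes (\<lambda>(s, t). \<phi> s (\<gamma> t)) J M f n (span {a, b})"
  unfolding parametrizes_def using J unfolding Mst_eq by blast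

lemma coordinate_derivative:
  assumes "((\<lambda>t. N t) has_vector_derivative Y) (at t)"
  shows "((\<lambda>t. mink (N t) z) has_real_derivative mink Y z) (at t)"
  using mink.has_vector_derivative[OF assms has_vector_derivative_const[of z]]
  by (simp add: has_real_derivative_iff_has_vector_derivative mink_simps)

end

context rot_surface_const begin

text \<open>The complement is a Euclidean plane in which the Gauss map has length
  \<open>sqrt ((r t)\<^sup>2 + 1)\<close>. The Wronskian makes its polar angle grow like
  \<open>\<psi>\<close>, so turning it back by \<open>\<psi>\<close> and normalizing gives a
  constant unit vector \<open>(k1, k2)\<close>, which is absorbed in the basis.\<close>

lemma hyperbolic_case:
  assumes e: "\<epsilon> = -1" and cd: "mink c c = 1" "mink d d = 1" "mink c d = 0" and ne: "Mst \<noteq> {}"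
  shows "\<exists>e0 e1 e2 e3 J \<Phi>. orthonormal_basis e0 e1 e2 e3 \<and> span {e0, e1} = span {a, b} \<and>
     parametrizes \<Phi> J M f n (span {a, b}) \<and>
     (\<forall>\<theta>. \<forall>t\<in>J. n (\<Phi> (\<theta>, t)) = in_basis (e0, e1, e2, e3) (hyperbolic_coords Hb C Cp Cm \<theta> t))"
proof -
  obtain J \<gamma> m y where J: "open J" "is_interval J" "J \<noteq> {}" "(\<lambda>(s, t). \<phi> s (\<gamma> t)) ` (UNIV \<times> J) = Mst"
    "\<And>w. w \<in> UNIV \<times> J \<Longrightarrow> \<exists>W. w \<in> W \<and> W \<subseteq> UNIV \<times> J \<and> chart W (\<lambda>(s, t). \<phi> s (\<gamma> t))"
    and m: "m = X y" "mink m m = 1" and \<gamma>: "\<And>t. t \<in> J \<Longrightarrow> \<gamma> t \<in> Mst" and Jq: "\<And>t. t \<in> J \<Longrightarrow> \<Xi> * t \<in> quarter pp"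
    and Xn: "\<And>t. t \<in> J \<Longrightarrow> X (n (\<gamma> t)) = r t *\<^sub>R m"
    and rp: "\<And>t. t \<in> J \<Longrightarrow> r t > 0 \<and> C - (r t)\<^sup>2 / Hb \<noteq> 0"
    and NY: "\<And>t. t \<in> J \<Longrightarrow> \<exists>Y. ((\<lambda>t. n (\<gamma> t)) has_vector_derivative Y) (at t) \<and> B (n (\<gamma> t)) Y = C - (r t)\<^sup>2 / Hb"
    by (rule gauss_map_profile[OF ne]) (rule that; assumption)
  define N where "N t = n (\<gamma> t)" for t
  obtain Y where Y: "\<And>t. t \<in> J \<Longrightarrow> (N has_vector_derivative Y t) (at t) \<and> B (N t) (Y t) = C - (r t)\<^sup>2 / Hb"
    using NY unfolding N_def[symmetric] by metis
  note pf = profile_frame[OF m Xn, folded N_def]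
  have pm: "mink (X m) (X m) = \<epsilon>" "mink (X m) m = 0" "mink m c = 0" "mink m d = 0" "mink (X m) c = 0" "mink (X m) d = 0" "X (X m) = - \<epsilon> *\<^sub>R m"
    using pf J(3) by blast+
  \<comment> \<open>The reversed \<open>d\<close> orients the plane so that the polar angle changes
    with \<open>\<psi>\<close> and not with \<open>- \<psi>\<close>.\<close>
  have ob0: "orthonormal_basis (X m) m c (- d)" unfolding orthonormal_basis_def using pm e m(2) cd by (simp add: mink_simps)
  define p q where "p t = mink (N t) c" and "q t = - mink (N t) d" for t
  have Nm: "mink (N t) m = 0" "mink (N t) (X m) = - r t" if "t \<in> J" for t using pf(1,2)[OF that] rp[OF that] by auto
  have Ne: "N t = r t *\<^sub>R X m + p t *\<^sub>R c + q t *\<^sub>R (- d)" if "t \<in> J" for t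
    by (rule trans[OF orthonormal_basis_expansion[OF ob0, of "N t"]]) (simp add: Nm[OF that] p_def q_def mink_simps)
  have pq: "(p t)\<^sup>2 + (q t)\<^sup>2 = (r t)\<^sup>2 + 1" if "t \<in> J" for t
  proof -
    have "mink (N t) (N t) = 1" using mink_fn(2)[OF Mst_M[OF \<gamma>[OF that]]] by (simp add: N_def)
    moreover have "mink (N t) (N t) = - (r t)\<^sup>2 + (p t)\<^sup>2 + (q t)\<^sup>2"
      unfolding Ne[OF that] using pm cd e mink_commute[of c "X m"] mink_commute[of d "X m"] mink_commute[of d c]
      by (simp add: mink_simps power2_eq_square)
    ultimately show ?thesis by simp
  qed
  define \<psi> where "\<psi> = profile_psi (-1) Hb C Cp Cm"
  have pd: "(p has_real_derivative mink (Y t) c) (at t)" "(q has_real_derivative - mink (Y t) d) (at t)" if "t \<in> J" for t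
    unfolding p_def[abs_def] q_def[abs_def] using coordinate_derivative Y[OF that] by (auto intro: DERIV_minus)
  have wr: "p t * mink (Y t) d + q t * mink (Y t) c = C - (r t)\<^sup>2 / Hb" if "t \<in> J" for t
    using Y[OF that] by (simp add: B_def p_def q_def)
  have \<psi>d: "(\<psi> has_real_derivative - (C - (r t)\<^sup>2 / Hb) / ((r t)\<^sup>2 + 1)) (at t)" if "t \<in> J" for t
  proof -
    have "(\<psi> has_real_derivative (1 / Hb) * (- (-1) + (Hb * C - (-1)) / ((-1) * (r t)\<^sup>2 - 1))) (at t)"
      unfolding \<psi>_def using Cp Jq[OF that] by (intro profile_psi_derivative) auto
    moreover have "(1 / Hb) * (- (-1) + (Hb * C - (-1)) / ((-1) * (r t)\<^sup>2 - 1)) = - (C - (r t)\<^sup>2 / Hb) / ((r t)\<^sup>2 + 1)"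
    proof -
      define u where "u = (r t)\<^sup>2 + 1"
      have u: "u > 0" "(r t)\<^sup>2 = u - 1" by (simp_all add: u_def add_nonneg_pos)
      show ?thesis unfolding u(2) using u(1) Hb_nz by (simp add: field_simps)
    qed
    ultimately show ?thesis by simp
  qed
  define A where "A t = (p t * cos (\<psi> t) + q t * sin (\<psi> t)) / sqrt ((r t)\<^sup>2 + 1)" for t
  define D where "D t = (q t * cos (\<psi> t) - p t * sin (\<psi> t)) / sqrt ((r t)\<^sup>2 + 1)" for t
  have zero: "(A has_real_derivative 0) (at t)" "(D has_real_derivative 0) (at t)" if t: "t \<in> J" for t
  proof -
    define p' q' u w where "p' = mink (Y t) c" and "q' = - mink (Y t) d" and "u = (r t)\<^sup>2 + 1" and "w = wd t"
    have u: "u > 0" by (simp add: u_def add_nonneg_pos)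
    have ud: "((\<lambda>t. (r t)\<^sup>2 + 1) has_real_derivative w) (at t)"
      using DERIV_add[OF r_deriv[OF Jq[OF t]] DERIV_const[of 1]] by (simp add: w_def wd_def)
    have "((\<lambda>t. (p t)\<^sup>2 + (q t)\<^sup>2) has_real_derivative 2 * (p t * p') + 2 * (q t * q')) (at t)"
      using DERIV_add[OF DERIV_power[OF pd(1)[OF t], where n = 2] DERIV_power[OF pd(2)[OF t], where n = 2]]
      by (simp add: p'_def q'_def mult.commute mult.left_commute)
    then have "((\<lambda>t. (r t)\<^sup>2 + 1) has_real_derivative 2 * (p t * p') + 2 * (q t * q')) (at t)"
      by (rule has_field_derivative_transform_within_open[OF _ J(1) t]) (use pq in auto)
    then have w: "w = 2 * (p t * p' + q t * q')" using DERIV_unique[OF ud] by simp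
    define \<psi>' where "\<psi>' = (p t * q' - q t * p') / u"
    have \<psi>': "(\<psi> has_real_derivative \<psi>') (at t)"
    proof -
      have "- (C - (r t)\<^sup>2 / Hb) = p t * q' - q t * p'" using wr[OF t] by (simp add: p'_def q'_def)
      then show ?thesis using \<psi>d[OF t] by (simp add: \<psi>'_def u_def)
    qed
    have uu: "u = (p t)\<^sup>2 + (q t)\<^sup>2" using pq[OF t] by (simp add: u_def)
    have s: "((\<lambda>t. 1 / sqrt ((r t)\<^sup>2 + 1)) has_real_derivative - w / (2 * u) * (1 / sqrt u)) (at t)"
    proof -
      have "(sqrt has_real_derivative inverse (sqrt u) / 2) (at ((r t)\<^sup>2 + 1))" using DERIV_real_sqrt[OF u] by (simp add: u_def)
      from DERIV_divide[OF DERIV_const[of 1] DERIV_chain2[of sqrt _ "\<lambda>t. (r t)\<^sup>2 + 1", OF this ud]]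
      have "((\<lambda>t. 1 / sqrt ((r t)\<^sup>2 + 1)) has_real_derivative - (inverse (sqrt u) / 2 * w) / (sqrt u * sqrt u)) (at t)"
        using u by (simp add: u_def)
      moreover have "- (inverse (sqrt u) / 2 * w) / (sqrt u * sqrt u) = - w / (2 * u) * (1 / sqrt u)"
        using u by (simp add: field_simps)
      ultimately show ?thesis by simp
    qed
    note c' = DERIV_chain2[of cos _ \<psi>, OF DERIV_cos \<psi>'] and s' = DERIV_chain2[of sin _ \<psi>, OF DERIV_sin \<psi>']
    note dp = pd(1)[OF t, folded p'_def] and dq = pd(2)[OF t, folded q'_def]
    \<comment> \<open>Used for \<open>A\<close> with cosine and sine, and for \<open>D\<close> with
      the pair turned by a right angle; both pairs turn at the rate \<open>\<psi>'\<close>.\<close>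
    have alg: "(x' * cs + x * (- sn' * \<psi>') + (z' * sn' + z * (cs * \<psi>'))) + (x * cs + z * sn') * (- w / (2 * u)) = 0"
      if "x * x + z * z = u" "w = 2 * (x * x' + z * z')" "\<psi>' = (x * z' - z * x') / u" for x x' z z' cs sn' :: real
    proof -
      have "u * \<psi>' = x * z' - z * x'" using that(3) u by simp
      have "u * ((x' * cs + x * (- sn' * \<psi>') + (z' * sn' + z * (cs * \<psi>'))) + (x * cs + z * sn') * (- w / (2 * u)))
        = u * x' * cs - x * sn' * (u * \<psi>') + u * z' * sn' + z * cs * (u * \<psi>') - (x * cs + z * sn') * (w / 2)"
        using u by (simp add: field_simps)
      also have "\<dots> = 0" unfolding \<open>u * \<psi>' = _\<close> that(2) unfolding that(1)[symmetric] by (simp add: algebra_simps)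
      finally show ?thesis using u by simp
    qed
    have "((\<lambda>t. (p t * cos (\<psi> t) + q t * sin (\<psi> t)) * (1 / sqrt ((r t)\<^sup>2 + 1))) has_real_derivative
       ((p' * cos (\<psi> t) + - sin (\<psi> t) * \<psi>' * p t) + (q' * sin (\<psi> t) + cos (\<psi> t) * \<psi>' * q t)) * (1 / sqrt ((r t)\<^sup>2 + 1))
        + (- w / (2 * u) * (1 / sqrt u)) * (p t * cos (\<psi> t) + q t * sin (\<psi> t))) (at t)"
      by (intro DERIV_mult DERIV_add dp dq c' s' s)
    moreover have "((p' * cos (\<psi> t) + - sin (\<psi> t) * \<psi>' * p t) + (q' * sin (\<psi> t) + cos (\<psi> t) * \<psi>' * q t)) * (1 / sqrt ((r t)\<^sup>2 + 1))
        + (- w / (2 * u) * (1 / sqrt u)) * (p t * cos (\<psi> t) + q t * sin (\<psi> t)) = (1 / sqrt u) *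
       ((p' * cos (\<psi> t) + p t * (- sin (\<psi> t) * \<psi>') + (q' * sin (\<psi> t) + q t * (cos (\<psi> t) * \<psi>'))) + (p t * cos (\<psi> t) + q t * sin (\<psi> t)) * (- w / (2 * u)))"
      unfolding u_def[symmetric] by (simp add: algebra_simps)
    ultimately show "(A has_real_derivative 0) (at t)"
      using alg[of "p t" "q t" p' q' "cos (\<psi> t)" "sin (\<psi> t)"] uu w \<psi>'_def unfolding A_def[abs_def] by (simp add: power2_eq_square)
    have "((\<lambda>t. (q t * cos (\<psi> t) - p t * sin (\<psi> t)) * (1 / sqrt ((r t)\<^sup>2 + 1))) has_real_derivative
       ((q' * cos (\<psi> t) + - sin (\<psi> t) * \<psi>' * q t) - (p' * sin (\<psi> t) + cos (\<psi> t) * \<psi>' * p t)) * (1 / sqrt ((r t)\<^sup>2 + 1))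
        + (- w / (2 * u) * (1 / sqrt u)) * (q t * cos (\<psi> t) - p t * sin (\<psi> t))) (at t)"
      by (intro DERIV_mult DERIV_diff dp dq c' s' s)
    moreover have "((q' * cos (\<psi> t) + - sin (\<psi> t) * \<psi>' * q t) - (p' * sin (\<psi> t) + cos (\<psi> t) * \<psi>' * p t)) * (1 / sqrt ((r t)\<^sup>2 + 1))
        + (- w / (2 * u) * (1 / sqrt u)) * (q t * cos (\<psi> t) - p t * sin (\<psi> t)) = (1 / sqrt u) *
       ((p' * (- sin (\<psi> t)) + p t * (- cos (\<psi> t) * \<psi>') + (q' * cos (\<psi> t) + q t * ((- sin (\<psi> t)) * \<psi>'))) + (p t * (- sin (\<psi> t)) + q t * cos (\<psi> t)) * (- w / (2 * u)))"
      unfolding u_def[symmetric] by (simp add: algebra_simps)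
    ultimately show "(D has_real_derivative 0) (at t)"
      using alg[of "p t" "q t" p' q' "- sin (\<psi> t)" "cos (\<psi> t)"] uu w \<psi>'_def unfolding D_def[abs_def] by (simp add: power2_eq_square)
  qed
  have conv: "convex J" using is_interval_convex[OF J(2)] .
  obtain k1 where k1: "\<And>t. t \<in> J \<Longrightarrow> A t = k1"
    using has_field_derivative_zero_constant[OF conv, of A] zero(1) has_field_derivative_at_within by blast
  obtain k2 where k2: "\<And>t. t \<in> J \<Longrightarrow> D t = k2"
    using has_field_derivative_zero_constant[OF conv, of D] zero(2) has_field_derivative_at_within by blast
  have sol: "p t = sqrt ((r t)\<^sup>2 + 1) * (k1 * cos (\<psi> t) - k2 * sin (\<psi> t))" "q t = sqrt ((r t)\<^sup>2 + 1) * (k1 * sin (\<psi> t) + k2 * cos (\<psi> t))"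
    and kk: "k1\<^sup>2 + k2\<^sup>2 = 1" if t: "t \<in> J" for t
  proof -
    define S where "S = sqrt ((r t)\<^sup>2 + 1)"
    have S: "S > 0" "S\<^sup>2 = (r t)\<^sup>2 + 1" by (simp_all add: S_def add_nonneg_pos)
    have 1: "S * k1 = p t * cos (\<psi> t) + q t * sin (\<psi> t)" "S * k2 = q t * cos (\<psi> t) - p t * sin (\<psi> t)"
      using k1[OF t] k2[OF t] S(1) by (auto simp: A_def D_def S_def[symmetric])
    have gen: "(P * u + Q * v) * u - (Q * u - P * v) * v = P * (u * u + v * v)"
      "(P * u + Q * v) * v + (Q * u - P * v) * u = Q * (u * u + v * v)"
      "(P * u + Q * v)\<^sup>2 + (Q * u - P * v)\<^sup>2 = (P\<^sup>2 + Q\<^sup>2) * (u * u + v * v)" for P Q u v :: real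
      by (simp_all add: power2_eq_square algebra_simps)
    have "S * (k1 * cos (\<psi> t) - k2 * sin (\<psi> t)) = (S * k1) * cos (\<psi> t) - (S * k2) * sin (\<psi> t)" by (simp add: algebra_simps)
    also have "\<dots> = p t" unfolding 1 gen by simp
    finally show "p t = sqrt ((r t)\<^sup>2 + 1) * (k1 * cos (\<psi> t) - k2 * sin (\<psi> t))" unfolding S_def[symmetric] by (rule sym)
    have "S * (k1 * sin (\<psi> t) + k2 * cos (\<psi> t)) = (S * k1) * sin (\<psi> t) + (S * k2) * cos (\<psi> t)" by (simp add: algebra_simps)
    also have "\<dots> = q t" unfolding 1 gen by simp
    finally show "q t = sqrt ((r t)\<^sup>2 + 1) * (k1 * sin (\<psi> t) + k2 * cos (\<psi> t))" unfolding S_def[symmetric] by (rule sym)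
    have "S\<^sup>2 * (k1\<^sup>2 + k2\<^sup>2) = (S * k1)\<^sup>2 + (S * k2)\<^sup>2" by (simp add: power_mult_distrib algebra_simps)
    also have "\<dots> = S\<^sup>2" unfolding 1 gen pq[OF t] S(2) by simp
    finally show "k1\<^sup>2 + k2\<^sup>2 = 1" using S(1) by simp
  qed
  \<comment> \<open>The orthonormal pair \<open>c\<close>, \<open>- d\<close> turned by the constant
    angle of \<open>(k1, k2)\<close>.\<close>
  define e2 e3 where "e2 = k1 *\<^sub>R c - k2 *\<^sub>R d" and "e3 = - k2 *\<^sub>R c - k1 *\<^sub>R d"
  have kk': "k1 * k1 + k2 * k2 = 1" using kk J(3) by (auto simp: power2_eq_square)
  have ob: "orthonormal_basis (X m) m e2 e3"
    unfolding orthonormal_basis_def e2_def e3_def using pm e m(2) cd kk' mink_commute[of d c]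
    by (simp add: mink_simps algebra_simps)
  have sp: "span {X m, m} = span {a, b}" using span_rotated_frame[OF m, of 1] by simp
  have XE: "X c = 0" "X d = 0" by (simp_all add: X_def frame_simps)
  have R1: "R \<theta> (X m) = cosh \<theta> *\<^sub>R X m + sinh \<theta> *\<^sub>R m" for \<theta>
  proof (rule R_unique)
    fix s
    have "((\<lambda>s. cosh s *\<^sub>R X m + sinh s *\<^sub>R m) has_vector_derivative sinh s *\<^sub>R X m + cosh s *\<^sub>R m) (at s)"
      by (auto intro!: derivative_eq_intros has_vector_derivative_scaleR simp: has_real_derivative_iff_has_vector_derivative[symmetric])
    then show "((\<lambda>s. cosh s *\<^sub>R X m + sinh s *\<^sub>R m) has_vector_derivative X (cosh s *\<^sub>R X m + sinh s *\<^sub>R m)) (at s)"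
      unfolding X_simps pm(7) e by (simp add: add.commute)
  qed simp
  have final: "n (\<phi> \<theta> (\<gamma> t)) = in_basis (X m, m, e2, e3) (hyperbolic_coords Hb C Cp Cm \<theta> t)" if t: "t \<in> J" for \<theta> t
  proof -
    define S where "S = sqrt ((r t)\<^sup>2 + 1)"
    have "n (\<phi> \<theta> (\<gamma> t)) = R \<theta> (N t)" using n_\<phi>[OF Mst_M[OF \<gamma>[OF t]]] by (simp add: N_def)
    also have "\<dots> = r t *\<^sub>R (cosh \<theta> *\<^sub>R X m + sinh \<theta> *\<^sub>R m) + p t *\<^sub>R c + q t *\<^sub>R (- d)"
      by (subst Ne[OF t]) (simp only: linear_add[OF linear_R] linear_scale[OF linear_R] linear_neg[OF linear_R] R1 R_perp)
    also have "\<dots> = (r t * cosh \<theta>) *\<^sub>R X m + (r t * sinh \<theta>) *\<^sub>R m + (p t *\<^sub>R c + q t *\<^sub>R (- d))"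
      by (simp add: algebra_simps)
    also have "p t *\<^sub>R c + q t *\<^sub>R (- d) = (S * cos (\<psi> t)) *\<^sub>R e2 + (S * sin (\<psi> t)) *\<^sub>R e3"
      unfolding sol[OF t] S_def[symmetric] e2_def e3_def by (simp add: vec_eq_iff algebra_simps)
    finally show ?thesis
      by (simp add: hyperbolic_coords_def Let_def \<Xi>_def[symmetric] \<psi>_def[symmetric] S_def add.assoc)
  qed
  show ?thesis
    by (intro exI[of _ "X m"] exI[of _ m] exI[of _ e2] exI[of _ e3] exI[of _ J] exI[of _ "\<lambda>(s, t). \<phi> s (\<gamma> t)"] conjI ob sp
        parametrizes_profile J) (use final in auto)
qed

end

context rot_surface_const begin

text \<open>The Wronskian of \<open>r\<close> and \<open>w\<close> determines the derivative of
  \<open>w t / r t\<close>, so that \<open>w t / r t - \<psi> t\<close> is a constant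
  \<open>k\<close>. A change of pseudo-orthonormal basis fixing \<open>v\<close> and
  \<open>m\<close> removes \<open>k\<close>, and the remaining coordinate follows from the unit
  length of the Gauss map.\<close>

lemma parabolic_case:
  assumes e: "\<epsilon> = 0" and cb': "c = b" and dd: "mink d d = 1" and ne: "Mst \<noteq> {}"
    and par: "par_Cp Hb C = Cp" "par_Cm Hb C = Cm" "par_Xi C = \<Xi>"
  shows "\<exists>v e1 u e2 J \<Phi>. pseudo_orthonormal_basis v e1 u e2 \<and> span {v, e1} = span {a, b} \<and>
     parametrizes \<Phi> J M f n (span {a, b}) \<and>
     (\<forall>\<theta>. \<forall>t\<in>J. n (\<Phi> (\<theta>, t)) = in_basis (v, e1, u, e2) (parabolic_coords Hb C \<theta> t))"
proof -
  obtain J \<gamma> m y where J: "open J" "is_interval J" "J \<noteq> {}" "(\<lambda>(s, t). \<phi> s (\<gamma> t)) ` (UNIV \<times> J) = Mst"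
    "\<And>w. w \<in> UNIV \<times> J \<Longrightarrow> \<exists>W. w \<in> W \<and> W \<subseteq> UNIV \<times> J \<and> chart W (\<lambda>(s, t). \<phi> s (\<gamma> t))"
    and m: "m = X y" "mink m m = 1" and \<gamma>: "\<And>t. t \<in> J \<Longrightarrow> \<gamma> t \<in> Mst" and Jq: "\<And>t. t \<in> J \<Longrightarrow> \<Xi> * t \<in> quarter pp"
    and Xn: "\<And>t. t \<in> J \<Longrightarrow> X (n (\<gamma> t)) = r t *\<^sub>R m"
    and rp: "\<And>t. t \<in> J \<Longrightarrow> r t > 0 \<and> C - (r t)\<^sup>2 / Hb \<noteq> 0"
    and NY: "\<And>t. t \<in> J \<Longrightarrow> \<exists>Y. ((\<lambda>t. n (\<gamma> t)) has_vector_derivative Y) (at t) \<and> B (n (\<gamma> t)) Y = C - (r t)\<^sup>2 / Hb"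
    by (rule gauss_map_profile[OF ne]) (rule that; assumption)
  define N where "N t = n (\<gamma> t)" for t
  obtain Y where Y: "\<And>t. t \<in> J \<Longrightarrow> (N has_vector_derivative Y t) (at t) \<and> B (N t) (Y t) = C - (r t)\<^sup>2 / Hb"
    using NY unfolding N_def[symmetric] by metis
  note pf = profile_frame[OF m Xn, folded N_def]
  define v where "v = X m"
  have pm: "mink v v = 0" "mink v m = 0" "mink m d = 0" "mink v d = 0" "X v = 0"
    using pf J(3) e unfolding v_def by auto
  define p where "p = mink y a"
  define q0 where "q0 = mink y b"
  have me: "m = p *\<^sub>R b - q0 *\<^sub>R a" unfolding m(1) p_def q0_def X_def ..
  have ve: "v = (- q0) *\<^sub>R b" unfolding v_def me X_def using e by (simp add: mink_simps frame_simps)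
  have q2: "q0 * q0 = 1" using m(2) e unfolding me by (simp add: mink_simps frame_simps)
  then have q1: "q0 = 1 \<or> q0 = -1" by (metis power2_eq_1_iff power2_eq_square)
  have "v \<noteq> 0" unfolding ve using q1 b_nz by auto
  then obtain u d' where ob0: "pseudo_orthonormal_basis v m u d'"
    using complete_null_plane[of m v] m(2) pm mink_commute[of m v] by metis
  note o0 = ob0[unfolded pseudo_orthonormal_basis_def]
  have "d = - mink d u *\<^sub>R v + mink d d' *\<^sub>R d'"
    by (rule trans[OF pseudo_orthonormal_basis_expansion[OF ob0, of d]]) (use pm mink_commute[of d m] mink_commute[of d v] in simp)
  then obtain k1 k2 where de: "d = k1 *\<^sub>R v + k2 *\<^sub>R d'" by blast
  have k22: "k2 * k2 = 1" using dd o0 mink_commute[of d' v] unfolding de by (simp add: mink_simps)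
  \<comment> \<open>\<open>b\<close> is \<open>v\<close> up to sign, and \<open>d\<close> is
    \<open>d'\<close> up to sign and a multiple of \<open>v\<close>. With this sign in
    \<open>e2\<close>, \<open>B\<close> is minus the minor of the products with \<open>v\<close> and
    \<open>e2\<close>.\<close>
  define s where "s = q0 * k2"
  have ss: "s * s = 1" unfolding s_def using q2 k22 by (simp add: mult.assoc mult.left_commute)
  have sc: "s = 1 \<or> s = -1" using ss by (metis power2_eq_1_iff power2_eq_square)
  define e2 where "e2 = s *\<^sub>R d'"
  have ob: "pseudo_orthonormal_basis v m u e2" using o0 ss unfolding pseudo_orthonormal_basis_def e2_def by (simp add: mink_simps)
  note o = ob[unfolded pseudo_orthonormal_basis_def]
  have be: "b = (- q0) *\<^sub>R v" unfolding ve using q2 by simp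
  have Be: "B x z = - (mink x v * mink z e2 - mink x e2 * mink z v)" for x z
    unfolding B_def unfolding cb' unfolding be de e2_def s_def using q2 by (simp add: mink_simps algebra_simps)
  define w where "w t = mink (N t) e2" for t
  have Nv: "mink (N t) v = - r t" "mink (N t) m = 0" if "t \<in> J" for t
    using pf(1,2)[OF that] rp[OF that] by (auto simp: v_def)
  have Ne: "N t = - mink (N t) u *\<^sub>R v + r t *\<^sub>R u + w t *\<^sub>R e2" if "t \<in> J" for t
    by (rule trans[OF pseudo_orthonormal_basis_expansion[OF ob, of "N t"]]) (simp add: Nv[OF that] w_def)
  have wd: "(w has_real_derivative mink (Y t) e2) (at t)" if "t \<in> J" for t
    unfolding w_def[abs_def] using coordinate_derivative Y[OF that] by auto
  have rd: "(r has_real_derivative - mink (Y t) v) (at t)" if "t \<in> J" for t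
  proof -
    have "((\<lambda>t. - mink (N t) v) has_real_derivative - mink (Y t) v) (at t)" using coordinate_derivative Y[OF that] by (auto intro: DERIV_minus)
    then show ?thesis by (rule has_field_derivative_transform_within_open[OF _ J(1) that]) (use Nv in auto)
  qed
  define \<psi> where "\<psi> = par_psi Hb C"
  have \<psi>d: "(\<psi> has_real_derivative C / (r t)\<^sup>2 - 1 / Hb) (at t)" if "t \<in> J" for t
  proof -
    \<comment> \<open>With parameter \<open>1\<close> the integrand of \<open>ellip_Pi\<close> is
      the inverse square of \<open>cn\<close>, finite on \<open>quarter pp\<close>, and multiplied
      by \<open>C / Cp\<close> it is \<open>C / (r t)\<^sup>2\<close>.\<close>
    have cp: "1 - 1 * (sn u)\<^sup>2 = (cn u)\<^sup>2" for u using sn_cn[of u] by linarith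
    have d1: "((\<lambda>t. (1 / \<Xi>) * ellip_Pi pp 1 (\<Xi> * t)) has_real_derivative 1 / (1 - 1 * (sn (\<Xi> * t))\<^sup>2)) (at t)"
    proof (rule Pi_scaled_derivative[OF _ Jq[OF that]])
      show "1 - 1 * (sn u)\<^sup>2 \<noteq> 0" if "u \<in> quarter pp" for u unfolding cp using cn_pos[OF that] by simp
    qed
    have "((\<lambda>t. - (1 / Hb) * t + C / Cp * ((1 / \<Xi>) * ellip_Pi pp 1 (\<Xi> * t))) has_real_derivative - (1 / Hb) * 1 + C / Cp * (1 / (1 - 1 * (sn (\<Xi> * t))\<^sup>2))) (at t)"
      by (intro DERIV_add DERIV_cmult DERIV_ident d1)
    moreover have "\<psi> = (\<lambda>t. - (1 / Hb) * t + C / Cp * ((1 / \<Xi>) * ellip_Pi pp 1 (\<Xi> * t)))"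
      by (simp add: \<psi>_def par_psi_def[abs_def] par pp_def mult.assoc)
    moreover have "- (1 / Hb) * 1 + C / Cp * (1 / (1 - 1 * (sn (\<Xi> * t))\<^sup>2)) = C / (r t)\<^sup>2 - 1 / Hb"
      unfolding cp profile_sq by simp
    ultimately show ?thesis by (simp only:)
  qed
  have "((\<lambda>t. w t / r t - \<psi> t) has_real_derivative 0) (at t)" if t: "t \<in> J" for t
  proof -
    define w' r' where "w' = mink (Y t) e2" and "r' = - mink (Y t) v"
    have rt: "r t > 0" using rp[OF t] by simp
    have "B (N t) (Y t) = r t * w' - w t * r'" unfolding Be Nv(1)[OF t] by (simp add: w_def w'_def r'_def)
    then have wr: "r t * w' - w t * r' = C - (r t)\<^sup>2 / Hb" using Y[OF t] by simp
    have "((\<lambda>t. w t / r t - \<psi> t) has_real_derivative (w' * r t - w t * r') / (r t * r t) - (C / (r t)\<^sup>2 - 1 / Hb)) (at t)"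
      using wd[OF t] rd[OF t] rt unfolding w'_def r'_def by (intro DERIV_diff DERIV_divide \<psi>d[OF t]) auto
    moreover have "(w' * r t - w t * r') / (r t * r t) = (C - (r t)\<^sup>2 / Hb) / (r t)\<^sup>2" using wr by (simp add: mult.commute power2_eq_square)
    then have "(w' * r t - w t * r') / (r t * r t) - (C / (r t)\<^sup>2 - 1 / Hb) = 0" using rt by (simp add: diff_divide_distrib)
    ultimately show ?thesis by simp
  qed
  then obtain k where k: "\<And>t. t \<in> J \<Longrightarrow> w t / r t - \<psi> t = k"
    using has_field_derivative_zero_constant[OF is_interval_convex[OF J(2)], of "\<lambda>t. w t / r t - \<psi> t"] has_field_derivative_at_within by blast
  \<comment> \<open>The null rotation about \<open>v\<close> that moves \<open>e2\<close> by
    \<open>k *\<^sub>R v\<close>; the quadratic term keeps \<open>u'\<close> lightlike.\<close>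
  define e2' u' where "e2' = e2 + k *\<^sub>R v" and "u' = u + k *\<^sub>R e2 + (k\<^sup>2 / 2) *\<^sub>R v"
  have comm: "mink e2 v = 0" "mink u v = -1" "mink e2 u = 0" "mink m v = 0" "mink e2 m = 0" "mink m e2 = 0" "mink m u = 0" using o mink_commute by metis+
  have ob': "pseudo_orthonormal_basis v m u' e2'"
    unfolding pseudo_orthonormal_basis_def e2'_def u'_def using o comm by (simp add: mink_simps power2_eq_square algebra_simps)
  note o' = ob'[unfolded pseudo_orthonormal_basis_def]
  have comm': "mink e2' v = 0" "mink u' v = -1" "mink e2' u' = 0" using o' mink_commute by metis+
  have w2: "mink (N t) e2' = r t * \<psi> t" if "t \<in> J" for t
  proof -
    have "w t = r t * (\<psi> t + k)" using k[OF that] rp[OF that] by (simp add: field_simps)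
    then show ?thesis using Nv[OF that] by (simp add: e2'_def mink_simps w_def algebra_simps)
  qed
  have Ne': "N t = ((-1 + (r t)\<^sup>2 * (\<psi> t)\<^sup>2) / (2 * r t)) *\<^sub>R v + r t *\<^sub>R u' + (r t * \<psi> t) *\<^sub>R e2'" if "t \<in> J" for t
  proof -
    define x where "x = - mink (N t) u'"
    have ex: "N t = x *\<^sub>R v + r t *\<^sub>R u' + (r t * \<psi> t) *\<^sub>R e2'"
      by (rule trans[OF pseudo_orthonormal_basis_expansion[OF ob', of "N t"]]) (simp add: Nv[OF that] w2[OF that] x_def)
    have "mink (N t) (N t) = 1" using mink_fn(2)[OF Mst_M[OF \<gamma>[OF that]]] by (simp add: N_def)
    then have "- 2 * x * r t + (r t * \<psi> t)\<^sup>2 = 1"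
      unfolding ex using o' comm' by (simp add: mink_simps power2_eq_square)
    then have "x = (-1 + (r t)\<^sup>2 * (\<psi> t)\<^sup>2) / (2 * r t)" using rp[OF that] by (simp add: field_simps power_mult_distrib)
    then show ?thesis using ex by simp
  qed
  have XE: "X u' = m" "X e2' = 0"
    using X_change_frame[OF m, of u'] X_change_frame[OF m, of e2'] o' comm' mink_commute[of e2' m] mink_commute[of u' m]
    unfolding v_def by simp_all
  have Rv: "R \<theta> v = v" "R \<theta> e2' = e2'" for \<theta> by (rule R_unique; simp add: pm XE)+
  have Ru: "R \<theta> u' = u' + \<theta> *\<^sub>R m + (\<theta>\<^sup>2 / 2) *\<^sub>R v" for \<theta>
  proof (rule R_unique)
    fix s
    have "((\<lambda>s. u' + s *\<^sub>R m + (s\<^sup>2 / 2) *\<^sub>R v) has_vector_derivative 0 + (1 *\<^sub>R m) + s *\<^sub>R v) (at s)"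
    proof (intro has_vector_derivative_add has_vector_derivative_const)
      show "((\<lambda>s. s *\<^sub>R m) has_vector_derivative 1 *\<^sub>R m) (at s)" by (simp add: has_vector_derivative_def has_derivative_scaleR_left)
      have "((\<lambda>s. s\<^sup>2 / 2) has_real_derivative s) (at s)" by (auto intro!: derivative_eq_intros)
      from has_vector_derivative_scaleR[OF this has_vector_derivative_const[of v]]
      show "((\<lambda>s. (s\<^sup>2 / 2) *\<^sub>R v) has_vector_derivative s *\<^sub>R v) (at s)" by simp
    qed
    then show "((\<lambda>s. u' + s *\<^sub>R m + (s\<^sup>2 / 2) *\<^sub>R v) has_vector_derivative X (u' + s *\<^sub>R m + (s\<^sup>2 / 2) *\<^sub>R v)) (at s)"
      unfolding X_simps XE pm(5) v_def[symmetric] by simp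
  qed simp
  have final: "n (\<phi> \<theta> (\<gamma> t)) = in_basis (v, m, u', e2') (parabolic_coords Hb C \<theta> t)" if t: "t \<in> J" for \<theta> t
  proof -
    have rt: "r t > 0" using rp[OF t] by simp
    have "n (\<phi> \<theta> (\<gamma> t)) = R \<theta> (N t)" using n_\<phi>[OF Mst_M[OF \<gamma>[OF t]]] by (simp add: N_def)
    also have "\<dots> = ((-1 + (r t)\<^sup>2 * (\<psi> t)\<^sup>2) / (2 * r t)) *\<^sub>R v + r t *\<^sub>R (u' + \<theta> *\<^sub>R m + (\<theta>\<^sup>2 / 2) *\<^sub>R v) + (r t * \<psi> t) *\<^sub>R e2'"
      by (subst Ne'[OF t]) (simp only: linear_add[OF linear_R] linear_scale[OF linear_R] Ru Rv)
    also have "\<dots> = ((-1 + (r t)\<^sup>2 * (\<psi> t)\<^sup>2) / (2 * r t) + r t * (\<theta>\<^sup>2 / 2)) *\<^sub>R v + (r t * \<theta>) *\<^sub>R m + r t *\<^sub>R u' + (r t * \<psi> t) *\<^sub>R e2'"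
      by (simp add: vec_eq_iff algebra_simps)
    also have "(-1 + (r t)\<^sup>2 * (\<psi> t)\<^sup>2) / (2 * r t) + r t * (\<theta>\<^sup>2 / 2) = (-1 + (r t)\<^sup>2 * ((\<psi> t)\<^sup>2 + \<theta>\<^sup>2)) / (2 * r t)"
      using rt by (simp add: field_simps power2_eq_square)
    finally show ?thesis
      by (simp add: parabolic_coords_def Let_def par \<psi>_def[symmetric])
  qed
  have sp: "span {v, m} = span {a, b}" using span_rotated_frame[OF m, of 1] by (simp add: v_def)
  show ?thesis
    by (intro exI[of _ v] exI[of _ m] exI[of _ u'] exI[of _ e2'] exI[of _ J] exI[of _ "\<lambda>(s, t). \<phi> s (\<gamma> t)"] conjI ob' sp
        parametrizes_profile J) (use final in auto)
qed

end

context rot_surface_const begin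

text \<open>On this branch \<open>cn\<close> rises and then falls, so between two points it is at
  least as large as at one of them. Connectedness of the set is what gives
  \<open>\<alpha> + \<beta>\<close> a single sign where \<open>r\<^sup>2 > 1\<close>.\<close>

lemma superlevel_interval:
  assumes J: "is_interval J" and Jq: "\<And>t. t \<in> J \<Longrightarrow> \<Xi> * t \<in> quarter pp"
  shows "is_interval {t \<in> J. (r t)\<^sup>2 > 1}"
  unfolding is_interval_1
proof (intro ballI allI impI)
  fix t1 t2 x assume t1: "t1 \<in> {t \<in> J. (r t)\<^sup>2 > 1}" and t2: "t2 \<in> {t \<in> J. (r t)\<^sup>2 > 1}" and x: "t1 \<le> x \<and> x \<le> t2"
  have xJ: "x \<in> J" using mem_is_interval_1_I[OF J, of t1 t2 x] t1 t2 x by simp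
  have q: "\<Xi> * t1 \<in> quarter pp" "\<Xi> * t2 \<in> quarter pp" "\<Xi> * x \<in> quarter pp" using Jq t1 t2 xJ by auto
  have le: "am (\<Xi> * t1) \<le> am (\<Xi> * x)" "am (\<Xi> * x) \<le> am (\<Xi> * t2)"
    using am_mono[OF q(3,1)] am_mono[OF q(2,3)] x \<Xi>(1) by (simp_all add: not_less[symmetric])
  note b = am_quarter(1)[OF q(1)] am_quarter(1)[OF q(2)] am_quarter(1)[OF q(3)]
  have "\<exists>s\<in>{t1, t2}. cn (\<Xi> * s) \<le> cn (\<Xi> * x)"
  proof (cases "am (\<Xi> * x) \<ge> 0")
    case True
    have "cos (am (\<Xi> * t2)) \<le> cos (am (\<Xi> * x))" by (rule cos_monotone_0_pi_le) (use True le b pi_gt_zero in linarith)+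
    then show ?thesis by (simp add: jacobi_cn_def)
  next
    case False
    have "cos (- am (\<Xi> * t1)) \<le> cos (- am (\<Xi> * x))" by (rule cos_monotone_0_pi_le) (use False le b pi_gt_zero in linarith)+
    then show ?thesis by (simp add: jacobi_cn_def)
  qed
  then obtain s where s: "s \<in> {t1, t2}" "cn (\<Xi> * s) \<le> cn (\<Xi> * x)" by blast
  have "cn (\<Xi> * s) \<ge> 0" using s(1) cn_pos[OF q(1)] cn_pos[OF q(2)] by auto
  from power_mono[OF s(2) this, of 2] have "(r s)\<^sup>2 \<le> (r x)\<^sup>2" unfolding profile_sq using Cp by simp
  moreover have "(r s)\<^sup>2 > 1" using s(1) t1 t2 by auto
  ultimately show "x \<in> {t \<in> J. (r t)\<^sup>2 > 1}" using xJ by simp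
qed

text \<open>The null coordinates of the complementary part, rescaled by a boost with factor
  \<open>K\<close> and by the sign \<open>sg\<close>, become \<open>h\<close> and \<open>h2\<close>
  with \<open>h t * h2 t = (r t)\<^sup>2 - 1\<close> and
  \<open>\<bar>h t\<bar> = S t * exp (\<psi> t)\<close>. The set where \<open>r\<^sup>2 > 1\<close>
  is connected, so there the basis can be chosen to make \<open>h\<close> positive. The set where
  \<open>r\<^sup>2 < 1\<close> may fall into two intervals, and there the sign remains as
  \<open>\<sigma>\<close>.\<close>

lemma elliptic_case:
  assumes e: "\<epsilon> = 1" and cd: "mink c c = -1" "mink d d = 1" "mink c d = 0" and ne: "Mst \<noteq> {}"
  shows "\<exists>e0 e1 e2 e3 \<sigma> J \<Phi>. orthonormal_basis e0 e1 e2 e3 \<and> span {e2, e3} = span {a, b} \<and>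
     parametrizes \<Phi> J M f n (span {a, b}) \<and> (\<forall>t. \<sigma> t = 1 \<or> \<sigma> t = -1) \<and> continuous_on {t\<in>J. (r t)\<^sup>2 < 1} \<sigma> \<and>
     (\<forall>\<theta>. \<forall>t\<in>J. (r t)\<^sup>2 \<noteq> 1 \<longrightarrow>
        n (\<Phi> (\<theta>, t)) = in_basis (elliptic_basis e0 e1 e2 e3 (\<sigma> t) (r t)) (elliptic_coords Hb C Cp Cm \<theta> t))"
proof -
  obtain J \<gamma> m y where J: "open J" "is_interval J" "J \<noteq> {}" "(\<lambda>(s, t). \<phi> s (\<gamma> t)) ` (UNIV \<times> J) = Mst"
    "\<And>w. w \<in> UNIV \<times> J \<Longrightarrow> \<exists>W. w \<in> W \<and> W \<subseteq> UNIV \<times> J \<and> chart W (\<lambda>(s, t). \<phi> s (\<gamma> t))"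
    and m: "m = X y" "mink m m = 1" and \<gamma>: "\<And>t. t \<in> J \<Longrightarrow> \<gamma> t \<in> Mst" and Jq: "\<And>t. t \<in> J \<Longrightarrow> \<Xi> * t \<in> quarter pp"
    and Xn: "\<And>t. t \<in> J \<Longrightarrow> X (n (\<gamma> t)) = r t *\<^sub>R m"
    and rp: "\<And>t. t \<in> J \<Longrightarrow> r t > 0 \<and> C - (r t)\<^sup>2 / Hb \<noteq> 0"
    and NY: "\<And>t. t \<in> J \<Longrightarrow> \<exists>Y. ((\<lambda>t. n (\<gamma> t)) has_vector_derivative Y) (at t) \<and> B (n (\<gamma> t)) Y = C - (r t)\<^sup>2 / Hb"
    by (rule gauss_map_profile[OF ne]) (rule that; assumption)
  define N where "N t = n (\<gamma> t)" for t
  obtain Y where Y: "\<And>t. t \<in> J \<Longrightarrow> (N has_vector_derivative Y t) (at t) \<and> B (N t) (Y t) = C - (r t)\<^sup>2 / Hb"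
    using NY unfolding N_def[symmetric] by metis
  note pf = profile_frame[OF m Xn, folded N_def]
  have pm: "mink (X m) (X m) = \<epsilon>" "mink (X m) m = 0" "mink m c = 0" "mink m d = 0" "mink (X m) c = 0" "mink (X m) d = 0" "X (X m) = - \<epsilon> *\<^sub>R m"
    using pf J(3) by blast+
  have pm': "mink c m = 0" "mink d m = 0" "mink c (X m) = 0" "mink d (X m) = 0" "mink m (X m) = 0" "mink d c = 0"
    using pm cd mink_commute by metis+
  \<comment> \<open>With \<open>- d\<close> the Wronskian of the first two coordinates is
    \<open>B\<close> itself, and with \<open>- X m\<close> the third coordinate is
    \<open>r\<close>.\<close>
  have ob0: "orthonormal_basis c (- d) (- X m) m" unfolding orthonormal_basis_def using pm pm' e m(2) cd by (simp add: mink_simps)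
  define \<alpha> \<beta> where "\<alpha> t = - mink (N t) c" and "\<beta> t = - mink (N t) d" for t
  have Nm: "mink (N t) m = 0" "mink (N t) (X m) = - r t" if "t \<in> J" for t using pf(1,2)[OF that] rp[OF that] by auto
  have Ne: "N t = \<alpha> t *\<^sub>R c + \<beta> t *\<^sub>R (- d) + r t *\<^sub>R (- X m)" if "t \<in> J" for t
    by (rule trans[OF orthonormal_basis_expansion[OF ob0, of "N t"]]) (simp add: Nm[OF that] \<alpha>_def \<beta>_def mink_simps)
  have sq: "(\<alpha> t)\<^sup>2 - (\<beta> t)\<^sup>2 = (r t)\<^sup>2 - 1" if "t \<in> J" for t
  proof -
    have "mink (N t) (N t) = 1" using mink_fn(2)[OF Mst_M[OF \<gamma>[OF that]]] by (simp add: N_def)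
    moreover have "mink (N t) (N t) = - (\<alpha> t)\<^sup>2 + (\<beta> t)\<^sup>2 + (r t)\<^sup>2"
      unfolding Ne[OF that] using pm pm' cd e by (simp add: mink_simps power2_eq_square)
    ultimately show ?thesis by simp
  qed
  have \<alpha>d: "(\<alpha> has_real_derivative - mink (Y t) c) (at t)" and \<beta>d: "(\<beta> has_real_derivative - mink (Y t) d) (at t)" if "t \<in> J" for t
    unfolding \<alpha>_def[abs_def] \<beta>_def[abs_def] using coordinate_derivative Y[OF that] by (auto intro: DERIV_minus)
  have wr: "\<alpha> t * (- mink (Y t) d) - (- mink (Y t) c) * \<beta> t = C - (r t)\<^sup>2 / Hb" if "t \<in> J" for t
    using Y[OF that] by (simp add: B_def \<alpha>_def \<beta>_def mult.commute)
  have qnz: "C - (r t)\<^sup>2 / Hb \<noteq> 0" if "t \<in> J" for t using rp[OF that] by simp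
  define \<psi> where "\<psi> = profile_psi 1 Hb C Cp Cm"
  obtain k where k: "k > 0" and kJ: "\<And>t. t \<in> J \<Longrightarrow> (r t)\<^sup>2 \<noteq> 1 \<Longrightarrow> (\<alpha> t + \<beta> t)\<^sup>2 = k * \<bar>(r t)\<^sup>2 - 1\<bar> * exp (2 * \<psi> t)"
    using growth[OF e J(1,2) Jq qnz \<alpha>d \<beta>d sq wr J(3)] unfolding \<psi>_def by blast
  define K where "K = sqrt k"
  have K: "K > 0" "K * K = k" using k by (simp_all add: K_def)
  have nz: "\<alpha> t + \<beta> t \<noteq> 0" if "t \<in> J" "(r t)\<^sup>2 \<noteq> 1" for t
  proof
    assume "\<alpha> t + \<beta> t = 0"
    moreover have "(\<alpha> t)\<^sup>2 - (\<beta> t)\<^sup>2 = (\<alpha> t + \<beta> t) * (\<alpha> t - \<beta> t)" by (simp add: power2_eq_square algebra_simps)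
    ultimately show False using sq[OF that(1)] that(2) by simp
  qed
  have cont: "continuous_on J (\<lambda>t. \<alpha> t + \<beta> t)"
    by (intro continuous_on_add continuous_at_imp_continuous_on ballI) (use \<alpha>d \<beta>d DERIV_isCont in blast)+
  obtain sg :: real where sg: "sg = 1 \<or> sg = -1" and sgp: "\<And>t. t \<in> J \<Longrightarrow> (r t)\<^sup>2 > 1 \<Longrightarrow> sg * (\<alpha> t + \<beta> t) > 0"
  proof -
    define J1 where "J1 = {t \<in> J. (r t)\<^sup>2 > 1}"
    have "connected J1" unfolding J1_def by (rule is_interval_connected[OF superlevel_interval[OF J(2) Jq]])
    then have con: "connected ((\<lambda>t. \<alpha> t + \<beta> t) ` J1)"
      by (rule connected_continuous_image[rotated]) (rule continuous_on_subset[OF cont], simp add: J1_def)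
    have nz1: "0 \<notin> (\<lambda>t. \<alpha> t + \<beta> t) ` J1" using nz unfolding J1_def by force
    show thesis
    proof (cases "\<exists>t\<in>J1. \<alpha> t + \<beta> t > 0")
      case True
      then obtain t0 where t0: "t0 \<in> J1" "\<alpha> t0 + \<beta> t0 > 0" by blast
      have "\<alpha> t + \<beta> t > 0" if "t \<in> J1" for t
      proof (rule ccontr)
        assume "\<not> ?thesis"
        then have "0 \<in> (\<lambda>t. \<alpha> t + \<beta> t) ` J1"
          using connectedD_interval[OF con imageI[OF that] imageI[OF t0(1)], of 0] t0(2) by simp
        with nz1 show False ..
      qed
      then show thesis using that[of 1] by (simp add: J1_def)
    next
      case False
      then have neg: "\<alpha> t + \<beta> t < 0" if "t \<in> J1" for t using that nz[of t] unfolding J1_def by force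
      have pos: "0 < -1 * (\<alpha> t + \<beta> t)" if "t \<in> J" "1 < (r t)\<^sup>2" for t
        using neg[of t] that unfolding J1_def by fastforce
      show thesis by (rule that[of "-1"], simp) (rule pos; assumption)
    qed
  qed
  have sgsg: "sg * sg = 1" using sg by auto
  define h h2 where "h t = sg * (\<alpha> t + \<beta> t) / K" and "h2 t = sg * K * (\<alpha> t - \<beta> t)" for t
  \<comment> \<open>Chosen so that \<open>x1 + x2 = sg * K\<close> and
    \<open>x1 - x2 = sg / K\<close>: these are the factors by which the null coordinates change when
    passing to \<open>e0\<close>, \<open>e1\<close>.\<close>
  define x1 x2 where "x1 = sg * (K + 1 / K) / 2" and "x2 = sg * (K - 1 / K) / 2"
  have x12: "x1 + x2 = sg * K" "x1 - x2 = sg / K" using K(1) by (simp_all add: x1_def x2_def field_simps)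
  have "(x1 - x2) * (x1 + x2) = 1" unfolding x12 using sgsg K(1) by simp
  then have xx: "x1 * x1 - x2 * x2 = 1" by (simp add: algebra_simps)
  have hK: "h t * (sg * K) = \<alpha> t + \<beta> t" "h2 t * (sg / K) = \<alpha> t - \<beta> t" for t
  proof -
    have "h t * (sg * K) = (sg * sg) * (\<alpha> t + \<beta> t)" "h2 t * (sg / K) = (sg * sg) * (\<alpha> t - \<beta> t)"
      using K(1) by (simp_all add: h_def h2_def)
    then show "h t * (sg * K) = \<alpha> t + \<beta> t" "h2 t * (sg / K) = \<alpha> t - \<beta> t" unfolding sgsg by simp_all
  qed
  have hh: "h t * h2 t = (r t)\<^sup>2 - 1" if "t \<in> J" for t
  proof -
    have "h t * h2 t = (sg * sg) * ((\<alpha> t + \<beta> t) * (\<alpha> t - \<beta> t))" using K(1) by (simp add: h_def h2_def)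
    also have "(\<alpha> t + \<beta> t) * (\<alpha> t - \<beta> t) = (\<alpha> t)\<^sup>2 - (\<beta> t)\<^sup>2" by (simp add: power2_eq_square algebra_simps)
    finally show ?thesis unfolding sgsg sq[OF that] by simp
  qed
  define S where "S t = sqrt \<bar>(r t)\<^sup>2 - 1\<bar>" for t
  have habs: "\<bar>h t\<bar> = S t * exp (\<psi> t)" if "t \<in> J" "(r t)\<^sup>2 \<noteq> 1" for t
  proof -
    have "(h t)\<^sup>2 = (sg * sg) * (\<alpha> t + \<beta> t)\<^sup>2 / k" unfolding K(2)[symmetric] by (simp add: h_def power2_eq_square)
    also have "\<dots> = \<bar>(r t)\<^sup>2 - 1\<bar> * exp (2 * \<psi> t)" unfolding sgsg kJ[OF that] using k by simp
    also have "\<dots> = (S t * exp (\<psi> t))\<^sup>2" by (simp add: S_def power_mult_distrib exp_double)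
    finally have "\<bar>h t\<bar> = \<bar>S t * exp (\<psi> t)\<bar>" by (simp only: power2_eq_iff abs_eq_iff)
    then show ?thesis by (simp add: S_def abs_mult)
  qed
  define e0 e1 where "e0 = x1 *\<^sub>R c - x2 *\<^sub>R d" and "e1 = x2 *\<^sub>R c - x1 *\<^sub>R d"
  have ob: "orthonormal_basis e0 e1 (- X m) m"
    unfolding orthonormal_basis_def e0_def e1_def using pm pm' e m(2) cd xx by (simp add: mink_simps algebra_simps)
  have dec: "\<alpha> t *\<^sub>R c + \<beta> t *\<^sub>R (- d) = ((h t + h2 t) / 2) *\<^sub>R e0 + ((h t - h2 t) / 2) *\<^sub>R e1" for t
  proof -
    have "(h t + h2 t) / 2 * x1 + (h t - h2 t) / 2 * x2 = (h t * (x1 + x2) + h2 t * (x1 - x2)) / 2"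
      "(h t + h2 t) / 2 * x2 + (h t - h2 t) / 2 * x1 = (h t * (x1 + x2) - h2 t * (x1 - x2)) / 2"
      by (simp_all add: field_simps)
    then have 1: "(h t + h2 t) / 2 * x1 + (h t - h2 t) / 2 * x2 = \<alpha> t" "(h t + h2 t) / 2 * x2 + (h t - h2 t) / 2 * x1 = \<beta> t"
      unfolding x12 hK by simp_all
    have "u *\<^sub>R e0 + v *\<^sub>R e1 = (u * x1 + v * x2) *\<^sub>R c + (u * x2 + v * x1) *\<^sub>R (- d)" for u v
      unfolding e0_def e1_def by (simp add: algebra_simps)
    then show ?thesis by (simp only: 1)
  qed
  define \<sigma> :: "real \<Rightarrow> real" where "\<sigma> t = (if h t \<ge> 0 then 1 else -1)" for t
  have \<sigma>c: "continuous_on {t \<in> J. (r t)\<^sup>2 < 1} \<sigma>"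
  proof -
    have hn: "h t \<noteq> 0" if "t \<in> {t \<in> J. (r t)\<^sup>2 < 1}" for t using nz[of t] that sg K(1) by (auto simp: h_def)
    have "continuous_on {t \<in> J. (r t)\<^sup>2 < 1} h" unfolding h_def[abs_def]
      by (intro continuous_on_divide continuous_on_mult continuous_on_const continuous_on_subset[OF cont]) (use K(1) in auto)
    then have "continuous_on {t \<in> J. (r t)\<^sup>2 < 1} (\<lambda>t. sgn (h t))" by (rule continuous_on_sgn) (use hn in blast)
    then show ?thesis by (rule continuous_on_cong[THEN iffD1, rotated -1]) (use hn in \<open>auto simp: \<sigma>_def sgn_if\<close>)
  qed
  have sp: "span {- X m, m} = span {a, b}" using span_rotated_frame[OF m, of "-1"] by simp
  have R1: "R \<theta> (- X m) = cos \<theta> *\<^sub>R (- X m) + sin \<theta> *\<^sub>R m" for \<theta>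
  proof (rule R_unique)
    fix s
    have "((\<lambda>s. cos s *\<^sub>R (- X m) + sin s *\<^sub>R m) has_vector_derivative (- sin s) *\<^sub>R (- X m) + cos s *\<^sub>R m) (at s)"
      by (auto intro!: derivative_eq_intros has_vector_derivative_scaleR simp: has_real_derivative_iff_has_vector_derivative[symmetric])
    moreover have "X (cos s *\<^sub>R (- X m) + sin s *\<^sub>R m) = (- sin s) *\<^sub>R (- X m) + cos s *\<^sub>R m"
      by (simp add: X_simps pm(7) e)
    ultimately show "((\<lambda>s. cos s *\<^sub>R (- X m) + sin s *\<^sub>R m) has_vector_derivative X (cos s *\<^sub>R (- X m) + sin s *\<^sub>R m)) (at s)" by simp
  qed simp
  have final: "n (\<phi> \<theta> (\<gamma> t)) = in_basis (elliptic_basis e0 e1 (- X m) m (\<sigma> t) (r t)) (elliptic_coords Hb C Cp Cm \<theta> t)"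
    if t: "t \<in> J" and r1: "(r t)\<^sup>2 \<noteq> 1" for \<theta> t
  proof -
    define E where "E = exp (\<psi> t)"
    have E: "E > 0" "cosh (\<psi> t) = (E + 1 / E) / 2" "sinh (\<psi> t) = (E - 1 / E) / 2"
      by (simp_all add: E_def cosh_field_def sinh_field_def exp_minus inverse_eq_divide)
    have S: "S t > 0" "S t * S t = \<bar>(r t)\<^sup>2 - 1\<bar>" using r1 by (simp_all add: S_def)
    have SE: "S t * E \<noteq> 0" using S(1) E(1) by simp
    have hE: "\<bar>h t\<bar> = S t * E" using habs[OF t r1] by (simp add: E_def)
    have "n (\<phi> \<theta> (\<gamma> t)) = R \<theta> (N t)" using n_\<phi>[OF Mst_M[OF \<gamma>[OF t]]] by (simp add: N_def)
    also have "\<dots> = \<alpha> t *\<^sub>R c + \<beta> t *\<^sub>R (- d) + r t *\<^sub>R (cos \<theta> *\<^sub>R (- X m) + sin \<theta> *\<^sub>R m)"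
      by (subst Ne[OF t]) (simp only: linear_add[OF linear_R] linear_scale[OF linear_R] R1 linear_neg[OF linear_R, of _ d] R_perp)
    also have "\<dots> = ((h t + h2 t) / 2) *\<^sub>R e0 + ((h t - h2 t) / 2) *\<^sub>R e1 + ((r t * cos \<theta>) *\<^sub>R (- X m) + (r t * sin \<theta>) *\<^sub>R m)"
      unfolding dec by (simp only: scaleR_add_right scaleR_scaleR)
    finally have nE: "n (\<phi> \<theta> (\<gamma> t)) = \<dots>" .
    have co: "elliptic_coords Hb C Cp Cm \<theta> t = (S t * cosh (\<psi> t), S t * sinh (\<psi> t), r t * cos \<theta>, r t * sin \<theta>)"
      by (simp add: elliptic_coords_def Let_def \<Xi>_def[symmetric] \<psi>_def[symmetric] S_def)
    show ?thesis
    proof (cases "(r t)\<^sup>2 > 1")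
      case True
      have "h t > 0" using sgp[OF t True] K(1) by (simp add: h_def)
      then have h: "h t = S t * E" using hE by simp
      have "(S t * E) * h2 t = (S t * E) * (S t / E)" using hh[OF t] S(2) True E(1) unfolding h by simp
      then have h2: "h2 t = S t / E" by (simp only: mult_left_cancel[OF SE])
      have "(h t + h2 t) / 2 = S t * cosh (\<psi> t)" "(h t - h2 t) / 2 = S t * sinh (\<psi> t)"
        unfolding h h2 E by (simp_all add: algebra_simps add_divide_distrib)
      then show ?thesis unfolding nE co elliptic_basis_def using True by (simp add: add.assoc)
    next
      case False
      have \<sigma>: "\<sigma> t * \<sigma> t = 1" "h t = \<sigma> t * (S t * E)" unfolding hE[symmetric] by (auto simp: \<sigma>_def)
      \<comment> \<open>Now the product of \<open>h t\<close> and \<open>h2 t\<close> is negative,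
        so their half sum and half difference exchange \<open>cosh\<close> and \<open>sinh\<close>;
        this is the exchange of \<open>e0\<close> and \<open>e1\<close> in
        \<open>elliptic_basis\<close>.\<close>
      have "(S t * E) * (\<sigma> t * h2 t) = (S t * E) * (- (S t / E))" using hh[OF t] S(2) False E(1) unfolding \<sigma>(2) by (simp add: mult_ac)
      then have "\<sigma> t * h2 t = - (S t / E)" by (simp only: mult_left_cancel[OF SE])
      then have "\<sigma> t * (\<sigma> t * h2 t) = \<sigma> t * (- (S t / E))" by simp
      then have h2: "h2 t = \<sigma> t * (- (S t / E))" unfolding mult.assoc[symmetric] \<sigma>(1) by simp
      have "(h t + h2 t) / 2 = S t * sinh (\<psi> t) * \<sigma> t" "(h t - h2 t) / 2 = S t * cosh (\<psi> t) * \<sigma> t"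
        unfolding \<sigma>(2) h2 E by (simp_all add: algebra_simps add_divide_distrib)
      then show ?thesis unfolding nE co elliptic_basis_def using False by (simp add: add_ac)
    qed
  qed
  show ?thesis
    by (intro exI[of _ e0] exI[of _ e1] exI[of _ "- X m"] exI[of _ m] exI[of _ \<sigma>] exI[of _ J] exI[of _ "\<lambda>(s, t). \<phi> s (\<gamma> t)"] conjI ob sp
        parametrizes_profile J \<sigma>c) (use final in \<open>auto simp: \<sigma>_def\<close>)
qed

end

section \<open>The parabolic roots and the assembly of the three cases\<close>

text \<open>The polynomial is the difference of squares
  \<open>(C - x / Hb)\<^sup>2 - x\<^sup>2\<close>, with roots \<open>C / (1 / Hb + s)\<close> for
  \<open>s = 1\<close> and \<open>s = -1\<close>. As \<open>\<bar>1 / Hb\<bar> < 1\<close>, the root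
  with \<open>s = sgn C\<close> is the positive one.\<close>

lemma parabolic_roots:
  assumes Hb: "Hb\<^sup>2 > 1" and f: "\<And>x. p_poly 0 Hb C x = (1 - 1 / Hb\<^sup>2) * (Cp - x) * (x - Cm)" and Cp: "Cp > 0" and Cm: "Cm < 0"
  shows "C \<noteq> 0" "par_Cp Hb C = Cp" "par_Cm Hb C = Cm" "par_Xi C = Xi Hb Cp Cm"
proof -
  define h where "h = 1 / Hb"
  have h2: "h * h < 1" using Hb by (simp add: h_def power2_eq_square field_simps)
  then have h1: "\<bar>h\<bar> < 1" using abs_square_less_1[of h] by (simp add: power2_eq_square)
  define \<mu> where "\<mu> = 1 - h * h"
  have \<mu>: "\<mu> > 0" using h2 by (simp add: \<mu>_def)
  have poly: "p_poly 0 Hb C x = (C - h * x)\<^sup>2 - x\<^sup>2" for x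
    by (simp add: p_poly_def h_def power2_eq_square algebra_simps)
  have f': "(C - h * x)\<^sup>2 - x\<^sup>2 = \<mu> * (Cp - x) * (x - Cm)" for x
    using f[of x] unfolding poly by (simp add: \<mu>_def h_def power2_eq_square)
  have "C\<^sup>2 = \<mu> * Cp * (- Cm)" using f'[of 0] by simp
  also have "\<dots> > 0" using \<mu> Cp Cm by (intro mult_pos_pos) auto
  finally show C: "C \<noteq> 0" by auto
  have root: "C / (h + s) = Cp \<or> C / (h + s) = Cm" if "s = 1 \<or> s = -1" for s :: real
  proof -
    define x where "x = C / (h + s)"
    have "C = (h + s) * x" using that h1 by (auto simp: x_def)
    then have "C - h * x = s * x" by (simp add: algebra_simps)
    then have "\<mu> * (Cp - x) * (x - Cm) = 0" using f'[of x] that by auto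
    then show ?thesis using \<mu> unfolding x_def[symmetric] by auto
  qed
  define s where "s = sgn C"
  have s: "s = 1 \<and> C > 0 \<or> s = -1 \<and> C < 0" using C by (auto simp: s_def sgn_if)
  have "C / (h + s) > 0" "C / (h - s) < 0" using s h1 by (auto simp: divide_pos_pos divide_neg_neg divide_pos_neg divide_neg_pos)
  then have e: "C / (h + s) = Cp" "C / (h - s) = Cm" using root[of s] root[of "- s"] s Cp Cm by auto
  then show "par_Cp Hb C = Cp" "par_Cm Hb C = Cm" by (simp_all add: par_Cp_def par_Cm_def h_def s_def)
  have e': "(h + s) * Cp = C" "(h - s) * Cm = C" using e s h1 by auto
  \<comment> \<open>Both \<open>(h + s) * Cp\<close> and \<open>(h - s) * Cm\<close> equal
    \<open>C\<close>. This combination isolates \<open>Cp - Cm\<close> and gives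
    \<open>\<mu> * (Cp - Cm) = 2 * \<bar>C\<bar>\<close>, so the two expressions for the frequency
    agree.\<close>
  have "(s - h) * ((h + s) * Cp) + (h + s) * ((h - s) * Cm) = (s * s - h * h) * (Cp - Cm)" by (simp add: algebra_simps)
  then have "\<mu> * (Cp - Cm) = 2 * (s * C)" unfolding e' using s by (auto simp: \<mu>_def algebra_simps)
  also have "s * C = \<bar>C\<bar>" using s by auto
  finally have "\<mu> * (Cp - Cm) = 2 * \<bar>C\<bar>" .
  moreover have "\<mu> = 1 - 1 / Hb\<^sup>2" by (simp add: \<mu>_def h_def power2_eq_square)
  ultimately show "par_Xi C = Xi Hb Cp Cm" by (simp add: par_Xi_def Xi_def real_sqrt_mult[symmetric])
qed

theorem theorem5p3:
  fixes Hb :: real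
    and M :: "'a::t2_space set"
    and f n :: "'a \<Rightarrow> vec4"
    and P :: "vec4 set"
    and R :: "real \<Rightarrow> vec4 \<Rightarrow> vec4"
  assumes "Hb\<^sup>2 > 1"
    and "surface_with_gauss_map M f n"
    and "constant_harmonic_mean_curvature M f n Hb"
    and "rotation_group P R"
    and "invariant_under R M f"
  shows
    "(plane_signature P 1 \<longrightarrow>
       (\<exists>C Cp Cm e0 e1 e2 e3 \<sigma> J \<Phi>.
          p_poly 1 Hb C Cp = 0 \<and> p_poly 1 Hb C Cm = 0 \<and> Cp > 0 \<and>
          (0 > Cm \<or> totally_umbilic M f n \<and> C = 0 \<and> Cm = 0) \<and>
          orthonormal_basis e0 e1 e2 e3 \<and> span {e2, e3} = P \<and>
          parametrizes \<Phi> J M f n P \<and>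
          (\<forall>t. \<sigma> t = 1 \<or> \<sigma> t = -1) \<and>
          continuous_on {t\<in>J. (profile_r (Xi Hb Cp Cm) Cp Cm t)\<^sup>2 < 1} \<sigma> \<and>
          (\<forall>\<theta>. \<forall>t\<in>J. (profile_r (Xi Hb Cp Cm) Cp Cm t)\<^sup>2 \<noteq> 1 \<longrightarrow>
             n (\<Phi> (\<theta>, t)) =
               in_basis (elliptic_basis e0 e1 e2 e3 (\<sigma> t) (profile_r (Xi Hb Cp Cm) Cp Cm t))
                 (elliptic_coords Hb C Cp Cm \<theta> t)))) \<and>
     (plane_signature P (-1) \<longrightarrow>
       (\<exists>C Cp Cm e0 e1 e2 e3 J \<Phi>.
          p_poly (-1) Hb C Cp = 0 \<and> p_poly (-1) Hb C Cm = 0 \<and> Cp > 0 \<and> 0 > Cm \<and>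
          orthonormal_basis e0 e1 e2 e3 \<and> span {e0, e1} = P \<and>
          parametrizes \<Phi> J M f n P \<and>
          (\<forall>\<theta>. \<forall>t\<in>J.
             n (\<Phi> (\<theta>, t)) = in_basis (e0, e1, e2, e3) (hyperbolic_coords Hb C Cp Cm \<theta> t)))) \<and>
     (plane_signature P 0 \<longrightarrow>
       (\<exists>C v e1 u e2 J \<Phi>.
          C \<noteq> 0 \<and> pseudo_orthonormal_basis v e1 u e2 \<and> span {v, e1} = P \<and>
          parametrizes \<Phi> J M f n P \<and>
          (\<forall>\<theta>. \<forall>t\<in>J.
             n (\<Phi> (\<theta>, t)) = in_basis (v, e1, u, e2) (parabolic_coords Hb C \<theta> t))))"
proof (intro conjI impI)
  assume "plane_signature P 1"
  then obtain a b where P: "P = span {a, b}" and g: "mink a a = 1" "mink a b = 0" "mink b b = 1"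
    unfolding plane_signature_def by blast
  obtain c d where cd: "mink c c = -1" "mink d d = 1" "mink c d = 0" and cd': "mink c a = 0" "mink c b = 0" "mink d a = 0" "mink d b = 0"
    by (rule complete_spacelike_plane[OF g]) (rule that; assumption)
  have ob: "orthonormal_basis c d a b" unfolding orthonormal_basis_def using g cd cd' by simp
  have pf: "plane_frame a b c d 1" by (rule plane_frame_elliptic[OF ob])
  have Qp: "plane_frame.Q a b y y > 0" if "mink y y = -1" "plane_frame.X a b y \<noteq> 0" for y
    using that(2) by (auto simp: plane_frame.X_eq_0_iff[OF pf] plane_frame.Q_eq[OF pf] sum_squares_gt_zero_iff)
  obtain R' \<phi> where rs: "rot_surface a b c d 1 R' Hb M f n \<phi>"
    by (rule rot_surface_exists[OF assms(1-3) assms(4)[unfolded P] assms(5) pf disjI1[OF refl] Qp]) (rule that | assumption)+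
  interpret rot_surface a b c d 1 R' Hb M f n \<phi> by (rule rs)
  \<comment> \<open>Only elliptic rotations have fixed points in hyperbolic space, so here
    nonemptiness and connectedness of the part off the axis rest on the isolation of the axis
    points.\<close>
  have ne: "Mst \<noteq> {}" by (rule Mst_nonempty[OF refl])
  obtain C Cp Cm where rc: "rot_surface_const a b c d 1 R' Hb M f n \<phi> C Cp Cm" and cm: "Cm < 0 \<or> (1::real) = 1 \<and> C = 0 \<and> Cm = 0"
    by (rule exists_roots[OF connected_Mst_elliptic[OF refl] ne]) (rule that; assumption)
  interpret const: rot_surface_const a b c d 1 R' Hb M f n \<phi> C Cp Cm by (rule rc)
  have roots: "p_poly 1 Hb C Cp = 0" "p_poly 1 Hb C Cm = 0" using const.factor[of Cp] const.factor[of Cm] by simp_all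
  have disj: "Cm < 0 \<or> totally_umbilic M f n \<and> C = 0 \<and> Cm = 0" using cm const.umbilic[OF _ refl] by auto
  note E = const.elliptic_case[OF refl cd ne, unfolded const.\<Xi>_def, folded P]
  show "\<exists>C Cp Cm e0 e1 e2 e3 \<sigma> J \<Phi>.
          p_poly 1 Hb C Cp = 0 \<and> p_poly 1 Hb C Cm = 0 \<and> Cp > 0 \<and>
          (0 > Cm \<or> totally_umbilic M f n \<and> C = 0 \<and> Cm = 0) \<and>
          orthonormal_basis e0 e1 e2 e3 \<and> span {e2, e3} = P \<and>
          parametrizes \<Phi> J M f n P \<and>
          (\<forall>t. \<sigma> t = 1 \<or> \<sigma> t = -1) \<and>
          continuous_on {t\<in>J. (profile_r (Xi Hb Cp Cm) Cp Cm t)\<^sup>2 < 1} \<sigma> \<and>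
          (\<forall>\<theta>. \<forall>t\<in>J. (profile_r (Xi Hb Cp Cm) Cp Cm t)\<^sup>2 \<noteq> 1 \<longrightarrow>
             n (\<Phi> (\<theta>, t)) =
               in_basis (elliptic_basis e0 e1 e2 e3 (\<sigma> t) (profile_r (Xi Hb Cp Cm) Cp Cm t))
                 (elliptic_coords Hb C Cp Cm \<theta> t))"
    by (rule exI[of _ C], rule exI[of _ Cp], rule exI[of _ Cm], simp only: roots const.Cp disj simp_thms, rule E)
next
  assume "plane_signature P (- 1)"
  then obtain a b where P: "P = span {a, b}" and g: "mink a a = 1" "mink a b = 0" "mink b b = -1"
    unfolding plane_signature_def by blast
  obtain c d where cd: "mink c c = 1" "mink d d = 1" "mink c d = 0" and cd': "mink c a = 0" "mink c b = 0" "mink d a = 0" "mink d b = 0"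
    by (rule complete_lorentz_plane[OF g]) (rule that; assumption)
  have "mink b a = 0" "mink b c = 0" "mink b d = 0" "mink a c = 0" "mink a d = 0" using g cd' mink_commute by metis+
  then have ob: "orthonormal_basis b a c d" unfolding orthonormal_basis_def using g cd by simp
  have pf: "plane_frame a b c d (-1)" by (rule plane_frame_hyperbolic[OF ob])
  have ex: "mink x y = - (mink x b * mink y b) + mink x a * mink y a + mink x c * mink y c + mink x d * mink y d" for x y
    by (subst orthonormal_basis_expansion[OF ob, of x]) (simp add: mink_simps mink_commute)
  \<comment> \<open>\<open>Q y y\<close> is minus the square of the part of \<open>y\<close> in the
    Lorentz plane, and this part is timelike because the complement is spacelike.\<close>
  have Qp: "plane_frame.Q a b y y > 0" if "mink y y = -1" for y
    unfolding plane_frame.Q_eq[OF pf] using ex[of y y] that zero_le_square[of "mink y c"] zero_le_square[of "mink y d"] by linarith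
  obtain R' \<phi> where rs: "rot_surface a b c d (-1) R' Hb M f n \<phi>"
    by (rule rot_surface_exists[OF assms(1-3) assms(4)[unfolded P] assms(5) pf disjI2[OF disjI2[OF refl]] Qp]) (rule that | assumption)+
  interpret rot_surface a b c d "-1" R' Hb M f n \<phi> by (rule rs)
  have hyp: "mink (f x) (f x) = -1" if "x \<in> M" for x
    using assms(2) that unfolding surface_with_gauss_map_def hyperbolic3_def by auto
  have "X (f x) \<noteq> 0" if "x \<in> M" for x
  proof
    assume "X (f x) = 0"
    then have "Q (f x) (f x) = 0" by (simp add: Q_eq X_eq_0_iff)
    then show False using Qp[OF hyp[OF that]] by simp
  qed
  then have MM: "Mst = M" unfolding Mst_def by blast
  have ne: "Mst \<noteq> {}" and con: "connected Mst" unfolding MM using assms(2) by (simp_all add: surface_with_gauss_map_def)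
  obtain C Cp Cm where rc: "rot_surface_const a b c d (-1) R' Hb M f n \<phi> C Cp Cm" and cm: "Cm < 0 \<or> (-1::real) = 1 \<and> C = 0 \<and> Cm = 0"
    by (rule exists_roots[OF con ne]) (rule that; assumption)
  interpret const: rot_surface_const a b c d "-1" R' Hb M f n \<phi> C Cp Cm by (rule rc)
  have roots: "p_poly (-1) Hb C Cp = 0" "p_poly (-1) Hb C Cm = 0" using const.factor[of Cp] const.factor[of Cm] by simp_all
  have cm': "Cm < 0" using cm by simp
  note E = const.hyperbolic_case[OF refl cd ne, folded P]
  show "\<exists>C Cp Cm e0 e1 e2 e3 J \<Phi>.
          p_poly (-1) Hb C Cp = 0 \<and> p_poly (-1) Hb C Cm = 0 \<and> Cp > 0 \<and> 0 > Cm \<and>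
          orthonormal_basis e0 e1 e2 e3 \<and> span {e0, e1} = P \<and>
          parametrizes \<Phi> J M f n P \<and>
          (\<forall>\<theta>. \<forall>t\<in>J.
             n (\<Phi> (\<theta>, t)) = in_basis (e0, e1, e2, e3) (hyperbolic_coords Hb C Cp Cm \<theta> t))"
    by (rule exI[of _ C], rule exI[of _ Cp], rule exI[of _ Cm], simp only: roots const.Cp cm' simp_thms, rule E)
next
  assume "plane_signature P 0"
  then obtain a b where P: "P = span {a, b}" and ind: "independent {a, b}" and g: "mink a a = 1" "mink a b = 0" "mink b b = 0"
    unfolding plane_signature_def by blast
  have b0: "b \<noteq> 0" using ind dependent_zero[of "{a, b}"] by auto
  obtain u d where ob: "pseudo_orthonormal_basis b a u d"
    by (rule complete_null_plane[OF g b0]) (rule that; assumption)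
  have dd: "mink d d = 1" using ob unfolding pseudo_orthonormal_basis_def by simp
  have pf: "plane_frame a b b d 0" by (rule plane_frame_parabolic[OF ob])
  have Qp: "plane_frame.Q a b y y > 0" if "mink y y = -1" for y
  proof -
    \<comment> \<open>A nonzero lightlike vector is never orthogonal to a timelike one, so
      \<open>Q y y\<close>, here the square of \<open>mink y b\<close>, is positive.\<close>
    have "mink b y \<noteq> 0" using perp_timelike_spacelike[of y b] that g b0 by auto
    then have "mink y b \<noteq> 0" by (simp add: mink_commute[of y b])
    then have "mink y b * mink y b > 0" using not_real_square_gt_zero by blast
    then show ?thesis unfolding plane_frame.Q_eq[OF pf] mult_zero_left add_0 .
  qed
  obtain R' \<phi> where rs: "rot_surface a b b d 0 R' Hb M f n \<phi>"
    by (rule rot_surface_exists[OF assms(1-3) assms(4)[unfolded P] assms(5) pf disjI2[OF disjI1[OF refl]] Qp]) (rule that | assumption)+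
  interpret rot_surface a b b d 0 R' Hb M f n \<phi> by (rule rs)
  have hyp: "mink (f x) (f x) = -1" if "x \<in> M" for x
    using assms(2) that unfolding surface_with_gauss_map_def hyperbolic3_def by auto
  have "X (f x) \<noteq> 0" if "x \<in> M" for x
  proof
    assume "X (f x) = 0"
    then have "Q (f x) (f x) = 0" by (simp add: Q_eq X_eq_0_iff)
    then show False using Qp[OF hyp[OF that]] by simp
  qed
  then have MM: "Mst = M" unfolding Mst_def by blast
  have ne: "Mst \<noteq> {}" and con: "connected Mst" unfolding MM using assms(2) by (simp_all add: surface_with_gauss_map_def)
  obtain C Cp Cm where rc: "rot_surface_const a b b d 0 R' Hb M f n \<phi> C Cp Cm" and cm: "Cm < 0 \<or> (0::real) = 1 \<and> C = 0 \<and> Cm = 0"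
    by (rule exists_roots[OF con ne]) (rule that; assumption)
  interpret const: rot_surface_const a b b d 0 R' Hb M f n \<phi> C Cp Cm by (rule rc)
  have cm': "Cm < 0" using cm by simp
  note par = parabolic_roots[OF assms(1) const.factor const.Cp cm']
  note E = const.parabolic_case[OF refl refl dd ne par(2,3) par(4)[folded const.\<Xi>_def], folded P]
  show "\<exists>C v e1 u e2 J \<Phi>.
          C \<noteq> 0 \<and> pseudo_orthonormal_basis v e1 u e2 \<and> span {v, e1} = P \<and>
          parametrizes \<Phi> J M f n P \<and>
          (\<forall>\<theta>. \<forall>t\<in>J.
             n (\<Phi> (\<theta>, t)) = in_basis (v, e1, u, e2) (parabolic_coords Hb C \<theta> t))"
    by (rule exI[of _ C], simp only: par(1) simp_thms not_False_eq_True, rule E)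
qed

end
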